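(* Let $K$ be a spherically complete $p$-adic field containing an element $\pi$ with $\pi^{p-1}+p=0$, fixed once and for all. Let $P=\sum_{k=0}^da_k(t)\partial_t^k\in K[t]\langle\partial_t\rangle$, $a_d\ne0$, and $\mathbb M_P=\mathbb W_t/\mathbb W_tP$. Assume: i) $P$ is singular only at zero and at infinity (i.e. $a_d(t)=\alpha_d t^\delta$ with $\alpha_d\in K\setminus\{0\}$, $\delta\ge0$), and $\deg(a_d(t))\ge\deg(a_i(t))$ for all $0\le i\le d$ (that is, the formal slopes of the singularity at infinity of $P$ are smaller than or equal to $+1$); ii) the $\mathcal R_t(1)$-module with connection $\mathcal R_t(1)\otimes_{K[t]}\mathbb M_P$ is soluble at $1$. Then the map $$\Upsilon:\mathcal A(\omega)[\eta]\otimes_{K[\eta]}\widehat{\mathbb M_P}\longrightarrow\Phi^{(0,\infty)}(\mathbb M_P),\qquad\Upsilon(\alpha\otimes\widehat m)=\alpha\otimes m,$$ is an isomorphism of $\mathcal A(\omega)[\eta]$-modules with connection.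
   Context: Modules are left modules unless stated otherwise. $K$ has absolute value $|\cdot|$ with $|p|=p^{-1}$. $\omega=\sqrt[p-1]{1/p}\in\mathbb R$. $\mathbb W_t=K[t]\langle\partial_t\rangle$, $\mathbb W_\eta=K[\eta]\langle\partial_\eta\rangle$ are Weyl algebras. $\mathcal A_t(1)$ is the ring of power series in $t$ over $K$ convergent for $|t|<1$, with norms $|\sum a_it^i|_\lambda=\sup_i|a_i|\lambda^i$ ($0<\lambda<1$). $\Phi^{(0,\infty)}$ is the set of Laurent series $\sum_{j\le r}a_j(t)\eta^j$, $r\in\mathbb Z$, $a_j(t)\in\mathcal A_t(1)$, such that for all real $\lambda,\rho$ with $0<\rho<\omega\lambda<\omega$ one has $\limsup_{j\to-\infty}|a_j(t)|_\lambda\rho^{-j}=0$; it is a ring under $F\cdot G=\sum_{\alpha\ge0}\frac1{\alpha!}\partial_\eta^\alpha F\cdot\partial_t^\alpha G$ (commutative products on the right-hand side). $\mathcal A(\omega)[\eta]$ is the subring of Laurent series $\sum_{j\le r}a_j\eta^j$, $a_j\in K$, with $\limsup_{j\to-\infty}|a_j|\rho^{-j}=0$ for all $0<\rho<\omega$; it has the derivation $\partial_{\eta^{-1}}=-\eta^2\partial_\eta$. A connection on an $\mathcal A(\omega)[\eta]$-module is a $K$-linear map $\nabla$ with $\nabla(\alpha v)=\partial_{\eta^{-1}}(\alpha)v+\alpha\nabla(v)$. $\Phi^{(0,\infty)}$ is a $\mathbb W_t$-bimodule via the $K$-algebra morphism $t\mapsto t/\pi$, $\partial_t\mapsto\pi\eta$.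 For a $\mathbb W_t$-module $\mathbb M$, $\Phi^{(0,\infty)}(\mathbb M)=\Phi^{(0,\infty)}\otimes_{\mathbb W_t}\mathbb M$, an $\mathcal A(\omega)[\eta]$-module with connection given by left multiplication by $\eta^2\cdot t$. The $p$-adic Fourier transform of $\mathbb M$ is $\widehat{\mathbb M}=\mathbb W_\eta\otimes_{\mathbb W_t}\mathbb M$, with $\mathbb W_\eta$ a right $\mathbb W_t$-module via $t\mapsto-\partial_\eta/\pi$, $\partial_t\mapsto\pi\eta$; $\widehat m=1\otimes m$. For a $\mathbb W_\eta$-module $\mathbb N$, $\mathcal A(\omega)[\eta]\otimes_{K[\eta]}\mathbb N$ carries the connection $\nabla(\alpha\otimes n)=\partial_{\eta^{-1}}(\alpha)\otimes n-\alpha\otimes\eta^2\partial_\eta n$. $\mathcal R_t(1)$ is the Robba ring of series $\sum_{i\in\mathbb Z}a_it^i$, $a_i\in K$, convergent in some annulus $1-\epsilon<|t|<1$, $\epsilon>0$, with derivation $\partial_t=d/dt$. A free $\mathcal R_t(1)$-module of finite rank with connection is soluble at $1$ (Christol–Mebkhout) if its generic radius of convergence $Ray(\cdot,\lambda)$ tends to $1$ as $\lambda\to1^-$; here, if $G_n$ is the matrix of $\partial_t^n$ in a basis, $Ray(\cdot,\lambda)=\min\big(\lambda,\liminf_{n\to\infty}|G_n/n!|_\lambda^{-1/n}\big)$ for $\lambda<1$ close to $1$, with $|\sum_{i\in\mathbb Z} a_it^i|_\lambda=\sup_i|a_i|\lambda^i$ (maximum over entries for matrices). *)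

theory Defs
  imports
    "HOL-Analysis.Analysis"
    "HOL-Computational_Algebra.Formal_Laurent_Series"
    "HOL-Algebra.Module"
    "HOL-Algebra.AbelCoset"
    "HOL-Algebra.Free_Abelian_Groups"
begin

section \<open>The base field\<close>

text \<open>The library constant \<open>norm\<close> is reserved for real normed spaces, so the absolute value \<open>av\<close> is a
  new class parameter. Positive definiteness and \<open>av (- x) = av x\<close> follow from the link with the
  metric, and \<open>av 1 = 1\<close> from multiplicativity.\<close>

class nonarch_field = field_char_0 + metric_space +
  fixes av :: "'a \<Rightarrow> real"
  assumes dist_av: "dist x y = av (x - y)"
    and av_mult: "av (x * y) = av x * av y"
    and av_add: "av (x + y) \<le> max (av x) (av y)"

definition spherically_complete :: "'k::metric_space itself \<Rightarrow> bool" where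
  "spherically_complete _ \<longleftrightarrow>
     (\<forall>(c :: nat \<Rightarrow> 'k) r.
        (\<forall>n. 0 < r n \<and> cball (c (Suc n)) (r (Suc n)) \<subseteq> cball (c n) (r n)) \<longrightarrow>
        (\<Inter>n. cball (c n) (r n)) \<noteq> {})"

definition omega :: "nat \<Rightarrow> real" where
  "omega p = root (p - 1) (1 / real p)"


section \<open>Modules, extension of scalars and connections\<close>

text \<open>Left modules over a possibly noncommutative ring are represented by the record type
  of \<^theory>\<open>HOL-Algebra.Module\<close>, whose fields \<open>mult\<close> and \<open>one\<close> carry no meaning for a module.\<close>

definition restrict_scalars ::
  "('s \<Rightarrow> 'r) \<Rightarrow> ('r, 'm) module \<Rightarrow> ('s, 'm) module" where
  "restrict_scalars f M =
     \<lparr>carrier = carrier M, monoid.mult = monoid.mult M, monoid.one = \<one>\<^bsub>M\<^esub>, ring.zero = \<zero>\<^bsub>M\<^esub>,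
      ring.add = ring.add M, smult = (\<lambda>s x. f s \<odot>\<^bsub>M\<^esub> x)\<rparr>"

text \<open>The tensor product \<open>R \<otimes>\<^sub>T M\<close>, for a ring morphism \<open>f : T \<rightarrow> R\<close> and a left \<open>T\<close>-module \<open>M\<close>,
  where \<open>R\<close> is a right \<open>T\<close>-module via \<open>f\<close>. The elements of \<open>T\<close> are all the elements of the
  type \<open>'t\<close>. The tensor product is the quotient of the free abelian group on \<open>R \<times> M\<close> by the
  subgroup generated by the bilinearity and balancing relations.\<close>

definition tens_free :: "('r, 'x) ring_scheme \<Rightarrow> ('t, 'm) module \<Rightarrow> (('r \<times> 'm) \<Rightarrow>\<^sub>0 int) monoid" where
  "tens_free R M = free_Abelian_group (carrier R \<times> carrier M)"

definition tens_rels ::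
  "('r, 'x) ring_scheme \<Rightarrow> ('t \<Rightarrow> 'r) \<Rightarrow> ('t, 'm) module \<Rightarrow> (('r \<times> 'm) \<Rightarrow>\<^sub>0 int) set" where
  "tens_rels R f M = generate (tens_free R M)
     ({frag_of (a \<oplus>\<^bsub>R\<^esub> b, m) - frag_of (a, m) - frag_of (b, m) | a b m.
         a \<in> carrier R \<and> b \<in> carrier R \<and> m \<in> carrier M}
    \<union> {frag_of (a, m \<oplus>\<^bsub>M\<^esub> n) - frag_of (a, m) - frag_of (a, n) | a m n.
         a \<in> carrier R \<and> m \<in> carrier M \<and> n \<in> carrier M}
    \<union> {frag_of (a \<otimes>\<^bsub>R\<^esub> f t, m) - frag_of (a, t \<odot>\<^bsub>M\<^esub> m) | a t m.
         a \<in> carrier R \<and> m \<in> carrier M})"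

definition tens ::
  "('r, 'x) ring_scheme \<Rightarrow> ('t \<Rightarrow> 'r) \<Rightarrow> ('t, 'm) module \<Rightarrow> 'r \<Rightarrow> 'm \<Rightarrow> (('r \<times> 'm) \<Rightarrow>\<^sub>0 int) set" where
  "tens R f M a m = tens_rels R f M #>\<^bsub>tens_free R M\<^esub> frag_of (a, m)"

text \<open>The additive endomorphism of \<open>R \<otimes>\<^sub>T M\<close> sending \<open>a \<otimes> m\<close> to the class of \<open>\<phi> (a, m)\<close>.
  When \<open>\<phi>\<close> is compatible with the relations, the union is a single coset.\<close>

definition tens_lift ::
  "('r, 'x) ring_scheme \<Rightarrow> ('t \<Rightarrow> 'r) \<Rightarrow> ('t, 'm) module \<Rightarrow>
   ('r \<times> 'm \<Rightarrow> (('r \<times> 'm) \<Rightarrow>\<^sub>0 int)) \<Rightarrow>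
   (('r \<times> 'm) \<Rightarrow>\<^sub>0 int) set \<Rightarrow> (('r \<times> 'm) \<Rightarrow>\<^sub>0 int) set" where
  "tens_lift R f M \<phi> X = (\<Union>c\<in>X. tens_rels R f M #>\<^bsub>tens_free R M\<^esub> frag_extend \<phi> c)"

definition ext_scalars ::
  "('r, 'x) ring_scheme \<Rightarrow> ('t \<Rightarrow> 'r) \<Rightarrow> ('t, 'm) module \<Rightarrow> ('r, (('r \<times> 'm) \<Rightarrow>\<^sub>0 int) set) module" where
  "ext_scalars R f M =
     (let Q = tens_free R M Mod tens_rels R f M in
      \<lparr>carrier = carrier Q, monoid.mult = undefined, monoid.one = undefined,
       ring.zero = \<one>\<^bsub>Q\<^esub>, ring.add = monoid.mult Q,
       smult = (\<lambda>s. tens_lift R f M (\<lambda>(a, m). frag_of (s \<otimes>\<^bsub>R\<^esub> a, m)))\<rparr>)"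

text \<open>\<open>M\<close> is a module over the commutative ring \<open>A\<close> and \<open>conn\<close> a \<open>K\<close>-linear connection on it,
  relative to the structural map \<open>\<kappa> : K \<rightarrow> A\<close> and the derivation \<open>D\<close> of \<open>A\<close>.\<close>

definition module_with_connection ::
  "('a, 'x) ring_scheme \<Rightarrow> ('k \<Rightarrow> 'a) \<Rightarrow> ('a \<Rightarrow> 'a) \<Rightarrow> ('a, 'm) module \<Rightarrow> ('m \<Rightarrow> 'm) \<Rightarrow> bool" where
  "module_with_connection A \<kappa> D M conn \<longleftrightarrow>
     Module.module A M \<and> conn \<in> carrier M \<rightarrow> carrier M \<and>
     (\<forall>u\<in>carrier M. \<forall>v\<in>carrier M. conn (u \<oplus>\<^bsub>M\<^esub> v) = conn u \<oplus>\<^bsub>M\<^esub> conn v) \<and>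
     (\<forall>c. \<forall>v\<in>carrier M. conn (\<kappa> c \<odot>\<^bsub>M\<^esub> v) = \<kappa> c \<odot>\<^bsub>M\<^esub> conn v) \<and>
     (\<forall>\<alpha>\<in>carrier A. \<forall>v\<in>carrier M.
        conn (\<alpha> \<odot>\<^bsub>M\<^esub> v) = (D \<alpha> \<odot>\<^bsub>M\<^esub> v) \<oplus>\<^bsub>M\<^esub> (\<alpha> \<odot>\<^bsub>M\<^esub> conn v))"

definition connection_iso ::
  "('a, 'x) ring_scheme \<Rightarrow> ('k \<Rightarrow> 'a) \<Rightarrow> ('a \<Rightarrow> 'a) \<Rightarrow>
   ('a, 'm) module \<Rightarrow> ('m \<Rightarrow> 'm) \<Rightarrow> ('a, 'n) module \<Rightarrow> ('n \<Rightarrow> 'n) \<Rightarrow> ('m \<Rightarrow> 'n) \<Rightarrow> bool" where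
  "connection_iso A \<kappa> D M conn N conn' \<Upsilon> \<longleftrightarrow>
     module_with_connection A \<kappa> D M conn \<and> module_with_connection A \<kappa> D N conn' \<and>
     bij_betw \<Upsilon> (carrier M) (carrier N) \<and>
     (\<forall>u\<in>carrier M. \<forall>v\<in>carrier M. \<Upsilon> (u \<oplus>\<^bsub>M\<^esub> v) = \<Upsilon> u \<oplus>\<^bsub>N\<^esub> \<Upsilon> v) \<and>
     (\<forall>\<alpha>\<in>carrier A. \<forall>v\<in>carrier M. \<Upsilon> (\<alpha> \<odot>\<^bsub>M\<^esub> v) = \<alpha> \<odot>\<^bsub>N\<^esub> \<Upsilon> v) \<and>
     (\<forall>v\<in>carrier M. \<Upsilon> (conn v) = conn' (\<Upsilon> v))"


section \<open>The Weyl algebra\<close>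

text \<open>An element \<open>\<Sum>\<^sub>k a\<^sub>k(x) \<partial>\<^sup>k\<close> of \<open>K[x]\<langle>\<partial>\<rangle>\<close> is the polynomial with coefficients \<open>a\<^sub>k\<close>. The product is
  given by the Leibniz rule \<open>F \<cdot> G = \<Sum>\<^sub>\<alpha> (1/\<alpha>!) \<partial>\<^sub>\<xi>\<^sup>\<alpha> F \<partial>\<^sub>x\<^sup>\<alpha> G\<close> on symbols, \<open>\<xi>\<close> being the symbol of \<open>\<partial>\<close>.
  The same ring serves as \<open>\<W>\<^sub>t\<close> and as \<open>\<W>\<^sub>\<eta>\<close>.\<close>

type_synonym 'k weyl = "'k poly poly"

definition weyl_mult :: "'k::field_char_0 weyl \<Rightarrow> 'k weyl \<Rightarrow> 'k weyl" where
  "weyl_mult F G =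
     (\<Sum>\<alpha>\<le>degree F. [:[:1 / fact \<alpha>:]:] * (pderiv ^^ \<alpha>) F * map_poly (pderiv ^^ \<alpha>) G)"

definition weyl :: "'k::field_char_0 weyl ring" where
  "weyl = \<lparr>carrier = UNIV, monoid.mult = weyl_mult, monoid.one = 1, ring.zero = 0, ring.add = (+)\<rparr>"

definition weyl_var :: "'k::field_char_0 weyl" where "weyl_var = [:[:0, 1:]:]"
definition weyl_d :: "'k::field_char_0 weyl" where "weyl_d = [:0, 1:]"

lemma weyl_commutator:
  "weyl_d \<otimes>\<^bsub>weyl\<^esub> weyl_var = weyl_var \<otimes>\<^bsub>weyl\<^esub> weyl_d \<oplus>\<^bsub>weyl\<^esub> (\<one>\<^bsub>weyl\<^esub> :: 'k::field_char_0 weyl)"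
  by (simp add: weyl_def weyl_mult_def weyl_var_def weyl_d_def pderiv_pCons map_poly_pCons one_pCons)

text \<open>The \<open>K\<close>-algebra morphism from the Weyl algebra to \<open>S\<close> which sends the variable to \<open>x\<close> and the
  derivation to \<open>y\<close> (a morphism as soon as \<open>y x - x y = 1\<close>); \<open>\<kappa> : K \<rightarrow> S\<close> is the structural map.\<close>

definition weyl_eval ::
  "('s, 'x) ring_scheme \<Rightarrow> ('k \<Rightarrow> 's) \<Rightarrow> 's \<Rightarrow> 's \<Rightarrow> 'k::field_char_0 weyl \<Rightarrow> 's" where
  "weyl_eval S \<kappa> x y P =
     (\<Oplus>\<^bsub>S\<^esub>k\<in>{..degree P}. \<Oplus>\<^bsub>S\<^esub>i\<in>{..degree (coeff P k)}.
        \<kappa> (coeff (coeff P k) i) \<otimes>\<^bsub>S\<^esub> (x [^]\<^bsub>S\<^esub> i) \<otimes>\<^bsub>S\<^esub> (y [^]\<^bsub>S\<^esub> k))"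

definition left_ideal_of :: "'k::field_char_0 weyl \<Rightarrow> 'k weyl set" where
  "left_ideal_of P = {Q \<otimes>\<^bsub>weyl\<^esub> P | Q. Q \<in> carrier weyl}"

text \<open>\<open>\<M>\<^sub>P = \<W>\<^sub>t / \<W>\<^sub>t P\<close>\<close>

definition cyclic_module :: "'k::field_char_0 weyl \<Rightarrow> ('k weyl, 'k weyl set) module" where
  "cyclic_module P =
     \<lparr>carrier = a_rcosets\<^bsub>weyl\<^esub> (left_ideal_of P), monoid.mult = undefined, monoid.one = undefined,
      ring.zero = left_ideal_of P, ring.add = set_add weyl,
      smult = (\<lambda>Q X. \<Union>R\<in>X. left_ideal_of P +>\<^bsub>weyl\<^esub> (Q \<otimes>\<^bsub>weyl\<^esub> R))\<rparr>"

text \<open>Restriction of scalars from the Weyl algebra to the polynomials in its variable.\<close>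

definition as_poly_module :: "('k::field_char_0 weyl, 'm) module \<Rightarrow> ('k poly, 'm) module" where
  "as_poly_module M = restrict_scalars (\<lambda>a. [:a:]) M"


section \<open>The p-adic Fourier transform\<close>

definition weyl_const :: "'k::field_char_0 \<Rightarrow> 'k weyl" where "weyl_const c = [:[:c:]:]"

text \<open>\<open>t \<mapsto> -\<partial>\<^sub>\<eta>/\<pi>\<close>, \<open>\<partial>\<^sub>t \<mapsto> \<pi>\<eta>\<close>\<close>

definition fourier_hom :: "'k::field_char_0 \<Rightarrow> 'k weyl \<Rightarrow> 'k weyl" where
  "fourier_hom \<pi> = weyl_eval weyl weyl_const
     (weyl_const (- 1 / \<pi>) \<otimes>\<^bsub>weyl\<^esub> weyl_d) (weyl_const \<pi> \<otimes>\<^bsub>weyl\<^esub> weyl_var)"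

definition fourier ::
  "'k::field_char_0 \<Rightarrow> ('k weyl, 'm) module \<Rightarrow> ('k weyl, (('k weyl \<times> 'm) \<Rightarrow>\<^sub>0 int) set) module" where
  "fourier \<pi> M = ext_scalars weyl (fourier_hom \<pi>) M"

definition hat ::
  "'k::field_char_0 \<Rightarrow> ('k weyl, 'm) module \<Rightarrow> 'm \<Rightarrow> (('k weyl \<times> 'm) \<Rightarrow>\<^sub>0 int) set" where
  "hat \<pi> M m = tens weyl (fourier_hom \<pi>) M \<one>\<^bsub>weyl\<^esub> m"


section \<open>The ring \<open>\<A>(\<omega>)[\<eta>]\<close>\<close>

text \<open>A Laurent series \<open>\<Sum>\<^bsub>j\<le>r\<^esub> a\<^sub>j \<eta>\<^sup>j\<close> is represented as a formal Laurent series in \<open>\<eta>\<^sup>-\<^sup>1\<close>: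
  \<open>a\<^sub>j = fls_nth F (- j)\<close>, \<open>\<eta>\<close> is \<open>fls_X_inv\<close> and \<open>\<partial>\<^bsub>\<eta>\<^sup>-\<^sup>1\<^esub> = -\<eta>\<^sup>2\<partial>\<^sub>\<eta>\<close> is \<open>fls_deriv\<close>.\<close>

definition A_eta :: "nat \<Rightarrow> 'k::nonarch_field fls ring" where
  "A_eta p =
     \<lparr>carrier = {F. \<forall>\<rho>. 0 < \<rho> \<and> \<rho> < omega p \<longrightarrow>
         limsup (\<lambda>n. ereal (av (fls_nth F (int n)) * \<rho> ^ n)) = 0},
      monoid.mult = (*), monoid.one = 1, ring.zero = 0, ring.add = (+)\<rparr>"

definition poly_in_eta :: "'k::comm_ring_1 poly \<Rightarrow> 'k fls" where
  "poly_in_eta q = poly (map_poly fls_const q) fls_X_inv"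

text \<open>\<open>\<A>(\<omega>)[\<eta>] \<otimes>\<^bsub>K[\<eta>]\<^esub> \<N>\<close>, for a \<open>\<W>\<^sub>\<eta>\<close>-module \<open>\<N>\<close>\<close>

definition at_infinity_module ::
  "nat \<Rightarrow> ('k::nonarch_field weyl, 'n) module \<Rightarrow> ('k fls, (('k fls \<times> 'n) \<Rightarrow>\<^sub>0 int) set) module" where
  "at_infinity_module p N = ext_scalars (A_eta p) poly_in_eta (as_poly_module N)"

definition at_infinity_connection ::
  "nat \<Rightarrow> ('k::nonarch_field weyl, 'n) module \<Rightarrow>
   (('k fls \<times> 'n) \<Rightarrow>\<^sub>0 int) set \<Rightarrow> (('k fls \<times> 'n) \<Rightarrow>\<^sub>0 int) set" where
  "at_infinity_connection p N =
     tens_lift (A_eta p) poly_in_eta (as_poly_module N)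
       (\<lambda>(\<alpha>, n). frag_of (fls_deriv \<alpha>, n)
          - frag_of (\<alpha>, (weyl_var \<otimes>\<^bsub>weyl\<^esub> weyl_var \<otimes>\<^bsub>weyl\<^esub> weyl_d) \<odot>\<^bsub>N\<^esub> n))"


section \<open>The ring \<open>\<Phi>\<^bsup>(0,\<infinity>)\<^esup>\<close>\<close>

text \<open>Convergence on the open unit disc (over every complete extension of the field).\<close>

definition disc_analytic :: "'k::nonarch_field fps \<Rightarrow> bool" where
  "disc_analytic a \<longleftrightarrow>
     (\<forall>l. 0 < l \<and> l < 1 \<longrightarrow> (\<lambda>i. av (fps_nth a i) * l ^ i) \<longlonglongrightarrow> 0)"

definition disc_norm :: "real \<Rightarrow> 'k::nonarch_field fps \<Rightarrow> real" where
  "disc_norm l a = (SUP i. av (fps_nth a i) * l ^ i)"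

text \<open>As above, \<open>\<Sum>\<^bsub>j\<le>r\<^esub> a\<^sub>j(t) \<eta>\<^sup>j\<close> is a formal Laurent series in \<open>\<eta>\<^sup>-\<^sup>1\<close>, now with coefficients in
  \<open>K[[t]]\<close>; so \<open>\<partial>\<^sub>\<eta> = -\<eta>\<^sup>-\<^sup>2\<partial>\<^bsub>\<eta>\<^sup>-\<^sup>1\<^esub>\<close>.\<close>

definition symb_d_eta :: "'k::field_char_0 fps fls \<Rightarrow> 'k fps fls" where
  "symb_d_eta F = - (fls_X\<^sup>2 * fls_deriv F)"

definition symb_d_t :: "'k::field_char_0 fps fls \<Rightarrow> 'k fps fls" where
  "symb_d_t F = Abs_fls (\<lambda>n. fps_deriv (fls_nth F n))"

definition symb_const :: "'k::field_char_0 \<Rightarrow> 'k fps fls" where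
  "symb_const c = fls_const (fps_const c)"

definition symb_t :: "'k::field_char_0 fps fls" where "symb_t = fls_const fps_X"
definition symb_eta :: "'k::field_char_0 fps fls" where "symb_eta = fls_X_inv"

text \<open>Each coefficient of \<open>\<Sum>\<^sub>\<alpha> (1/\<alpha>!) \<partial>\<^sub>\<eta>\<^sup>\<alpha> F \<partial>\<^sub>t\<^sup>\<alpha> G\<close> is a finite sum, as \<open>\<partial>\<^sub>\<eta>\<close> lowers the degree in \<open>\<eta>\<close>.\<close>

definition symb_mult :: "'k::field_char_0 fps fls \<Rightarrow> 'k fps fls \<Rightarrow> 'k fps fls" where
  "symb_mult F G =
     (let T = (\<lambda>\<alpha>. symb_const (1 / fact \<alpha>) * (symb_d_eta ^^ \<alpha>) F * (symb_d_t ^^ \<alpha>) G)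
      in Abs_fls (\<lambda>n. \<Sum>\<alpha> | fls_nth (T \<alpha>) n \<noteq> 0. fls_nth (T \<alpha>) n))"

definition Phi :: "nat \<Rightarrow> 'k::nonarch_field fps fls ring" where
  "Phi p =
     \<lparr>carrier = {F. (\<forall>n. disc_analytic (fls_nth F n)) \<and>
         (\<forall>l \<rho>. 0 < \<rho> \<and> \<rho> < omega p * l \<and> omega p * l < omega p \<longrightarrow>
            limsup (\<lambda>n. ereal (disc_norm l (fls_nth F (int n)) * \<rho> ^ n)) = 0)},
      monoid.mult = symb_mult, monoid.one = 1, ring.zero = 0, ring.add = (+)\<rparr>"

text \<open>\<open>t \<mapsto> t/\<pi>\<close>, \<open>\<partial>\<^sub>t \<mapsto> \<pi>\<eta>\<close>\<close>

definition Phi_hom :: "nat \<Rightarrow> 'k::nonarch_field \<Rightarrow> 'k weyl \<Rightarrow> 'k fps fls" where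
  "Phi_hom p \<pi> = weyl_eval (Phi p) symb_const
     (symb_const (1 / \<pi>) \<otimes>\<^bsub>Phi p\<^esub> symb_t) (symb_const \<pi> \<otimes>\<^bsub>Phi p\<^esub> symb_eta)"

text \<open>The inclusion of \<open>\<A>(\<omega>)[\<eta>]\<close> in \<open>\<Phi>\<^bsup>(0,\<infinity>)\<^esup>\<close>.\<close>

definition A_to_Phi :: "'k::field_char_0 fls \<Rightarrow> 'k fps fls" where
  "A_to_Phi \<alpha> = Abs_fls (\<lambda>n. fps_const (fls_nth \<alpha> n))"

definition Phi_module ::
  "nat \<Rightarrow> 'k::nonarch_field \<Rightarrow> ('k weyl, 'm) module \<Rightarrow>
   ('k fls, (('k fps fls \<times> 'm) \<Rightarrow>\<^sub>0 int) set) module" where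
  "Phi_module p \<pi> M = restrict_scalars A_to_Phi (ext_scalars (Phi p) (Phi_hom p \<pi>) M)"

text \<open>Here \<open>t\<close> is the element \<open>t\<close> of \<open>\<Phi>\<^bsup>(0,\<infinity>)\<^esup>\<close>, not the image \<open>t/\<pi>\<close> of the element \<open>t\<close> of \<open>\<W>\<^sub>t\<close>.\<close>

definition Phi_connection ::
  "nat \<Rightarrow> 'k::nonarch_field \<Rightarrow> ('k weyl, 'm) module \<Rightarrow>
   (('k fps fls \<times> 'm) \<Rightarrow>\<^sub>0 int) set \<Rightarrow> (('k fps fls \<times> 'm) \<Rightarrow>\<^sub>0 int) set" where
  "Phi_connection p \<pi> M X =
     (symb_eta \<otimes>\<^bsub>Phi p\<^esub> symb_eta \<otimes>\<^bsub>Phi p\<^esub> symb_t) \<odot>\<^bsub>ext_scalars (Phi p) (Phi_hom p \<pi>) M\<^esub> X"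


section \<open>The Robba ring and solubility\<close>

text \<open>A series \<open>\<Sum>\<^sub>i a\<^sub>i t\<^sup>i\<close> over all integers \<open>i\<close> is the function \<open>a\<close>.\<close>

definition robba_mult ::
  "(int \<Rightarrow> 'k::nonarch_field) \<Rightarrow> (int \<Rightarrow> 'k) \<Rightarrow> int \<Rightarrow> 'k" where
  "robba_mult f g n = (\<Sum>\<^sub>\<infinity>i\<in>UNIV. f i * g (n - i))"

definition robba :: "(int \<Rightarrow> 'k::nonarch_field) ring" where
  "robba =
     \<lparr>carrier = {f. \<exists>\<epsilon>>0. \<forall>l. 0 < l \<and> 1 - \<epsilon> < l \<and> l < 1 \<longrightarrow>
         ((\<lambda>i. av (f i) * l powi i) \<longlongrightarrow> 0) at_top \<and>
         ((\<lambda>i. av (f i) * l powi i) \<longlongrightarrow> 0) at_bot},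
      monoid.mult = robba_mult, monoid.one = (\<lambda>i. if i = 0 then 1 else 0), ring.zero = (\<lambda>_. 0),
      ring.add = (\<lambda>f g i. f i + g i)\<rparr>"

definition robba_deriv :: "(int \<Rightarrow> 'k::nonarch_field) \<Rightarrow> int \<Rightarrow> 'k" where
  "robba_deriv f i = of_int (i + 1) * f (i + 1)"

definition poly_to_robba :: "'k::nonarch_field poly \<Rightarrow> int \<Rightarrow> 'k" where
  "poly_to_robba a i = (if 0 \<le> i then coeff a (nat i) else 0)"

text \<open>\<open>\<R>\<^sub>t(1) \<otimes>\<^bsub>K[t]\<^esub> \<M>\<close> with connection \<open>conn (f \<otimes> m) = f' \<otimes> m + f \<otimes> \<partial>\<^sub>t m\<close>\<close>

definition robba_module ::
  "('k::nonarch_field weyl, 'm) module \<Rightarrow>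
   (int \<Rightarrow> 'k, (((int \<Rightarrow> 'k) \<times> 'm) \<Rightarrow>\<^sub>0 int) set) module" where
  "robba_module M = ext_scalars robba poly_to_robba (as_poly_module M)"

definition robba_connection ::
  "('k::nonarch_field weyl, 'm) module \<Rightarrow>
   (((int \<Rightarrow> 'k) \<times> 'm) \<Rightarrow>\<^sub>0 int) set \<Rightarrow> (((int \<Rightarrow> 'k) \<times> 'm) \<Rightarrow>\<^sub>0 int) set" where
  "robba_connection M =
     tens_lift robba poly_to_robba (as_poly_module M)
       (\<lambda>(f, m). frag_of (robba_deriv f, m) + frag_of (f, weyl_d \<odot>\<^bsub>M\<^esub> m))"

definition is_basis ::
  "('a, 'x) ring_scheme \<Rightarrow> ('a, 'm) module \<Rightarrow> nat \<Rightarrow> (nat \<Rightarrow> 'm) \<Rightarrow> bool" where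
  "is_basis A M r e \<longleftrightarrow>
     (\<forall>i<r. e i \<in> carrier M) \<and>
     (\<forall>v\<in>carrier M. \<exists>!c. c \<in> {..<r} \<rightarrow>\<^sub>E carrier A \<and> v = (\<Oplus>\<^bsub>M\<^esub>i\<in>{..<r}. c i \<odot>\<^bsub>M\<^esub> e i))"

definition robba_norm :: "real \<Rightarrow> (int \<Rightarrow> 'k::nonarch_field) \<Rightarrow> real" where
  "robba_norm l f = (SUP i. av (f i) * l powi i)"

text \<open>The maximum of the norms of the entries, \<open>0\<close> for the empty matrix.\<close>

definition matrix_norm :: "nat \<Rightarrow> real \<Rightarrow> (nat \<Rightarrow> nat \<Rightarrow> int \<Rightarrow> 'k::nonarch_field) \<Rightarrow> real" where
  "matrix_norm r l H = Max (insert 0 {robba_norm l (H i j) | i j. i < r \<and> j < r})"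

text \<open>\<open>x\<^bsup>-1/n\<^esup>\<close> for \<open>x \<ge> 0\<close>, equal to \<open>\<infinity>\<close> when \<open>x = 0\<close>.\<close>

definition inv_root :: "nat \<Rightarrow> real \<Rightarrow> ereal" where
  "inv_root n x = (if x = 0 then \<infinity> else ereal (x powr (- 1 / real n)))"

definition Ray ::
  "nat \<Rightarrow> (nat \<Rightarrow> nat \<Rightarrow> nat \<Rightarrow> int \<Rightarrow> 'k::nonarch_field) \<Rightarrow> real \<Rightarrow> ereal" where
  "Ray r G l =
     min (ereal l)
       (liminf (\<lambda>n. inv_root n (matrix_norm r l (\<lambda>i j k. G n i j k / fact n))))"

text \<open>\<open>M\<close> is free of finite rank \<open>r\<close> over the Robba ring, \<open>G n\<close> is the matrix of \<open>conn\<^sup>n\<close> in a basis, and the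
  generic radius of convergence tends to 1.\<close>

definition soluble_at_1 ::
  "(int \<Rightarrow> 'k::nonarch_field, 'm) module \<Rightarrow> ('m \<Rightarrow> 'm) \<Rightarrow> bool" where
  "soluble_at_1 M conn \<longleftrightarrow>
     (\<exists>r e G. is_basis robba M r e \<and>
        (\<forall>n. \<forall>i<r. \<forall>j<r. G n i j \<in> carrier robba) \<and>
        (\<forall>n. \<forall>j<r. (conn ^^ n) (e j) = (\<Oplus>\<^bsub>M\<^esub>i\<in>{..<r}. G n i j \<odot>\<^bsub>M\<^esub> e i)) \<and>
        (Ray r G \<longlongrightarrow> 1) (at_left 1))"

end

theory Submission imports Defs begin

text \<open>
  Solubility at \<open>1\<close> bounds every coefficient of \<open>P\<close> by its leading coefficient: otherwise the remainders
  of \<open>\<partial>\<^sup>n\<close> modulo \<open>P\<close> grow geometrically for a suitable Gauss norm on \<open>|t| = l\<close>, \<open>l\<close> close to \<open>1\<close>, while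
  solubility makes \<open>\<partial>\<^sup>n = n! (\<partial>\<^sup>n / n!)\<close> tend to \<open>0\<close>, as \<open>|n!|\<close> decreases geometrically.

  By this bound, the slope condition at infinity and \<open>|\<pi>| = \<omega>\<close>, the image of \<open>P\<close> in \<open>\<Phi>\<close> has a dominant
  term \<open>c t\<^sup>\<delta> \<eta>\<^sup>d\<close>, so that one can divide by it: \<open>\<Phi>(\<M>\<^sub>P)\<close> is free over \<open>\<A>(\<omega>)[\<eta>]\<close> with basis
  \<open>t\<^sup>i \<otimes> 1\<close>, \<open>i < \<delta>\<close>. The Fourier transform of \<open>P\<close> has degree \<open>\<delta>\<close> in \<open>\<partial>\<^sub>\<eta>\<close>, and its leading coefficient,
  a polynomial in \<open>\<eta>\<close>, is invertible in \<open>\<A>(\<omega>)[\<eta>]\<close> by the same bound. Hence the elements \<open>(-\<partial>\<^sub>\<eta>)\<^sup>i \<otimes> 1\<close>,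
  \<open>i < \<delta>\<close>, generate the source of the comparison map, and they are sent to that basis.
\<close>

section \<open>The product of symbols\<close>

text \<open>The radii are chosen for definite reasons. In \<open>Phi\<close> the weight \<rho> of
  1/\<eta> stays below the weight l of t: each correction of the product differentiates once in each
  variable, so the product is submultiplicative. It also stays below \<omega>: as |\<pi>| =
  \<omega>, lowering the order by one may enlarge a coefficient by 1/\<omega>. Only l > \<omega> is
  examined, where powers of t/\<pi> grow in norm and t^\<delta> wins. In the Weyl algebra the weight
  of the derivation is \<rho> = 1/l^2: then l \<rho> > 1, which makes the Gauss norm multiplicative,
  and \<rho> > 1 tends to 1 with l, so a coefficient larger than \<alpha> still outweighs the
  leading term for l near 1. Solubility is stated in an unknown basis over the Robba ring, so the
  coordinates of remainders are turned into linear functionals that can be evaluated in that basis.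
  Tensor products are quotients of free groups, so linear independence is shown by an additive map
  that detects the elements. The comparison map comes from the morphism \<eta> -> \<eta>, derivation
  -> -t into \<open>Phi\<close>; composed with the Fourier morphism it is
  \<open>Phi_hom\<close>.\<close>

definition vanishes_below :: "int \<Rightarrow> 'a::zero fls \<Rightarrow> bool" where
  "vanishes_below B F \<longleftrightarrow> (\<forall>n<B. fls_nth F n = 0)"

lemma vanishes_belowD: "vanishes_below B F \<Longrightarrow> n < B \<Longrightarrow> fls_nth F n = 0"
  by (simp add: vanishes_below_def)

lemma vanishes_below_mono: "vanishes_below B F \<Longrightarrow> B' \<le> B \<Longrightarrow> vanishes_below B' F"
  by (auto simp: vanishes_below_def)

lemma vanishes_below_ex: "\<exists>B. vanishes_below B F"
  by (metis fls_eq0_below_subdegree vanishes_below_def)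

lemma common_vanishes_below: "\<exists>B. vanishes_below B F \<and> vanishes_below B G"
  by (metis vanishes_below_ex vanishes_below_mono min.cobounded1 min.cobounded2)

text \<open>Shifting both factors turns them into power series, where this is the Cauchy product;
  lower bounds need not be sharp.\<close>

lemma fls_times_nth_vanishing:
  fixes f g :: "'a::comm_ring_1 fls"
  assumes f: "vanishes_below a f" and g: "vanishes_below b g"
  shows "fls_nth (f * g) (a + b + int n) =
      (\<Sum>i\<le>n. fls_nth f (a + int i) * fls_nth g (b + int (n - i)))" (is ?A)
    and "vanishes_below (a + b) (f * g)" (is ?B)
proof -
  define f' where "f' = Abs_fps (\<lambda>i. fls_nth f (a + int i))"
  define g' where "g' = Abs_fps (\<lambda>i. fls_nth g (b + int i))"
  have F: "f = fls_shift (- a) (fps_to_fls f')" and G: "g = fls_shift (- b) (fps_to_fls g')"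
    using f g by (auto intro!: fls_eqI simp: f'_def g'_def vanishes_below_def)
  have P: "f * g = fls_shift (- a - b) (fps_to_fls (f' * g'))"
    by (subst F, subst G) (simp add: fls_times_both_shifted_simp fls_times_fps_to_fls)
  show ?A unfolding P
    by (simp add: fps_mult_nth f'_def g'_def atMost_atLeast0)
  show ?B unfolding P vanishes_below_def by simp
qed

lemma nth_symb_d_t: "fls_nth (symb_d_t F) n = fps_deriv (fls_nth F n)"
  unfolding symb_d_t_def
  by (subst nth_Abs_fls_lower_bound[of "fls_subdegree F"]) auto

lemma nth_symb_d_t_iter: "fls_nth ((symb_d_t ^^ k) F) n = (fps_deriv ^^ k) (fls_nth F n)"
  by (induction k) (auto simp: nth_symb_d_t)

lemma nth_symb_d_eta: "fls_nth (symb_d_eta F) n = of_int (1 - n) * fls_nth F (n - 1)"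
  by (simp add: symb_d_eta_def fls_X_power_times_conv_shift algebra_simps)

lemma fps_const_gbinomial_Suc:
  "fps_const (fact (Suc k) * ((x::'k::field_char_0) gchoose Suc k)) =
    fps_const (x - of_nat k) * fps_const (fact k * (x gchoose k))"
  by (simp only: gbinomial_mult_fact prod.op_ivl_Suc fps_const_mult) (simp add: mult.commute)

text \<open>Index \<open>n\<close> of the result stems from \<eta>^(k-n), which k derivations
  multiply by a falling factorial. Writing it as \<open>fact k\<close> times a binomial coefficient
  lets the 1/k! of the product cancel: an integer remains, of absolute value at most 1.\<close>

lemma nth_symb_d_eta_iter:
  "fls_nth ((symb_d_eta ^^ k) F) n =
     fps_const (fact k * (of_int (int k - n) gchoose k)) * fls_nth F (n - int k)"
proof (induction k arbitrary: n)
  case (Suc k)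
  have "fls_nth ((symb_d_eta ^^ Suc k) F) n =
    of_int (1 - n) * (fps_const (fact k * (of_int (int k - (n - 1)) gchoose k)) * fls_nth F (n - 1 - int k))"
    by (simp add: nth_symb_d_eta Suc.IH)
  also have "(of_int (1 - n) :: 'a fps) = fps_const (of_int (int (Suc k) - n) - of_nat k)"
    by (metis (no_types, lifting) add_diff_cancel_left' diff_diff_eq2 fps_of_int group_cancel.sub1 of_int_diff of_int_of_nat_eq of_nat_Suc)
  also have "int k - (n - 1) = int (Suc k) - n" by simp
  also have "n - 1 - int k = n - int (Suc k)" by simp
  finally show ?case
    by (simp only: fps_const_gbinomial_Suc mult.assoc)
qed simp

text \<open>The i-th coefficient of the left factor belongs to \<eta>^(-(B + i)), which explains the
  binomial coefficient. Since each correction lowers the degree in \<eta> by one, the indices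
  satisfy \<alpha> + i + j = n.\<close>

definition symb_conv :: "int \<Rightarrow> (nat \<Rightarrow> 'k::field_char_0 fps) \<Rightarrow> (nat \<Rightarrow> 'k fps) \<Rightarrow> nat \<Rightarrow> 'k fps" where
  "symb_conv B f g n = (\<Sum>\<alpha>\<le>n. \<Sum>i\<le>n - \<alpha>.
     fps_const (of_int (- (B + int i)) gchoose \<alpha>) * f i * (fps_deriv ^^ \<alpha>) (g (n - \<alpha> - i)))"

text \<open>Each differentiation in \<eta> raises the order in 1/\<eta>, so the term
  \<open>T \<alpha>\<close> starts only at \<open>B + C + int \<alpha>\<close>. This makes the sum
  over \<alpha> finite in every degree and justifies \<open>Abs_fls\<close>.\<close>

lemma nth_symb_mult:
  assumes F: "vanishes_below B F" and G: "vanishes_below C G"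
  shows "fls_nth (symb_mult F G) (B + C + int n) =
      symb_conv B (\<lambda>i. fls_nth F (B + int i)) (\<lambda>i. fls_nth G (C + int i)) n" (is ?A)
    and "vanishes_below (B + C) (symb_mult F G)" (is ?B)
proof -
  define T where
    "T = (\<lambda>\<alpha>. symb_const (1 / fact \<alpha>) * (symb_d_eta ^^ \<alpha>) F * (symb_d_t ^^ \<alpha>) G)"
  have vF: "vanishes_below (B + int \<alpha>) ((symb_d_eta ^^ \<alpha>) F)" for \<alpha>
    using F by (auto simp: vanishes_below_def nth_symb_d_eta_iter)
  have vG: "vanishes_below C ((symb_d_t ^^ \<alpha>) G)" for \<alpha>
  proof -
    have "(fps_deriv ^^ \<alpha>) (0 :: 'a fps) = 0" by (induction \<alpha>) auto
    thus ?thesis using G by (auto simp: vanishes_below_def nth_symb_d_t_iter)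
  qed
  have Tn: "fls_nth (T \<alpha>) (B + int \<alpha> + C + int m) = (\<Sum>i\<le>m.
     fps_const (of_int (- (B + int i)) gchoose \<alpha>) * fls_nth F (B + int i) *
       (fps_deriv ^^ \<alpha>) (fls_nth G (C + int (m - i))))" for \<alpha> m
  proof -
    have "fls_nth (T \<alpha>) (B + int \<alpha> + C + int m) = fps_const (1 / fact \<alpha>) *
       (\<Sum>i\<le>m. fls_nth ((symb_d_eta ^^ \<alpha>) F) (B + int \<alpha> + int i) * fls_nth ((symb_d_t ^^ \<alpha>) G) (C + int (m - i)))"
      unfolding T_def symb_const_def mult.assoc
      by (simp only: fls_mult_const_nth fls_times_nth_vanishing(1)[OF vF vG])
    also have "\<dots> = (\<Sum>i\<le>m.
     fps_const (of_int (- (B + int i)) gchoose \<alpha>) * fls_nth F (B + int i) *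
       (fps_deriv ^^ \<alpha>) (fls_nth G (C + int (m - i))))"
      unfolding sum_distrib_left
      by (intro sum.cong refl)
         (simp add: nth_symb_d_eta_iter nth_symb_d_t_iter mult.assoc[symmetric] add.commute)
    finally show ?thesis .
  qed
  have Tz: "vanishes_below (B + int \<alpha> + C) (T \<alpha>)" for \<alpha>
    using fls_times_nth_vanishing(2)[OF vF vG, of \<alpha>]
    by (auto simp: T_def symb_const_def mult.assoc vanishes_below_def)
  define S where "S = (\<lambda>n. \<Sum>\<alpha> | fls_nth (T \<alpha>) n \<noteq> 0. fls_nth (T \<alpha>) n)"
  have Sz: "S n = 0" if "n < B + C" for n
  proof -
    have "fls_nth (T \<alpha>) n = 0" for \<alpha> by (rule vanishes_belowD[OF Tz]) (use that in simp)
    thus ?thesis by (simp add: S_def)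
  qed
  have E: "fls_nth (symb_mult F G) n = S n" for n
    unfolding symb_mult_def Let_def T_def[symmetric] S_def[symmetric]
    by (rule nth_Abs_fls_lower_bound[of "B + C"]) (simp add: Sz)
  show ?B using Sz by (simp add: vanishes_below_def E)
  have "S (B + C + int n) = (\<Sum>\<alpha>\<le>n. fls_nth (T \<alpha>) (B + C + int n))"
    unfolding S_def
  proof (rule sum.mono_neutral_left)
    show "{\<alpha>. fls_nth (T \<alpha>) (B + C + int n) \<noteq> 0} \<subseteq> {..n}"
    proof
      fix \<alpha> assume "\<alpha> \<in> {\<alpha>. fls_nth (T \<alpha>) (B + C + int n) \<noteq> 0}"
      hence "\<not> B + C + int n < B + int \<alpha> + C" using vanishes_belowD[OF Tz] by blast
      thus "\<alpha> \<in> {..n}" by simp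
    qed
  qed auto
  also have "\<dots> = symb_conv B (\<lambda>i. fls_nth F (B + int i)) (\<lambda>i. fls_nth G (C + int i)) n"
    unfolding symb_conv_def
  proof (rule sum.cong[OF refl])
    fix \<alpha> assume "\<alpha> \<in> {..n}"
    hence "B + C + int n = B + int \<alpha> + C + int (n - \<alpha>)" by simp
    thus "fls_nth (T \<alpha>) (B + C + int n) = (\<Sum>i\<le>n - \<alpha>.
       fps_const (of_int (- (B + int i)) gchoose \<alpha>) * fls_nth F (B + int i) *
       (fps_deriv ^^ \<alpha>) (fls_nth G (C + int (n - \<alpha> - i))))"
      by (simp only: Tn)
  qed
  finally show ?A by (simp only: E)
qed

section \<open>Iterated derivatives of power series and the Leibniz rule\<close>

lemma fps_deriv_iter_add: "(fps_deriv ^^ n) (f + g) = (fps_deriv ^^ n) f + (fps_deriv ^^ n) (g :: 'a::comm_ring_1 fps)"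
  by (induction n) auto

lemma fps_deriv_iter_0 [simp]: "(fps_deriv ^^ n) (0 :: 'a::comm_ring_1 fps) = 0"
  by (induction n) auto

lemma fps_deriv_iter_const_mult:
  "(fps_deriv ^^ n) (fps_const c * f) = fps_const c * (fps_deriv ^^ n) (f :: 'a::comm_ring_1 fps)"
  by (induction n) auto

lemma fps_deriv_iter_sum:
  "(fps_deriv ^^ n) (\<Sum>i\<in>A. f i :: 'a::comm_ring_1 fps) = (\<Sum>i\<in>A. (fps_deriv ^^ n) (f i))"
  by (induction A rule: infinite_finite_induct) (auto simp: fps_deriv_iter_add)

lemma fps_deriv_iter_mult:
  "(fps_deriv ^^ n) (f * g :: 'a::comm_ring_1 fps) =
    (\<Sum>k\<le>n. of_nat (n choose k) * (fps_deriv ^^ k) f * (fps_deriv ^^ (n - k)) g)"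
proof (induction n)
  case (Suc n)
  let ?t = "\<lambda>n k. (fps_deriv ^^ k) f * (fps_deriv ^^ (n - k)) g"
  have "(fps_deriv ^^ Suc n) (f * g) = (\<Sum>k\<le>n. of_nat (n choose k) *
      ((fps_deriv ^^ Suc k) f * (fps_deriv ^^ (n - k)) g + (fps_deriv ^^ k) f * (fps_deriv ^^ Suc (n - k)) g))"
    by (simp add: Suc.IH fps_deriv_sum mult.assoc) (auto intro!: sum.cong simp: algebra_simps)
  also have "\<dots> = (\<Sum>k\<le>n. of_nat (n choose k) * ?t (Suc n) (Suc k)) + (\<Sum>k\<le>n. of_nat (n choose k) * ?t (Suc n) k)"
    by (simp add: sum.distrib[symmetric] distrib_left Suc_diff_le del: funpow.simps)
  also have "(\<Sum>k\<le>n. of_nat (n choose k) * ?t (Suc n) k) = (\<Sum>k\<le>Suc n. of_nat (n choose k) * ?t (Suc n) k)"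
    by (simp add: binomial_eq_0 del: funpow.simps)
  also have "\<dots> = ?t (Suc n) 0 + (\<Sum>k\<le>n. of_nat (n choose Suc k) * ?t (Suc n) (Suc k))"
    by (subst sum.atMost_Suc_shift) (simp del: funpow.simps add: funpow_0)
  also have "(\<Sum>k\<le>n. of_nat (n choose k) * ?t (Suc n) (Suc k)) +
      (?t (Suc n) 0 + (\<Sum>k\<le>n. of_nat (n choose Suc k) * ?t (Suc n) (Suc k)))
      = ?t (Suc n) 0 + (\<Sum>k\<le>n. of_nat (Suc n choose Suc k) * ?t (Suc n) (Suc k))"
    by (simp add: sum.distrib[symmetric] algebra_simps del: funpow.simps)
  also have "\<dots> = (\<Sum>k\<le>Suc n. of_nat (Suc n choose k) * ?t (Suc n) k)"
    by (simp add: sum.atMost_Suc_shift[of _ n] del: funpow.simps sum.atMost_Suc)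
  finally show ?case by (simp add: mult.assoc del: funpow.simps)
qed simp

text \<open>The binomial identity behind associativity: trinomial revision followed by Vandermonde.\<close>

lemma gbinomial_symb_assoc:
  fixes x y :: "'k::field_char_0"
  shows "(\<Sum>(a, b)\<in>{(a, b). a + b = s}. (x gchoose (\<gamma> + a)) * (y gchoose b) * of_nat ((\<gamma> + a) choose \<gamma>)) =
    (x gchoose \<gamma>) * ((x + y - of_nat \<gamma>) gchoose s)"
proof -
  have "(\<Sum>(a, b)\<in>{(a, b). a + b = s}. (x gchoose (\<gamma> + a)) * (y gchoose b) * of_nat ((\<gamma> + a) choose \<gamma>)) =
    (\<Sum>(a, b)\<in>{(a, b). a + b = s}. (x gchoose \<gamma>) * (((x - of_nat \<gamma>) gchoose a) * (y gchoose b)))"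
  proof (intro sum.cong refl, clarify)
    fix a b
    have "(x gchoose (\<gamma> + a)) * of_nat ((\<gamma> + a) choose \<gamma>) = (x gchoose \<gamma>) * ((x - of_nat \<gamma>) gchoose a)"
      using gbinomial_trinomial_revision[of \<gamma> "\<gamma> + a" x] by (simp add: binomial_gbinomial)
    thus "(x gchoose (\<gamma> + a)) * (y gchoose b) * of_nat ((\<gamma> + a) choose \<gamma>) =
      (x gchoose \<gamma>) * (((x - of_nat \<gamma>) gchoose a) * (y gchoose b))"
      by (simp add: mult_ac)
  qed
  also have "\<dots> = (x gchoose \<gamma>) * (\<Sum>(a, b)\<in>{(a, b). a + b = s}. ((x - of_nat \<gamma>) gchoose a) * (y gchoose b))"
    by (simp add: sum_distrib_left case_prod_unfold)
  also have "(\<Sum>(a, b)\<in>{(a, b). a + b = s}. ((x - of_nat \<gamma>) gchoose a) * (y gchoose b)) =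
      (\<Sum>k=0..s. ((x - of_nat \<gamma>) gchoose k) * (y gchoose (s - k)))"
    by (rule sum.reindex_bij_witness[of _ "\<lambda>k. (k, s - k)" fst]) auto
  also have "\<dots> = (x + y - of_nat \<gamma>) gchoose s"
    by (simp only: gbinomial_Vandermonde diff_add_eq)
  finally show ?thesis .
qed

section \<open>Associativity of the product of symbols\<close>

lemma fps_const_sum_distrib: "fps_const (\<Sum>i\<in>A. f i) = (\<Sum>i\<in>A. fps_const (f i :: 'a::comm_ring_1))"
  by (induction A rule: infinite_finite_induct) (auto simp: fps_const_add[symmetric] simp del: fps_const_add)

lemma sum_triples:
  "(\<Sum>a\<le>n. \<Sum>b\<le>n - a. F a b (n - a - b)) = (\<Sum>(a, b, c)\<in>{(a, b, c). a + b + c = (n::nat)}. F a b c)"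
  unfolding sum.Sigma[OF finite_atMost ballI[OF finite_atMost]]
  by (rule sum.reindex_bij_witness[of _ "\<lambda>(a, b, c). (a, b)" "\<lambda>(a, b). (a, b, n - a - b)"]) auto

lemma sum_pairs: "(\<Sum>a\<le>n. F a (n - a)) = (\<Sum>(a, b)\<in>{(a, b). a + b = (n::nat)}. F a b)"
  by (rule sum.reindex_bij_witness[of _ fst "\<lambda>a. (a, n - a)"]) auto

lemma finite_triples: "finite {(a, b, c). a + b + c = (n::nat)}"
  by (rule finite_subset[of _ "{..n} \<times> {..n} \<times> {..n}"]) auto

lemma finite_pairs: "finite {(a, b). a + b = (n::nat)}"
  by (rule finite_subset[of _ "{..n} \<times> {..n}"]) auto

lemma symb_conv_triples:
  "symb_conv B f g n = (\<Sum>(\<alpha>, i, j)\<in>{(\<alpha>, i, j). \<alpha> + i + j = n}.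
     fps_const (of_int (- (B + int i)) gchoose \<alpha>) * f i * (fps_deriv ^^ \<alpha>) (g j))"
  unfolding symb_conv_def by (rule sum_triples)

text \<open>Both sides are sums of f_i times the \<gamma>-th derivative of g_j times the \<beta>-th
  derivative of h_k. On the left the coefficient is a product of two binomials. On the right \<beta>
  = a + b, where a derivations come from the Leibniz rule and b from the inner product;
  \<open>gbinomial_symb_assoc\<close> adds up these splittings.\<close>

lemma symb_conv_assoc:
  fixes f g h :: "nat \<Rightarrow> 'k::field_char_0 fps"
  shows "symb_conv (B + C) (symb_conv B f g) h n = symb_conv B f (symb_conv C g h) n"
proof -
  define T :: "nat \<Rightarrow> (nat \<times> nat \<times> nat) set" where "T = (\<lambda>n. {(a, b, c). a + b + c = n})"
  define T2 :: "nat \<Rightarrow> (nat \<times> nat) set" where "T2 = (\<lambda>n. {(a, b). a + b = n})"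
  have fin [simp]: "finite (T m)" "finite (T2 m)" for m
    using finite_triples finite_pairs by (auto simp: T_def T2_def)
  define t where "t = (\<lambda>i j \<gamma> k \<beta>. f i * (fps_deriv ^^ \<gamma>) (g j) * (fps_deriv ^^ \<beta>) (h k))"
  define X where "X = (\<lambda>i::nat. of_int (- (B + int i)) :: 'k)"
  define Y where "Y = (\<lambda>j::nat. of_int (- (C + int j)) :: 'k)"
  define Z where "Z = (\<lambda>l::nat. of_int (- (B + C + int l)) :: 'k)"
  define I where "I = {(i, j, k, \<gamma>, \<beta>). i + j + k + \<gamma> + \<beta> = n}"
  have "I \<subseteq> {..n} \<times> {..n} \<times> {..n} \<times> {..n} \<times> {..n}" by (auto simp: I_def)
  hence finI [simp]: "finite I" by (rule finite_subset) auto
  have "symb_conv (B + C) (symb_conv B f g) h n =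
     (\<Sum>x\<in>T n. case x of (\<beta>, l, k) \<Rightarrow> \<Sum>y\<in>T l. case y of (\<gamma>, i, j) \<Rightarrow>
        fps_const ((X i gchoose \<gamma>) * (Z l gchoose \<beta>)) * t i j \<gamma> k \<beta>)"
  proof -
    have *: "fps_const (a * b) * t i j \<gamma> k \<beta> =
        fps_const b * (fps_const a * f i * (fps_deriv ^^ \<gamma>) (g j)) * (fps_deriv ^^ \<beta>) (h k)" for a b i j \<gamma> k \<beta>
      by (simp add: t_def fps_const_mult[symmetric] mult_ac del: fps_const_mult)
    show ?thesis
      unfolding * symb_conv_triples X_def Z_def T_def
      by (intro sum.cong refl) (auto simp: sum_distrib_left sum_distrib_right intro!: sum.cong)
  qed
  also have "\<dots> = (\<Sum>(x, y)\<in>Sigma (T n) (\<lambda>(\<beta>, l, k). T l). case x of (\<beta>, l, k) \<Rightarrow> case y of (\<gamma>, i, j) \<Rightarrow>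
        fps_const ((X i gchoose \<gamma>) * (Z l gchoose \<beta>)) * t i j \<gamma> k \<beta>)"
    by (subst sum.Sigma[symmetric]) (auto intro!: sum.cong)
  also have "\<dots> = (\<Sum>(i, j, k, \<gamma>, \<beta>)\<in>I.
      fps_const ((X i gchoose \<gamma>) * ((X i + Y j - of_nat \<gamma>) gchoose \<beta>)) * t i j \<gamma> k \<beta>)"
  proof -
    have "Z (\<gamma> + i + j) = X i + Y j - of_nat \<gamma>" for i j \<gamma>
      by (simp add: X_def Y_def Z_def)
    thus ?thesis
      by (intro sum.reindex_bij_witness[of _ "\<lambda>(i, j, k, \<gamma>, \<beta>). ((\<beta>, \<gamma> + i + j, k), (\<gamma>, i, j))"
        "\<lambda>((\<beta>, l, k), (\<gamma>, i, j)). (i, j, k, \<gamma>, \<beta>)"]) (auto simp: I_def T_def)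
  qed
  also have "\<dots> = (\<Sum>x\<in>I. case x of (i, j, k, \<gamma>, \<beta>) \<Rightarrow> \<Sum>(a, b)\<in>T2 \<beta>.
      fps_const ((X i gchoose (\<gamma> + a)) * (Y j gchoose b) * of_nat ((\<gamma> + a) choose \<gamma>)) * t i j \<gamma> k \<beta>)"
    unfolding T2_def gbinomial_symb_assoc[symmetric]
    by (intro sum.cong refl) (auto simp: fps_const_sum_distrib sum_distrib_right intro!: sum.cong)
  also have "\<dots> = (\<Sum>(x, y)\<in>Sigma I (\<lambda>(i, j, k, \<gamma>, \<beta>). T2 \<beta>).
      case x of (i, j, k, \<gamma>, \<beta>) \<Rightarrow> case y of (a, b) \<Rightarrow>
      fps_const ((X i gchoose (\<gamma> + a)) * (Y j gchoose b) * of_nat ((\<gamma> + a) choose \<gamma>)) * t i j \<gamma> k \<beta>)"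
    by (subst sum.Sigma[symmetric]) (auto intro!: sum.cong)
  \<comment> \<open>Here \<alpha> = \<gamma> + a counts the derivations of the outer product, and l
    = b + j + k is the index in the inner product.\<close>
  also have "\<dots> = (\<Sum>(x, y, z)\<in>Sigma (T n) (\<lambda>(\<alpha>, i, l). T l \<times> T2 \<alpha>).
      case x of (\<alpha>, i, l) \<Rightarrow> case y of (\<beta>, j, k) \<Rightarrow> case z of (\<gamma>, \<delta>) \<Rightarrow>
      fps_const ((X i gchoose \<alpha>) * (Y j gchoose \<beta>) * of_nat (\<alpha> choose \<gamma>)) * t i j \<gamma> k (\<delta> + \<beta>))"
    by (intro sum.reindex_bij_witness[of _
        "\<lambda>((\<alpha>, i, l), (\<beta>, j, k), (\<gamma>, \<delta>)). ((i, j, k, \<gamma>, \<delta> + \<beta>), (\<delta>, \<beta>))"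
        "\<lambda>((i, j, k, \<gamma>, \<beta>), (a, b)). ((\<gamma> + a, i, b + j + k), (b, j, k), (\<gamma>, a))"])
      (auto simp: I_def T_def T2_def)
  also have "\<dots> = (\<Sum>x\<in>T n. case x of (\<alpha>, i, l) \<Rightarrow> \<Sum>y\<in>T l. case y of (\<beta>, j, k) \<Rightarrow> \<Sum>z\<in>T2 \<alpha>. case z of (\<gamma>, \<delta>) \<Rightarrow>
      fps_const ((X i gchoose \<alpha>) * (Y j gchoose \<beta>) * of_nat (\<alpha> choose \<gamma>)) * t i j \<gamma> k (\<delta> + \<beta>))"
    by (subst sum.Sigma[symmetric]) (auto simp: sum.cartesian_product case_prod_unfold intro!: sum.cong)
  also have "\<dots> = symb_conv B f (symb_conv C g h) n"
  proof -
    have *: "fps_const ((X i gchoose \<alpha>) * (Y j gchoose \<beta>) * of_nat (\<alpha> choose \<gamma>)) * t i j \<gamma> k (\<delta> + \<beta>)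
      = fps_const (X i gchoose \<alpha>) * f i * (fps_const (Y j gchoose \<beta>) *
          (of_nat (\<alpha> choose \<gamma>) * (fps_deriv ^^ \<gamma>) (g j) * (fps_deriv ^^ \<delta>) ((fps_deriv ^^ \<beta>) (h k))))"
      for i j k \<alpha> \<beta> \<gamma> \<delta>
      unfolding funpow_add t_def
      by (simp add: fps_const_mult[symmetric] fps_of_nat mult_ac del: fps_const_mult)
    have **: "(fps_deriv ^^ \<alpha>) (u * v) =
      (\<Sum>z\<in>T2 \<alpha>. case z of (\<gamma>, \<delta>) \<Rightarrow> of_nat (\<alpha> choose \<gamma>) * (fps_deriv ^^ \<gamma>) u * (fps_deriv ^^ \<delta>) v)"
      for \<alpha> and u v :: "'k fps"
      unfolding fps_deriv_iter_mult T2_def by (rule sum_pairs)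
    have "(\<Sum>z\<in>T2 \<alpha>. case z of (\<gamma>, \<delta>) \<Rightarrow>
      fps_const ((X i gchoose \<alpha>) * (Y j gchoose \<beta>) * of_nat (\<alpha> choose \<gamma>)) * t i j \<gamma> k (\<delta> + \<beta>)) =
      fps_const (X i gchoose \<alpha>) * f i * (fps_const (Y j gchoose \<beta>) * (fps_deriv ^^ \<alpha>) (g j * (fps_deriv ^^ \<beta>) (h k)))"
      for i j k \<alpha> \<beta>
      unfolding * ** sum_distrib_left by (simp add: case_prod_unfold)
    hence ***: "(\<Sum>z\<in>T2 \<alpha>. case z of (\<gamma>, \<delta>) \<Rightarrow>
      fps_const ((X i gchoose \<alpha>) * (Y j gchoose \<beta>) * of_nat (\<alpha> choose \<gamma>)) * t i j \<gamma> k (\<delta> + \<beta>)) =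
      fps_const (X i gchoose \<alpha>) * f i * (fps_deriv ^^ \<alpha>) (fps_const (Y j gchoose \<beta>) * (g j * (fps_deriv ^^ \<beta>) (h k)))"
      for i j k \<alpha> \<beta>
      by (simp only: fps_deriv_iter_const_mult)
    show ?thesis
      unfolding ***
      unfolding symb_conv_triples X_def Y_def T_def fps_deriv_iter_sum sum_distrib_left
      by (simp add: case_prod_unfold mult.assoc)
  qed
  finally show ?thesis .
qed

section \<open>Ring laws for symbols and products without corrections\<close>

lemma vanishes_below_eqI:
  assumes "vanishes_below B F" "vanishes_below B G" "\<And>n. fls_nth F (B + int n) = fls_nth G (B + int n)"
  shows "F = G"
proof (rule fls_eqI)
  fix m show "fls_nth F m = fls_nth G m"
  proof (cases "m < B")
    case False
    then obtain n where "m = B + int n" using zle_iff_zadd[of B m] by auto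
    thus ?thesis using assms by simp
  qed (use assms in \<open>simp add: vanishes_below_def\<close>)
qed

lemma symb_mult_assoc:
  "symb_mult (symb_mult F G) H = symb_mult F (symb_mult G (H :: 'k::field_char_0 fps fls))"
proof -
  obtain A B C where v: "vanishes_below A F" "vanishes_below B G" "vanishes_below C H"
    using vanishes_below_ex by metis
  note fg = nth_symb_mult[OF v(1,2)] and gh = nth_symb_mult[OF v(2,3)]
  show ?thesis
  proof (rule vanishes_below_eqI)
    show "vanishes_below (A + B + C) (symb_mult (symb_mult F G) H)"
      using nth_symb_mult(2)[OF fg(2) v(3)] .
    show "vanishes_below (A + B + C) (symb_mult F (symb_mult G H))"
      using nth_symb_mult(2)[OF v(1) gh(2)] by (simp add: add.assoc)
    fix n
    show "fls_nth (symb_mult (symb_mult F G) H) (A + B + C + int n) =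
      fls_nth (symb_mult F (symb_mult G H)) (A + B + C + int n)"
      using nth_symb_mult(1)[OF fg(2) v(3), of n] nth_symb_mult(1)[OF v(1) gh(2), of n]
      unfolding fg(1) gh(1) symb_conv_assoc by (simp only: add.assoc)
  qed
qed

lemma vanishes_below_add: "vanishes_below B F \<Longrightarrow> vanishes_below B G \<Longrightarrow> vanishes_below B (F + (G::'a::comm_ring_1 fls))"
  by (simp add: vanishes_below_def)

lemma symb_mult_distrib_right: "symb_mult (F + G) H = symb_mult F H + symb_mult G H"
proof -
  obtain B C where v: "vanishes_below B F" "vanishes_below B G" "vanishes_below C H"
    using vanishes_below_ex common_vanishes_below by metis
  note w = vanishes_below_add[OF v(1,2)]
  show ?thesis
    by (rule vanishes_below_eqI[of "B + C"])
       (simp_all only: nth_symb_mult[OF w v(3)] nth_symb_mult[OF v(1,3)] nth_symb_mult[OF v(2,3)]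
         vanishes_below_add symb_conv_def sum.distrib fls_plus_nth distrib_left distrib_right)
qed

lemma symb_mult_distrib_left: "symb_mult H (F + G) = symb_mult H F + symb_mult H G"
proof -
  obtain B C where v: "vanishes_below B F" "vanishes_below B G" "vanishes_below C H"
    using vanishes_below_ex common_vanishes_below by metis
  note w = vanishes_below_add[OF v(1,2)]
  show ?thesis
    by (rule vanishes_below_eqI[of "C + B"])
       (simp_all only: nth_symb_mult[OF v(3) w] nth_symb_mult[OF v(3,1)] nth_symb_mult[OF v(3,2)]
         vanishes_below_add symb_conv_def sum.distrib fls_plus_nth distrib_left fps_deriv_iter_add)
qed

text \<open>Only \<alpha> = 0 survives: a left factor free of \<eta> sits in degree 0, and
  \<open>0 gchoose \<alpha>\<close> vanishes for \<alpha> > 0.\<close>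

lemma symb_mult_fls_const: "symb_mult (fls_const a) G = fls_const a * G"
proof -
  obtain C where v: "vanishes_below C G" using vanishes_below_ex by metis
  have c: "vanishes_below 0 (fls_const a)" by (simp add: vanishes_below_def)
  have "symb_conv 0 (\<lambda>i. fls_nth (fls_const a) (0 + int i)) (\<lambda>i. fls_nth G (C + int i)) n
      = a * fls_nth G (C + int n)" for n
  proof -
    have "symb_conv 0 (\<lambda>i. fls_nth (fls_const a) (0 + int i)) (\<lambda>i. fls_nth G (C + int i)) n =
      (\<Sum>\<alpha>\<le>n. if \<alpha> = 0 then a * fls_nth G (C + int n) else 0)"
      unfolding symb_conv_def
    proof (intro sum.cong refl)
      fix \<alpha> assume "\<alpha> \<in> {..n}"
      have "(\<Sum>i\<le>n - \<alpha>. fps_const (of_int (- (0 + int i)) gchoose \<alpha>) * fls_nth (fls_const a) (0 + int i) *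
          (fps_deriv ^^ \<alpha>) (fls_nth G (C + int (n - \<alpha> - i)))) =
        (\<Sum>i\<le>n - \<alpha>. if i = 0 then fps_const (0 gchoose \<alpha>) * a * (fps_deriv ^^ \<alpha>) (fls_nth G (C + int (n - \<alpha>))) else 0)"
        by (intro sum.cong) auto
      thus "(\<Sum>i\<le>n - \<alpha>. fps_const (of_int (- (0 + int i)) gchoose \<alpha>) * fls_nth (fls_const a) (0 + int i) *
          (fps_deriv ^^ \<alpha>) (fls_nth G (C + int (n - \<alpha> - i)))) = (if \<alpha> = 0 then a * fls_nth G (C + int n) else 0)"
        by (cases \<alpha>) auto
    qed
    thus ?thesis by simp
  qed
  thus ?thesis
    by (intro vanishes_below_eqI[of C])
       (use nth_symb_mult[OF c v] v in \<open>auto simp: vanishes_below_def\<close>)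
qed

text \<open>Mirror image of \<open>symb_mult_fls_const\<close>: a right factor free of t has no
  t-derivatives. It applies to every element of \<open>A_eta\<close> placed on the right.\<close>

lemma symb_mult_const_coeffs:
  assumes "\<And>n. fps_deriv (fls_nth G n) = 0"
  shows "symb_mult F G = F * G"
proof -
  obtain B C where v: "vanishes_below B F" "vanishes_below C G" using vanishes_below_ex by metis
  have d: "(fps_deriv ^^ \<alpha>) (fls_nth G m) = (if \<alpha> = 0 then fls_nth G m else 0)" for \<alpha> m
    using assms by (cases \<alpha>) (simp_all only: funpow_Suc_right comp_def fps_deriv_iter_0, simp_all)
  have "symb_conv B (\<lambda>i. fls_nth F (B + int i)) (\<lambda>i. fls_nth G (C + int i)) n =
     (\<Sum>i\<le>n. fls_nth F (B + int i) * fls_nth G (C + int (n - i)))" for n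
  proof -
    have "symb_conv B (\<lambda>i. fls_nth F (B + int i)) (\<lambda>i. fls_nth G (C + int i)) n =
      (\<Sum>\<alpha>\<le>n. if \<alpha> = 0 then (\<Sum>i\<le>n. fls_nth F (B + int i) * fls_nth G (C + int (n - i))) else 0)"
      unfolding symb_conv_def d by (intro sum.cong) auto
    thus ?thesis by simp
  qed
  thus ?thesis
    by (intro vanishes_below_eqI[of "B + C"])
       (use nth_symb_mult[OF v] fls_times_nth_vanishing[OF v] in auto)
qed

lemma symb_mult_1_left [simp]: "symb_mult 1 F = F"
  using symb_mult_fls_const[of 1 F] by simp

lemma symb_mult_1_right [simp]: "symb_mult F 1 = F"
  using symb_mult_const_coeffs[of 1 F] by simp

section \<open>Ultrametric estimates\<close>

lemma av_dist_0: "av (x::'k::nonarch_field) = dist x 0"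
  by (simp add: dist_av)

lemma av_nonneg [simp]: "0 \<le> av (x::'k::nonarch_field)"
  by (simp add: av_dist_0)

lemma av_eq_0_iff [simp]: "av (x::'k::nonarch_field) = 0 \<longleftrightarrow> x = 0"
  by (simp add: av_dist_0)

lemma av_0 [simp]: "av (0::'k::nonarch_field) = 0"
  by simp

lemma av_pos_iff [simp]: "0 < av (x::'k::nonarch_field) \<longleftrightarrow> x \<noteq> 0"
  by (metis av_eq_0_iff av_nonneg order_le_less order_less_irrefl)

lemma av_1 [simp]: "av (1::'k::nonarch_field) = 1"
  using av_mult[of "1::'k" 1] by simp

lemma av_minus [simp]: "av (- x :: 'k::nonarch_field) = av x"
  by (metis av_dist_0 diff_0 dist_av dist_commute)

lemma av_diff_le: "av (x - y :: 'k::nonarch_field) \<le> max (av x) (av y)"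
  using av_add[of x "- y"] by simp

lemma av_add_le: "av x \<le> C \<Longrightarrow> av y \<le> C \<Longrightarrow> av (x + y :: 'k::nonarch_field) \<le> C"
  using av_add[of x y] by simp

lemma av_add_eq: "av y < av x \<Longrightarrow> av (x + y :: 'k::nonarch_field) = av x"
  using av_add[of x y] av_diff_le[of "x + y" y] by simp

lemma av_sum_le: "0 \<le> C \<Longrightarrow> (\<And>i. i \<in> A \<Longrightarrow> av (f i :: 'k::nonarch_field) \<le> C) \<Longrightarrow> av (sum f A) \<le> C"
  by (induction A rule: infinite_finite_induct) (auto intro: av_add_le)

lemma av_sum_less:
  assumes "0 < C" "finite A" "\<And>i. i \<in> A \<Longrightarrow> av (f i :: 'k::nonarch_field) < C"
  shows "av (sum f A) < C"
  using assms(2,3)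
proof (induction A rule: finite_induct)
  case (insert x A)
  hence "av (f x) < C" "av (sum f A) < C" by auto
  thus ?case using insert.hyps av_add[of "f x" "sum f A"] by auto
qed (use assms(1) in simp)

lemma av_power: "av (x ^ n :: 'k::nonarch_field) = av x ^ n"
  by (induction n) (auto simp: av_mult)

lemma av_inverse: "av (inverse x :: 'k::nonarch_field) = inverse (av x)"
proof (cases "x = 0")
  case False
  hence "av x * av (inverse x) = 1" by (simp flip: av_mult)
  thus ?thesis by (metis inverse_unique)
qed simp

lemma av_divide: "av (x / y :: 'k::nonarch_field) = av x / av y"
  by (simp add: divide_inverse av_mult av_inverse)

lemma av_of_nat_le_1: "av (of_nat n :: 'k::nonarch_field) \<le> 1"
  by (induction n) (auto intro: av_add_le)

lemma av_of_int_le_1: "av (of_int n :: 'k::nonarch_field) \<le> 1"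
  by (cases n rule: int_cases2) (auto simp: av_of_nat_le_1)

lemma av_gbinomial_le_1: "av ((of_int m :: 'k::nonarch_field) gchoose k) \<le> 1"
  by (simp only: of_int_gbinomial[symmetric] av_of_int_le_1)

text \<open>A bound is carried along instead of the supremum \<open>disc_norm\<close>: it is
  meaningful for every power series, so no set has to be known to be bounded above before an
  estimate.\<close>

definition disc_bounded :: "real \<Rightarrow> real \<Rightarrow> 'k::nonarch_field fps \<Rightarrow> bool" where
  "disc_bounded l C a \<longleftrightarrow> (\<forall>i. av (fps_nth a i) * l ^ i \<le> C)"

lemma disc_boundedD: "disc_bounded l C a \<Longrightarrow> av (fps_nth a i) * l ^ i \<le> C"
  by (simp add: disc_bounded_def)

lemma disc_bounded_nonneg: "disc_bounded l C a \<Longrightarrow> 0 \<le> C"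
  by (metis av_nonneg disc_boundedD mult_1_right order_trans power_0)

lemma disc_bounded_mono: "disc_bounded l C a \<Longrightarrow> C \<le> D \<Longrightarrow> disc_bounded l D a"
  by (auto simp: disc_bounded_def intro: order_trans)

lemma disc_bounded_0 [simp]: "disc_bounded l C 0 \<longleftrightarrow> 0 \<le> C"
  by (auto simp: disc_bounded_def)

lemma disc_bounded_add:
  assumes "0 \<le> l" "disc_bounded l C a" "disc_bounded l C b"
  shows "disc_bounded l C (a + b)"
  unfolding disc_bounded_def
proof
  fix i
  have "av (fps_nth (a + b) i) * l ^ i \<le> max (av (fps_nth a i)) (av (fps_nth b i)) * l ^ i"
    using assms(1) by (intro mult_right_mono) (auto simp: av_add)
  also have "\<dots> \<le> C"
    using disc_boundedD[OF assms(2)] disc_boundedD[OF assms(3)] by (simp add: max_def)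
  finally show "av (fps_nth (a + b) i) * l ^ i \<le> C" .
qed

lemma disc_bounded_minus [simp]: "disc_bounded l C (- a) \<longleftrightarrow> disc_bounded l C a"
  by (simp add: disc_bounded_def)

lemma disc_bounded_diff:
  "0 \<le> l \<Longrightarrow> disc_bounded l C a \<Longrightarrow> disc_bounded l C b \<Longrightarrow> disc_bounded l C (a - b)"
  using disc_bounded_add[of l C a "- b"] by simp

lemma disc_bounded_sum:
  "0 \<le> l \<Longrightarrow> 0 \<le> C \<Longrightarrow> (\<And>i. i \<in> A \<Longrightarrow> disc_bounded l C (f i)) \<Longrightarrow> disc_bounded l C (sum f A)"
  by (induction A rule: infinite_finite_induct) (auto intro: disc_bounded_add)

lemma mult_mult_swap_middle: "(a * b) * (c * d) = (a * c) * (b * (d::'a::ab_semigroup_mult))"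
  by (simp add: ac_simps)

lemma disc_bounded_mult:
  assumes "0 \<le> l" "disc_bounded l C a" "disc_bounded l D b"
  shows "disc_bounded l (C * D) (a * b)"
  unfolding disc_bounded_def
proof
  fix n
  have CD: "0 \<le> C" "0 \<le> D" using assms disc_bounded_nonneg by blast+
  show "av (fps_nth (a * b) n) * l ^ n \<le> C * D"
  proof (cases "l ^ n = 0")
    case False
    hence pos: "0 < l ^ n" using zero_le_power[OF assms(1), of n] by linarith
    have "av (fps_nth (a * b) n) \<le> C * D / l ^ n"
      unfolding fps_mult_nth
    proof (intro av_sum_le)
      fix i assume i: "i \<in> {0..n}"
      have "av (fps_nth a i * fps_nth b (n - i)) * l ^ n =
          (av (fps_nth a i) * l ^ i) * (av (fps_nth b (n - i)) * l ^ (n - i))"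
      proof -
        have l: "l ^ n = l ^ i * l ^ (n - i)" using i power_add[of l i "n - i"] by simp
        show ?thesis unfolding l av_mult by (rule mult_mult_swap_middle)
      qed
      also have "\<dots> \<le> C * D"
        using CD assms by (intro mult_mono disc_boundedD) auto
      finally show "av (fps_nth a i * fps_nth b (n - i)) \<le> C * D / l ^ n"
        using pos by (simp add: pos_le_divide_eq)
    qed (use CD pos in auto)
    thus ?thesis using pos by (simp add: pos_le_divide_eq)
  next
    case True
    show ?thesis unfolding True using CD by simp
  qed
qed

text \<open>The integer factors of a derivative have absolute value at most 1, so only the shift of
  the index costs something, namely 1/l.\<close>

lemma disc_bounded_deriv:
  assumes "0 < l" "disc_bounded l C a"
  shows "disc_bounded l (C / l) (fps_deriv a)"
  unfolding disc_bounded_def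
proof
  fix i
  have "av (fps_nth (fps_deriv a) i) * l ^ i \<le> 1 * av (fps_nth a (Suc i)) * l ^ i"
    using assms(1) av_of_nat_le_1[of "Suc i", where 'k = 'a]
    unfolding fps_deriv_nth Suc_eq_plus1[symmetric] av_mult
    by (intro mult_right_mono) (auto simp del: of_nat_Suc)
  also have "\<dots> \<le> C / l"
    using disc_boundedD[OF assms(2), of "Suc i"] assms(1) by (simp add: pos_le_divide_eq mult_ac)
  finally show "av (fps_nth (fps_deriv a) i) * l ^ i \<le> C / l" .
qed

lemma disc_bounded_deriv_iter:
  "0 < l \<Longrightarrow> disc_bounded l C a \<Longrightarrow> disc_bounded l (C / l ^ n) ((fps_deriv ^^ n) a)"
proof (induction n)
  case (Suc n)
  from disc_bounded_deriv[OF Suc.prems(1) Suc.IH[OF Suc.prems]] show ?case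
    by (simp add: mult.commute)
qed simp

lemma disc_bounded_const: "disc_bounded l C (fps_const c) \<longleftrightarrow> av c \<le> C"
  by (auto simp: disc_bounded_def dest: spec[of _ 0] intro: order_trans[OF av_nonneg])

text \<open>Index \<open>n\<close> stands for \<eta>^(-n), so \<rho> is the weight of 1/\<eta>.
  Positive powers of \<eta> occur too, hence \<open>powi\<close>.\<close>

definition symb_bounded :: "real \<Rightarrow> real \<Rightarrow> real \<Rightarrow> 'k::nonarch_field fps fls \<Rightarrow> bool" where
  "symb_bounded l \<rho> C F \<longleftrightarrow> (\<forall>n. disc_bounded l (C * \<rho> powi (- n)) (fls_nth F n))"

lemma symb_bounded_alt:
  assumes "0 < \<rho>"
  shows "symb_bounded l \<rho> C F \<longleftrightarrow> (\<forall>n i. av (fps_nth (fls_nth F n) i) * l ^ i * \<rho> powi n \<le> C)"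
proof -
  have "0 < \<rho> powi n" for n using assms by simp
  thus ?thesis
    by (auto simp: symb_bounded_def disc_bounded_def power_int_minus field_simps)
qed

lemma symb_bounded_add:
  "0 \<le> l \<Longrightarrow> symb_bounded l \<rho> C F \<Longrightarrow> symb_bounded l \<rho> C G \<Longrightarrow> symb_bounded l \<rho> C (F + G)"
  by (simp add: symb_bounded_def disc_bounded_add)

lemma symb_bounded_minus [simp]: "symb_bounded l \<rho> C (- F) \<longleftrightarrow> symb_bounded l \<rho> C F"
  by (simp add: symb_bounded_def)

lemma symb_bounded_mono: "0 < \<rho> \<Longrightarrow> symb_bounded l \<rho> C F \<Longrightarrow> C \<le> D \<Longrightarrow> symb_bounded l \<rho> D F"
  by (auto simp: symb_bounded_alt intro: order_trans)

lemma symb_bounded_nonneg: "0 < \<rho> \<Longrightarrow> symb_bounded l \<rho> C F \<Longrightarrow> 0 \<le> C"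
  unfolding symb_bounded_def
  by (metis disc_bounded_nonneg minus_zero mult.right_neutral power_int_0_right)

lemma symb_bounded_mono_l:
  assumes "0 < \<rho>" "0 \<le> l'" "l' \<le> l" "symb_bounded l \<rho> C F"
  shows "symb_bounded l' \<rho> C F"
  unfolding symb_bounded_alt[OF assms(1)]
proof (intro allI)
  fix n i
  have "av (fps_nth (fls_nth F n) i) * l' ^ i * \<rho> powi n \<le> av (fps_nth (fls_nth F n) i) * l ^ i * \<rho> powi n"
    using assms by (intro mult_right_mono mult_left_mono power_mono) auto
  thus "av (fps_nth (fls_nth F n) i) * l' ^ i * \<rho> powi n \<le> C"
    using assms(4) by (meson order_trans symb_bounded_alt[OF assms(1)])
qed

text \<open>The correction \<alpha> loses l^(-\<alpha>) through the t-derivatives but lands \<alpha>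
  places further in 1/\<eta>, where \<rho>^(-\<alpha>) is allowed; \<rho> \<le> l pays for the loss.
  The binomial coefficients are integers and cost nothing.\<close>

lemma symb_bounded_mult:
  assumes "0 < \<rho>" "\<rho> \<le> l" "symb_bounded l \<rho> C F" "symb_bounded l \<rho> D G"
  shows "symb_bounded l \<rho> (C * D) (symb_mult F G)"
  unfolding symb_bounded_def
proof
  fix N
  have CD: "0 \<le> C" "0 \<le> D" using assms symb_bounded_nonneg by blast+
  have l: "0 < l" using assms by simp
  obtain B B' where v: "vanishes_below B F" "vanishes_below B' G" using vanishes_below_ex by metis
  show "disc_bounded l (C * D * \<rho> powi (- N)) (fls_nth (symb_mult F G) N)"
  proof (cases "N < B + B'")
    case True
    thus ?thesis using vanishes_belowD[OF nth_symb_mult(2)[OF v] True] CD assms(1) by simp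
  next
    case False
    then obtain n where N: "N = B + B' + int n" using zle_iff_zadd[of "B + B'" N] by auto
    show ?thesis
      unfolding N nth_symb_mult(1)[OF v] symb_conv_triples
    proof (rule disc_bounded_sum, goal_cases)
      case (3 x)
      then obtain \<alpha> i j where x: "x = (\<alpha>, i, j)" "\<alpha> + i + j = n" by auto
      have "disc_bounded l ((1 * (C * \<rho> powi (- (B + int i)))) * (D * \<rho> powi (- (B' + int j)) / l ^ \<alpha>))
         (fps_const (of_int (- (B + int i)) gchoose \<alpha>) * fls_nth F (B + int i) * (fps_deriv ^^ \<alpha>) (fls_nth G (B' + int j)))"
        using assms l av_gbinomial_le_1
        by (intro disc_bounded_mult disc_bounded_deriv_iter)
           (auto simp only: disc_bounded_const symb_bounded_def less_imp_le)
      also have "(1 * (C * \<rho> powi (- (B + int i)))) * (D * \<rho> powi (- (B' + int j)) / l ^ \<alpha>)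
          = C * D * \<rho> powi (- (B + B' + int i + int j)) * (1 / l ^ \<alpha>)"
        using assms(1) by (simp add: power_int_add power_int_minus power_int_diff field_simps)
      finally show ?case
        unfolding x prod.case
      proof (rule disc_bounded_mono)
        have "\<rho> powi (- (B + B' + int n)) = \<rho> powi (- (B + B' + int i + int j)) * (1 / \<rho> ^ \<alpha>)"
          using assms(1) x(2) by (simp add: power_int_add power_int_minus power_int_diff field_simps flip: x(2))
        moreover have "1 / l ^ \<alpha> \<le> 1 / \<rho> ^ \<alpha>"
          using assms(1,2) by (simp add: frac_le power_mono)
        ultimately show "C * D * \<rho> powi - (B + B' + int i + int j) * (1 / l ^ \<alpha>) \<le> C * D * \<rho> powi - (B + B' + int n)"
          using CD assms(1) by (simp only: mult.assoc) (intro mult_left_mono, auto)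
      qed
    qed (use CD l assms(1) in auto)
  qed
qed

section \<open>Membership in \<open>Phi\<close> through bounds at each pair of radii\<close>

lemma disc_analytic_bounded:
  assumes "disc_analytic a" "0 < l" "l < 1"
  shows "disc_bounded l (disc_norm l a) a" "0 \<le> disc_norm l a"
proof -
  have "(\<lambda>i. av (fps_nth a i) * l ^ i) \<longlonglongrightarrow> 0" using assms by (auto simp: disc_analytic_def)
  hence "Bseq (\<lambda>i. av (fps_nth a i) * l ^ i)" by (rule convergentI[THEN convergent_imp_Bseq])
  hence "bdd_above (range (\<lambda>i. av (fps_nth a i) * l ^ i))"
    by (simp add: Bseq_eq_bounded bounded_imp_bdd_above)
  thus "disc_bounded l (disc_norm l a) a"
    unfolding disc_bounded_def disc_norm_def by (intro allI cSUP_upper) auto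
  thus "0 \<le> disc_norm l a" by (rule disc_bounded_nonneg)
qed

lemma disc_norm_le: "disc_bounded l C a \<Longrightarrow> disc_norm l a \<le> C"
  unfolding disc_norm_def disc_bounded_def by (intro cSUP_least) auto

lemma limsup_ereal_0_bounded:
  assumes "limsup (\<lambda>n. ereal (f n)) = 0" shows "\<exists>N. \<forall>n\<ge>N. f n \<le> 1"
proof -
  have "eventually (\<lambda>n. ereal (f n) < 1) sequentially"
    using assms by (intro Limsup_lessD) auto
  thus ?thesis unfolding eventually_sequentially
    by (metis ereal_less_eq(3) one_ereal_def order_less_imp_le)
qed

lemma limsup_ereal_0I:
  assumes "f \<longlonglongrightarrow> 0" shows "limsup (\<lambda>n. ereal (f n)) = 0"
  using assms by (intro lim_imp_Limsup) (auto simp: zero_ereal_def)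

lemma tendsto_0_geometric_bound:
  fixes f :: "nat \<Rightarrow> real"
  assumes "\<And>n. 0 \<le> f n" "\<And>n. f n \<le> D * q ^ n" "0 \<le> q" "q < 1"
  shows "f \<longlonglongrightarrow> 0"
proof (rule tendsto_sandwich[of "\<lambda>_. 0" f _ "\<lambda>n. D * q ^ n"])
  show "(\<lambda>n. D * q ^ n) \<longlonglongrightarrow> 0"
    using assms(3,4) by (intro tendsto_mult_right_zero LIMSEQ_realpow_zero)
qed (use assms in auto)

lemma omega_bounds:
  assumes "prime p" shows "0 < omega p" "omega p < 1"
proof -
  have "2 \<le> p" using assms prime_ge_2_nat by blast
  thus "0 < omega p" "omega p < 1"
    by (auto simp: omega_def)
qed

text \<open>Boundedness can replace decay because the set of admissible pairs is open: a bound at a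
  slightly larger radius gives geometric decay at the given one, both in t and in 1/\<eta>.\<close>

lemma Phi_carrier_iff:
  assumes "0 < omega p"
  shows "F \<in> carrier (Phi p) \<longleftrightarrow>
    (\<forall>l \<rho>. 0 < l \<longrightarrow> l < 1 \<longrightarrow> 0 < \<rho> \<longrightarrow> \<rho> < omega p * l \<longrightarrow> (\<exists>C. symb_bounded l \<rho> C F))" (is "_ = ?R")
proof
  assume F: "F \<in> carrier (Phi p)"
  show ?R
  proof (intro allI impI)
    fix l \<rho> assume l: "0 < l" "l < 1" "0 < \<rho>" "\<rho> < omega p * l"
    have an: "disc_analytic (fls_nth F n)" for n using F by (simp add: Phi_def)
    have "limsup (\<lambda>n. ereal (disc_norm l (fls_nth F (int n)) * \<rho> ^ n)) = 0"
      using F l assms by (auto simp: Phi_def)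
    then obtain N where N: "\<And>n. n \<ge> N \<Longrightarrow> disc_norm l (fls_nth F (int n)) * \<rho> ^ n \<le> 1"
      using limsup_ereal_0_bounded[of "\<lambda>n. disc_norm l (fls_nth F (int n)) * \<rho> ^ n"] by blast
    obtain B where B: "vanishes_below B F" using vanishes_below_ex by blast
    define D where "D = (\<lambda>n. disc_norm l (fls_nth F n) * \<rho> powi n)"
    have D0: "0 \<le> D n" for n
      using disc_analytic_bounded(2)[OF an l(1,2)] l by (simp add: D_def)
    \<comment> \<open>Indices below B contribute nothing and those from N on at most 1, by the
      limsup. The remaining finitely many are bounded by the sum of their norms.\<close>
    have "symb_bounded l \<rho> (1 + (\<Sum>n\<in>{B..int N}. D n)) F"
      unfolding symb_bounded_alt[OF l(3)]
    proof (intro allI)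
      fix n i
      have "av (fps_nth (fls_nth F n) i) * l ^ i * \<rho> powi n \<le> D n"
        unfolding D_def using l disc_boundedD[OF disc_analytic_bounded(1)[OF an l(1,2)]]
        by (intro mult_right_mono) auto
      also have "D n \<le> 1 + (\<Sum>n\<in>{B..int N}. D n)"
      proof -
        consider "n < B" | "n \<in> {B..int N}" | "n \<ge> int N" "\<not> n < B" by force
        thus ?thesis
        proof cases
          case 1
          hence "D n = 0" using vanishes_belowD[OF B] by (simp add: D_def disc_norm_def)
          thus ?thesis using D0 by (simp add: sum_nonneg)
        next
          case 2
          hence "D n \<le> (\<Sum>n\<in>{B..int N}. D n)" using D0 by (intro member_le_sum) auto
          thus ?thesis by simp
        next
          case 3
          hence "D n \<le> 1" using N[of "nat n"] by (auto simp: D_def power_int_def)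
          moreover have "0 \<le> (\<Sum>n\<in>{B..int N}. D n)" using D0 by (simp add: sum_nonneg)
          ultimately show ?thesis by simp
        qed
      qed
      finally show "av (fps_nth (fls_nth F n) i) * l ^ i * \<rho> powi n \<le> 1 + (\<Sum>n\<in>{B..int N}. D n)" .
    qed
    thus "\<exists>C. symb_bounded l \<rho> C F" ..
  qed
next
  assume R: ?R
  have an: "disc_analytic (fls_nth F n)" for n
    unfolding disc_analytic_def
  proof (intro allI impI)
    fix l :: real assume l: "0 < l \<and> l < 1"
    define m where "m = (l + 1) / 2"
    have m: "0 < m" "m < 1" "l < m" using l by (auto simp: m_def)
    then obtain C where C: "symb_bounded m (omega p * m / 2) C F"
      using R[rule_format, of m "omega p * m / 2"] assms by auto
    define D where "D = C * (omega p * m / 2) powi (- n)"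
    have D: "disc_bounded m D (fls_nth F n)" using C by (simp add: symb_bounded_def D_def)
    have "av (fps_nth (fls_nth F n) i) * l ^ i \<le> D * (l / m) ^ i" for i
    proof -
      have "av (fps_nth (fls_nth F n) i) * l ^ i = (av (fps_nth (fls_nth F n) i) * m ^ i) * (l / m) ^ i"
        using m by (simp add: power_divide)
      also have "\<dots> \<le> D * (l / m) ^ i"
        using m l disc_boundedD[OF D] by (intro mult_right_mono) auto
      finally show ?thesis .
    qed
    thus "(\<lambda>i. av (fps_nth (fls_nth F n) i) * l ^ i) \<longlonglongrightarrow> 0"
      by (rule tendsto_0_geometric_bound[rotated]) (use l m in auto)
  qed
  moreover have "limsup (\<lambda>n. ereal (disc_norm l (fls_nth F (int n)) * \<rho> ^ n)) = 0"
    if h: "0 < \<rho>" "\<rho> < omega p * l" "omega p * l < omega p" for l \<rho>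
  proof (rule limsup_ereal_0I)
    have "0 < omega p * l" using h(1,2) by (rule less_trans)
    hence l0: "0 < l" using assms by (simp add: zero_less_mult_iff)
    have l1: "l < 1" using h(3) assms by simp
    note l = l0 l1
    obtain \<sigma> where "\<rho> < \<sigma>" "\<sigma> < omega p * l" using dense[OF h(2)] by blast
    with h(1) have \<sigma>: "0 < \<sigma>" "\<sigma> < omega p * l" "\<rho> < \<sigma>" by auto
    then obtain C where C: "symb_bounded l \<sigma> C F" using R[rule_format, of l \<sigma>] l by auto
    have "disc_norm l (fls_nth F (int n)) * \<rho> ^ n \<le> C * (\<rho> / \<sigma>) ^ n" for n
    proof -
      have "disc_norm l (fls_nth F (int n)) \<le> C * \<sigma> powi (- int n)"
        using C unfolding symb_bounded_def by (intro disc_norm_le) blast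
      hence "disc_norm l (fls_nth F (int n)) * \<rho> ^ n \<le> C * \<sigma> powi (- int n) * \<rho> ^ n"
        using h by (intro mult_right_mono) auto
      thus ?thesis using \<sigma> by (simp add: power_int_minus power_divide field_simps)
    qed
    thus "(\<lambda>n. disc_norm l (fls_nth F (int n)) * \<rho> ^ n) \<longlonglongrightarrow> 0"
      by (rule tendsto_0_geometric_bound[rotated])
         (use h(1) \<sigma> disc_analytic_bounded(2)[OF an l] in auto)
  qed
  ultimately show "F \<in> carrier (Phi p)" by (auto simp: Phi_def)
qed

text \<open>A bound on a larger disc holds on a smaller one, so l may be enlarged beyond \<omega>.
  In that range t/\<pi> has norm greater than 1, and the estimates for the division apply.\<close>

lemma Phi_memI:
  assumes "0 < omega p" "omega p < 1"
    and "\<And>l \<rho>. omega p < l \<Longrightarrow> l < 1 \<Longrightarrow> 0 < \<rho> \<Longrightarrow> \<rho> < omega p * l \<Longrightarrow> \<exists>C. symb_bounded l \<rho> C F"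
  shows "F \<in> carrier (Phi p)"
  unfolding Phi_carrier_iff[OF assms(1)]
proof (intro allI impI)
  fix l \<rho> assume l: "0 < l" "l < 1" "0 < \<rho>" "\<rho> < omega p * l"
  define m where "m = max l ((1 + omega p) / 2)"
  have m: "omega p < m" "m < 1" "l \<le> m" using l assms(1,2) by (auto simp: m_def less_max_iff_disj)
  have "omega p * l \<le> omega p * m" using m assms by simp
  hence "\<rho> < omega p * m" using l by simp
  then obtain C where "symb_bounded m \<rho> C F" using assms(3)[OF m(1,2) l(3)] by blast
  thus "\<exists>C. symb_bounded l \<rho> C F" using symb_bounded_mono_l[OF l(3) _ m(3)] l(1) by auto
qed

section \<open>The embedding of \<open>A_eta\<close> into \<open>Phi\<close>\<close>

lemma Phi_simps [simp]:
  "x \<otimes>\<^bsub>Phi p\<^esub> y = symb_mult x y" "\<one>\<^bsub>Phi p\<^esub> = 1" "\<zero>\<^bsub>Phi p\<^esub> = 0" "x \<oplus>\<^bsub>Phi p\<^esub> y = x + y"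
  by (simp_all add: Phi_def)

lemma A_eta_simps [simp]:
  "x \<otimes>\<^bsub>A_eta p\<^esub> y = x * y" "\<one>\<^bsub>A_eta p\<^esub> = 1" "\<zero>\<^bsub>A_eta p\<^esub> = 0" "x \<oplus>\<^bsub>A_eta p\<^esub> y = x + y"
  by (simp_all add: A_eta_def)

lemma fls_nth_A_to_Phi [simp]: "fls_nth (A_to_Phi \<alpha>) n = fps_const (fls_nth \<alpha> n)"
  unfolding A_to_Phi_def by (rule nth_Abs_fls_lower_bound[of "fls_subdegree \<alpha>"]) simp

lemma A_to_Phi_add: "A_to_Phi (a + b) = A_to_Phi a + A_to_Phi b"
  by (rule fls_eqI) simp

lemma A_to_Phi_mult: "A_to_Phi (a * b) = A_to_Phi a * A_to_Phi b"
proof -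
  obtain B C where v: "vanishes_below B a" "vanishes_below C b" using vanishes_below_ex by metis
  hence w: "vanishes_below B (A_to_Phi a)" "vanishes_below C (A_to_Phi b)" by (auto simp: vanishes_below_def)
  have c: "fps_const (sum f I) = (\<Sum>i\<in>I. fps_const (f i))" for f :: "nat \<Rightarrow> 'a" and I
    by (rule fps_const_sum_distrib)
  show ?thesis
    by (rule vanishes_below_eqI[of "B + C"])
       (use fls_times_nth_vanishing[OF v] fls_times_nth_vanishing[OF w] in
         \<open>auto simp: vanishes_below_def c\<close>)
qed

lemma symb_mult_A_to_Phi_right: "symb_mult F (A_to_Phi b) = F * A_to_Phi b"
  by (rule symb_mult_const_coeffs) simp

lemma A_to_Phi_1 [simp]: "A_to_Phi 1 = 1"
  by (rule fls_eqI) simp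

lemma A_to_Phi_0 [simp]: "A_to_Phi 0 = 0"
  by (rule fls_eqI) simp

lemma A_to_Phi_uminus: "A_to_Phi (- a) = - A_to_Phi a"
  by (rule fls_eqI) simp

lemma disc_norm_const: "0 < l \<Longrightarrow> disc_norm l (fps_const c) = av c"
proof (rule antisym)
  assume l: "0 < l"
  show "disc_norm l (fps_const c) \<le> av c" by (rule disc_norm_le) (simp add: disc_bounded_const)
  have "bdd_above (range (\<lambda>i. av (fps_nth (fps_const c) i) * l ^ i))"
    by (rule bdd_aboveI[of _ "av c"]) (auto split: if_splits)
  from cSUP_upper[OF UNIV_I this, of 0] show "av c \<le> disc_norm l (fps_const c)"
    by (simp add: disc_norm_def)
qed

lemma disc_analytic_const: "disc_analytic (fps_const c)"
  unfolding disc_analytic_def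
proof (intro allI impI)
  fix l :: real assume "0 < l \<and> l < 1"
  have "eventually (\<lambda>i. av (fps_nth (fps_const c) i) * l ^ i = 0) sequentially"
    using eventually_gt_at_top[of 0] by eventually_elim simp
  thus "(\<lambda>i. av (fps_nth (fps_const c) i) * l ^ i) \<longlonglongrightarrow> 0" by (rule tendsto_eventually)
qed

text \<open>A series constant in t has the same norm on every disc, and \<omega> l runs through (0,
  \<omega>) as l runs through (0, 1). Ring closure of \<open>A_eta\<close> can thus be inherited
  from \<open>Phi\<close>.\<close>

lemma A_eta_carrier_iff:
  assumes "0 < omega p"
  shows "\<alpha> \<in> carrier (A_eta p) \<longleftrightarrow> A_to_Phi \<alpha> \<in> carrier (Phi p)"
proof -
  have *: "\<exists>l. \<rho> < omega p * l \<and> omega p * l < omega p" if r: "0 < \<rho>" "\<rho> < omega p" for \<rho>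
  proof -
    obtain \<sigma> where "\<rho> < \<sigma>" "\<sigma> < omega p" using dense[OF r(2)] by blast
    thus ?thesis using assms by (intro exI[of _ "\<sigma> / omega p"]) simp
  qed
  have l: "disc_norm l (fps_const (fls_nth \<alpha> (int n))) = av (fls_nth \<alpha> (int n))"
    if "0 < \<rho>" "\<rho> < omega p * l" for l \<rho> n
  proof -
    have "0 < omega p * l" using that by (rule less_trans)
    hence "0 < l" using assms by (simp add: zero_less_mult_iff)
    thus ?thesis by (rule disc_norm_const)
  qed
  define L where "L = (\<lambda>\<rho>. limsup (\<lambda>n. ereal (av (fls_nth \<alpha> (int n)) * \<rho> ^ n)) = 0)"
  have A: "\<alpha> \<in> carrier (A_eta p) \<longleftrightarrow> (\<forall>\<rho>. 0 < \<rho> \<and> \<rho> < omega p \<longrightarrow> L \<rho>)"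
    by (simp add: A_eta_def L_def)
  have L: "limsup (\<lambda>n. ereal (disc_norm l (fps_const (fls_nth \<alpha> (int n))) * \<rho> ^ n)) = 0 \<longleftrightarrow> L \<rho>"
    if "0 < \<rho> \<and> \<rho> < omega p * l \<and> omega p * l < omega p" for l \<rho>
    unfolding L_def using l[of \<rho> l] that by simp
  have P: "A_to_Phi \<alpha> \<in> carrier (Phi p) \<longleftrightarrow>
      (\<forall>l \<rho>. 0 < \<rho> \<and> \<rho> < omega p * l \<and> omega p * l < omega p \<longrightarrow> L \<rho>)"
    using L by (simp add: Phi_def disc_analytic_const)
  show ?thesis
    unfolding A P
  proof (intro iffI allI impI)
    fix l \<rho> assume "\<forall>\<rho>. 0 < \<rho> \<and> \<rho> < omega p \<longrightarrow> L \<rho>"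
      and "0 < \<rho> \<and> \<rho> < omega p * l \<and> omega p * l < omega p"
    thus "L \<rho>" by (meson less_trans)
  next
    fix \<rho> assume "\<forall>l \<rho>. 0 < \<rho> \<and> \<rho> < omega p * l \<and> omega p * l < omega p \<longrightarrow> L \<rho>"
      and "0 < \<rho> \<and> \<rho> < omega p"
    thus "L \<rho>" using *[of \<rho>] by blast
  qed
qed

lemma symb_d_eta_A_to_Phi: "symb_d_eta (A_to_Phi \<alpha>) = - A_to_Phi (fls_X\<^sup>2 * fls_deriv \<alpha>)"
  by (rule fls_eqI) (simp add: nth_symb_d_eta fls_X_power_times_conv_shift fps_of_int[symmetric] algebra_simps)

lemma symb_bounded_deriv_A:
  assumes "0 < \<rho>" "symb_bounded l \<rho> C (A_to_Phi \<alpha>)"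
  shows "symb_bounded l \<rho> (C / \<rho>) (A_to_Phi (fls_deriv \<alpha>))"
  unfolding symb_bounded_def fls_nth_A_to_Phi disc_bounded_const
proof
  fix n
  have "av (fls_nth (fls_deriv \<alpha>) n) \<le> 1 * av (fls_nth \<alpha> (n + 1))"
    unfolding fls_deriv_nth av_mult by (intro mult_right_mono av_of_int_le_1) auto
  also have "\<dots> \<le> C * \<rho> powi - (n + 1)"
    using assms(2) by (simp only: symb_bounded_def fls_nth_A_to_Phi disc_bounded_const mult_1)
  also have "\<dots> = C / \<rho> * \<rho> powi - n"
    using assms(1) by (simp add: power_int_diff power_int_minus field_simps)
  finally show "av (fls_nth (fls_deriv \<alpha>) n) \<le> C / \<rho> * \<rho> powi - n" .
qed

section \<open>\<open>Phi\<close> is a ring and \<open>A_eta\<close> a commutative ring\<close>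

context
  fixes p :: nat
  assumes om: "0 < omega p" "omega p < 1"
begin

lemma Phi_add_closed: "F \<in> carrier (Phi p) \<Longrightarrow> G \<in> carrier (Phi p) \<Longrightarrow> F + G \<in> carrier (Phi p)"
proof (rule Phi_memI[OF om])
  fix l \<rho> assume "F \<in> carrier (Phi p)" "G \<in> carrier (Phi p)" and
    l: "omega p < l" "l < 1" "0 < \<rho>" "\<rho> < omega p * l"
  then obtain C D where "symb_bounded l \<rho> C F" "symb_bounded l \<rho> D G"
    using om Phi_carrier_iff[OF om(1)] by (meson less_trans)
  hence "symb_bounded l \<rho> (max C D) F" "symb_bounded l \<rho> (max C D) G"
    using l(3) symb_bounded_mono by (metis max.cobounded1, metis max.cobounded2)
  moreover have "0 \<le> l" using om l by linarith
  ultimately have "symb_bounded l \<rho> (max C D) (F + G)" by (intro symb_bounded_add)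
  thus "\<exists>C. symb_bounded l \<rho> C (F + G)" ..
qed

lemma Phi_uminus_closed: "F \<in> carrier (Phi p) \<Longrightarrow> - F \<in> carrier (Phi p)"
  by (simp add: Phi_carrier_iff[OF om(1)])

lemma omega_mult_less: "omega p < l \<Longrightarrow> \<rho> < omega p * l \<Longrightarrow> \<rho> < l"
proof -
  assume "omega p < l" "\<rho> < omega p * l"
  moreover have "omega p * l < 1 * l" using om \<open>omega p < l\<close> by (intro mult_strict_right_mono) auto
  ultimately show ?thesis by simp
qed

lemma Phi_mult_closed: "F \<in> carrier (Phi p) \<Longrightarrow> G \<in> carrier (Phi p) \<Longrightarrow> symb_mult F G \<in> carrier (Phi p)"
proof (rule Phi_memI[OF om])
  fix l \<rho> assume "F \<in> carrier (Phi p)" "G \<in> carrier (Phi p)" and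
    l: "omega p < l" "l < 1" "0 < \<rho>" "\<rho> < omega p * l"
  then obtain C D where "symb_bounded l \<rho> C F" "symb_bounded l \<rho> D G"
    using om Phi_carrier_iff[OF om(1)] by (meson less_trans)
  hence "symb_bounded l \<rho> (C * D) (symb_mult F G)"
    using l omega_mult_less[OF l(1,4)] by (intro symb_bounded_mult) auto
  thus "\<exists>C. symb_bounded l \<rho> C (symb_mult F G)" ..
qed

lemma Phi_poly_closed:
  assumes "\<And>m. \<exists>N. \<forall>i>N. fps_nth (fls_nth F m) i = 0" "\<exists>N. \<forall>m>N. fls_nth F m = 0"
  shows "F \<in> carrier (Phi p)"
proof (rule Phi_memI[OF om])
  fix l \<rho> assume l: "omega p < l" "l < 1" "0 < \<rho>" "\<rho> < omega p * l"
  obtain N where N: "\<And>m i. i > N m \<Longrightarrow> fps_nth (fls_nth F m) i = 0" using assms(1) by metis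
  obtain U where U: "\<And>m. m > U \<Longrightarrow> fls_nth F m = 0" using assms(2) by blast
  obtain B where B: "\<And>m. m < B \<Longrightarrow> fls_nth F m = 0" using vanishes_below_ex[of F] by (auto simp: vanishes_below_def)
  define t where "t = (\<lambda>m i. av (fps_nth (fls_nth F m) i) * l ^ i * \<rho> powi m)"
  have t0: "0 \<le> t m i" for m i using l om by (simp add: t_def)
  have tz: "t m i = 0" if "m \<notin> {B..U} \<or> i \<notin> {..N m}" for m i
    using that N[of m i] U[of m] B[of m] by (auto simp: t_def not_le)
  have "t m i \<le> (\<Sum>m\<in>{B..U}. \<Sum>i\<in>{..N m}. t m i)" for m i
  proof (cases "m \<in> {B..U} \<and> i \<in> {..N m}")
    case True
    hence "t m i \<le> (\<Sum>i\<in>{..N m}. t m i)" using t0 by (intro member_le_sum) auto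
    also have "\<dots> \<le> (\<Sum>m\<in>{B..U}. \<Sum>i\<in>{..N m}. t m i)"
      using t0 True by (intro member_le_sum[of m "{B..U}" "\<lambda>m. \<Sum>i\<in>{..N m}. t m i"]) (auto intro: sum_nonneg)
    finally show ?thesis .
  qed (use tz t0 in \<open>auto intro!: sum_nonneg\<close>)
  hence "symb_bounded l \<rho> (\<Sum>m\<in>{B..U}. \<Sum>i\<in>{..N m}. t m i) F"
    unfolding symb_bounded_alt[OF l(3)] by (simp add: t_def)
  thus "\<exists>C. symb_bounded l \<rho> C F" ..
qed

lemma symb_t_closed: "symb_t \<in> carrier (Phi p)"
  by (rule Phi_poly_closed) (auto simp: symb_t_def intro!: exI[of _ 1])

lemma symb_eta_closed: "symb_eta \<in> carrier (Phi p)"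
  by (rule Phi_poly_closed) (auto simp: symb_eta_def intro!: exI[of _ 1])

lemma symb_const_closed: "symb_const c \<in> carrier (Phi p)"
  by (rule Phi_poly_closed) (auto simp: symb_const_def intro!: exI[of _ 1])

lemma Phi_0_1_closed: "0 \<in> carrier (Phi p)" "1 \<in> carrier (Phi p)"
  using symb_const_closed[of 0] symb_const_closed[of 1] by (simp_all add: symb_const_def)

lemma Phi_abelian_group: "abelian_group (Phi p)"
proof (rule abelian_groupI)
  fix x assume "x \<in> carrier (Phi p)"
  thus "\<exists>y\<in>carrier (Phi p). y \<oplus>\<^bsub>Phi p\<^esub> x = \<zero>\<^bsub>Phi p\<^esub>"
    by (intro bexI[of _ "- x"]) (auto simp: Phi_uminus_closed)
qed (simp_all add: Phi_add_closed Phi_0_1_closed add_ac)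

lemma Phi_ring: "ring (Phi p)"
  by (rule ringI[OF Phi_abelian_group])
     (auto intro!: monoidI simp: Phi_mult_closed Phi_0_1_closed symb_mult_assoc symb_mult_distrib_left symb_mult_distrib_right)

lemma A_eta_mem: "\<alpha> \<in> carrier (A_eta p) \<longleftrightarrow> A_to_Phi \<alpha> \<in> carrier (Phi p)"
  by (rule A_eta_carrier_iff[OF om(1)])

lemma A_eta_mult_closed: "a \<in> carrier (A_eta p) \<Longrightarrow> b \<in> carrier (A_eta p) \<Longrightarrow> a * b \<in> carrier (A_eta p)"
  using Phi_mult_closed[of "A_to_Phi a" "A_to_Phi b"]
  by (simp add: A_eta_mem A_to_Phi_mult symb_mult_A_to_Phi_right)

lemma A_eta_add_closed: "a \<in> carrier (A_eta p) \<Longrightarrow> b \<in> carrier (A_eta p) \<Longrightarrow> a + b \<in> carrier (A_eta p)"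
  by (simp add: A_eta_mem A_to_Phi_add Phi_add_closed)

lemma A_eta_uminus_closed: "a \<in> carrier (A_eta p) \<Longrightarrow> - a \<in> carrier (A_eta p)"
  by (simp add: A_eta_mem A_to_Phi_uminus Phi_uminus_closed)

lemma A_eta_const_closed: "fls_const c \<in> carrier (A_eta p)"
proof -
  have "A_to_Phi (fls_const c) = symb_const c" by (rule fls_eqI) (simp add: symb_const_def)
  thus ?thesis by (simp add: A_eta_mem symb_const_closed)
qed

lemma A_to_Phi_X_inv: "A_to_Phi fls_X_inv = symb_eta"
  by (rule fls_eqI) (simp add: symb_eta_def)

lemma A_eta_X_inv_closed: "fls_X_inv \<in> carrier (A_eta p)"
  by (simp add: A_eta_mem A_to_Phi_X_inv symb_eta_closed)

lemma A_eta_0_1_closed: "0 \<in> carrier (A_eta p)" "1 \<in> carrier (A_eta p)"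
  by (simp_all add: A_eta_mem Phi_0_1_closed)

lemma A_eta_deriv_closed: "a \<in> carrier (A_eta p) \<Longrightarrow> fls_deriv a \<in> carrier (A_eta p)"
  unfolding A_eta_mem Phi_carrier_iff[OF om(1)] by (meson symb_bounded_deriv_A)

lemma A_eta_abelian_group: "abelian_group (A_eta p)"
proof (rule abelian_groupI)
  fix x assume "x \<in> carrier (A_eta p)"
  thus "\<exists>y\<in>carrier (A_eta p). y \<oplus>\<^bsub>A_eta p\<^esub> x = \<zero>\<^bsub>A_eta p\<^esub>"
    by (intro bexI[of _ "- x"]) (auto simp: A_eta_uminus_closed)
qed (simp_all add: A_eta_add_closed A_eta_0_1_closed add_ac)

lemma A_eta_cring: "cring (A_eta p)"
  by (rule cringI[OF A_eta_abelian_group])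
     (auto intro!: comm_monoidI simp: A_eta_mult_closed A_eta_0_1_closed mult_ac ring_distribs)

end

section \<open>Extension of scalars\<close>

definition additive_map :: "('a, 'x) ring_scheme \<Rightarrow> ('b, 'y) ring_scheme \<Rightarrow> ('a \<Rightarrow> 'b) \<Rightarrow> bool" where
  "additive_map A B U \<longleftrightarrow> U \<in> carrier A \<rightarrow> carrier B \<and>
     (\<forall>x\<in>carrier A. \<forall>y\<in>carrier A. U (x \<oplus>\<^bsub>A\<^esub> y) = U x \<oplus>\<^bsub>B\<^esub> U y)"

lemma additive_mapD:
  assumes "additive_map A B U"
  shows "x \<in> carrier A \<Longrightarrow> U x \<in> carrier B"
    and "x \<in> carrier A \<Longrightarrow> y \<in> carrier A \<Longrightarrow> U (x \<oplus>\<^bsub>A\<^esub> y) = U x \<oplus>\<^bsub>B\<^esub> U y"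
  using assms by (auto simp: additive_map_def)

lemma additive_map_0:
  assumes "additive_map A B U" "abelian_group A" "abelian_group B"
  shows "U \<zero>\<^bsub>A\<^esub> = \<zero>\<^bsub>B\<^esub>"
proof -
  interpret A: abelian_group A by fact
  interpret B: abelian_group B by fact
  have c: "U \<zero>\<^bsub>A\<^esub> \<in> carrier B" using additive_mapD(1)[OF assms(1)] by simp
  have "U \<zero>\<^bsub>A\<^esub> \<oplus>\<^bsub>B\<^esub> U \<zero>\<^bsub>A\<^esub> = U \<zero>\<^bsub>A\<^esub>"
    using additive_mapD(2)[OF assms(1), of "\<zero>\<^bsub>A\<^esub>" "\<zero>\<^bsub>A\<^esub>"] by simp
  thus ?thesis using c by (metis B.add.l_cancel_one')
qed

lemma additive_map_minus:
  assumes "additive_map A B U" "abelian_group A" "abelian_group B" "x \<in> carrier A"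
  shows "U (\<ominus>\<^bsub>A\<^esub> x) = \<ominus>\<^bsub>B\<^esub> U x"
proof -
  interpret A: abelian_group A by fact
  interpret B: abelian_group B by fact
  have c: "U x \<in> carrier B" "U (\<ominus>\<^bsub>A\<^esub> x) \<in> carrier B"
    using additive_mapD(1)[OF assms(1)] assms(4) by auto
  have "U (\<ominus>\<^bsub>A\<^esub> x) \<oplus>\<^bsub>B\<^esub> U x = \<zero>\<^bsub>B\<^esub>"
    using additive_mapD(2)[OF assms(1), of "\<ominus>\<^bsub>A\<^esub> x" x] assms(4) additive_map_0[OF assms(1-3)]
    by (simp add: A.l_neg)
  thus ?thesis using c by (metis B.minus_equality)
qed

lemma additive_map_finsum:
  assumes "additive_map A B U" "abelian_group A" "abelian_group B" "f \<in> I \<rightarrow> carrier A"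
  shows "U (finsum A f I) = finsum B (\<lambda>i. U (f i)) I"
proof -
  interpret A: abelian_group A by fact
  interpret B: abelian_group B by fact
  show ?thesis
    using assms(4)
  proof (induction I rule: infinite_finite_induct)
    case (insert i I)
    hence "f i \<in> carrier A" "f \<in> I \<rightarrow> carrier A" by auto
    moreover from this have "(\<lambda>i. U (f i)) \<in> I \<rightarrow> carrier B" "U (f i) \<in> carrier B"
      using additive_mapD(1)[OF assms(1)] by auto
    ultimately show ?case using insert additive_mapD(2)[OF assms(1)]
      by (simp add: A.finsum_insert B.finsum_insert A.finsum_closed)
  qed (simp_all add: additive_map_0[OF assms(1-3)] A.finsum_infinite B.finsum_infinite)
qed

lemma finsum_eq_sum:
  fixes S :: "('a::comm_monoid_add, 'x) ring_scheme"
  assumes "abelian_monoid S" "ring.add S = (+)" "\<zero>\<^bsub>S\<^esub> = 0" "f \<in> I \<rightarrow> carrier S"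
  shows "finsum S f I = sum f I"
proof -
  interpret abelian_monoid S by fact
  show ?thesis using assms(4)
    by (induction I rule: infinite_finite_induct) (auto simp: assms(2,3) finsum_infinite finsum_insert)
qed

lemma additive_map_comp: "additive_map A B U \<Longrightarrow> additive_map B C V \<Longrightarrow> additive_map A C (\<lambda>x. V (U x))"
  by (auto simp: additive_map_def Pi_def)

text \<open>The ring T is present through \<open>f\<close> and its action. The same locale then
  serves the Weyl algebra, acting through \<open>fourier_hom\<close> or \<open>Phi_hom\<close>, and
  polynomials, acting through \<open>poly_to_robba\<close> or \<open>poly_in_eta\<close>.\<close>

locale scalar_extension = R: ring R + M: abelian_group M
  for R :: "('r, 'x) ring_scheme" and f :: "'t \<Rightarrow> 'r" and M :: "('t, 'm) module" +
  assumes f_closed [simp]: "f t \<in> carrier R"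
    and act_closed [simp]: "m \<in> carrier M \<Longrightarrow> t \<odot>\<^bsub>M\<^esub> m \<in> carrier M"
begin

abbreviation "FR \<equiv> tens_free R M"
abbreviation "RL \<equiv> tens_rels R f M"
abbreviation "E \<equiv> ext_scalars R f M"
abbreviation cls where "cls c \<equiv> RL #>\<^bsub>FR\<^esub> c"

sublocale FR: comm_group FR
  by (simp add: tens_free_def abelian_free_Abelian_group)

lemma FR_simps [simp]: "x \<otimes>\<^bsub>FR\<^esub> y = x + y" "\<one>\<^bsub>FR\<^esub> = 0"
  by (simp_all add: tens_free_def)

lemma FR_carrier: "c \<in> carrier FR \<longleftrightarrow> Poly_Mapping.keys c \<subseteq> carrier R \<times> carrier M"
  by (simp add: tens_free_def)

lemma FR_inv [simp]: "c \<in> carrier FR \<Longrightarrow> inv\<^bsub>FR\<^esub> c = - c"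
  by (simp add: tens_free_def)

lemma frag_of_carrier [simp]: "frag_of (a, m) \<in> carrier FR \<longleftrightarrow> a \<in> carrier R \<and> m \<in> carrier M"
  by (simp add: FR_carrier)

lemma FR_add [simp]: "c \<in> carrier FR \<Longrightarrow> d \<in> carrier FR \<Longrightarrow> c + d \<in> carrier FR"
  using FR.m_closed[of c d] by simp

lemma FR_uminus [simp]: "c \<in> carrier FR \<Longrightarrow> - c \<in> carrier FR"
  using FR.inv_closed[of c] by simp

lemma FR_diff [simp]: "c \<in> carrier FR \<Longrightarrow> d \<in> carrier FR \<Longrightarrow> c - d \<in> carrier FR"
  using FR_add[OF _ FR_uminus, of c d] by simp

definition gens where "gens =
   {frag_of (a \<oplus>\<^bsub>R\<^esub> b, m) - frag_of (a, m) - frag_of (b, m) | a b m.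
         a \<in> carrier R \<and> b \<in> carrier R \<and> m \<in> carrier M}
    \<union> {frag_of (a, m \<oplus>\<^bsub>M\<^esub> n) - frag_of (a, m) - frag_of (a, n) | a m n.
         a \<in> carrier R \<and> m \<in> carrier M \<and> n \<in> carrier M}
    \<union> {frag_of (a \<otimes>\<^bsub>R\<^esub> f t, m) - frag_of (a, t \<odot>\<^bsub>M\<^esub> m) | a t m.
         a \<in> carrier R \<and> m \<in> carrier M}"

lemma RL_gens: "RL = generate FR gens"
  by (simp add: tens_rels_def gens_def)

lemma gens_carrier: "gens \<subseteq> carrier FR"
  unfolding gens_def by auto

lemma RL_subgroup: "subgroup RL FR"
  unfolding RL_gens by (rule FR.generate_is_subgroup[OF gens_carrier])

lemma RL_normal: "RL \<lhd> FR"
  using RL_subgroup FR.normal_iff_subgroup by blast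

sublocale RL: normal RL FR by (rule RL_normal)

lemma RL_closed:
  "0 \<in> RL" "h \<in> RL \<Longrightarrow> k \<in> RL \<Longrightarrow> h + k \<in> RL" "h \<in> RL \<Longrightarrow> - h \<in> RL" "h \<in> RL \<Longrightarrow> h \<in> carrier FR"
  using RL.one_closed RL.m_closed[of h k] RL.m_inv_closed[of h] RL.subset by auto

lemma cls_def: "cls c = (\<lambda>h. h + c) ` RL"
  by (auto simp: r_coset_def)

lemma cls_eq_iff: "cls c = cls d \<longleftrightarrow> c - d \<in> RL"
proof
  assume "cls c = cls d"
  moreover have "c \<in> cls c" using RL_closed(1) by (force simp: cls_def)
  ultimately obtain h where "h \<in> RL" "c = h + d" by (auto simp: cls_def)
  thus "c - d \<in> RL" by simp
next
  assume h: "c - d \<in> RL"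
  have "h' + c \<in> cls d" if "h' \<in> RL" for h'
    using RL_closed(2)[OF that h] unfolding cls_def by (intro image_eqI[of _ _ "h' + (c - d)"]) auto
  moreover have "h' + d \<in> cls c" if "h' \<in> RL" for h'
    using RL_closed(2)[OF that RL_closed(3)[OF h]] unfolding cls_def
    by (intro image_eqI[of _ _ "h' + - (c - d)"]) auto
  ultimately show "cls c = cls d" unfolding cls_def by blast
qed

lemma E_carrier: "carrier E = cls ` carrier FR"
  by (auto simp: ext_scalars_def Let_def FactGroup_def RCOSETS_def)

lemma E_zero: "\<zero>\<^bsub>E\<^esub> = cls 0"
  by (simp add: ext_scalars_def Let_def FactGroup_def cls_def)

lemma E_add: "c \<in> carrier FR \<Longrightarrow> d \<in> carrier FR \<Longrightarrow> cls c \<oplus>\<^bsub>E\<^esub> cls d = cls (c + d)"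
  using RL.rcos_sum[of c d] by (simp add: ext_scalars_def Let_def FactGroup_def)

lemma cls_carrier [simp]: "c \<in> carrier FR \<Longrightarrow> cls c \<in> carrier E"
  by (simp add: E_carrier)

sublocale E: abelian_group E
proof (rule abelian_groupI)
  fix x assume "x \<in> carrier E"
  then obtain c where c: "c \<in> carrier FR" "x = cls c" by (auto simp: E_carrier)
  hence "cls (- c) \<oplus>\<^bsub>E\<^esub> x = \<zero>\<^bsub>E\<^esub>" by (simp add: E_add E_zero)
  thus "\<exists>y\<in>carrier E. y \<oplus>\<^bsub>E\<^esub> x = \<zero>\<^bsub>E\<^esub>" using c by (meson FR_uminus cls_carrier)
qed (use FR.one_closed in \<open>auto simp: E_carrier E_add E_zero add_ac\<close>)

lemma cls_minus: "c \<in> carrier FR \<Longrightarrow> cls (- c) = \<ominus>\<^bsub>E\<^esub> cls c"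
  by (rule E.minus_equality[symmetric]) (auto simp: E_add E_zero)

abbreviation tn where "tn \<equiv> tens R f M"

lemma tens_closed [simp]: "a \<in> carrier R \<Longrightarrow> m \<in> carrier M \<Longrightarrow> tn a m \<in> carrier E"
  by (simp add: tens_def)

lemma tens_add_left:
  assumes "a \<in> carrier R" "b \<in> carrier R" "m \<in> carrier M"
  shows "tn (a \<oplus>\<^bsub>R\<^esub> b) m = tn a m \<oplus>\<^bsub>E\<^esub> tn b m"
proof -
  have "frag_of (a \<oplus>\<^bsub>R\<^esub> b, m) - frag_of (a, m) - frag_of (b, m) \<in> RL"
    unfolding RL_gens gens_def using assms by (intro generate.incl) blast
  thus ?thesis unfolding tens_def using assms by (simp add: E_add cls_eq_iff algebra_simps)
qed

lemma tens_add_right: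
  assumes "a \<in> carrier R" "m \<in> carrier M" "n \<in> carrier M"
  shows "tn a (m \<oplus>\<^bsub>M\<^esub> n) = tn a m \<oplus>\<^bsub>E\<^esub> tn a n"
proof -
  have "frag_of (a, m \<oplus>\<^bsub>M\<^esub> n) - frag_of (a, m) - frag_of (a, n) \<in> RL"
    unfolding RL_gens gens_def using assms by (intro generate.incl) blast
  thus ?thesis unfolding tens_def using assms by (simp add: E_add cls_eq_iff algebra_simps)
qed

lemma tens_balanced:
  assumes "a \<in> carrier R" "m \<in> carrier M"
  shows "tn (a \<otimes>\<^bsub>R\<^esub> f t) m = tn a (t \<odot>\<^bsub>M\<^esub> m)"
proof -
  have "frag_of (a \<otimes>\<^bsub>R\<^esub> f t, m) - frag_of (a, t \<odot>\<^bsub>M\<^esub> m) \<in> RL"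
    unfolding RL_gens gens_def using assms by (intro generate.incl) blast
  thus ?thesis unfolding tens_def by (simp add: cls_eq_iff)
qed

lemma additive_map_tens_left: "m \<in> carrier M \<Longrightarrow> additive_map R E (\<lambda>a. tn a m)"
  by (simp add: additive_map_def tens_add_left)

lemma additive_map_tens_right: "a \<in> carrier R \<Longrightarrow> additive_map M E (tn a)"
  by (simp add: additive_map_def tens_add_right)

text \<open>Induction on the free group proceeds by differences while \<open>add\<close> handles
  sums only. Hence \<open>cls c\<close> and \<open>cls (- c)\<close> are treated together, the sign
  being moved into the first factor of a pure tensor.\<close>

lemma tens_induct [consumes 1, case_names pure add]:
  assumes "x \<in> carrier E"
    and pure: "\<And>a m. a \<in> carrier R \<Longrightarrow> m \<in> carrier M \<Longrightarrow> Q (tn a m)"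
    and add: "\<And>x y. x \<in> carrier E \<Longrightarrow> y \<in> carrier E \<Longrightarrow> Q x \<Longrightarrow> Q y \<Longrightarrow> Q (x \<oplus>\<^bsub>E\<^esub> y)"
  shows "Q x"
proof -
  from assms(1) obtain c where c: "c \<in> carrier FR" "x = cls c" by (auto simp: E_carrier)
  have "\<zero>\<^bsub>E\<^esub> = tn \<zero>\<^bsub>R\<^esub> \<zero>\<^bsub>M\<^esub>"
    using additive_map_0[OF additive_map_tens_right M.abelian_group_axioms E.abelian_group_axioms, of "\<zero>\<^bsub>R\<^esub>"] by simp
  hence zero: "Q \<zero>\<^bsub>E\<^esub>" using pure by simp
  have neg: "\<ominus>\<^bsub>E\<^esub> tn a m = tn (\<ominus>\<^bsub>R\<^esub> a) m" if "a \<in> carrier R" "m \<in> carrier M" for a m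
    using additive_map_minus[OF additive_map_tens_left[OF that(2)] R.abelian_group_axioms E.abelian_group_axioms that(1)] by simp
  from c(1) have "Poly_Mapping.keys c \<subseteq> carrier R \<times> carrier M" by (simp add: FR_carrier)
  hence "c \<in> carrier FR \<and> Q (cls c) \<and> Q (cls (- c))"
  proof (induction c rule: frag_induction)
    case zero
    show ?case using \<open>Q \<zero>\<^bsub>E\<^esub>\<close> FR.one_closed by (simp add: E_zero)
  next
    case (one x)
    obtain a m where x: "x = (a, m)" "a \<in> carrier R" "m \<in> carrier M" using one by auto
    thus ?case using pure[of a m] pure[of "\<ominus>\<^bsub>R\<^esub> a" m] neg[of a m] by (simp add: tens_def cls_minus)
  next
    case (diff a b)
    have "Q (cls a \<oplus>\<^bsub>E\<^esub> cls (- b))" "Q (cls b \<oplus>\<^bsub>E\<^esub> cls (- a))"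
      using diff.IH by (intro add; simp)+
    thus ?case using diff.IH by (simp add: E_add)
  qed
  thus ?thesis using c by simp
qed

lemma tens_ext:
  assumes "additive_map E G U" "additive_map E G V"
    and "\<And>a m. a \<in> carrier R \<Longrightarrow> m \<in> carrier M \<Longrightarrow> U (tn a m) = V (tn a m)" and "x \<in> carrier E"
  shows "U x = V x"
  using assms(4) by (induction rule: tens_induct) (simp_all add: assms(3) additive_mapD[OF assms(1)] additive_mapD[OF assms(2)])

text \<open>The balanced map extends to the free abelian group and kills the generators of
  \<open>RL\<close>, so it factors through the quotient. Besides constructing maps, this is the
  means of showing that a tensor is nonzero.\<close>

lemma tens_universal:
  fixes G :: "('g, 'y) ring_scheme"
  assumes G: "abelian_group G"
    and closed: "\<And>a m. a \<in> carrier R \<Longrightarrow> m \<in> carrier M \<Longrightarrow> \<phi> a m \<in> carrier G"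
    and add_left: "\<And>a b m. a \<in> carrier R \<Longrightarrow> b \<in> carrier R \<Longrightarrow> m \<in> carrier M \<Longrightarrow>
      \<phi> (a \<oplus>\<^bsub>R\<^esub> b) m = \<phi> a m \<oplus>\<^bsub>G\<^esub> \<phi> b m"
    and add_right: "\<And>a m n. a \<in> carrier R \<Longrightarrow> m \<in> carrier M \<Longrightarrow> n \<in> carrier M \<Longrightarrow>
      \<phi> a (m \<oplus>\<^bsub>M\<^esub> n) = \<phi> a m \<oplus>\<^bsub>G\<^esub> \<phi> a n"
    and balanced: "\<And>a t m. a \<in> carrier R \<Longrightarrow> m \<in> carrier M \<Longrightarrow>
      \<phi> (a \<otimes>\<^bsub>R\<^esub> f t) m = \<phi> a (t \<odot>\<^bsub>M\<^esub> m)"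
  obtains U where "additive_map E G U"
    and "\<And>a m. a \<in> carrier R \<Longrightarrow> m \<in> carrier M \<Longrightarrow> U (tn a m) = \<phi> a m"
proof -
  interpret G: abelian_group G by fact
  have cg: "comm_group (add_monoid G)" by (rule G.a_comm_group)
  have "(\<lambda>(a, m). \<phi> a m) ` (carrier R \<times> carrier M) \<subseteq> carrier (add_monoid G)"
    using closed by auto
  from comm_group.free_Abelian_group_universal[OF cg this] obtain h
    where h: "h \<in> hom (free_Abelian_group (carrier R \<times> carrier M)) (add_monoid G)"
      and h_of: "\<And>x. x \<in> carrier R \<times> carrier M \<Longrightarrow> h (frag_of x) = (case x of (a, m) \<Rightarrow> \<phi> a m)"
    by blast
  hence hh: "h \<in> hom FR (add_monoid G)" by (simp add: tens_free_def)
  interpret h: group_hom FR "add_monoid G" h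
    using hh cg by (simp add: group_hom_def group_hom_axioms_def comm_group_def)
  have h_cl: "h c \<in> carrier G" if "c \<in> carrier FR" for c using h.hom_closed[OF that] by simp
  have h_add: "h (c + d) = h c \<oplus>\<^bsub>G\<^esub> h d" if "c \<in> carrier FR" "d \<in> carrier FR" for c d
    using h.hom_mult[OF that] by simp
  have h_diff: "h (c - d) = h c \<ominus>\<^bsub>G\<^esub> h d" if "c \<in> carrier FR" "d \<in> carrier FR" for c d
    using h_add[of c "- d"] that h.hom_inv[OF that(2)] by (simp add: G.minus_eq a_inv_def)
  have h_of': "h (frag_of (a, m)) = \<phi> a m" if "a \<in> carrier R" "m \<in> carrier M" for a m
    using h_of[of "(a, m)"] that by simp
  have zero3: "x \<oplus>\<^bsub>G\<^esub> y \<ominus>\<^bsub>G\<^esub> x \<ominus>\<^bsub>G\<^esub> y = \<zero>\<^bsub>G\<^esub>" if "x \<in> carrier G" "y \<in> carrier G" for x y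
  proof -
    have "x \<oplus>\<^bsub>G\<^esub> y \<ominus>\<^bsub>G\<^esub> x \<ominus>\<^bsub>G\<^esub> y = (x \<oplus>\<^bsub>G\<^esub> y) \<oplus>\<^bsub>G\<^esub> \<ominus>\<^bsub>G\<^esub> (x \<oplus>\<^bsub>G\<^esub> y)"
      using that by (simp add: G.minus_eq G.a_assoc G.minus_add)
    thus ?thesis using that by (simp add: G.r_neg)
  qed
  have "gens \<subseteq> kernel FR (add_monoid G) h"
  proof
    fix x assume x: "x \<in> gens"
    have "h x = \<zero>\<^bsub>G\<^esub>"
      using x unfolding gens_def
    proof (elim UnE CollectE exE conjE)
      fix a b m assume "x = frag_of (a \<oplus>\<^bsub>R\<^esub> b, m) - frag_of (a, m) - frag_of (b, m)"
        "a \<in> carrier R" "b \<in> carrier R" "m \<in> carrier M"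
      thus ?thesis by (simp add: h_diff h_of' add_left closed zero3)
    next
      fix a m n assume "x = frag_of (a, m \<oplus>\<^bsub>M\<^esub> n) - frag_of (a, m) - frag_of (a, n)"
        "a \<in> carrier R" "m \<in> carrier M" "n \<in> carrier M"
      thus ?thesis by (simp add: h_diff h_of' add_right closed zero3)
    next
      fix a t m assume "x = frag_of (a \<otimes>\<^bsub>R\<^esub> f t, m) - frag_of (a, t \<odot>\<^bsub>M\<^esub> m)"
        "a \<in> carrier R" "m \<in> carrier M"
      thus ?thesis by (simp add: h_diff h_of' balanced closed G.minus_eq G.r_neg)
    qed
    thus "x \<in> kernel FR (add_monoid G) h" using x gens_carrier by (auto simp: kernel_def)
  qed
  hence "RL \<subseteq> kernel FR (add_monoid G) h"
    unfolding RL_gens by (rule FR.generate_subgroup_incl[OF _ h.subgroup_kernel])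
  from h.FactGroup_universal_kernel[OF RL_normal this] obtain U
    where U: "U \<in> hom (FR Mod RL) (add_monoid G)" "\<And>x. x \<in> carrier FR \<Longrightarrow> U (cls x) = h x" by blast
  have "additive_map E G U"
    unfolding additive_map_def E_carrier by (auto simp: E_add U(2) h_cl h_add)
  moreover have "U (tn a m) = \<phi> a m" if "a \<in> carrier R" "m \<in> carrier M" for a m
    using that by (simp add: tens_def U(2) h_of')
  ultimately show thesis by (rule that)
qed

text \<open>The union in \<open>tens_lift\<close> ranges over all representatives of a class.
  Compatibility with the relations makes every member of the union the same coset, which is the
  value of the map given by the universal property.\<close>

lemma tens_lift:
  assumes closed: "\<And>a m. a \<in> carrier R \<Longrightarrow> m \<in> carrier M \<Longrightarrow> \<phi> (a, m) \<in> carrier FR"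
    and add_left: "\<And>a b m. a \<in> carrier R \<Longrightarrow> b \<in> carrier R \<Longrightarrow> m \<in> carrier M \<Longrightarrow>
      cls (\<phi> (a \<oplus>\<^bsub>R\<^esub> b, m)) = cls (\<phi> (a, m)) \<oplus>\<^bsub>E\<^esub> cls (\<phi> (b, m))"
    and add_right: "\<And>a m n. a \<in> carrier R \<Longrightarrow> m \<in> carrier M \<Longrightarrow> n \<in> carrier M \<Longrightarrow>
      cls (\<phi> (a, m \<oplus>\<^bsub>M\<^esub> n)) = cls (\<phi> (a, m)) \<oplus>\<^bsub>E\<^esub> cls (\<phi> (a, n))"
    and balanced: "\<And>a t m. a \<in> carrier R \<Longrightarrow> m \<in> carrier M \<Longrightarrow>
      cls (\<phi> (a \<otimes>\<^bsub>R\<^esub> f t, m)) = cls (\<phi> (a, t \<odot>\<^bsub>M\<^esub> m))"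
  shows "additive_map E E (tens_lift R f M \<phi>)"
    and "\<And>a m. a \<in> carrier R \<Longrightarrow> m \<in> carrier M \<Longrightarrow> tens_lift R f M \<phi> (tn a m) = cls (\<phi> (a, m))"
proof -
  obtain U where U: "additive_map E E U"
    and U_tn: "\<And>a m. a \<in> carrier R \<Longrightarrow> m \<in> carrier M \<Longrightarrow> U (tn a m) = cls (\<phi> (a, m))"
    by (rule tens_universal[OF E.abelian_group_axioms, of "\<lambda>a m. cls (\<phi> (a, m))"])
       (auto simp: closed add_left add_right balanced)
  have fe: "c \<in> carrier FR \<and> frag_extend \<phi> c \<in> carrier FR \<and> U (cls c) = cls (frag_extend \<phi> c)"
    if "c \<in> carrier FR" for c
    using that unfolding FR_carrier[of c]
  proof (induction c rule: frag_induction)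
    case zero
    show ?case using FR.one_closed additive_map_0[OF U E.abelian_group_axioms E.abelian_group_axioms]
      by (simp add: E_zero)
  next
    case (one x)
    then obtain a m where x: "x = (a, m)" "a \<in> carrier R" "m \<in> carrier M" by auto
    thus ?case using U_tn[of a m] closed by (simp add: tens_def)
  next
    case (diff a b)
    hence ab: "a \<in> carrier FR" "b \<in> carrier FR" "frag_extend \<phi> a \<in> carrier FR" "frag_extend \<phi> b \<in> carrier FR"
      "U (cls a) = cls (frag_extend \<phi> a)" "U (cls b) = cls (frag_extend \<phi> b)"
      by (auto simp: FR_carrier)
    have "U (cls (a - b)) = U (cls a \<oplus>\<^bsub>E\<^esub> \<ominus>\<^bsub>E\<^esub> cls b)"
      using ab by (simp add: E_add flip: cls_minus)
    also have "\<dots> = cls (frag_extend \<phi> a) \<oplus>\<^bsub>E\<^esub> \<ominus>\<^bsub>E\<^esub> cls (frag_extend \<phi> b)"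
      using ab by (simp add: additive_mapD(2)[OF U] additive_map_minus[OF U E.abelian_group_axioms E.abelian_group_axioms])
    also have "\<dots> = cls (frag_extend \<phi> (a - b))"
      using ab by (simp add: E_add frag_extend_diff flip: cls_minus)
    finally show ?case using ab by (simp add: frag_extend_diff flip: FR_carrier)
  qed
  have eq: "tens_lift R f M \<phi> x = U x" if "x \<in> carrier E" for x
  proof -
    from that obtain c where c: "c \<in> carrier FR" "x = cls c" by (auto simp: E_carrier)
    have *: "cls (frag_extend \<phi> c') = U x" if "c' \<in> x" for c'
    proof -
      have "c' \<in> (\<lambda>h. h + c) ` RL" using that unfolding c(2) cls_def .
      then obtain h where h: "h \<in> RL" "c' = h + c" by (elim imageE)
      hence "c' \<in> carrier FR" using c RL_closed(4) by simp
      moreover have "cls c' = x" using h c by (simp add: cls_eq_iff)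
      ultimately show ?thesis using fe[of c'] by metis
    qed
    have "c \<in> x" unfolding c(2) cls_def by (rule image_eqI[OF _ RL_closed(1)]) simp
    hence ne: "x \<noteq> {}" by blast
    have "tens_lift R f M \<phi> x = (\<Union>c'\<in>x. U x)" unfolding tens_lift_def by (rule SUP_cong[OF refl *])
    thus ?thesis using ne by simp
  qed
  show "additive_map E E (tens_lift R f M \<phi>)"
    using U by (auto simp: additive_map_def eq)
  show "\<And>a m. a \<in> carrier R \<Longrightarrow> m \<in> carrier M \<Longrightarrow> tens_lift R f M \<phi> (tn a m) = cls (\<phi> (a, m))"
    by (simp add: eq U_tn)
qed

section \<open>The module structure on the tensor product\<close>

lemma E_smult:
  assumes "s \<in> carrier R"
  shows "additive_map E E (\<lambda>x. s \<odot>\<^bsub>E\<^esub> x)"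
    and "\<And>a m. a \<in> carrier R \<Longrightarrow> m \<in> carrier M \<Longrightarrow> s \<odot>\<^bsub>E\<^esub> tn a m = tn (s \<otimes>\<^bsub>R\<^esub> a) m"
proof -
  let ?\<phi> = "\<lambda>(a, m). frag_of (s \<otimes>\<^bsub>R\<^esub> a, m)"
  have s: "(\<lambda>x. s \<odot>\<^bsub>E\<^esub> x) = tens_lift R f M ?\<phi>"
    by (simp add: ext_scalars_def Let_def)
  have c: "cls (frag_of (a, m)) = tn a m" for a m by (simp add: tens_def)
  have "additive_map E E (tens_lift R f M ?\<phi>) \<and> (\<forall>a\<in>carrier R. \<forall>m\<in>carrier M.
      tens_lift R f M ?\<phi> (tn a m) = cls (?\<phi> (a, m)))"
    by (intro conjI ballI tens_lift)
       (simp_all add: assms c R.r_distr tens_add_left tens_add_right tens_balanced flip: R.m_assoc)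
  thus "additive_map E E (\<lambda>x. s \<odot>\<^bsub>E\<^esub> x)"
    and "\<And>a m. a \<in> carrier R \<Longrightarrow> m \<in> carrier M \<Longrightarrow> s \<odot>\<^bsub>E\<^esub> tn a m = tn (s \<otimes>\<^bsub>R\<^esub> a) m"
    unfolding s by (simp_all add: c)
qed

lemma E_smult_closed [simp]: "s \<in> carrier R \<Longrightarrow> x \<in> carrier E \<Longrightarrow> s \<odot>\<^bsub>E\<^esub> x \<in> carrier E"
  using additive_mapD(1)[OF E_smult(1)] .

lemma E_smult_r_distr: "s \<in> carrier R \<Longrightarrow> x \<in> carrier E \<Longrightarrow> y \<in> carrier E \<Longrightarrow>
    s \<odot>\<^bsub>E\<^esub> (x \<oplus>\<^bsub>E\<^esub> y) = s \<odot>\<^bsub>E\<^esub> x \<oplus>\<^bsub>E\<^esub> s \<odot>\<^bsub>E\<^esub> y"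
  using additive_mapD(2)[OF E_smult(1)] .

lemma E_smult_l_distr:
  assumes "s \<in> carrier R" "t \<in> carrier R" "x \<in> carrier E"
  shows "(s \<oplus>\<^bsub>R\<^esub> t) \<odot>\<^bsub>E\<^esub> x = s \<odot>\<^bsub>E\<^esub> x \<oplus>\<^bsub>E\<^esub> t \<odot>\<^bsub>E\<^esub> x"
  using assms(3)
proof (induction rule: tens_induct)
  case (add x y)
  thus ?case using assms(1,2) by (simp add: E_smult_r_distr E.a_ac)
qed (use assms(1,2) in \<open>simp add: E_smult(2) R.l_distr tens_add_left\<close>)

lemma E_smult_assoc:
  assumes "s \<in> carrier R" "t \<in> carrier R" "x \<in> carrier E"
  shows "(s \<otimes>\<^bsub>R\<^esub> t) \<odot>\<^bsub>E\<^esub> x = s \<odot>\<^bsub>E\<^esub> (t \<odot>\<^bsub>E\<^esub> x)"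
  using assms(3)
proof (induction rule: tens_induct)
  case (add x y)
  thus ?case using assms(1,2) by (simp add: E_smult_r_distr)
qed (use assms(1,2) in \<open>simp add: E_smult(2) R.m_assoc\<close>)

lemma E_smult_one: "x \<in> carrier E \<Longrightarrow> \<one>\<^bsub>R\<^esub> \<odot>\<^bsub>E\<^esub> x = x"
  by (induction rule: tens_induct) (simp_all add: E_smult(2) E_smult_r_distr)

lemma E_module: "cring R \<Longrightarrow> Module.module R E"
  by (rule Module.moduleI)
     (auto simp: E_smult_l_distr E_smult_r_distr E_smult_assoc E_smult_one E.abelian_group_axioms)

lemma E_Leibniz:
  assumes C: "additive_map E E C"
    and C_tn: "\<And>a m. a \<in> carrier R \<Longrightarrow> m \<in> carrier M \<Longrightarrow> C (tn a m) = tn (D a) m \<oplus>\<^bsub>E\<^esub> tn a (\<delta> m)"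
    and D: "\<And>a. a \<in> carrier R \<Longrightarrow> D a \<in> carrier R"
      "\<And>a b. a \<in> carrier R \<Longrightarrow> b \<in> carrier R \<Longrightarrow> D (a \<otimes>\<^bsub>R\<^esub> b) = D a \<otimes>\<^bsub>R\<^esub> b \<oplus>\<^bsub>R\<^esub> a \<otimes>\<^bsub>R\<^esub> D b"
    and \<delta>: "\<And>m. m \<in> carrier M \<Longrightarrow> \<delta> m \<in> carrier M"
    and "s \<in> carrier R" "x \<in> carrier E"
  shows "C (s \<odot>\<^bsub>E\<^esub> x) = D s \<odot>\<^bsub>E\<^esub> x \<oplus>\<^bsub>E\<^esub> s \<odot>\<^bsub>E\<^esub> C x"
  using assms(7)
proof (induction rule: tens_induct)
  case (add x y)
  thus ?case using assms(6) D(1)[OF assms(6)] additive_mapD(1)[OF C]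
    by (simp add: E_smult_r_distr additive_mapD(2)[OF C] E.a_ac)
next
  case (pure a m)
  thus ?case using assms(6) D(1) \<delta>
    by (simp add: E_smult_r_distr E_smult(2) C_tn D(2) tens_add_left E.a_ac)
qed

end

section \<open>The Weyl algebra and its representations\<close>

lemma weyl_simps [simp]:
  "x \<otimes>\<^bsub>weyl\<^esub> y = weyl_mult x y" "\<one>\<^bsub>weyl\<^esub> = 1" "\<zero>\<^bsub>weyl\<^esub> = 0" "x \<oplus>\<^bsub>weyl\<^esub> y = x + y" "carrier weyl = UNIV"
  by (simp_all add: weyl_def)

text \<open>The associativity of the product of the Weyl algebra is inherited from that of symbols.\<close>

definition weyl_symbol :: "'k::field_char_0 weyl \<Rightarrow> 'k fps fls" where
  "weyl_symbol F = Abs_fls (\<lambda>n. if n \<le> 0 then fps_of_poly (coeff F (nat (- n))) else 0)"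

lemma nth_weyl_symbol:
  "fls_nth (weyl_symbol F) n = (if n \<le> 0 then fps_of_poly (coeff F (nat (- n))) else 0)"
  unfolding weyl_symbol_def
  by (rule nth_Abs_fls_lower_bound[of "- int (degree F)"]) (auto simp: coeff_eq_0)

lemma weyl_symbol_inj: "weyl_symbol F = weyl_symbol G \<Longrightarrow> F = G"
proof (rule poly_eqI)
  fix k assume "weyl_symbol F = weyl_symbol G"
  hence "fls_nth (weyl_symbol F) (- int k) = fls_nth (weyl_symbol G) (- int k)" by simp
  thus "coeff F k = coeff G k" by (simp add: nth_weyl_symbol fps_of_poly_eq_iff)
qed

lemma weyl_symbol_add: "weyl_symbol (F + G) = weyl_symbol F + weyl_symbol G"
  by (rule fls_eqI) (simp add: nth_weyl_symbol fps_of_poly_add)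

lemma weyl_symbol_sum: "weyl_symbol (sum f A) = (\<Sum>i\<in>A. weyl_symbol (f i))"
proof -
  have "weyl_symbol 0 = (0 :: 'a fps fls)" by (rule fls_eqI) (simp add: nth_weyl_symbol)
  thus ?thesis by (induction A rule: infinite_finite_induct) (auto simp: weyl_symbol_add)
qed

lemma weyl_symbol_mult: "weyl_symbol (F * G) = weyl_symbol F * weyl_symbol G"
proof -
  have shift: "weyl_symbol (pCons a F) = fls_const (fps_of_poly a) + fls_X_inv * weyl_symbol F"
    for a and F :: "'a weyl"
  proof (rule fls_eqI)
    fix n :: int
    have "fls_X_inv * weyl_symbol F = fls_shift 1 (weyl_symbol F)"
      by (simp add: fls_X_inv_times_conv_shift)
    moreover have "nat (- n) = Suc (nat (- n - 1))" if "n < 0" using that by simp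
    ultimately show "fls_nth (weyl_symbol (pCons a F)) n =
        fls_nth (fls_const (fps_of_poly a) + fls_X_inv * weyl_symbol F) n"
      by (cases "n < 0"; cases "n = 0") (auto simp: nth_weyl_symbol)
  qed
  have smult: "weyl_symbol (Polynomial.smult a F) = fls_const (fps_of_poly a) * weyl_symbol F" for a and F :: "'a weyl"
    by (rule fls_eqI) (simp add: nth_weyl_symbol fps_of_poly_mult)
  have 0: "weyl_symbol 0 = (0 :: 'a fps fls)" by (rule fls_eqI) (simp add: nth_weyl_symbol)
  show ?thesis
    by (induction F) (simp_all add: 0 shift smult weyl_symbol_add algebra_simps)
qed

lemma symb_d_eta_weyl_symbol: "symb_d_eta (weyl_symbol F) = weyl_symbol (pderiv F)"
proof (rule fls_eqI)
  fix n :: int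
  consider m where "n = - int m" | "n = 1" | "1 < n"
    by (metis linorder_neqE_linordered_idom int_one_le_iff_zero_less less_le nonneg_int_cases minus_minus neg_0_le_iff_le not_less)
  thus "fls_nth (symb_d_eta (weyl_symbol F)) n = fls_nth (weyl_symbol (pderiv F)) n"
  proof cases
    case 1
    have "nat (1 - n) = Suc m" "nat (- n) = m" using 1 by auto
    moreover have "of_int (1 - n) = (fps_const (of_nat (Suc m)) :: 'a fps)"
      using 1 by (simp only: fps_of_nat) simp
    moreover have "fps_of_poly (of_nat (Suc m) * c) = fps_const (of_nat (Suc m)) * fps_of_poly c" for c :: "'a poly"
      by (rule fps_ext) (simp add: of_nat_poly del: of_nat_Suc)
    ultimately show ?thesis using 1
      by (simp add: nth_symb_d_eta nth_weyl_symbol coeff_pderiv del: of_nat_Suc)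
  qed (simp_all add: nth_symb_d_eta nth_weyl_symbol)
qed

lemma symb_d_t_weyl_symbol: "symb_d_t (weyl_symbol F) = weyl_symbol (map_poly pderiv F)"
  by (rule fls_eqI) (simp add: nth_symb_d_t nth_weyl_symbol coeff_map_poly fps_of_poly_pderiv)

lemma symb_d_eta_iter_weyl_symbol: "(symb_d_eta ^^ n) (weyl_symbol F) = weyl_symbol ((pderiv ^^ n) F)"
  by (induction n) (auto simp: symb_d_eta_weyl_symbol)

lemma symb_d_t_iter_weyl_symbol:
  "(symb_d_t ^^ n) (weyl_symbol F) = weyl_symbol (map_poly (pderiv ^^ n) F)"
  by (induction n) (auto simp: symb_d_t_weyl_symbol map_poly_map_poly o_def)

lemma symb_mult_finite:
  fixes F G :: "'k::field_char_0 fps fls"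
  defines "T \<equiv> \<lambda>\<alpha>. symb_const (1 / fact \<alpha>) * (symb_d_eta ^^ \<alpha>) F * (symb_d_t ^^ \<alpha>) G"
  assumes "\<And>\<alpha>. N < \<alpha> \<Longrightarrow> T \<alpha> = 0"
  shows "symb_mult F G = (\<Sum>\<alpha>\<le>N. T \<alpha>)"
proof -
  have "\<alpha> \<le> N" if "fls_nth (T \<alpha>) m \<noteq> 0" for \<alpha> m
    using assms(2)[of \<alpha>] that by (cases "N < \<alpha>") auto
  hence "(\<Sum>\<alpha> | fls_nth (T \<alpha>) m \<noteq> 0. fls_nth (T \<alpha>) m) = fls_nth (\<Sum>\<alpha>\<le>N. T \<alpha>) m" for m
    unfolding fls_nth_sum by (intro sum.mono_neutral_left) auto
  thus ?thesis
    unfolding symb_mult_def Let_def T_def[symmetric] by (simp only: fls_nth_inverse)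
qed

lemma pderiv_iter_eq_0: "degree F < n \<Longrightarrow> (pderiv ^^ n) (F :: 'a::field_char_0 poly poly) = 0"
proof -
  assume d: "degree F < n"
  have deg: "degree ((pderiv ^^ m) F) = degree F - m" for m
    by (induction m) (auto simp: degree_pderiv)
  obtain m where m: "n = Suc m" "degree F \<le> m" using d by (cases n) auto
  have "degree ((pderiv ^^ m) F) = 0" using m deg by simp
  thus ?thesis using m by (simp add: pderiv_eq_0_iff)
qed

lemma weyl_symbol_0 [simp]: "weyl_symbol 0 = 0"
  by (rule fls_eqI) (simp add: nth_weyl_symbol)

lemma weyl_symbol_weyl_mult: "weyl_symbol (weyl_mult F G) = symb_mult (weyl_symbol F) (weyl_symbol G)"
proof -
  have c: "symb_const c = weyl_symbol [:[:c:]:]" for c :: 'a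
    by (rule fls_eqI) (auto simp: nth_weyl_symbol symb_const_def fps_of_poly_const coeff_pCons split: nat.splits)
  have T: "symb_const (1 / fact \<alpha>) * (symb_d_eta ^^ \<alpha>) (weyl_symbol F) * (symb_d_t ^^ \<alpha>) (weyl_symbol G) =
      weyl_symbol ([:[:1 / fact \<alpha>:]:] * (pderiv ^^ \<alpha>) F * map_poly (pderiv ^^ \<alpha>) G)" for \<alpha>
    unfolding c symb_d_eta_iter_weyl_symbol symb_d_t_iter_weyl_symbol weyl_symbol_mult ..
  have "symb_mult (weyl_symbol F) (weyl_symbol G) = (\<Sum>\<alpha>\<le>degree F.
      symb_const (1 / fact \<alpha>) * (symb_d_eta ^^ \<alpha>) (weyl_symbol F) * (symb_d_t ^^ \<alpha>) (weyl_symbol G))"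
    by (rule symb_mult_finite) (simp add: symb_d_eta_iter_weyl_symbol pderiv_iter_eq_0)
  thus ?thesis unfolding T weyl_mult_def weyl_symbol_sum by simp
qed

lemma weyl_mult_assoc: "weyl_mult (weyl_mult F G) H = weyl_mult F (weyl_mult G H)"
  by (rule weyl_symbol_inj) (simp add: weyl_symbol_weyl_mult symb_mult_assoc)

lemma weyl_mult_distrib_left: "weyl_mult H (F + G) = weyl_mult H F + weyl_mult H G"
  by (rule weyl_symbol_inj) (simp add: weyl_symbol_weyl_mult weyl_symbol_add symb_mult_distrib_left)

lemma weyl_mult_distrib_right: "weyl_mult (F + G) H = weyl_mult F H + weyl_mult G H"
  by (rule weyl_symbol_inj) (simp add: weyl_symbol_weyl_mult weyl_symbol_add symb_mult_distrib_right)

lemma weyl_mult_const_left: "weyl_mult [:a:] G = Polynomial.smult a G"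
  by (simp add: weyl_mult_def map_poly_idI)

lemma weyl_mult_1 [simp]: "weyl_mult 1 F = F" "weyl_mult F 1 = F"
proof -
  show "weyl_mult 1 F = F" using weyl_mult_const_left[of 1 F] by (simp flip: one_pCons)
  have "weyl_symbol 1 = (1 :: 'a fps fls)"
    by (rule fls_eqI) (auto simp: nth_weyl_symbol coeff_pCons one_pCons split: nat.splits)
  thus "weyl_mult F 1 = F" by (intro weyl_symbol_inj) (simp add: weyl_symbol_weyl_mult)
qed

lemma weyl_mult_0 [simp]: "weyl_mult 0 F = 0" "weyl_mult F 0 = 0"
  using weyl_mult_distrib_right[of 0 0 F] weyl_mult_distrib_left[of F 0 0] by simp_all

lemma weyl_mult_d: "weyl_mult weyl_d G = pCons 0 G + map_poly pderiv G"
  by (simp add: weyl_mult_def weyl_d_def pderiv_pCons map_poly_idI flip: one_pCons)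

lemma weyl_abelian_group: "abelian_group (weyl :: 'k::field_char_0 weyl ring)"
proof (rule abelian_groupI)
  fix x :: "'k weyl"
  show "\<exists>y\<in>carrier weyl. y \<oplus>\<^bsub>weyl\<^esub> x = \<zero>\<^bsub>weyl\<^esub>" by (intro bexI[of _ "- x"]) auto
qed (simp_all add: add_ac)

lemma weyl_ring: "ring (weyl :: 'k::field_char_0 weyl ring)"
  by (rule ringI[OF weyl_abelian_group])
     (auto intro!: monoidI simp: weyl_mult_assoc weyl_mult_distrib_left weyl_mult_distrib_right)

section \<open>Induction principles for the Weyl algebra\<close>

lemma weyl_induct [case_names monom add]:
  fixes F :: "'k::field_char_0 weyl"
  assumes "\<And>c i k. Q (monom (monom c i) k)" "\<And>F G. Q F \<Longrightarrow> Q G \<Longrightarrow> Q (F + G)"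
  shows "Q F"
proof -
  have 0: "Q 0" using assms(1)[of 0 0 0] by simp
  have S: "Q (sum f A)" if "\<And>i. i \<in> A \<Longrightarrow> Q (f i)" for f :: "nat \<Rightarrow> 'k weyl" and A
    using that by (induction A rule: infinite_finite_induct) (auto intro: 0 assms(2))
  have "Q (monom a k)" for a :: "'k poly" and k
  proof -
    have "monom a k = monom (\<Sum>i\<le>degree a. monom (coeff a i) i) k"
      by (simp add: poly_as_sum_of_monoms)
    also have "\<dots> = (\<Sum>i\<le>degree a. monom (monom (coeff a i) i) k)" by (rule monom_sum)
    finally show ?thesis using S assms(1) by simp
  qed
  hence "Q (\<Sum>k\<le>degree F. monom (coeff F k) k)" using S by simp
  thus ?thesis by (simp add: poly_as_sum_of_monoms)
qed

text \<open>A monomial in normal form is itself a product of a constant, powers of the variable and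
  powers of the derivation. Multiplicative identities then reduce to generators.\<close>

lemma weyl_generated [case_names const var d add mult]:
  fixes F :: "'k::field_char_0 weyl"
  assumes "\<And>c. Q [:[:c:]:]" "Q weyl_var" "Q weyl_d"
    and add: "\<And>F G. Q F \<Longrightarrow> Q G \<Longrightarrow> Q (F + G)" and mult: "\<And>F G. Q F \<Longrightarrow> Q G \<Longrightarrow> Q (weyl_mult F G)"
  shows "Q F"
proof (induction F rule: weyl_induct)
  case (monom c i k)
  have d: "Q (monom 1 k)" for k
  proof (induction k)
    case 0
    show ?case using assms(1)[of 1] by (simp add: one_pCons monom_0)
  next
    case (Suc k)
    have "weyl_mult weyl_d (monom 1 k) = (monom 1 (Suc k) :: 'k weyl)"
      by (simp add: weyl_mult_d monom_Suc map_poly_monom)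
    thus ?case using mult[OF assms(3) Suc.IH] by simp
  qed
  have "Q (monom (monom 1 i) k)"
  proof (induction i)
    case 0
    show ?case using d[of k] by (simp add: monom_0 one_pCons)
  next
    case (Suc i)
    have "weyl_mult weyl_var (monom (monom 1 i) k) = (monom (monom 1 (Suc i)) k :: 'k weyl)"
      by (simp add: weyl_var_def weyl_mult_const_left smult_monom monom_Suc)
    thus ?case using mult[OF assms(2) Suc.IH] by simp
  qed
  from mult[OF assms(1)[of c] this] show ?case
    by (simp add: weyl_mult_const_left smult_monom)
qed (rule add)

text \<open>The relation \<open>commutator\<close> is what makes \<open>weyl_eval\<close> a
  morphism. Three instances occur: the Fourier morphism, \<open>Phi_hom\<close>, and the morphism
  into \<open>Phi\<close> with \<eta> -> \<eta> and derivation -> -t.\<close>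

locale weyl_rep = ring S for S :: "('s::ab_group_add, 'x) ring_scheme" (structure) +
  fixes \<kappa> :: "'k::field_char_0 \<Rightarrow> 's" and x y :: 's
  assumes add_eq [simp]: "a \<oplus> b = a + b" and zero_eq [simp]: "\<zero> = 0"
    and \<kappa>_closed [simp]: "\<kappa> c \<in> carrier S" and x_closed [simp]: "x \<in> carrier S" and y_closed [simp]: "y \<in> carrier S"
    and \<kappa>_add: "\<kappa> (c + c') = \<kappa> c + \<kappa> c'" and \<kappa>_mult: "\<kappa> (c * c') = \<kappa> c \<otimes> \<kappa> c'" and \<kappa>_1 [simp]: "\<kappa> 1 = \<one>"
    and \<kappa>_central: "s \<in> carrier S \<Longrightarrow> s \<otimes> \<kappa> c = \<kappa> c \<otimes> s"
    and commutator: "y \<otimes> x = x \<otimes> y + \<one>"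
begin

lemma plus_closed [simp]: "a \<in> carrier S \<Longrightarrow> b \<in> carrier S \<Longrightarrow> a + b \<in> carrier S"
  using a_closed by simp

lemma zero_mem [simp]: "0 \<in> carrier S"
  using zero_closed by simp

lemma sum_closed: "(\<And>i. i \<in> A \<Longrightarrow> f i \<in> carrier S) \<Longrightarrow> sum f A \<in> carrier S"
  by (induction A rule: infinite_finite_induct) auto

lemma \<kappa>_0 [simp]: "\<kappa> 0 = 0"
  using \<kappa>_add[of 0 0] by simp

lemma l_distr': "a \<in> carrier S \<Longrightarrow> b \<in> carrier S \<Longrightarrow> c \<in> carrier S \<Longrightarrow> (a + b) \<otimes> c = a \<otimes> c + b \<otimes> c"
  using l_distr by simp

lemma r_distr': "a \<in> carrier S \<Longrightarrow> b \<in> carrier S \<Longrightarrow> c \<in> carrier S \<Longrightarrow> c \<otimes> (a + b) = c \<otimes> a + c \<otimes> b"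
  using r_distr by simp

lemma null' [simp]: "a \<in> carrier S \<Longrightarrow> 0 \<otimes> a = 0" "a \<in> carrier S \<Longrightarrow> a \<otimes> 0 = 0"
  using l_null[of a] r_null[of a] by simp_all

abbreviation ev where "ev \<equiv> weyl_eval S \<kappa> x y"

definition tm where "tm c i k = \<kappa> c \<otimes> (x [^] (i::nat)) \<otimes> (y [^] (k::nat))"

lemma tm_closed [simp]: "tm c i k \<in> carrier S"
  by (simp add: tm_def)

lemma tm_0 [simp]: "tm 0 i k = 0"
  by (simp add: tm_def)

lemma tm_add: "tm (c + c') i k = tm c i k + tm c' i k"
  by (simp add: tm_def \<kappa>_add l_distr')

text \<open>A rectangle of indices common to several elements replaces the degree-dependent ranges
  in \<open>weyl_eval\<close>, which makes additivity visible.\<close>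

lemma ev_sum:
  assumes "degree P \<le> N" "\<And>k. degree (coeff P k) \<le> M"
  shows "ev P = (\<Sum>k\<le>N. \<Sum>i\<le>M. tm (coeff (coeff P k) i) i k)"
proof -
  have fin: "finsum S f I = sum f I" if "\<And>i. i \<in> I \<Longrightarrow> f i \<in> carrier S" for f :: "nat \<Rightarrow> 's" and I
    by (rule finsum_eq_sum) (use that abelian_monoid_axioms in \<open>auto simp: fun_eq_iff\<close>)
  have "ev P = (\<Sum>k\<le>degree P. \<Sum>i\<le>degree (coeff P k). tm (coeff (coeff P k) i) i k)"
    unfolding weyl_eval_def tm_def[symmetric] by (simp add: fin sum_closed)
  also have "\<dots> = (\<Sum>k\<le>degree P. \<Sum>i\<le>M. tm (coeff (coeff P k) i) i k)"
    by (intro sum.cong refl sum.mono_neutral_left) (auto simp: assms(2) coeff_eq_0)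
  also have "\<dots> = (\<Sum>k\<le>N. \<Sum>i\<le>M. tm (coeff (coeff P k) i) i k)"
    by (intro sum.mono_neutral_left) (auto simp: assms(1) coeff_eq_0)
  finally show ?thesis .
qed

lemma coeff_degree_bound: "\<exists>M. \<forall>k. degree (coeff P k) \<le> M"
proof (intro exI allI)
  fix k show "degree (coeff P k) \<le> (\<Sum>k\<le>degree P. degree (coeff P k))"
    by (cases "k \<le> degree P") (auto intro: member_le_sum simp: coeff_eq_0)
qed

lemma ev_add: "ev (P + Q) = ev P + ev Q"
proof -
  obtain M1 M2 where "\<And>k. degree (coeff P k) \<le> M1" "\<And>k. degree (coeff Q k) \<le> M2"
    using coeff_degree_bound by metis
  hence M: "\<And>k. degree (coeff P k) \<le> max M1 M2" "\<And>k. degree (coeff Q k) \<le> max M1 M2"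
    by (meson max.coboundedI1 max.coboundedI2)+
  let ?N = "max (degree P) (degree Q)"
  have "degree (P + Q) \<le> ?N" "\<And>k. degree (coeff (P + Q) k) \<le> max M1 M2"
    using degree_add_le M by (auto intro: degree_add_le)
  from ev_sum[OF this] show ?thesis
    using ev_sum[of P ?N, OF _ M(1)] ev_sum[of Q ?N, OF _ M(2)]
    by (simp add: tm_add sum.distrib)
qed

lemma ev_closed [simp]: "ev P \<in> carrier S"
proof -
  obtain M where "\<And>k. degree (coeff P k) \<le> M" using coeff_degree_bound by metis
  from ev_sum[OF order_refl this] show ?thesis by (simp add: sum_closed)
qed

lemma ev_monom: "ev (monom (monom c i) k) = tm c i k"
proof -
  have "ev (monom (monom c i) k) =
      (\<Sum>k'\<le>k. \<Sum>i'\<le>i. tm (coeff (coeff (monom (monom c i) k) k') i') i' k')"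
    by (rule ev_sum) (auto simp: degree_monom_le coeff_monom)
  also have "\<dots> = (\<Sum>k'\<le>k. \<Sum>i'\<le>i. if k' = k then if i' = i then tm c i k else 0 else 0)"
    by (intro sum.cong refl) auto
  also have "\<dots> = (\<Sum>k'\<le>k. if k' = k then tm c i k else 0)"
    by (intro sum.cong refl) auto
  finally show ?thesis by simp
qed

lemma ev_0 [simp]: "ev 0 = 0"
  using ev_monom[of 0 0 0] by simp

lemma ev_const: "ev [:[:c:]:] = \<kappa> c"
  using ev_monom[of c 0 0] by (simp add: monom_0 tm_def)

lemma ev_1 [simp]: "ev 1 = \<one>"
  using ev_const[of 1] by (simp add: one_pCons)

lemma ev_var: "ev weyl_var = x"
  using ev_monom[of 1 1 0] by (simp add: monom_0 monom_Suc tm_def weyl_var_def one_pCons)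

lemma ev_d: "ev weyl_d = y"
  using ev_monom[of 1 0 1] by (simp add: monom_0 monom_Suc tm_def weyl_d_def one_pCons)

lemma y_pow_x: "y \<otimes> x [^] i = x [^] i \<otimes> y + \<kappa> (of_nat i) \<otimes> x [^] (i - 1)"
proof (induction i)
  case (Suc i)
  have "y \<otimes> x [^] Suc i = (y \<otimes> x [^] i) \<otimes> x" by (simp add: m_assoc)
  also have "\<dots> = x [^] i \<otimes> (y \<otimes> x) + \<kappa> (of_nat i) \<otimes> x [^] (i - 1) \<otimes> x"
    by (simp add: Suc.IH l_distr' m_assoc)
  also have "\<kappa> (of_nat i) \<otimes> x [^] (i - 1) \<otimes> x = \<kappa> (of_nat i) \<otimes> x [^] i"
    by (cases i) (simp_all add: m_assoc)
  also have "x [^] i \<otimes> (y \<otimes> x) = x [^] Suc i \<otimes> y + x [^] i"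
    by (simp add: commutator r_distr' m_assoc)
  finally show ?case by (simp add: \<kappa>_add l_distr' add_ac)
qed simp

text \<open>The left factor is reduced to generators, the right one to monomials. Only for the
  derivation must x and y be exchanged: moving y past x^i leaves i x^(i-1), as the Leibniz rule in
  \<open>weyl_mult\<close> demands.\<close>

lemma ev_mult: "ev (weyl_mult F G) = ev F \<otimes> ev G"
proof (induction F arbitrary: G rule: weyl_generated)
  case (const c)
  show ?case
  proof (induction G rule: weyl_induct)
    case (monom c' i k)
    show ?case by (simp add: weyl_mult_const_left smult_monom ev_monom ev_const tm_def \<kappa>_mult m_assoc)
  qed (simp add: weyl_mult_distrib_left ev_add r_distr')
next
  case var
  show ?case
  proof (induction G rule: weyl_induct)
    case (monom c i k)
    have "weyl_mult weyl_var (monom (monom c i) k) = monom (monom c (Suc i)) k"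
      by (simp add: weyl_var_def weyl_mult_const_left smult_monom monom_Suc)
    moreover have "x \<otimes> (\<kappa> c \<otimes> x [^] i) = \<kappa> c \<otimes> x [^] Suc i"
      using \<kappa>_central[of x c] nat_pow_Suc2[of x i] by (simp only: m_assoc[symmetric] x_closed \<kappa>_closed nat_pow_closed)
    ultimately show ?case
      by (simp add: ev_monom ev_var tm_def m_assoc[symmetric])
  qed (simp add: weyl_mult_distrib_left ev_add r_distr')
next
  case d
  show ?case
  proof (induction G rule: weyl_induct)
    case (monom c i k)
    have "weyl_mult weyl_d (monom (monom c i) k) = monom (monom c i) (Suc k) + monom (monom (of_nat i * c) (i - 1)) k"
      by (simp add: weyl_mult_d monom_Suc map_poly_monom pderiv_monom)
    hence "ev (weyl_mult weyl_d (monom (monom c i) k)) = tm c i (Suc k) + tm (of_nat i * c) (i - 1) k"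
      by (simp add: ev_add ev_monom)
    moreover have "y \<otimes> tm c i k = tm c i (Suc k) + tm (of_nat i * c) (i - 1) k"
    proof -
      have "y \<otimes> tm c i k = \<kappa> c \<otimes> (y \<otimes> x [^] i) \<otimes> y [^] k"
        using \<kappa>_central[of y c] unfolding tm_def by (simp add: m_assoc[symmetric])
      also have "\<dots> = \<kappa> c \<otimes> (x [^] i \<otimes> (y \<otimes> y [^] k)) + \<kappa> c \<otimes> (\<kappa> (of_nat i) \<otimes> x [^] (i - 1)) \<otimes> y [^] k"
        unfolding y_pow_x by (simp add: r_distr' l_distr' m_assoc)
      also have "y \<otimes> y [^] k = y [^] Suc k" by (rule nat_pow_Suc2[symmetric]) simp
      also have "\<kappa> c \<otimes> (\<kappa> (of_nat i) \<otimes> x [^] (i - 1)) = \<kappa> (of_nat i * c) \<otimes> x [^] (i - 1)"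
        unfolding mult.commute[of "of_nat i" c] \<kappa>_mult by (simp add: m_assoc)
      finally show ?thesis unfolding tm_def by (simp add: m_assoc)
    qed
    ultimately show ?case by (simp add: ev_d ev_monom)
  qed (simp add: weyl_mult_distrib_left ev_add r_distr')
qed (simp_all add: weyl_mult_distrib_right ev_add l_distr' weyl_mult_assoc m_assoc)

lemma ev_unique:
  assumes add: "\<And>F G. h (F + G) = h F + h G" and mult: "\<And>F G. h (weyl_mult F G) = h F \<otimes> h G"
    and "\<And>c. h [:[:c:]:] = \<kappa> c" "h weyl_var = x" "h weyl_d = y"
  shows "h F = ev F"
  by (induction F rule: weyl_generated)
     (simp_all add: assms ev_const ev_var ev_d ev_add ev_mult)

end

section \<open>Division in the ring of symbols\<close>

lemma symb_mult_t: "symb_mult F symb_t = symb_t * F + symb_d_eta F"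
proof -
  have d1: "symb_d_t symb_t = (1 :: 'a fps fls)"
    by (rule fls_eqI) (simp add: nth_symb_d_t symb_t_def)
  have d2: "symb_d_t 1 = (0 :: 'a fps fls)" "symb_d_t 0 = (0 :: 'a fps fls)"
    by (rule fls_eqI, simp add: nth_symb_d_t)+
  have "(symb_d_t ^^ \<alpha>) symb_t = (0 :: 'a fps fls)" if a: "1 < \<alpha>" for \<alpha>
  proof -
    obtain m where m: "\<alpha> = Suc (Suc m)" using a by (auto dest: less_imp_Suc_add)
    have "(symb_d_t ^^ k) 0 = (0 :: 'a fps fls)" for k by (induction k) (auto simp: d2)
    thus ?thesis unfolding m funpow_Suc_right comp_def d1 d2 .
  qed
  hence "symb_mult F symb_t = (\<Sum>\<alpha>\<le>1. symb_const (1 / fact \<alpha>) * (symb_d_eta ^^ \<alpha>) F * (symb_d_t ^^ \<alpha>) symb_t)"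
    by (intro symb_mult_finite) simp
  thus ?thesis by (simp add: d1 symb_const_def mult.commute)
qed

definition t_degree_less :: "nat \<Rightarrow> 'k::zero fps fls \<Rightarrow> bool" where
  "t_degree_less \<delta> R \<longleftrightarrow> (\<forall>n. \<forall>i\<ge>\<delta>. fps_nth (fls_nth R n) i = 0)"

lemma t_degree_lessD: "t_degree_less \<delta> R \<Longrightarrow> \<delta> \<le> i \<Longrightarrow> fps_nth (fls_nth R n) i = 0"
  by (simp add: t_degree_less_def)

definition fls_of_seq :: "int \<Rightarrow> (nat \<Rightarrow> 'a::zero) \<Rightarrow> 'a fls" where
  "fls_of_seq B q = fls_shift (- B) (fps_to_fls (Abs_fps q))"

lemma nth_fls_of_seq [simp]: "fls_nth (fls_of_seq B q) (B + int n) = q n"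
  by (simp add: fls_of_seq_def)

lemma vanishes_fls_of_seq: "vanishes_below B (fls_of_seq B q)"
  by (simp add: fls_of_seq_def vanishes_below_def)

lemma wf_recursion_exists:
  fixes H :: "(nat \<Rightarrow> 'a) \<Rightarrow> nat \<Rightarrow> 'a"
  assumes "\<And>f g n. (\<And>m. m < n \<Longrightarrow> f m = g m) \<Longrightarrow> H f n = H g n"
  shows "\<exists>f. \<forall>n. f n = H f n"
proof -
  have "adm_wf less_than H"
    unfolding adm_wf_def by (intro allI impI assms) simp
  from wfrec_fixpoint[OF wf_less_than this] have "wfrec less_than H n = H (wfrec less_than H) n" for n
    by (rule fun_cong)
  thus ?thesis by blast
qed

lemma fps_cutoff_plus_shift: "fps_cutoff n f + fps_X ^ n * fps_shift n f = (f :: 'a::comm_ring_1 fps)"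
  by (rule fps_ext) (auto simp: fps_X_power_mult_nth)

text \<open>The part of a coefficient of \<open>Q \<star> P\<close> that involves only earlier coefficients of \<open>Q\<close>.\<close>

definition conv_rest :: "int \<Rightarrow> (nat \<Rightarrow> 'k::field_char_0 fps) \<Rightarrow> (nat \<Rightarrow> 'k fps) \<Rightarrow> nat \<Rightarrow> 'k fps" where
  "conv_rest B q a n = (\<Sum>(\<alpha>, i, j)\<in>{(\<alpha>, i, j). \<alpha> + i + j = n \<and> i < n}.
     fps_const (of_int (- (B + int i)) gchoose \<alpha>) * q i * (fps_deriv ^^ \<alpha>) (a j))"

text \<open>Among the triples with sum n only (0, n, 0) has i = n. This isolates the one unknown of
  the recursion for a quotient.\<close>

lemma symb_conv_rest: "symb_conv B q a n = q n * a 0 + conv_rest B q a n"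
proof -
  have e: "{(\<alpha>, i, j). \<alpha> + i + j = n} = insert (0, n, 0) {(\<alpha>, i, j). \<alpha> + i + j = n \<and> i < n}"
  proof (rule Set.set_eqI)
    fix x :: "nat \<times> nat \<times> nat"
    obtain \<alpha> i j where x: "x = (\<alpha>, i, j)" by (cases x) auto
    have "\<alpha> + i + j = n \<longleftrightarrow> \<alpha> = 0 \<and> i = n \<and> j = 0 \<or> \<alpha> + i + j = n \<and> i < n" by arith
    thus "x \<in> {(\<alpha>, i, j). \<alpha> + i + j = n} \<longleftrightarrow> x \<in> insert (0, n, 0) {(\<alpha>, i, j). \<alpha> + i + j = n \<and> i < n}"
      by (simp add: x)
  qed
  have fin: "finite {(\<alpha>, i, j). \<alpha> + i + j = n \<and> i < n}" by (rule finite_subset[OF _ finite_triples[of n]]) auto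
  have ni: "(0, n, 0) \<notin> {(\<alpha>, i, j). \<alpha> + i + j = n \<and> i < n}" by simp
  show ?thesis unfolding symb_conv_triples conv_rest_def e sum.insert[OF fin ni] by simp
qed

lemma conv_rest_cong: "(\<And>i. i < n \<Longrightarrow> q i = q' i) \<Longrightarrow> conv_rest B q a n = conv_rest B q' a n"
  unfolding conv_rest_def by (intro sum.cong) auto

text \<open>As \<alpha> + i + j = n, the conditions \<rho> \<le> w and \<rho> \<le> l turn the
  losses w^(-j) and l^(-\<alpha>) into powers of 1/\<rho>, and the E in the bound on
  \<open>a\<close> cancels the 1/E in that on \<open>q\<close>. The result has the bound expected of
  a dividend, so the bound reproduces itself in the recursion.\<close>

lemma disc_bounded_conv_rest:
  assumes "0 < \<rho>" "\<rho> \<le> w" "\<rho> \<le> l" "0 \<le> C" "0 < E"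
    and q: "\<And>i. i < n \<Longrightarrow> disc_bounded l (C / E / \<rho> ^ i) (q i)"
    and a: "\<And>j. disc_bounded l (E / w ^ j) (a j)"
  shows "disc_bounded l (C / \<rho> ^ n) (conv_rest B q a n)"
  unfolding conv_rest_def
proof (rule disc_bounded_sum, goal_cases)
  case (3 x)
  then obtain \<alpha> i j where x: "x = (\<alpha>, i, j)" "\<alpha> + i + j = n" "i < n" by auto
  have l: "0 < l" using assms by simp
  have "disc_bounded l ((1 * (C / E / \<rho> ^ i)) * (E / w ^ j / l ^ \<alpha>))
      (fps_const (of_int (- (B + int i)) gchoose \<alpha>) * q i * (fps_deriv ^^ \<alpha>) (a j))"
    using l av_gbinomial_le_1 q[OF x(3)] a
    by (intro disc_bounded_mult disc_bounded_deriv_iter) (auto simp only: disc_bounded_const less_imp_le)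
  also have "(1 * (C / E / \<rho> ^ i)) * (E / w ^ j / l ^ \<alpha>) = C * (1 / \<rho> ^ i * (1 / w ^ j) * (1 / l ^ \<alpha>))"
    using assms(5) by simp
  finally show ?case
    unfolding x prod.case
  proof (rule disc_bounded_mono)
    have "1 / \<rho> ^ i * (1 / w ^ j) * (1 / l ^ \<alpha>) \<le> 1 / \<rho> ^ i * (1 / \<rho> ^ j) * (1 / \<rho> ^ \<alpha>)"
      using assms(1-3) by (intro mult_mono frac_le power_mono) auto
    also have "\<dots> = 1 / \<rho> ^ n" by (simp add: power_add ac_simps flip: x(2))
    finally have "C * (1 / \<rho> ^ i * (1 / w ^ j) * (1 / l ^ \<alpha>)) \<le> C * (1 / \<rho> ^ n)"
      using assms(4) by (rule mult_left_mono)
    thus "C * (1 / \<rho> ^ i * (1 / w ^ j) * (1 / l ^ \<alpha>)) \<le> C / \<rho> ^ n" by simp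
  qed
qed (use assms in auto)

lemma symb_bounded_seqI:
  assumes "0 < \<rho>" "vanishes_below B F" "0 \<le> K" "\<And>n. disc_bounded l (K / \<rho> ^ n) (fls_nth F (B + int n))"
  shows "symb_bounded l \<rho> (K * \<rho> powi B) F"
  unfolding symb_bounded_def
proof
  fix m
  show "disc_bounded l (K * \<rho> powi B * \<rho> powi - m) (fls_nth F m)"
  proof (cases "m < B")
    case True
    thus ?thesis using vanishes_belowD[OF assms(2) True] assms(1,3) by simp
  next
    case False
    then obtain n where m: "m = B + int n" using zle_iff_zadd[of B m] by auto
    have "K * \<rho> powi B * \<rho> powi - m = K / \<rho> ^ n"
      using assms(1) unfolding m by (simp add: power_int_add power_int_minus power_int_diff field_simps)
    thus ?thesis using assms(4)[of n] m by simp
  qed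
qed

text \<open>By \<open>bound\<close> the leading term c t^\<delta> \<eta>^d dominates P on |t| = l
  for every weight \<rho> < \<omega> of 1/\<eta>: the factor 1/\<omega>^j is outweighed by \<rho>^j.
  The hypothesis itself is independent of \<rho>.\<close>

locale symbol_division =
  fixes p d \<delta> :: nat and c :: "'k::nonarch_field" and P :: "'k fps fls"
  assumes om: "0 < omega p" "omega p < 1"
    and van: "vanishes_below (- int d) P"
    and top: "fls_nth P (- int d) = fps_const c * fps_X ^ \<delta>" and c0: "c \<noteq> 0"
    and bound: "\<And>l j. omega p < l \<Longrightarrow> l < 1 \<Longrightarrow>
      disc_bounded l (av c * l ^ \<delta> / omega p ^ j) (fls_nth P (- int d + int j))"
begin

lemma nth_mult_P:
  assumes "vanishes_below B Q"
  shows "fls_nth (symb_mult Q P) (B - int d + int n) = fls_nth Q (B + int n) * (fps_const c * fps_X ^ \<delta>) +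
      conv_rest B (\<lambda>i. fls_nth Q (B + int i)) (\<lambda>j. fls_nth P (- int d + int j)) n"
proof -
  have "B - int d + int n = B + - int d + int n" by simp
  thus ?thesis
    by (simp only: nth_symb_mult(1)[OF assms van] symb_conv_rest of_nat_0 add_0_right top)
qed

text \<open>Quotient and remainder are computed one power of 1/\<eta> at a time:
  \<open>conv_rest\<close> removes what earlier quotient coefficients contribute, and the difference
  is split at t^\<delta>. The inductive bound survives both operations, so the formal solution
  converges for all admissible radii.\<close>

theorem division:
  assumes "F \<in> carrier (Phi p)"
  shows "\<exists>Q\<in>carrier (Phi p). \<exists>R\<in>carrier (Phi p). F = symb_mult Q P + R \<and> t_degree_less \<delta> R"
proof -
  obtain B0 where B0: "vanishes_below B0 F" using vanishes_below_ex by blast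
  \<comment> \<open>Multiplication by P lowers the index by d, so the quotient starts d places after
    F.\<close>
  define B where "B = B0 + int d"
  define f where "f = (\<lambda>n. fls_nth F (B - int d + int n))"
  define a where "a = (\<lambda>j. fls_nth P (- int d + int j))"
  have vF: "vanishes_below (B - int d) F" using B0 by (simp add: B_def)
  obtain q where q: "\<And>n. q n = fps_const (1 / c) * fps_shift \<delta> (f n - conv_rest B q a n)"
    using wf_recursion_exists[of "\<lambda>q n. fps_const (1 / c) * fps_shift \<delta> (f n - conv_rest B q a n)"]
      conv_rest_cong by metis
  define r where "r = (\<lambda>n. fps_cutoff \<delta> (f n - conv_rest B q a n))"
  have fn: "f n = q n * (fps_const c * fps_X ^ \<delta>) + conv_rest B q a n + r n" for n
  proof -
    have "q n * (fps_const c * fps_X ^ \<delta>) =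
        (fps_const (1 / c) * fps_shift \<delta> (f n - conv_rest B q a n)) * (fps_const c * fps_X ^ \<delta>)"
      using q[of n] by (rule arg_cong)
    also have "\<dots> = (fps_const (1 / c) * fps_const c) * (fps_X ^ \<delta> * fps_shift \<delta> (f n - conv_rest B q a n))"
      by (simp only: ac_simps)
    also have "fps_const (1 / c) * fps_const c = 1" using c0 by simp
    finally have "q n * (fps_const c * fps_X ^ \<delta>) = fps_X ^ \<delta> * fps_shift \<delta> (f n - conv_rest B q a n)" by simp
    hence "q n * (fps_const c * fps_X ^ \<delta>) + r n = f n - conv_rest B q a n"
      using fps_cutoff_plus_shift[of \<delta> "f n - conv_rest B q a n"] by (simp only: r_def add.commute)
    thus ?thesis by (simp add: algebra_simps)
  qed
  define Q where "Q = fls_of_seq B q"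
  define R where "R = fls_of_seq (B - int d) r"
  have vQ: "vanishes_below B Q" and vR: "vanishes_below (B - int d) R"
    by (simp_all add: Q_def R_def vanishes_fls_of_seq)
  have Qn: "fls_nth Q (B + int n) = q n" and Rn: "fls_nth R (B - int d + int n) = r n" for n
    by (simp_all add: Q_def R_def)
  have eq: "F = symb_mult Q P + R"
  proof (rule vanishes_below_eqI[OF vF])
    show "vanishes_below (B - int d) (symb_mult Q P + R)"
      using nth_symb_mult(2)[OF vQ van] vR by (simp add: vanishes_below_add)
    show "fls_nth F (B - int d + int n) = fls_nth (symb_mult Q P + R) (B - int d + int n)" for n
      unfolding fls_plus_nth nth_mult_P[OF vQ] Qn Rn using fn[of n] by (simp add: f_def a_def)
  qed
  have td: "t_degree_less \<delta> R"
    unfolding t_degree_less_def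
  proof (intro allI impI)
    fix n i assume "\<delta> \<le> i"
    show "fps_nth (fls_nth R n) i = 0"
    proof (cases "n < B - int d")
      case False
      then obtain m where "n = B - int d + int m" using zle_iff_zadd[of "B - int d" n] by auto
      thus ?thesis using Rn[of m] \<open>\<delta> \<le> i\<close> by (simp add: r_def)
    qed (use vR in \<open>simp add: vanishes_below_def\<close>)
  qed
  \<comment> \<open>The recursion does not involve the radii, so the same \<open>q\<close> and
    \<open>r\<close> are estimated for every pair. One K serves all n because the bound passes
    through \<open>conv_rest\<close> unchanged.\<close>
  have bd: "\<exists>K\<ge>0. (\<forall>n. disc_bounded l (K / (av c * l ^ \<delta>) / \<rho> ^ n) (q n)) \<and> (\<forall>n. disc_bounded l (K / \<rho> ^ n) (r n))"
    if l: "omega p < l" "l < 1" "0 < \<rho>" "\<rho> < omega p * l" for l \<rho>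
  proof -
    have l0: "0 < l" using l om by linarith
    have \<rho>l: "\<rho> \<le> l" using omega_mult_less[OF om l(1,4)] by simp
    have "omega p * l < omega p * 1" using om l by (intro mult_strict_left_mono) auto
    hence \<rho>w: "\<rho> \<le> omega p" using l by simp
    obtain C where C: "symb_bounded l \<rho> C F" using assms l l0 Phi_carrier_iff[OF om(1)] by blast
    define K where "K = C * \<rho> powi (int d - B)"
    have K0: "0 \<le> K" using symb_bounded_nonneg[OF l(3) C] l(3) by (simp add: K_def)
    have f: "disc_bounded l (K / \<rho> ^ n) (f n)" for n
    proof -
      have "C * \<rho> powi - (B - int d + int n) = K / \<rho> ^ n"
        using l(3) by (simp add: K_def power_int_add power_int_minus power_int_diff field_simps)
      thus ?thesis using C unfolding symb_bounded_def f_def by metis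
    qed
    define E where "E = av c * l ^ \<delta>"
    have E: "0 < E" using c0 l0 by (simp add: E_def)
    have a: "disc_bounded l (E / omega p ^ j) (a j)" for j
      using bound[OF l(1,2)] by (simp add: E_def a_def)
    have "disc_bounded l (K / E / \<rho> ^ n) (q n) \<and> disc_bounded l (K / \<rho> ^ n) (f n - conv_rest B q a n)" for n
    proof (induction n rule: less_induct)
      case (less n)
      have e: "disc_bounded l (K / \<rho> ^ n) (f n - conv_rest B q a n)"
        using less.IH l0 by (intro disc_bounded_diff f disc_bounded_conv_rest[OF l(3) \<rho>w \<rho>l K0 E _ a]) auto
      moreover have "disc_bounded l (K / E / \<rho> ^ n) (q n)"
        unfolding disc_bounded_def
      proof
        \<comment> \<open>Dividing by c t^\<delta> shifts the index by \<delta> and divides the norm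
          by exactly E = |c| l^\<delta>.\<close>
        fix i
        have "av (fps_nth (q n) i) * l ^ i = av (fps_nth (f n - conv_rest B q a n) (i + \<delta>)) * l ^ (i + \<delta>) / E"
          using l0 c0 by (subst q) (simp add: av_mult av_divide E_def power_add field_simps)
        also have "\<dots> \<le> K / \<rho> ^ n / E"
          using disc_boundedD[OF e] E by (intro divide_right_mono) auto
        finally show "av (fps_nth (q n) i) * l ^ i \<le> K / E / \<rho> ^ n" by (simp add: field_simps)
      qed
      ultimately show ?case by simp
    qed
    moreover have "disc_bounded l (K / \<rho> ^ n) (r n)" if "disc_bounded l (K / \<rho> ^ n) (f n - conv_rest B q a n)" for n
      using that K0 l(3) by (auto simp: r_def disc_bounded_def)
    ultimately show ?thesis using K0 by (auto simp: E_def)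
  qed
  have "Q \<in> carrier (Phi p)"
  proof (rule Phi_memI[OF om])
    fix l \<rho> assume l: "omega p < l" "l < 1" "0 < \<rho>" "\<rho> < omega p * l"
    obtain K where K: "K \<ge> 0" "\<And>n. disc_bounded l (K / (av c * l ^ \<delta>) / \<rho> ^ n) (q n)" using bd[OF l] by blast
    have "0 \<le> K / (av c * l ^ \<delta>)" using K l om by simp
    from symb_bounded_seqI[OF l(3) vQ this, of l] K(2) show "\<exists>C. symb_bounded l \<rho> C Q" by (auto simp: Qn)
  qed
  moreover have "R \<in> carrier (Phi p)"
  proof (rule Phi_memI[OF om])
    fix l \<rho> assume l: "omega p < l" "l < 1" "0 < \<rho>" "\<rho> < omega p * l"
    obtain K where K: "K \<ge> 0" "\<And>n. disc_bounded l (K / \<rho> ^ n) (r n)" using bd[OF l] by blast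
    from symb_bounded_seqI[OF l(3) vR K(1), of l] K(2) show "\<exists>C. symb_bounded l \<rho> C R" by (auto simp: Rn)
  qed
  ultimately show ?thesis using eq td by blast
qed

text \<open>At the first possibly nonzero coefficient of Q the equation equates a multiple of
  t^\<delta> with a polynomial of degree below \<delta>, so both vanish. The argument is formal,
  hence uniqueness holds against arbitrary formal quotients.\<close>

theorem division_unique:
  assumes eq: "symb_mult Q P + R = 0" and td: "t_degree_less \<delta> R"
  shows "R = 0"
proof -
  obtain B1 B2 where v: "vanishes_below B1 Q" "vanishes_below B2 R" using vanishes_below_ex by metis
  define B where "B = min B1 (B2 + int d)"
  have vQ: "vanishes_below B Q" by (rule vanishes_below_mono[OF v(1)]) (simp add: B_def)
  have vR: "vanishes_below (B - int d) R" by (rule vanishes_below_mono[OF v(2)]) (simp add: B_def)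
  have q: "fls_nth Q (B + int n) = 0" for n
  proof (induction n rule: less_induct)
    case (less n)
    let ?q = "\<lambda>i. fls_nth Q (B + int i)"
    have "conv_rest B ?q (\<lambda>j. fls_nth P (- int d + int j)) n = conv_rest B (\<lambda>i. 0) (\<lambda>j. fls_nth P (- int d + int j)) n"
      by (rule conv_rest_cong) (use less.IH in simp)
    also have "\<dots> = 0" by (simp add: conv_rest_def)
    finally have "?q n * (fps_const c * fps_X ^ \<delta>) + fls_nth R (B - int d + int n) = 0"
      using arg_cong[OF eq, of "\<lambda>F. fls_nth F (B - int d + int n)"] nth_mult_P[OF vQ, of n] by simp
    hence "fps_nth (fps_X ^ \<delta> * (fps_const c * ?q n)) (i + \<delta>) + fps_nth (fls_nth R (B - int d + int n)) (i + \<delta>) = 0" for i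
      by (metis (no_types, lifting) fps_add_nth fps_zero_nth mult.commute mult.assoc)
    moreover have "fps_nth (fls_nth R (B - int d + int n)) (i + \<delta>) = 0" for i
      using td by (simp add: t_degree_less_def)
    ultimately have "c * fps_nth (?q n) i = 0" for i by (simp add: fps_X_power_mult_nth)
    thus ?case using c0 by (intro fps_ext) simp
  qed
  have "Q = 0" by (rule vanishes_below_eqI[OF vQ]) (auto simp: vanishes_below_def q)
  moreover have "symb_mult 0 P = 0" using symb_mult_distrib_right[of 0 0 P] by simp
  ultimately show ?thesis using eq by simp
qed

end

subsection \<open>Polynomials in \<open>t\<close> with coefficients in \<open>\<A>(\<omega>)[\<eta>]\<close>\<close>

text \<open>Moving t^i from the right of an element of \<open>A_eta\<close> to its left adds only
  lower powers of t, by \<open>symb_mult_t\<close>. The passage between the two normal forms is thus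
  unitriangular.\<close>

lemma t_power_mult_A:
  "t_degree_less (Suc i) (symb_mult (A_to_Phi r) (fls_const (fps_X ^ i)))"
  "fps_nth (fls_nth (symb_mult (A_to_Phi r) (fls_const (fps_X ^ i))) n) i = fls_nth r n"
proof (induction i arbitrary: n)
  case 0
  {
    case 1
    show ?case using symb_mult_1_right[of "A_to_Phi r"] by (simp add: t_degree_less_def)
  next
    case 2
    show ?case using symb_mult_1_right[of "A_to_Phi r"] by simp
  }
next
  case (Suc i)
  let ?G = "symb_mult (A_to_Phi r) (fls_const (fps_X ^ i))"
  have "symb_mult (fls_const (fps_X ^ i)) symb_t = fls_const (fps_X ^ Suc i :: 'a fps)"
    by (simp add: symb_mult_fls_const symb_t_def mult.commute)
  hence e: "symb_mult (A_to_Phi r) (fls_const (fps_X ^ Suc i)) = symb_t * ?G + symb_d_eta ?G"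
    by (metis symb_mult_assoc symb_mult_t)
  {
    case 1
    show ?case unfolding e t_degree_less_def
    proof (intro allI impI)
      fix n j assume j: "Suc (Suc i) \<le> j"
      then obtain k where k: "j = Suc k" "Suc i \<le> k" by (cases j) auto
      have z: "fps_nth (fls_nth ?G m) j' = 0" if "Suc i \<le> j'" for m j'
        using Suc.IH(1) that by (simp add: t_degree_less_def)
      show "fps_nth (fls_nth (symb_t * ?G + symb_d_eta ?G) n) j = 0"
        using z[of k n] z[of j "n - 1"] k
        by (simp add: symb_t_def nth_symb_d_eta fps_of_int[symmetric])
    qed
  next
    case 2
    have "fps_nth (fls_nth ?G m) (Suc i) = 0" for m using Suc.IH(1) by (simp add: t_degree_less_def)
    thus ?case unfolding e using Suc.IH(2)[of n]
      by (simp add: symb_t_def nth_symb_d_eta fps_of_int[symmetric])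
  }
qed

lemma t_degree_less_add: "t_degree_less n F \<Longrightarrow> t_degree_less n G \<Longrightarrow> t_degree_less n (F + (G::'k::comm_ring_1 fps fls))"
  by (simp add: t_degree_less_def)

lemma t_degree_less_mono: "t_degree_less n F \<Longrightarrow> n \<le> m \<Longrightarrow> t_degree_less m F"
  by (simp add: t_degree_less_def)

lemma t_degree_less_sum_A:
  "t_degree_less \<delta> (\<Sum>i<\<delta>. symb_mult (A_to_Phi (r i)) (fls_const (fps_X ^ i)))"
proof (induction \<delta>)
  case (Suc \<delta>)
  show ?case unfolding sum.lessThan_Suc
    by (intro t_degree_less_add t_power_mult_A(1) t_degree_less_mono[OF Suc.IH]) simp
qed (simp add: t_degree_less_def)

lemma t_poly_unique:
  assumes "(\<Sum>i<\<delta>. symb_mult (A_to_Phi (r i)) (fls_const (fps_X ^ i))) = (0 :: 'k::field_char_0 fps fls)" "i < \<delta>"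
  shows "r i = 0"
  using assms
proof (induction \<delta>)
  case (Suc \<delta>)
  let ?S = "(\<Sum>i<\<delta>. symb_mult (A_to_Phi (r i)) (fls_const (fps_X ^ i)))"
  have "fps_nth (fls_nth ?S n) \<delta> = 0" for n using t_degree_less_sum_A[of \<delta> r] by (simp add: t_degree_less_def)
  moreover have "fps_nth (fls_nth (?S + symb_mult (A_to_Phi (r \<delta>)) (fls_const (fps_X ^ \<delta>))) n) \<delta> = 0" for n
    using Suc.prems(1) by simp
  ultimately have "fls_nth (r \<delta>) n = 0" for n by (simp add: t_power_mult_A(2))
  hence z: "r \<delta> = 0" by (intro fls_eqI) simp
  have "symb_mult 0 (fls_const (fps_X ^ \<delta>)) = (0 :: 'k fps fls)"
    using symb_mult_distrib_right[of 0 0 "fls_const (fps_X ^ \<delta>) :: 'k fps fls"] by simp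
  with z Suc show ?case by (cases "i = \<delta>") auto
qed simp

text \<open>The coefficient of the highest power of t is peeled off. It lies in
  \<open>A_eta\<close>, since the coefficient of t^\<delta> in a series bounded by C on |t| = l is
  at most C / l^\<delta>.\<close>

lemma t_poly_exists:
  fixes R :: "'k::nonarch_field fps fls"
  assumes om: "0 < omega p" "omega p < 1" and "R \<in> carrier (Phi p)" "t_degree_less \<delta> R"
  shows "\<exists>r. (\<forall>i. r i \<in> carrier (A_eta p)) \<and> R = (\<Sum>i<\<delta>. symb_mult (A_to_Phi (r i)) (fls_const (fps_X ^ i)))"
  using assms(3,4)
proof (induction \<delta> arbitrary: R)
  case 0
  hence "R = 0" by (intro fls_eqI fps_ext) (simp add: t_degree_less_def)
  thus ?case using A_eta_0_1_closed(1)[OF om] by (intro exI[of _ "\<lambda>_. 0"]) simp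
next
  case (Suc \<delta>)
  define s where "s = Abs_fls (\<lambda>n. fps_nth (fls_nth R n) \<delta>)"
  have s: "fls_nth s n = fps_nth (fls_nth R n) \<delta>" for n
    unfolding s_def by (rule nth_Abs_fls_lower_bound[of "fls_subdegree R"]) simp
  have sA: "s \<in> carrier (A_eta p)"
    unfolding A_eta_mem[OF om]
  proof (rule Phi_memI[OF om])
    fix l \<rho> assume l: "omega p < l" "l < 1" "0 < \<rho>" "\<rho> < omega p * l"
    have l0: "0 < l" using l om by linarith
    obtain C where C: "symb_bounded l \<rho> C R" using Suc.prems(1) l l0 Phi_carrier_iff[OF om(1)] by blast
    have "symb_bounded l \<rho> (C / l ^ \<delta>) (A_to_Phi s)"
      unfolding symb_bounded_def fls_nth_A_to_Phi disc_bounded_const s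
    proof
      fix n
      have "av (fps_nth (fls_nth R n) \<delta>) * l ^ \<delta> \<le> C * \<rho> powi - n"
        using C by (simp add: symb_bounded_def disc_bounded_def)
      thus "av (fps_nth (fls_nth R n) \<delta>) \<le> C / l ^ \<delta> * \<rho> powi - n" using l0 by (simp add: field_simps)
    qed
    thus "\<exists>C. symb_bounded l \<rho> C (A_to_Phi s)" ..
  qed
  let ?T = "symb_mult (A_to_Phi s) (fls_const (fps_X ^ \<delta>))"
  have X: "fls_const (fps_X ^ \<delta> :: 'k fps) \<in> carrier (Phi p)"
  proof (rule Phi_poly_closed[OF om])
    show "\<exists>N. \<forall>i>N. fps_nth (fls_nth (fls_const (fps_X ^ \<delta> :: 'k fps)) m) i = 0" for m
      by (rule exI[of _ \<delta>]) auto
  qed (auto intro!: exI[of _ 0])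
  have T: "?T \<in> carrier (Phi p)" using sA X unfolding A_eta_mem[OF om] by (rule Phi_mult_closed[OF om])
  have "t_degree_less \<delta> (R - ?T)"
    unfolding t_degree_less_def
  proof (intro allI impI)
    fix n i assume "\<delta> \<le> i"
    show "fps_nth (fls_nth (R - ?T) n) i = 0"
    proof (cases "i = \<delta>")
      case True
      show ?thesis unfolding True fls_minus_nth fps_sub_nth t_power_mult_A(2) s by (rule diff_self)
    next
      case False
      hence "Suc \<delta> \<le> i" using \<open>\<delta> \<le> i\<close> by simp
      hence "fps_nth (fls_nth R n) i = 0" "fps_nth (fls_nth ?T n) i = 0"
        by (rule t_degree_lessD[OF Suc.prems(2)], rule t_degree_lessD[OF t_power_mult_A(1)])
      thus ?thesis by (simp only: fls_minus_nth fps_sub_nth diff_self)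
    qed
  qed
  moreover have "R - ?T \<in> carrier (Phi p)"
    using Phi_add_closed[OF om Suc.prems(1) Phi_uminus_closed[OF om T]] by simp
  ultimately obtain r where r: "\<And>i. r i \<in> carrier (A_eta p)"
    "R - ?T = (\<Sum>i<\<delta>. symb_mult (A_to_Phi (r i)) (fls_const (fps_X ^ i)))" using Suc.IH by blast
  have "R = (R - ?T) + ?T" by simp
  also have "\<dots> = (\<Sum>i<Suc \<delta>. symb_mult (A_to_Phi ((r(\<delta> := s)) i)) (fls_const (fps_X ^ i)))"
    unfolding r(2) by simp
  finally show ?case using r(1) sA by (intro exI[of _ "r(\<delta> := s)"]) auto
qed

text \<open>This is division of 1 by b with \<delta> = 0: a remainder of t-degree below 0 is zero,
  so the quotient is an inverse.\<close>

lemma A_eta_invertible: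
  fixes b :: "'k::nonarch_field fls"
  assumes om: "0 < omega p" "omega p < 1"
    and van: "vanishes_below (- int d) b" and b0: "fls_nth b (- int d) \<noteq> 0"
    and bound: "\<And>j. av (fls_nth b (- int d + int j)) \<le> av (fls_nth b (- int d)) / omega p ^ j"
  shows "\<exists>g\<in>carrier (A_eta p). g * b = 1"
proof -
  interpret symbol_division p d 0 "fls_nth b (- int d)" "A_to_Phi b"
  proof
    show "vanishes_below (- int d) (A_to_Phi b)" using van by (simp add: vanishes_below_def)
  qed (use om b0 bound in \<open>simp_all add: disc_bounded_const\<close>)
  obtain Q R where Q: "Q \<in> carrier (Phi p)" "1 = symb_mult Q (A_to_Phi b) + R" "t_degree_less 0 R"
    using division[OF Phi_0_1_closed(2)[OF om]] by blast
  have "R = 0" using Q(3) by (intro fls_eqI fps_ext) (simp add: t_degree_less_def)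
  hence Q1: "Q * A_to_Phi b = 1" using Q(2) by (simp add: symb_mult_A_to_Phi_right)
  have "b \<noteq> 0" using b0 by auto
  hence ib: "inverse b * b = 1" by simp
  hence i1: "A_to_Phi (inverse b) * A_to_Phi b = 1" by (simp flip: A_to_Phi_mult)
  \<comment> \<open>A priori Q may depend on t. Uniqueness of inverses identifies it with the formal
    inverse of b, which therefore converges.\<close>
  have "A_to_Phi (inverse b) = (Q * A_to_Phi b) * A_to_Phi (inverse b)" unfolding Q1 by simp
  also have "\<dots> = (A_to_Phi (inverse b) * A_to_Phi b) * Q" by (simp only: ac_simps)
  finally have "A_to_Phi (inverse b) = Q" unfolding i1 by simp
  hence "inverse b \<in> carrier (A_eta p)" using Q(1) by (simp add: A_eta_mem[OF om])
  thus ?thesis using ib by blast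
qed

section \<open>The cyclic module \<open>\<W>/\<W>P\<close>\<close>

definition cyc :: "'k::field_char_0 weyl \<Rightarrow> 'k weyl \<Rightarrow> 'k weyl set" where
  "cyc P F = left_ideal_of P +>\<^bsub>weyl\<^esub> F"

lemma cyc_altdef: "cyc P F = range (\<lambda>Q. weyl_mult Q P + F)"
  by (auto simp: cyc_def left_ideal_of_def a_r_coset_def r_coset_def)

lemma weyl_mult_diff_right: "weyl_mult (F - G) H = weyl_mult F H - weyl_mult G H"
  using weyl_mult_distrib_right[of "F - G" G H] by (simp add: algebra_simps)

lemma cyc_eq_iff: "cyc P F = cyc P G \<longleftrightarrow> (\<exists>Q. F - G = weyl_mult Q P)"
proof
  assume "cyc P F = cyc P G"
  moreover have "F \<in> cyc P F" unfolding cyc_altdef by (rule range_eqI[of _ _ 0]) simp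
  ultimately have "F \<in> range (\<lambda>Q. weyl_mult Q P + G)" by (simp add: cyc_altdef)
  thus "\<exists>Q. F - G = weyl_mult Q P" by auto
next
  assume "\<exists>Q. F - G = weyl_mult Q P"
  then obtain Q where Q: "F = weyl_mult Q P + G" by (metis diff_add_cancel)
  have "weyl_mult X P + F \<in> cyc P G" for X
    unfolding cyc_altdef by (rule range_eqI[of _ _ "X + Q"]) (simp add: Q weyl_mult_distrib_right)
  moreover have "weyl_mult X P + G \<in> cyc P F" for X
    unfolding cyc_altdef by (rule range_eqI[of _ _ "X - Q"]) (simp add: Q weyl_mult_diff_right)
  ultimately show "cyc P F = cyc P G" by (auto simp: cyc_altdef[of P F] cyc_altdef[of P G])
qed

lemma cyclic_carrier: "carrier (cyclic_module P) = range (cyc P)"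
  by (auto simp: cyclic_module_def A_RCOSETS_def RCOSETS_def cyc_def a_r_coset_def)

lemma cyclic_zero: "\<zero>\<^bsub>cyclic_module P\<^esub> = cyc P 0"
  by (auto simp: cyclic_module_def cyc_altdef left_ideal_of_def)

lemma cyclic_add: "cyc P F \<oplus>\<^bsub>cyclic_module P\<^esub> cyc P G = cyc P (F + G)"
proof -
  have "set_add weyl (cyc P F) (cyc P G) = cyc P (F + G)"
  proof (rule Set.set_eqI)
    fix x
    have "x \<in> set_add weyl (cyc P F) (cyc P G) \<longleftrightarrow> (\<exists>Q Q'. x = (weyl_mult Q P + F) + (weyl_mult Q' P + G))"
      by (auto simp: set_add_def set_mult_def cyc_altdef)
    also have "\<dots> \<longleftrightarrow> (\<exists>Q. x = weyl_mult Q P + (F + G))"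
    proof
      assume "\<exists>Q Q'. x = (weyl_mult Q P + F) + (weyl_mult Q' P + G)"
      then obtain Q Q' where "x = (weyl_mult Q P + F) + (weyl_mult Q' P + G)" by blast
      hence "x = weyl_mult (Q + Q') P + (F + G)" by (simp add: weyl_mult_distrib_right)
      thus "\<exists>Q. x = weyl_mult Q P + (F + G)" ..
    next
      assume "\<exists>Q. x = weyl_mult Q P + (F + G)"
      then obtain Q where "x = weyl_mult Q P + (F + G)" by blast
      hence "x = (weyl_mult Q P + F) + (weyl_mult 0 P + G)" by simp
      thus "\<exists>Q Q'. x = (weyl_mult Q P + F) + (weyl_mult Q' P + G)" by blast
    qed
    also have "\<dots> \<longleftrightarrow> x \<in> cyc P (F + G)" by (auto simp: cyc_altdef)
    finally show "x \<in> set_add weyl (cyc P F) (cyc P G) \<longleftrightarrow> x \<in> cyc P (F + G)" .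
  qed
  thus ?thesis by (simp add: cyclic_module_def)
qed

lemma cyclic_smult: "Q \<odot>\<^bsub>cyclic_module P\<^esub> cyc P F = cyc P (weyl_mult Q F)"
proof -
  have "cyc P (weyl_mult Q R) = cyc P (weyl_mult Q F)" if R: "R \<in> cyc P F" for R
  proof -
    obtain X where "R = weyl_mult X P + F" using R by (auto simp: cyc_altdef)
    hence "weyl_mult Q R - weyl_mult Q F = weyl_mult (weyl_mult Q X) P"
      by (simp add: weyl_mult_distrib_left weyl_mult_assoc)
    thus ?thesis unfolding cyc_eq_iff by blast
  qed
  hence "(\<Union>R\<in>cyc P F. cyc P (weyl_mult Q R)) = (\<Union>R\<in>cyc P F. cyc P (weyl_mult Q F))"
    by (intro SUP_cong refl)
  also have "\<dots> = cyc P (weyl_mult Q F)"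
  proof -
    have "cyc P F \<noteq> {}" by (simp add: cyc_altdef)
    thus ?thesis by simp
  qed
  finally show ?thesis by (simp add: cyclic_module_def cyc_def)
qed

lemma cyclic_abelian_group: "abelian_group (cyclic_module P)"
proof (rule abelian_groupI)
  fix x assume "x \<in> carrier (cyclic_module P)"
  then obtain F where "x = cyc P F" by (auto simp: cyclic_carrier)
  hence "cyc P (- F) \<oplus>\<^bsub>cyclic_module P\<^esub> x = \<zero>\<^bsub>cyclic_module P\<^esub>" by (simp add: cyclic_add cyclic_zero)
  thus "\<exists>y\<in>carrier (cyclic_module P). y \<oplus>\<^bsub>cyclic_module P\<^esub> x = \<zero>\<^bsub>cyclic_module P\<^esub>"
    by (auto simp: cyclic_carrier)
qed (auto simp: cyclic_carrier cyclic_add cyclic_zero add_ac)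

lemma restrict_scalars_simps [simp]:
  "carrier (restrict_scalars f M) = carrier M" "\<zero>\<^bsub>restrict_scalars f M\<^esub> = \<zero>\<^bsub>M\<^esub>"
  "x \<oplus>\<^bsub>restrict_scalars f M\<^esub> y = x \<oplus>\<^bsub>M\<^esub> y" "s \<odot>\<^bsub>restrict_scalars f M\<^esub> x = f s \<odot>\<^bsub>M\<^esub> x"
  by (simp_all add: restrict_scalars_def)

lemma restrict_scalars_abelian_group: "abelian_group M \<Longrightarrow> abelian_group (restrict_scalars f M)"
proof -
  assume "abelian_group M"
  then interpret M: abelian_group M .
  show ?thesis
  proof (rule abelian_groupI)
    fix x assume "x \<in> carrier (restrict_scalars f M)"
    thus "\<exists>y\<in>carrier (restrict_scalars f M). y \<oplus>\<^bsub>restrict_scalars f M\<^esub> x = \<zero>\<^bsub>restrict_scalars f M\<^esub>"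
      using M.l_neg by (intro bexI[of _ "\<ominus>\<^bsub>M\<^esub> x"]) auto
  qed (auto simp: M.a_ac)
qed

lemma as_poly_module_simps [simp]:
  "carrier (as_poly_module M) = carrier M" "\<zero>\<^bsub>as_poly_module M\<^esub> = \<zero>\<^bsub>M\<^esub>"
  "x \<oplus>\<^bsub>as_poly_module M\<^esub> y = x \<oplus>\<^bsub>M\<^esub> y" "s \<odot>\<^bsub>as_poly_module M\<^esub> x = [:s:] \<odot>\<^bsub>M\<^esub> x"
  by (simp_all add: as_poly_module_def)

subsection \<open>Degrees\<close>

lemma degree_pderiv_iter: "degree ((pderiv ^^ m) (F :: 'a::field_char_0 poly poly)) = degree F - m"
  by (induction m) (auto simp: degree_pderiv)

lemma coeff_map_pderiv_iter: "coeff (map_poly (pderiv ^^ m) G) k = (pderiv ^^ m) (coeff G k)"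
  by (simp add: coeff_map_poly)

lemma degree_map_pderiv_iter: "degree (map_poly (pderiv ^^ m) G) \<le> degree G"
  by (rule degree_le) (simp add: coeff_map_pderiv_iter coeff_eq_0)

lemma weyl_mult_split:
  "weyl_mult F G = F * G + (\<Sum>\<alpha>=1..degree F. [:[:1 / fact \<alpha>:]:] * (pderiv ^^ \<alpha>) F * map_poly (pderiv ^^ \<alpha>) G)"
proof -
  have "weyl_mult F G = (\<Sum>\<alpha>\<in>insert 0 {1..degree F}. [:[:1 / fact \<alpha>:]:] * (pderiv ^^ \<alpha>) F * map_poly (pderiv ^^ \<alpha>) G)"
    unfolding weyl_mult_def by (intro sum.cong) auto
  thus ?thesis by (simp add: map_poly_idI flip: one_pCons)
qed

lemma coeff_mult_top:
  fixes F G :: "'a::comm_semiring_1 poly"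
  assumes "degree F \<le> m" "degree G \<le> n"
  shows "coeff (F * G) (m + n) = coeff F m * coeff G n"
proof -
  have "coeff (F * G) (m + n) = (\<Sum>i\<le>m + n. if i = m then coeff F m * coeff G n else 0)"
    unfolding coeff_mult
  proof (intro sum.cong refl)
    fix i assume "i \<in> {..m + n}"
    consider "i < m" | "i = m" | "m < i" by linarith
    thus "coeff F i * coeff G (m + n - i) = (if i = m then coeff F m * coeff G n else 0)"
    proof cases
      case 1
      hence "coeff G (m + n - i) = 0" using assms by (intro coeff_eq_0) simp
      thus ?thesis using 1 by simp
    qed (use assms in \<open>simp_all add: coeff_eq_0\<close>)
  qed
  thus ?thesis by simp
qed

text \<open>The corrections in the Leibniz rule have smaller order in the derivation, so the
  coefficients of top order multiply as commutative polynomials.\<close>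

lemma weyl_mult_coeff_top:
  assumes "degree F \<le> m" "degree G \<le> n"
  shows "coeff (weyl_mult F G) (m + n) = coeff F m * coeff G n"
    and "degree (weyl_mult F G) \<le> m + n"
proof -
  have low: "degree ([:[:1 / fact \<alpha>:]:] * (pderiv ^^ \<alpha>) F * map_poly (pderiv ^^ \<alpha>) G) < m + n"
    if "\<alpha> \<in> {1..degree F}" for \<alpha>
  proof -
    have "degree ([:[:1 / fact \<alpha>:]:] * (pderiv ^^ \<alpha>) F * map_poly (pderiv ^^ \<alpha>) G)
        \<le> degree ((pderiv ^^ \<alpha>) F) + degree (map_poly (pderiv ^^ \<alpha>) G)"
      by (rule order_trans[OF degree_mult_le]) (use degree_mult_le[of "[:[:1 / fact \<alpha>:]:]" "(pderiv ^^ \<alpha>) F"] in simp)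
    also have "\<dots> \<le> (degree F - \<alpha>) + degree G"
      using degree_map_pderiv_iter[of \<alpha> G] by (simp add: degree_pderiv_iter)
    also have "\<dots> < m + n" using that assms by auto
    finally show ?thesis .
  qed
  hence "coeff (weyl_mult F G) (m + n) = coeff (F * G) (m + n)"
    unfolding weyl_mult_split coeff_add coeff_sum by (simp add: coeff_eq_0)
  also have "\<dots> = coeff F m * coeff G n" using assms by (rule coeff_mult_top)
  finally show "coeff (weyl_mult F G) (m + n) = coeff F m * coeff G n" .
  show "degree (weyl_mult F G) \<le> m + n"
    unfolding weyl_mult_split
    using low assms degree_mult_le[of F G] by (intro degree_add_le degree_sum_le) (auto intro: less_imp_le)
qed

section \<open>The Robba ring\<close>

text \<open>Infinite sums in \<open>robba_mult\<close> require continuous addition. By the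
  ultrametric inequality the same e works for both summands.\<close>

instance nonarch_field \<subseteq> topological_comm_monoid_add
proof
  fix a b :: 'a
  show "((\<lambda>x. fst x + snd x) \<longlongrightarrow> a + b) (nhds a \<times>\<^sub>F nhds b)"
  proof (rule tendstoI)
    fix e :: real assume e: "0 < e"
    have "eventually (\<lambda>x. dist (fst x) a < e \<and> dist (snd x) b < e) (nhds a \<times>\<^sub>F nhds b)"
      by (intro eventually_conj; rule eventually_compose_filterlim[OF _ filterlim_fst] eventually_compose_filterlim[OF _ filterlim_snd])
         (use e in \<open>auto simp: eventually_nhds_metric\<close>)
    thus "eventually (\<lambda>x. dist (fst x + snd x) (a + b) < e) (nhds a \<times>\<^sub>F nhds b)"
    proof eventually_elim
      case (elim x)
      have "fst x + snd x - (a + b) = (fst x - a) + (snd x - b)" by simp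
      hence "dist (fst x + snd x) (a + b) \<le> max (dist (fst x) a) (dist (snd x) b)"
        unfolding dist_av by (metis av_add)
      also have "\<dots> < e" using elim by simp
      finally show ?case .
    qed
  qed
qed

lemma uniformly_continuous_plus: "uniformly_continuous_on UNIV (\<lambda>(x::'k::nonarch_field, y). x + y)"
proof -
  have *: "dist (fst x' + snd x') (fst x + snd x) < e" if d: "dist x' x < e" for x x' :: "'k \<times> 'k" and e
  proof -
    have "dist (fst x') (fst x) < e" "dist (snd x') (snd x) < e"
      using d dist_fst_le[of x' x] dist_snd_le[of x' x] by linarith+
    moreover have "fst x' + snd x' - (fst x + snd x) = (fst x' - fst x) + (snd x' - snd x)" by simp
    hence "dist (fst x' + snd x') (fst x + snd x) \<le> max (dist (fst x') (fst x)) (dist (snd x') (snd x))"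
      unfolding dist_av by (metis av_add)
    ultimately show ?thesis by (meson le_less_trans max_less_iff_conj)
  qed
  show ?thesis
    unfolding uniformly_continuous_on_def case_prod_unfold
    by (rule allI, rule impI, rule_tac x = e in exI) (simp add: *)
qed

section \<open>Unordered sums in an ultrametric field\<close>

definition null_family :: "('i \<Rightarrow> 'k::nonarch_field) \<Rightarrow> bool" where
  "null_family f \<longleftrightarrow> (\<forall>e>0. finite {i. e \<le> av (f i)})"

text \<open>Let s_n be the sum of the terms of size at least 2^(-n). The balls of radius 2^(-n)
  around s_n are nested, because the remaining terms together stay below that size; spherical
  completeness yields a common point, and this is the sum.\<close>

lemma null_summable:
  fixes f :: "'i \<Rightarrow> 'k::nonarch_field"
  assumes sc: "spherically_complete TYPE('k)" and f: "null_family f"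
  shows "f summable_on UNIV"
proof -
  define F where "F = (\<lambda>n. {i. (1 / 2) ^ n \<le> av (f i)})"
  define s where "s = (\<lambda>n. sum f (F n))"
  have fin: "finite (F n)" for n using f by (simp add: null_family_def F_def)
  have close: "av (sum f G - s n) \<le> (1 / 2) ^ n" if G: "finite G" "F n \<subseteq> G" for G n
  proof -
    have "sum f G - s n = sum f (G - F n)" unfolding s_def by (simp only: sum_diff[OF G])
    also have "av \<dots> \<le> (1 / 2) ^ n" by (rule av_sum_le) (auto simp: F_def)
    finally show ?thesis .
  qed
  have ball: "cball (s (Suc n)) ((1 / 2) ^ Suc n) \<subseteq> cball (s n) ((1 / 2) ^ n)" for n
  proof
    fix y assume "y \<in> cball (s (Suc n)) ((1 / 2) ^ Suc n)"
    hence "av (s (Suc n) - y) \<le> (1 / 2) ^ Suc n" by (simp only: mem_cball dist_av)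
    also have "\<dots> \<le> (1 / 2) ^ n" by simp
    finally have y: "av (s (Suc n) - y) \<le> (1 / 2) ^ n" .
    have "(1 / 2 :: real) ^ Suc n \<le> (1 / 2) ^ n" by simp
    hence "F n \<subseteq> F (Suc n)" unfolding F_def by (intro subsetI CollectI) (elim CollectE, rule order_trans)
    hence "av (s (Suc n) - s n) \<le> (1 / 2) ^ n" using close[OF fin, of n "Suc n"] by (simp add: s_def)
    hence "av ((s (Suc n) - y) - (s (Suc n) - s n)) \<le> (1 / 2) ^ n" using y av_diff_le[of "s (Suc n) - y" "s (Suc n) - s n"] by linarith
    thus "y \<in> cball (s n) ((1 / 2) ^ n)" by (simp add: dist_av)
  qed
  have nested: "\<forall>n. 0 < (1 / 2 :: real) ^ n \<and> cball (s (Suc n)) ((1 / 2) ^ Suc n) \<subseteq> cball (s n) ((1 / 2) ^ n)"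
    by (intro allI conjI ball) simp
  have "(\<Inter>n. cball (s n) ((1 / 2) ^ n)) \<noteq> {}"
    by (rule sc[unfolded spherically_complete_def, THEN spec, THEN spec, THEN mp, OF nested])
  then obtain x where "x \<in> (\<Inter>n. cball (s n) ((1 / 2) ^ n))" by blast
  hence x: "av (s n - x) \<le> (1 / 2) ^ n" for n by (simp add: dist_av)
  have "(f has_sum x) UNIV"
    unfolding has_sum_def
  proof (rule tendstoI)
    fix e :: real assume "0 < e"
    then obtain n where n: "(1 / 2) ^ n < e" using real_arch_pow_inv[of e "1 / 2"] by auto
    show "eventually (\<lambda>G. dist (sum f G) x < e) (finite_subsets_at_top UNIV)"
      unfolding eventually_finite_subsets_at_top
    proof (intro exI[of _ "F n"] conjI allI impI fin subset_UNIV)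
      fix G assume "finite G \<and> F n \<subseteq> G \<and> G \<subseteq> UNIV"
      hence "av ((sum f G - s n) + (s n - x)) \<le> (1 / 2) ^ n" using x by (intro av_add_le close) auto
      thus "dist (sum f G) x < e" using n by (simp add: dist_av)
    qed
  qed
  thus ?thesis by (auto simp: summable_on_def)
qed

text \<open>A finite partial sum closer to the limit than the limit is to 0 would have the same
  absolute value as the limit. Without summability \<open>infsum\<close> is 0 by convention, and 0
  \<le> C covers this.\<close>

lemma av_infsum_le:
  fixes f :: "'i \<Rightarrow> 'k::nonarch_field"
  assumes "0 \<le> C" "\<And>i. av (f i) \<le> C"
  shows "av (infsum f A) \<le> C"
proof (cases "f summable_on A")
  case True
  hence S: "(f has_sum infsum f A) A" by simp
  show ?thesis
  proof (rule ccontr)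
    assume n: "\<not> av (infsum f A) \<le> C"
    hence "0 < av (infsum f A)" using assms(1) by linarith
    from tendstoD[OF S[unfolded has_sum_def] this]
    obtain X where "dist (sum f X) (infsum f A) < av (infsum f A)"
      unfolding eventually_finite_subsets_at_top by blast
    hence d: "av (sum f X - infsum f A) < av (infsum f A)" by (simp only: dist_av)
    have c: "av (sum f X) \<le> C" using assms by (intro av_sum_le) auto
    have "av (infsum f A) = av (sum f X - (sum f X - infsum f A))" by simp
    also have "\<dots> \<le> max (av (sum f X)) (av (sum f X - infsum f A))" by (rule av_diff_le)
    also have "\<dots> < av (infsum f A)" using d c n by simp
    finally show False by simp
  qed
qed (use assms in \<open>simp add: infsum_not_exists\<close>)

lemma infsum_cmult_nonarch:
  fixes f :: "'i \<Rightarrow> 'k::nonarch_field"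
  assumes "f summable_on A"
  shows "infsum (\<lambda>i. c * f i) A = c * infsum f A" "(\<lambda>i. c * f i) summable_on A"
proof -
  have S: "(sum f \<longlongrightarrow> infsum f A) (finite_subsets_at_top A)"
    using assms has_sum_infsum[of f A] by (simp add: has_sum_def)
  have "((\<lambda>i. c * f i) has_sum (c * infsum f A)) A"
    unfolding has_sum_def
  proof (rule tendstoI)
    fix e :: real assume e: "0 < e"
    have "eventually (\<lambda>X. dist (sum f X) (infsum f A) < e / (av c + 1)) (finite_subsets_at_top A)"
      using e by (intro tendstoD[OF S]) (simp add: add_nonneg_pos)
    thus "eventually (\<lambda>X. dist (\<Sum>i\<in>X. c * f i) (c * infsum f A) < e) (finite_subsets_at_top A)"
    proof eventually_elim
      case (elim X)
      have pos: "0 < av c + 1" by (simp add: add_nonneg_pos)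
      have "dist (\<Sum>i\<in>X. c * f i) (c * infsum f A) = av c * dist (sum f X) (infsum f A)"
        by (simp add: dist_av av_mult flip: sum_distrib_left right_diff_distrib)
      also have "\<dots> \<le> (av c + 1) * dist (sum f X) (infsum f A)" by (intro mult_right_mono) auto
      also have "\<dots> < e" using elim pos by (simp add: pos_less_divide_eq mult.commute)
      finally show ?case .
    qed
  qed
  thus "infsum (\<lambda>i. c * f i) A = c * infsum f A" "(\<lambda>i. c * f i) summable_on A"
    by (auto simp: infsumI summable_on_def)
qed

text \<open>Decay in both directions is expressed through finiteness, by
  \<open>int_tendsto_0_iff\<close>: this form is stable under injective reindexing and under images,
  as needed for products.\<close>

definition conv_at :: "real \<Rightarrow> (int \<Rightarrow> 'k::nonarch_field) \<Rightarrow> bool" where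
  "conv_at l f \<longleftrightarrow> (\<forall>e>0. finite {i. e \<le> av (f i) * l powi i})"

definition bnd_at :: "real \<Rightarrow> real \<Rightarrow> (int \<Rightarrow> 'k::nonarch_field) \<Rightarrow> bool" where
  "bnd_at l C f \<longleftrightarrow> (\<forall>i. av (f i) * l powi i \<le> C)"

lemma bnd_atD: "bnd_at l C f \<Longrightarrow> av (f i) * l powi i \<le> C"
  by (simp add: bnd_at_def)

lemma bnd_at_mono: "bnd_at l C f \<Longrightarrow> C \<le> D \<Longrightarrow> bnd_at l D f"
  by (auto simp: bnd_at_def intro: order_trans)

lemma bnd_at_nonneg: "0 < l \<Longrightarrow> bnd_at l C f \<Longrightarrow> 0 \<le> C"
  using order_trans[OF av_nonneg[of "f 0"], of C] bnd_atD[of l C f 0] by simp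

lemma conv_at_bnd:
  assumes "conv_at l f" "0 < l"
  shows "\<exists>C>0. bnd_at l C f"
proof -
  have fin: "finite {i. 1 \<le> av (f i) * l powi i}" using assms by (simp add: conv_at_def)
  define C where "C = 1 + (\<Sum>i\<in>{i. 1 \<le> av (f i) * l powi i}. av (f i) * l powi i)"
  have nn: "0 \<le> av (f i) * l powi i" for i using assms(2) by simp
  hence S: "0 \<le> (\<Sum>i\<in>{i. 1 \<le> av (f i) * l powi i}. av (f i) * l powi i)" by (intro sum_nonneg)
  have "av (f i) * l powi i \<le> C" for i
  proof (cases "1 \<le> av (f i) * l powi i")
    case True
    hence "av (f i) * l powi i \<le> (\<Sum>i\<in>{i. 1 \<le> av (f i) * l powi i}. av (f i) * l powi i)"
      using fin nn by (intro member_le_sum) auto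
    thus ?thesis by (simp add: C_def)
  qed (use S in \<open>simp add: C_def\<close>)
  thus ?thesis using S by (intro exI[of _ C]) (auto simp: bnd_at_def C_def)
qed

lemma int_tendsto_0_iff:
  fixes g :: "int \<Rightarrow> real"
  assumes "\<And>i. 0 \<le> g i"
  shows "(g \<longlongrightarrow> 0) at_top \<and> (g \<longlongrightarrow> 0) at_bot \<longleftrightarrow> (\<forall>e>0. finite {i. e \<le> g i})"
proof (intro iffI allI impI)
  fix e :: real assume lim: "(g \<longlongrightarrow> 0) at_top \<and> (g \<longlongrightarrow> 0) at_bot" and e: "0 < e"
  from lim e have "eventually (\<lambda>i. g i < e) at_top" "eventually (\<lambda>i. g i < e) at_bot"
    by (auto intro: order_tendstoD(2))
  then obtain M N where "\<And>i. M \<le> i \<Longrightarrow> g i < e" "\<And>i. i \<le> N \<Longrightarrow> g i < e"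
    unfolding eventually_at_top_linorder eventually_at_bot_linorder by blast
  hence "{i. e \<le> g i} \<subseteq> {N..M}" by (metis (mono_tags, lifting) atLeastAtMost_iff linorder_le_cases mem_Collect_eq not_less subsetI)
  thus "finite {i. e \<le> g i}" by (rule finite_subset) simp
next
  assume fin: "\<forall>e>0. finite {i. e \<le> g i}"
  have "eventually (\<lambda>i. dist (g i) 0 < e) at_top \<and> eventually (\<lambda>i. dist (g i) 0 < e) at_bot" if e: "0 < e" for e
  proof -
    have f: "finite {i. e \<le> g i}" using fin e by blast
    obtain M where M: "\<And>i. i \<in> {i. e \<le> g i} \<Longrightarrow> i \<le> M" using bdd_above_finite[OF f] by (auto simp: bdd_above_def)
    obtain N where N: "\<And>i. i \<in> {i. e \<le> g i} \<Longrightarrow> N \<le> i" using bdd_below_finite[OF f] by (auto simp: bdd_below_def)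
    have "dist (g i) 0 < e" if "M + 1 \<le> i" for i using M[of i] that assms[of i] by force
    moreover have "dist (g i) 0 < e" if "i \<le> N - 1" for i using N[of i] that assms[of i] by force
    ultimately show ?thesis unfolding eventually_at_top_linorder eventually_at_bot_linorder by blast
  qed
  thus "(g \<longlongrightarrow> 0) at_top \<and> (g \<longlongrightarrow> 0) at_bot" by (simp add: tendsto_iff)
qed

section \<open>The Robba ring as a commutative ring\<close>

lemma robba_carrier_iff: "f \<in> carrier robba \<longleftrightarrow> eventually (\<lambda>l. conv_at l f) (at_left 1)"
proof -
  have c: "((\<lambda>i. av (f i) * l powi i) \<longlongrightarrow> 0) at_top \<and> ((\<lambda>i. av (f i) * l powi i) \<longlongrightarrow> 0) at_bot \<longleftrightarrow> conv_at l f"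
    if "0 < l" for l
    unfolding conv_at_def using that by (intro int_tendsto_0_iff) simp
  have "f \<in> carrier robba \<longleftrightarrow> (\<exists>\<epsilon>>0. \<forall>l. 0 < l \<and> 1 - \<epsilon> < l \<and> l < 1 \<longrightarrow> conv_at l f)"
    unfolding robba_def using c by auto
  also have "\<dots> \<longleftrightarrow> (\<exists>b<1. \<forall>l>b. l < 1 \<longrightarrow> conv_at l f)"
  proof
    assume "\<exists>\<epsilon>>0. \<forall>l. 0 < l \<and> 1 - \<epsilon> < l \<and> l < 1 \<longrightarrow> conv_at l f"
    then obtain \<epsilon> where "0 < \<epsilon>" "\<And>l. 0 < l \<Longrightarrow> 1 - \<epsilon> < l \<Longrightarrow> l < 1 \<Longrightarrow> conv_at l f" by blast
    thus "\<exists>b<1. \<forall>l>b. l < 1 \<longrightarrow> conv_at l f" by (intro exI[of _ "max 0 (1 - \<epsilon>)"]) auto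
  next
    assume "\<exists>b<1. \<forall>l>b. l < 1 \<longrightarrow> conv_at l f"
    then obtain b where "b < 1" "\<And>l. b < l \<Longrightarrow> l < 1 \<Longrightarrow> conv_at l f" by blast
    thus "\<exists>\<epsilon>>0. \<forall>l. 0 < l \<and> 1 - \<epsilon> < l \<and> l < 1 \<longrightarrow> conv_at l f" by (intro exI[of _ "1 - b"]) auto
  qed
  also have "\<dots> \<longleftrightarrow> eventually (\<lambda>l. conv_at l f) (at_left 1)"
    by (subst eventually_at_left[of 0]) auto
  finally show ?thesis .
qed

lemma eventually_at_left_1_pos: "eventually (\<lambda>l::real. 0 < l \<and> l < 1) (at_left 1)"
  by (subst eventually_at_left[of 0]) (auto intro: exI[of _ 0])

lemma robba_simps [simp]:
  "x \<otimes>\<^bsub>robba\<^esub> y = robba_mult x y" "\<zero>\<^bsub>robba\<^esub> = (\<lambda>_. 0)" "x \<oplus>\<^bsub>robba\<^esub> y = (\<lambda>i. x i + y i)"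
  "\<one>\<^bsub>robba\<^esub> = (\<lambda>i. if i = 0 then 1 else 0)"
  by (simp_all add: robba_def)

lemma bnd_at_add: "0 < l \<Longrightarrow> bnd_at l C f \<Longrightarrow> bnd_at l C g \<Longrightarrow> bnd_at l C (\<lambda>i. f i + g i)"
  unfolding bnd_at_def
proof
  fix i assume l: "0 < l" and f: "\<forall>i. av (f i) * l powi i \<le> C" and g: "\<forall>i. av (g i) * l powi i \<le> C"
  have "av (f i + g i) * l powi i \<le> max (av (f i)) (av (g i)) * l powi i"
    using l by (intro mult_right_mono av_add) auto
  also have "\<dots> \<le> C" using f g by (auto simp: max_def)
  finally show "av (f i + g i) * l powi i \<le> C" .
qed

lemma conv_at_add:
  assumes "0 < l" "conv_at l f" "conv_at l g"
  shows "conv_at l (\<lambda>i. f i + g i)"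
  unfolding conv_at_def
proof (intro allI impI)
  fix e :: real assume e: "0 < e"
  have "{i. e \<le> av (f i + g i) * l powi i} \<subseteq> {i. e \<le> av (f i) * l powi i} \<union> {i. e \<le> av (g i) * l powi i}"
  proof
    fix i assume "i \<in> {i. e \<le> av (f i + g i) * l powi i}"
    moreover have "av (f i + g i) * l powi i \<le> max (av (f i)) (av (g i)) * l powi i"
      using assms(1) by (intro mult_right_mono av_add) auto
    ultimately show "i \<in> {i. e \<le> av (f i) * l powi i} \<union> {i. e \<le> av (g i) * l powi i}"
      by (auto simp: max_def split: if_splits)
  qed
  thus "finite {i. e \<le> av (f i + g i) * l powi i}"
    by (rule finite_subset) (use assms e in \<open>auto simp: conv_at_def\<close>)
qed

lemma conv_at_le:
  assumes "conv_at l f" "\<And>i. av (g i) * l powi i \<le> D * (av (f (h i)) * l powi (h i))" "0 \<le> D" "inj h" "0 < l"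
  shows "conv_at l g"
  unfolding conv_at_def
proof (intro allI impI)
  fix e :: real assume e: "0 < e"
  have "{i. e \<le> av (g i) * l powi i} \<subseteq> h -` {j. e / (D + 1) \<le> av (f j) * l powi j}"
  proof
    fix i assume "i \<in> {i. e \<le> av (g i) * l powi i}"
    hence a: "e \<le> D * (av (f (h i)) * l powi (h i))" using assms(2)[of i] by simp
    have "0 \<le> av (f (h i)) * l powi (h i)" using assms(5) by simp
    hence "e \<le> (D + 1) * (av (f (h i)) * l powi (h i))" using a by (simp add: algebra_simps)
    thus "i \<in> h -` {j. e / (D + 1) \<le> av (f j) * l powi j}" using assms(3) by (simp add: pos_divide_le_eq mult.commute)
  qed
  moreover have "finite (h -` {j. e / (D + 1) \<le> av (f j) * l powi j})"
    using assms e by (intro finite_vimageI) (auto simp: conv_at_def)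
  ultimately show "finite {i. e \<le> av (g i) * l powi i}" by (rule finite_subset)
qed

text \<open>The double family behind a product. Its finiteness gives both the existence of each
  coefficient of the product and the decay of these coefficients.\<close>

definition pair_null :: "real \<Rightarrow> (int \<Rightarrow> 'k::nonarch_field) \<Rightarrow> (int \<Rightarrow> 'k) \<Rightarrow> bool" where
  "pair_null l f g \<longleftrightarrow> (\<forall>e>0. finite {(i, j). e \<le> av (f i) * l powi i * (av (g j) * l powi j)})"

lemma conv_at_pair_null:
  assumes "0 < l" "conv_at l f" "conv_at l g"
  shows "pair_null l f g"
  unfolding pair_null_def
proof (intro allI impI)
  fix e :: real assume e: "0 < e"
  obtain C D where C: "C > 0" "bnd_at l C f" and D: "D > 0" "bnd_at l D g"
    using conv_at_bnd assms by metis
  have "{(i, j). e \<le> av (f i) * l powi i * (av (g j) * l powi j)} \<subseteq>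
      {i. e / D \<le> av (f i) * l powi i} \<times> {j. e / C \<le> av (g j) * l powi j}"
  proof
    fix p assume "p \<in> {(i, j). e \<le> av (f i) * l powi i * (av (g j) * l powi j)}"
    then obtain i j where p: "p = (i, j)" and a: "e \<le> av (f i) * l powi i * (av (g j) * l powi j)" by auto
    have nn: "0 \<le> av (f i) * l powi i" "0 \<le> av (g j) * l powi j" using assms(1) by simp_all
    have "e \<le> av (f i) * l powi i * D"
      using a bnd_atD[OF D(2), of j] mult_left_mono[OF _ nn(1)] by (meson order_trans)
    moreover have "e \<le> C * (av (g j) * l powi j)"
      using a bnd_atD[OF C(2), of i] mult_right_mono[OF _ nn(2)] by (meson order_trans)
    ultimately show "p \<in> {i. e / D \<le> av (f i) * l powi i} \<times> {j. e / C \<le> av (g j) * l powi j}"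
      using C(1) D(1) by (simp add: p pos_divide_le_eq mult.commute)
  qed
  moreover have "finite \<dots>" using assms e C(1) D(1) by (intro finite_cartesian_product) (auto simp: conv_at_def)
  ultimately show "finite {(i, j). e \<le> av (f i) * l powi i * (av (g j) * l powi j)}" by (rule finite_subset)
qed

lemma powi_split: "0 < l \<Longrightarrow> (l::real) powi n = l powi i * l powi (n - i)"
  by (simp add: power_int_diff)

lemma conv_at_null_mult:
  assumes "0 < l" "conv_at l f" "conv_at l g"
  shows "null_family (\<lambda>i. f i * g (n - i))"
  unfolding null_family_def
proof (intro allI impI)
  fix e :: real assume e: "0 < e"
  have "{i. e \<le> av (f i * g (n - i))} \<subseteq>
     fst ` {(i, j). e * l powi n \<le> av (f i) * l powi i * (av (g j) * l powi j)}"
  proof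
    fix i assume "i \<in> {i. e \<le> av (f i * g (n - i))}"
    hence "e * l powi n \<le> av (f i) * av (g (n - i)) * l powi n"
      using assms(1) by (simp add: av_mult)
    also have "\<dots> = av (f i) * l powi i * (av (g (n - i)) * l powi (n - i))"
      using powi_split[OF assms(1), of n i] by (simp add: mult_ac)
    finally show "i \<in> fst ` {(i, j). e * l powi n \<le> av (f i) * l powi i * (av (g j) * l powi j)}"
      by (intro image_eqI[of _ _ "(i, n - i)"]) auto
  qed
  moreover have "finite {(i, j). e * l powi n \<le> av (f i) * l powi i * (av (g j) * l powi j)}"
    using conv_at_pair_null[OF assms] e assms(1) by (simp add: pair_null_def)
  ultimately show "finite {i. e \<le> av (f i * g (n - i))}" by (rule finite_surj[rotated])
qed

lemma robba_mult_term_bound: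
  assumes "0 < l" "\<And>i. av (f i) * l powi i * (av (g (n - i)) * l powi (n - i)) \<le> C"
  shows "av (robba_mult f g n) * l powi n \<le> C"
proof -
  have pn: "0 < l powi n" using assms(1) by simp
  have "av (f i * g (n - i)) \<le> C / l powi n" for i
    using assms(2)[of i] powi_split[OF assms(1), of n i] pn by (simp add: pos_le_divide_eq av_mult mult_ac)
  moreover have "0 \<le> C"
  proof -
    have "0 \<le> av (f 0) * l powi 0 * (av (g (n - 0)) * l powi (n - 0))" using assms(1) by simp
    thus ?thesis using assms(2)[of 0] by (rule order_trans)
  qed
  ultimately have "av (robba_mult f g n) \<le> C / l powi n"
    unfolding robba_mult_def using pn by (intro av_infsum_le) auto
  thus ?thesis using pn by (simp add: pos_le_divide_eq)
qed

lemma bnd_at_mult: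
  assumes "0 < l" "bnd_at l C f" "bnd_at l D g"
  shows "bnd_at l (C * D) (robba_mult f g)"
  unfolding bnd_at_def
proof
  fix n
  show "av (robba_mult f g n) * l powi n \<le> C * D"
  proof (rule robba_mult_term_bound[OF assms(1)])
    fix i
    show "av (f i) * l powi i * (av (g (n - i)) * l powi (n - i)) \<le> C * D"
    proof (rule mult_mono[OF bnd_atD[OF assms(2)] bnd_atD[OF assms(3)] bnd_at_nonneg[OF assms(1,2)]])
      have "0 \<le> l powi (n - i)" using assms(1) by simp
      thus "0 \<le> av (g (n - i)) * l powi (n - i)" by (rule mult_nonneg_nonneg[OF av_nonneg])
    qed
  qed
qed

lemma conv_at_mult:
  assumes "0 < l" "conv_at l f" "conv_at l g"
  shows "conv_at l (robba_mult f g)"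
  unfolding conv_at_def
proof (intro allI impI)
  fix e :: real assume e: "0 < e"
  have "{n. e \<le> av (robba_mult f g n) * l powi n} \<subseteq>
     (\<lambda>(i, j). i + j) ` {(i, j). e / 2 \<le> av (f i) * l powi i * (av (g j) * l powi j)}"
  proof
    fix n assume n: "n \<in> {n. e \<le> av (robba_mult f g n) * l powi n}"
    \<comment> \<open>Halving e restores a strict inequality: if all terms are below e/2, the sum is
      only known to be at most e/2, which is below e.\<close>
    have "\<exists>i. e / 2 \<le> av (f i) * l powi i * (av (g (n - i)) * l powi (n - i))"
    proof (rule ccontr)
      assume "\<nexists>i. e / 2 \<le> av (f i) * l powi i * (av (g (n - i)) * l powi (n - i))"
      hence lt: "\<forall>i. av (f i) * l powi i * (av (g (n - i)) * l powi (n - i)) < e / 2"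
        unfolding not_ex not_le .
      have "av (robba_mult f g n) * l powi n \<le> e / 2"
      proof (rule robba_mult_term_bound[OF assms(1)])
        fix i show "av (f i) * l powi i * (av (g (n - i)) * l powi (n - i)) \<le> e / 2"
          using spec[OF lt, of i] by simp
      qed
      thus False using n e by simp
    qed
    then obtain i where "e / 2 \<le> av (f i) * l powi i * (av (g (n - i)) * l powi (n - i))" ..
    thus "n \<in> (\<lambda>(i, j). i + j) ` {(i, j). e / 2 \<le> av (f i) * l powi i * (av (g j) * l powi j)}"
      by (intro image_eqI[of _ _ "(i, n - i)"]) auto
  qed
  moreover have "finite {(i, j). e / 2 \<le> av (f i) * l powi i * (av (g j) * l powi j)}"
    by (rule conv_at_pair_null[OF assms, unfolded pair_null_def, THEN spec, THEN mp]) (use e in simp)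
  ultimately show "finite {n. e \<le> av (robba_mult f g n) * l powi n}" by (rule finite_surj[rotated])
qed

lemma robba_mult_commute: "robba_mult f g = robba_mult g f"
proof
  fix n
  have "bij_betw (\<lambda>i. n - i) UNIV (UNIV :: int set)"
    by (rule bij_betwI[of _ _ _ "\<lambda>i. n - i"]) auto
  from infsum_reindex_bij_betw[OF this, of "\<lambda>i. g i * f (n - i)"]
  show "robba_mult f g n = robba_mult g f n" by (simp add: robba_mult_def mult.commute)
qed

lemma robba_mult_finite:
  assumes "finite A" "\<And>i. i \<notin> A \<Longrightarrow> f i = 0"
  shows "robba_mult f g n = (\<Sum>i\<in>A. f i * g (n - i))"
proof -
  have "robba_mult f g n = infsum (\<lambda>i. f i * g (n - i)) A"
    unfolding robba_mult_def by (rule infsum_cong_neutral) (auto simp: assms(2))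
  thus ?thesis using assms(1) by simp
qed

lemma robba_mult_1: "robba_mult (\<lambda>i. if i = 0 then 1 else 0) g = g"
  by (rule ext, subst robba_mult_finite[of "{0}"]) auto

context
  assumes sc: "spherically_complete TYPE('k::nonarch_field)"
begin

lemma robba_mult_distrib:
  fixes f g h :: "int \<Rightarrow> 'k"
  assumes "0 < l" "conv_at l f" "conv_at l g" "conv_at l h"
  shows "robba_mult (\<lambda>i. f i + g i) h = (\<lambda>n. robba_mult f h n + robba_mult g h n)"
  unfolding robba_mult_def distrib_right
  by (intro ext infsum_add null_summable[OF sc] conv_at_null_mult[OF assms(1)] assms)

text \<open>Fubini for null families: the triple products indexed by (i, j) form a null family, h
  being bounded on the circle, and they are summed once along i and once along m = i + j.\<close>

lemma robba_mult_assoc: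
  fixes f g h :: "int \<Rightarrow> 'k"
  assumes l: "0 < l" and f: "conv_at l f" and g: "conv_at l g" and h: "conv_at l h"
  shows "robba_mult (robba_mult f g) h = robba_mult f (robba_mult g h)"
proof
  fix n
  define u where "u = (\<lambda>(i, j). f i * (g j * h (n - i - j)))"
  obtain C where C: "C > 0" "bnd_at l C h" using conv_at_bnd[OF h l] by blast
  have nu: "null_family u"
    unfolding null_family_def
  proof (intro allI impI)
    fix e :: real assume e: "0 < e"
    have "{p. e \<le> av (u p)} \<subseteq> {(i, j). e * l powi n / C \<le> av (f i) * l powi i * (av (g j) * l powi j)}"
    proof
      fix p assume p: "p \<in> {p. e \<le> av (u p)}"
      obtain i j where ij: "p = (i, j)" by (cases p) auto
      have ln: "l powi n = l powi i * (l powi j * l powi (n - i - j))"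
        using powi_split[OF l, of n i] powi_split[OF l, of "n - i" j] by simp
      have "e * l powi n \<le> av (u p) * l powi n" using p l by (intro mult_right_mono) auto
      also have "\<dots> = av (f i) * l powi i * (av (g j) * l powi j) * (av (h (n - i - j)) * l powi (n - i - j))"
        unfolding ln ij u_def by (simp add: av_mult ac_simps)
      also have "\<dots> \<le> av (f i) * l powi i * (av (g j) * l powi j) * C"
        using l by (intro mult_left_mono bnd_atD[OF C(2)]) auto
      finally show "p \<in> {(i, j). e * l powi n / C \<le> av (f i) * l powi i * (av (g j) * l powi j)}"
        using C(1) by (simp add: ij pos_divide_le_eq)
    qed
    moreover have "finite {(i, j). e * l powi n / C \<le> av (f i) * l powi i * (av (g j) * l powi j)}"
      using conv_at_pair_null[OF l f g] e l C(1) by (simp add: pair_null_def)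
    ultimately show "finite {p. e \<le> av (u p)}" by (rule finite_subset)
  qed
  define b where "b = (\<lambda>(m::int, i::int). (i, m - i))"
  have b: "bij_betw b UNIV UNIV"
    unfolding b_def by (rule bij_betwI[of _ _ _ "\<lambda>(i, j). (i + j, i)"]) auto
  have nv: "null_family (\<lambda>p. u (b p))"
    unfolding null_family_def
  proof (intro allI impI)
    fix e :: real assume "0 < e"
    hence "finite (b -` {p. e \<le> av (u p)})"
      using nu b by (intro finite_vimageI) (auto simp: null_family_def bij_betw_def)
    thus "finite {p. e \<le> av (u (b p))}" by (simp add: vimage_def)
  qed
  have s1: "(\<lambda>j. g j * h (n - i - j)) summable_on UNIV" for i
    by (intro null_summable[OF sc] conv_at_null_mult[OF l g h])
  have s2: "(\<lambda>i. f i * g (m - i)) summable_on UNIV" for m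
    by (intro null_summable[OF sc] conv_at_null_mult[OF l f g])
  have "robba_mult f (robba_mult g h) n = infsum (\<lambda>i. infsum (\<lambda>j. u (i, j)) UNIV) UNIV"
    unfolding robba_mult_def u_def using s1 by (simp add: infsum_cmult_nonarch(1))
  also have "\<dots> = infsum u (Sigma UNIV (\<lambda>_. UNIV))"
    using null_summable[OF sc nu] infsum_cmult_nonarch(2)[OF s1]
    by (intro infsum_Sigma[OF uniformly_continuous_plus, symmetric]) (auto simp: u_def)
  also have "\<dots> = infsum (\<lambda>p. u (b p)) UNIV"
    using infsum_reindex_bij_betw[OF b, of u] by simp
  also have "\<dots> = infsum (\<lambda>p. u (b p)) (Sigma UNIV (\<lambda>_. UNIV))" by simp
  also have "\<dots> = infsum (\<lambda>m. infsum (\<lambda>i. u (b (m, i))) UNIV) UNIV"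
  proof (rule infsum_Sigma[OF uniformly_continuous_plus])
    show "(\<lambda>p. u (b p)) summable_on (UNIV \<times> UNIV)" using null_summable[OF sc nv] by simp
    show "(\<lambda>i. u (b (m, i))) summable_on UNIV" for m
      using infsum_cmult_nonarch(2)[OF s2[of m], of "h (n - m)"] by (simp add: u_def b_def mult_ac)
  qed
  also have "\<dots> = robba_mult (robba_mult f g) h n"
    unfolding robba_mult_def
    using infsum_cmult_nonarch(1)[OF s2, of "h (n - m)" m for m] by (simp add: u_def b_def mult_ac)
  finally show "robba_mult (robba_mult f g) h n = robba_mult f (robba_mult g h) n" ..
qed

lemma robba_common_radius:
  assumes "f \<in> carrier (robba :: (int \<Rightarrow> 'k) ring)" "g \<in> carrier robba" "h \<in> carrier robba"
  obtains l where "0 < l" "conv_at l f" "conv_at l g" "conv_at l h"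
proof -
  have "eventually (\<lambda>l. 0 < l \<and> conv_at l f \<and> conv_at l g \<and> conv_at l h) (at_left 1)"
    using eventually_at_left_1_pos assms unfolding robba_carrier_iff by eventually_elim auto
  thus thesis using that eventually_happens[of _ "at_left (1::real)"] by (auto simp: trivial_limit_at_left_real)
qed

lemma robba_closed:
  fixes f g :: "int \<Rightarrow> 'k"
  shows "f \<in> carrier robba \<Longrightarrow> g \<in> carrier robba \<Longrightarrow> (\<lambda>i. f i + g i) \<in> carrier robba"
    and "f \<in> carrier robba \<Longrightarrow> g \<in> carrier robba \<Longrightarrow> robba_mult f g \<in> carrier robba"
    and "f \<in> carrier robba \<Longrightarrow> (\<lambda>i. - f i) \<in> carrier robba"
proof -
  assume f: "f \<in> carrier robba"
  show "(\<lambda>i. - f i) \<in> carrier robba" using f by (simp add: robba_carrier_iff conv_at_def)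
  assume g: "g \<in> carrier robba"
  show "(\<lambda>i. f i + g i) \<in> carrier robba"
    using f g eventually_at_left_1_pos unfolding robba_carrier_iff by eventually_elim (auto intro: conv_at_add)
  show "robba_mult f g \<in> carrier robba"
    using f g eventually_at_left_1_pos unfolding robba_carrier_iff by eventually_elim (auto intro: conv_at_mult)
qed

lemma conv_at_finite:
  fixes f :: "int \<Rightarrow> 'k"
  assumes "finite A" "\<And>i. i \<notin> A \<Longrightarrow> f i = 0"
  shows "conv_at l f"
  unfolding conv_at_def
proof (intro allI impI)
  fix e :: real assume "0 < e"
  hence "{i. e \<le> av (f i) * l powi i} \<subseteq> A" using assms(2) by force
  thus "finite {i. e \<le> av (f i) * l powi i}" using assms(1) by (rule finite_subset)
qed

lemma robba_finite_closed:
  fixes f :: "int \<Rightarrow> 'k"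
  shows "finite A \<Longrightarrow> (\<And>i. i \<notin> A \<Longrightarrow> f i = 0) \<Longrightarrow> f \<in> carrier robba"
  unfolding robba_carrier_iff using conv_at_finite by (intro always_eventually allI) blast

lemma robba_cring: "cring (robba :: (int \<Rightarrow> 'k) ring)"
proof (rule cringI)
  show "abelian_group (robba :: (int \<Rightarrow> 'k) ring)"
  proof (rule abelian_groupI)
    fix x :: "int \<Rightarrow> 'k" assume x: "x \<in> carrier robba"
    thus "\<exists>y\<in>carrier robba. y \<oplus>\<^bsub>robba\<^esub> x = \<zero>\<^bsub>robba\<^esub>"
      by (intro bexI[of _ "\<lambda>i. - x i"]) (auto simp: robba_closed)
  next
    show "\<zero>\<^bsub>robba\<^esub> \<in> carrier (robba :: (int \<Rightarrow> 'k) ring)" by (rule robba_finite_closed[of "{}"]) auto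
  qed (simp_all add: robba_closed add_ac)
  show "Group.comm_monoid (robba :: (int \<Rightarrow> 'k) ring)"
  proof (rule comm_monoidI)
    show "\<one>\<^bsub>robba\<^esub> \<in> carrier (robba :: (int \<Rightarrow> 'k) ring)" by (rule robba_finite_closed[of "{0}"]) auto
    fix x y z :: "int \<Rightarrow> 'k" assume "x \<in> carrier robba" "y \<in> carrier robba" "z \<in> carrier robba"
    then obtain l where "0 < l" "conv_at l x" "conv_at l y" "conv_at l z" by (rule robba_common_radius)
    thus "x \<otimes>\<^bsub>robba\<^esub> y \<otimes>\<^bsub>robba\<^esub> z = x \<otimes>\<^bsub>robba\<^esub> (y \<otimes>\<^bsub>robba\<^esub> z)" by (simp add: robba_mult_assoc)
  next
    fix x y :: "int \<Rightarrow> 'k"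
    show "x \<otimes>\<^bsub>robba\<^esub> y = y \<otimes>\<^bsub>robba\<^esub> x" by (simp add: robba_mult_commute)
  qed (simp_all add: robba_closed robba_mult_1)
  fix x y z :: "int \<Rightarrow> 'k" assume "x \<in> carrier robba" "y \<in> carrier robba" "z \<in> carrier robba"
  then obtain l where "0 < l" "conv_at l x" "conv_at l y" "conv_at l z" by (rule robba_common_radius)
  thus "(x \<oplus>\<^bsub>robba\<^esub> y) \<otimes>\<^bsub>robba\<^esub> z = x \<otimes>\<^bsub>robba\<^esub> z \<oplus>\<^bsub>robba\<^esub> y \<otimes>\<^bsub>robba\<^esub> z"
    by (simp add: robba_mult_distrib)
qed

end

subsection \<open>The derivation\<close>

lemma conv_at_deriv:
  assumes "0 < l" "conv_at l f"
  shows "conv_at l (robba_deriv f)"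
proof (rule conv_at_le[OF assms(2), of _ "1 / l" "\<lambda>i. i + 1"])
  fix i
  have "av (robba_deriv f i) * l powi i \<le> 1 * av (f (i + 1)) * l powi i"
    using assms(1) unfolding robba_deriv_def av_mult by (intro mult_right_mono av_of_int_le_1) auto
  also have "\<dots> = 1 / l * (av (f (i + 1)) * l powi (i + 1))"
    using assms(1) by (simp add: power_int_add)
  finally show "av (robba_deriv f i) * l powi i \<le> 1 / l * (av (f (i + 1)) * l powi (i + 1))" .
qed (use assms in \<open>auto simp: inj_def\<close>)

lemma robba_deriv_closed: "f \<in> carrier robba \<Longrightarrow> robba_deriv f \<in> carrier robba"
  unfolding robba_carrier_iff
proof -
  assume "eventually (\<lambda>l. conv_at l f) (at_left 1)"
  with eventually_at_left_1_pos show "eventually (\<lambda>l. conv_at l (robba_deriv f)) (at_left 1)"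
    by eventually_elim (auto intro: conv_at_deriv)
qed

lemma robba_deriv_iter: "(robba_deriv ^^ m) f i = fact m * (of_int (i + int m) gchoose m) * f (i + int m)"
proof (induction m arbitrary: i)
  case (Suc m)
  have "fact (Suc m) * ((of_int (i + int (Suc m)) :: 'a) gchoose Suc m) =
      (of_int (i + int (Suc m)) - of_nat m) * (fact m * (of_int (i + int (Suc m)) gchoose m))"
    by (simp only: gbinomial_mult_fact prod.op_ivl_Suc) (simp add: mult.commute)
  thus ?case using Suc.IH[of "i + 1"] by (simp add: robba_deriv_def algebra_simps)
qed simp

text \<open>Iterated derivation is m! times integral binomial coefficients and a shift. The factor
  |m!| kept here is what later makes derivatives decay geometrically on circles close to 1.\<close>

lemma bnd_at_deriv_iter:
  fixes f :: "int \<Rightarrow> 'k::nonarch_field"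
  assumes "0 < l" "bnd_at l C f"
  shows "bnd_at l (av (fact m :: 'k) * C / l ^ m) ((robba_deriv ^^ m) f)"
  unfolding bnd_at_def
proof
  fix i
  have "av ((robba_deriv ^^ m) f i) * l powi i \<le> av (fact m :: 'k) * 1 * av (f (i + int m)) * l powi i"
    using assms(1) unfolding robba_deriv_iter av_mult
    by (intro mult_right_mono mult_left_mono av_gbinomial_le_1) auto
  also have "\<dots> = av (fact m :: 'k) / l ^ m * (av (f (i + int m)) * l powi (i + int m))"
    using assms(1) by (simp add: power_int_add)
  also have "\<dots> \<le> av (fact m :: 'k) / l ^ m * C"
    using assms by (intro mult_left_mono bnd_atD) auto
  finally show "av ((robba_deriv ^^ m) f i) * l powi i \<le> av (fact m :: 'k) * C / l ^ m" by simp
qed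

lemma robba_deriv_add: "robba_deriv (\<lambda>i. f i + g i) = (\<lambda>i. robba_deriv f i + robba_deriv g i)"
  by (rule ext) (simp add: robba_deriv_def algebra_simps)

text \<open>After a shift by one both products are sums over f_i g_(n+1-i), with factors i and
  n+1-i; these add up to n+1.\<close>

lemma robba_deriv_mult:
  fixes f g :: "int \<Rightarrow> 'k::nonarch_field"
  assumes sc: "spherically_complete TYPE('k)" and "0 < l" "conv_at l f" "conv_at l g"
  shows "robba_deriv (robba_mult f g) = (\<lambda>i. robba_mult (robba_deriv f) g i + robba_mult f (robba_deriv g) i)"
proof
  fix n
  have s: "(\<lambda>i. f i * g (n + 1 - i)) summable_on UNIV"
    by (intro null_summable[OF sc] conv_at_null_mult[OF assms(2-4)])
  have s1: "(\<lambda>i. robba_deriv f i * g (n - i)) summable_on UNIV"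
    by (intro null_summable[OF sc] conv_at_null_mult[OF assms(2)] conv_at_deriv assms)
  have s2: "(\<lambda>i. f i * robba_deriv g (n - i)) summable_on UNIV"
    by (intro null_summable[OF sc] conv_at_null_mult[OF assms(2)] conv_at_deriv assms)
  have b: "bij_betw (\<lambda>i::int. i - 1) UNIV UNIV" by (rule bij_betwI[of _ _ _ "\<lambda>i. i + 1"]) auto
  have s1': "(\<lambda>i. of_int i * f i * g (n + 1 - i)) summable_on UNIV"
    using summable_on_reindex_bij_betw[OF b, of "\<lambda>i. robba_deriv f i * g (n - i)"] s1
    by (simp add: robba_deriv_def algebra_simps)
  have "robba_mult (robba_deriv f) g n = infsum (\<lambda>i. of_int i * f i * g (n + 1 - i)) UNIV"
    using infsum_reindex_bij_betw[OF b, of "\<lambda>i. robba_deriv f i * g (n - i)"]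
    by (simp add: robba_mult_def robba_deriv_def algebra_simps)
  hence "robba_mult (robba_deriv f) g n + robba_mult f (robba_deriv g) n =
      infsum (\<lambda>i. of_int i * f i * g (n + 1 - i) + f i * robba_deriv g (n - i)) UNIV"
    using s1' s2 by (simp add: robba_mult_def infsum_add)
  also have "\<dots> = infsum (\<lambda>i. of_int (n + 1) * (f i * g (n + 1 - i))) UNIV"
  proof (rule infsum_cong)
    fix i :: int
    have c1: "n - i + 1 = n + 1 - i" by simp
    have c2: "of_int (n + 1) = (of_int i + of_int (n + 1 - i) :: 'k)" by (simp flip: of_int_add)
    show "of_int i * f i * g (n + 1 - i) + f i * robba_deriv g (n - i) = of_int (n + 1) * (f i * g (n + 1 - i))"
      unfolding robba_deriv_def c1 c2 by (simp only: ring_distribs mult.assoc mult.left_commute)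
  qed
  also have "\<dots> = robba_deriv (robba_mult f g) n"
    using infsum_cmult_nonarch(1)[OF s] by (simp add: robba_deriv_def robba_mult_def)
  finally show "robba_deriv (robba_mult f g) n = robba_mult (robba_deriv f) g n + robba_mult f (robba_deriv g) n" ..
qed

lemma poly_to_robba_closed: "poly_to_robba a \<in> carrier robba"
proof -
  have "conv_at l (poly_to_robba a)" for l
    unfolding conv_at_def
  proof (intro allI impI)
    fix e :: real assume "0 < e"
    hence "{i. e \<le> av (poly_to_robba a i) * l powi i} \<subseteq> {0..int (degree a)}"
    proof (intro subsetI)
      fix i assume "0 < e" "i \<in> {i. e \<le> av (poly_to_robba a i) * l powi i}"
      hence "poly_to_robba a i \<noteq> 0" by auto
      hence "0 \<le> i" "nat i \<le> degree a" by (auto simp: poly_to_robba_def split: if_splits intro: le_degree)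
      thus "i \<in> {0..int (degree a)}" by simp
    qed
    thus "finite {i. e \<le> av (poly_to_robba a i) * l powi i}" by (rule finite_subset) simp
  qed
  thus ?thesis by (simp add: robba_carrier_iff)
qed

lemma robba_deriv_poly: "robba_deriv (poly_to_robba a) = poly_to_robba (pderiv a)"
proof
  fix i
  have "nat (i + 1) = Suc (nat i)" if "0 \<le> i" using that by simp
  thus "robba_deriv (poly_to_robba a) i = poly_to_robba (pderiv a) i"
    by (cases "0 \<le> i"; cases "i = -1") (auto simp: robba_deriv_def poly_to_robba_def coeff_pderiv)
qed

section \<open>Gauss norms on the Weyl algebra\<close>

text \<open>The Gauss norm is the maximum of these weights. They are kept apart because the proof
  has to know at which monomial the maximum is attained.\<close>

definition wt :: "real \<Rightarrow> real \<Rightarrow> 'k::nonarch_field weyl \<Rightarrow> nat \<Rightarrow> nat \<Rightarrow> real" where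
  "wt l \<rho> F k i = av (coeff (coeff F k) i) * l ^ i * \<rho> ^ k"

lemma fact_coeff_pderiv_iter:
  "fact k * coeff ((pderiv ^^ n) p) k = fact (k + n) * coeff (p :: 'a::{comm_semiring_1,semiring_no_zero_divisors,semiring_char_0} poly) (k + n)"
proof (induction n arbitrary: k)
  case (Suc n)
  have "fact k * coeff ((pderiv ^^ Suc n) p) k = fact (Suc k) * coeff ((pderiv ^^ n) p) (Suc k)"
    by (simp add: coeff_pderiv mult_ac)
  thus ?case using Suc.IH[of "Suc k"] by simp
qed simp

locale gauss_weights =
  fixes l \<rho> :: real
  assumes l: "0 < l" and \<rho>: "0 < \<rho>" and l\<rho>: "1 < l * \<rho>"
begin

lemma wt_nonneg: "0 \<le> wt l \<rho> F k i"
  using l \<rho> by (simp add: wt_def)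

lemma wt_0_iff: "wt l \<rho> F k i = 0 \<longleftrightarrow> coeff (coeff F k) i = 0"
  using l \<rho> by (simp add: wt_def)

lemma wt_bound_iff: "wt l \<rho> F k i \<le> M \<longleftrightarrow> av (coeff (coeff F k) i) \<le> M / (l ^ i * \<rho> ^ k)"
  using l \<rho> by (simp add: wt_def pos_le_divide_eq mult.assoc)

lemma wt_less_iff: "wt l \<rho> F k i < M \<longleftrightarrow> av (coeff (coeff F k) i) < M / (l ^ i * \<rho> ^ k)"
  using l \<rho> by (simp add: wt_def pos_less_divide_eq mult.assoc)

text \<open>The order in the derivation is minimised first. With this tie-break a dominant
  coefficient of order below d places the chosen monomial of P below d even when the leading term
  has the same weight.\<close>

lemma lex_least_maximum:
  fixes F :: "'k::nonarch_field weyl"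
  assumes "F \<noteq> 0"
  obtains M k i where "0 < M" "wt l \<rho> F k i = M" "\<And>k' i'. wt l \<rho> F k' i' \<le> M"
    "\<And>k' i'. k' < k \<or> k' = k \<and> i' < i \<Longrightarrow> wt l \<rho> F k' i' < M"
proof -
  define S where "S = {(k, i). coeff (coeff F k) i \<noteq> 0}"
  have "S \<subseteq> Sigma {..degree F} (\<lambda>k. {..degree (coeff F k)})"
    using le_degree by (fastforce simp: S_def intro: le_degree)
  hence fin: "finite S" by (rule finite_subset) auto
  have ne: "S \<noteq> {}"
  proof -
    have "coeff F (degree F) \<noteq> 0" using assms by simp
    hence "(degree F, degree (coeff F (degree F))) \<in> S" by (simp add: S_def)
    thus ?thesis by blast
  qed
  define M where "M = Max ((\<lambda>(k, i). wt l \<rho> F k i) ` S)"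
  have "M \<in> (\<lambda>(k, i). wt l \<rho> F k i) ` S" unfolding M_def using fin ne by (intro Max_in) auto
  then obtain k1 i1 where ki: "(k1, i1) \<in> S" "wt l \<rho> F k1 i1 = M" by auto
  have M0: "0 < M" using ki wt_nonneg[of F k1 i1] wt_0_iff[of F k1 i1] by (auto simp: S_def)
  have le: "wt l \<rho> F k' i' \<le> M" for k' i'
  proof (cases "(k', i') \<in> S")
    case True
    thus ?thesis unfolding M_def using fin by (intro Max_ge) force+
  next
    case False
    hence "wt l \<rho> F k' i' = 0" by (simp add: S_def wt_0_iff)
    thus ?thesis using M0 by simp
  qed
  define k where "k = (LEAST k. \<exists>i. wt l \<rho> F k i = M)"
  have k: "\<exists>i. wt l \<rho> F k i = M" unfolding k_def using ki(2) by (rule LeastI[of _ k1, OF exI])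
  define i where "i = (LEAST i. wt l \<rho> F k i = M)"
  have i: "wt l \<rho> F k i = M" unfolding i_def using k by (rule LeastI_ex)
  have "wt l \<rho> F k' i' < M" if "k' < k \<or> k' = k \<and> i' < i" for k' i'
  proof -
    have "wt l \<rho> F k' i' \<noteq> M"
    proof (cases "k' < k")
      case True
      thus ?thesis using not_less_Least[of k' "\<lambda>k. \<exists>i. wt l \<rho> F k i = M"] unfolding k_def by blast
    next
      case False
      hence "k' = k" "i' < i" using that by auto
      thus ?thesis using not_less_Least[of i' "\<lambda>i. wt l \<rho> F k i = M"] unfolding i_def by blast
    qed
    thus ?thesis using le[of k' i'] by simp
  qed
  thus thesis using that[OF M0 i le] by blast
qed

lemma coeff2_mult:
  "coeff (coeff (F * G) K) I = (\<Sum>(k, i)\<in>{..K} \<times> {..I}. coeff (coeff F k) i * coeff (coeff G (K - k)) (I - i))"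
  for F G :: "'k::nonarch_field weyl"
  unfolding coeff_mult coeff_sum sum.cartesian_product[symmetric] ..

lemma term_weight:
  assumes "k \<le> K" "i \<le> I"
  shows "av (coeff (coeff F k) i * coeff (coeff G (K - k)) (I - i)) =
    wt l \<rho> F k i * wt l \<rho> G (K - k) (I - i) / (l ^ I * \<rho> ^ K)"
proof -
  have "l ^ I = l ^ i * l ^ (I - i)" "\<rho> ^ K = \<rho> ^ k * \<rho> ^ (K - k)"
    using assms by (simp_all flip: power_add)
  thus ?thesis using l \<rho> by (simp add: wt_def av_mult)
qed

lemma wt_mult_le:
  assumes "\<And>k i. wt l \<rho> F k i \<le> M1" "\<And>k i. wt l \<rho> G k i \<le> M2"
  shows "wt l \<rho> (F * G) K I \<le> M1 * M2"
proof -
  have M: "0 \<le> M1" "0 \<le> M2" using assms wt_nonneg order_trans by blast+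
  have "av (coeff (coeff F k) i * coeff (coeff G (K - k)) (I - i)) \<le> M1 * M2 / (l ^ I * \<rho> ^ K)"
    if "k \<le> K" "i \<le> I" for k i
    unfolding term_weight[OF that] using l \<rho> M wt_nonneg
    by (intro divide_right_mono mult_mono assms) auto
  thus ?thesis unfolding wt_bound_iff coeff2_mult using M l \<rho> by (intro av_sum_le) auto
qed

lemma wt_sum_less:
  assumes "0 < M" "finite A" "\<And>a. a \<in> A \<Longrightarrow> wt l \<rho> (F a) k i < M"
  shows "wt l \<rho> (sum F A) k i < M"
  unfolding wt_less_iff coeff_sum
proof (rule av_sum_less)
  show "0 < M / (l ^ i * \<rho> ^ k)" using assms(1) l \<rho> by simp
  show "av (coeff (coeff (F a) k) i) < M / (l ^ i * \<rho> ^ k)" if "a \<in> A" for a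
    using assms(3)[OF that] unfolding wt_less_iff .
qed (rule assms(2))

lemma wt_pderiv_iter:
  assumes "\<And>k i. wt l \<rho> F k i \<le> M"
  shows "wt l \<rho> ([:[:1 / fact n:]:] * (pderiv ^^ n) F) k i \<le> M / \<rho> ^ n"
proof -
  have "coeff ([:[:1 / fact n:]:] * (pderiv ^^ n) F) k = Polynomial.smult (of_nat ((k + n) choose n)) (coeff F (k + n))"
  proof -
    have "fact k * coeff ([:[:1 / fact n:]:] * (pderiv ^^ n) F) k
        = [:1 / fact n:] * (fact k * coeff ((pderiv ^^ n) F) k)" by simp
    also have "\<dots> = [:1 / fact n:] * (fact (k + n) * coeff F (k + n))"
      by (simp only: fact_coeff_pderiv_iter)
    also have "(fact (k + n) :: 'a poly) = fact k * fact n * of_nat ((k + n) choose n)"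
      using arg_cong[OF binomial_fact_lemma[of n "k + n"], of "of_nat :: nat \<Rightarrow> 'a poly"] by (simp add: mult_ac)
    also have "[:1 / fact n:] * (fact k * fact n * of_nat ((k + n) choose n) * coeff F (k + n)) =
       fact k * (([:1 / fact n:] * fact n) * (of_nat ((k + n) choose n) * coeff F (k + n)))"
      by (simp only: ac_simps)
    also have "[:1 / fact n:] * fact n = (1 :: 'a poly)"
    proof -
      have "(fact n :: 'a poly) = [:fact n:]" by (metis of_nat_fact of_nat_poly)
      thus ?thesis by (simp flip: one_pCons)
    qed
    finally have "fact k * coeff ([:[:1 / fact n:]:] * (pderiv ^^ n) F) k =
        fact k * (of_nat ((k + n) choose n) * coeff F (k + n))" by simp
    hence "coeff ([:[:1 / fact n:]:] * (pderiv ^^ n) F) k = of_nat ((k + n) choose n) * coeff F (k + n)"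
      by (rule mult_left_cancel[OF fact_nonzero, THEN iffD1])
    thus ?thesis by (simp add: of_nat_poly)
  qed
  hence "wt l \<rho> ([:[:1 / fact n:]:] * (pderiv ^^ n) F) k i =
      av (of_nat ((k + n) choose n) :: 'a) * (wt l \<rho> F (k + n) i / \<rho> ^ n)"
    using \<rho> by (simp add: wt_def av_mult power_add)
  also have "\<dots> \<le> 1 * (wt l \<rho> F (k + n) i / \<rho> ^ n)"
    using \<rho> by (intro mult_right_mono av_of_nat_le_1 divide_nonneg_nonneg wt_nonneg) simp
  also have "\<dots> \<le> M / \<rho> ^ n" using assms[of "k + n" i] \<rho> by (simp add: divide_right_mono)
  finally show ?thesis .
qed

lemma wt_map_pderiv_iter:
  assumes "\<And>k i. wt l \<rho> F k i \<le> M"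
  shows "wt l \<rho> (map_poly (pderiv ^^ n) F) k i \<le> M / l ^ n"
proof (induction n arbitrary: i)
  case 0
  thus ?case using assms by (simp add: map_poly_idI)
next
  case (Suc n)
  have "wt l \<rho> (map_poly (pderiv ^^ Suc n) F) k i =
      av (of_nat (Suc i) :: 'a) * (wt l \<rho> (map_poly (pderiv ^^ n) F) k (Suc i) / l)"
  proof -
    have "coeff (coeff (map_poly (pderiv ^^ Suc n) F) k) i =
        of_nat (Suc i) * coeff (coeff (map_poly (pderiv ^^ n) F) k) (Suc i)"
      unfolding coeff_map_pderiv_iter unfolding funpow.simps comp_apply coeff_pderiv ..
    thus ?thesis using l unfolding wt_def by (simp add: av_mult del: of_nat_Suc funpow.simps)
  qed
  also have "\<dots> \<le> 1 * (wt l \<rho> (map_poly (pderiv ^^ n) F) k (Suc i) / l)"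
    using l by (intro mult_right_mono av_of_nat_le_1 divide_nonneg_nonneg wt_nonneg) simp
  also have "\<dots> \<le> M / l ^ n / l" using l unfolding mult_1 by (intro divide_right_mono Suc.IH) simp
  finally show ?case by (simp only: power_Suc2 divide_divide_eq_left)
qed

text \<open>Divided by \<alpha>!, the derivations in the symbol of the derivation lose
  \<rho>^(-\<alpha>), those in t lose l^(-\<alpha>). So the \<alpha>-th correction carries a factor
  (l \<rho>)^(-\<alpha>) < 1.\<close>

lemma wt_correction:
  assumes M: "0 < M1" "0 < M2" and F: "\<And>k i. wt l \<rho> F k i \<le> M1" and G: "\<And>k i. wt l \<rho> G k i \<le> M2"
  shows "wt l \<rho> (\<Sum>\<alpha>=1..degree F. [:[:1 / fact \<alpha>:]:] * (pderiv ^^ \<alpha>) F * map_poly (pderiv ^^ \<alpha>) G) K I < M1 * M2"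
proof (rule wt_sum_less)
  fix \<alpha> assume "\<alpha> \<in> {1..degree F}"
  have "wt l \<rho> ([:[:1 / fact \<alpha>:]:] * (pderiv ^^ \<alpha>) F * map_poly (pderiv ^^ \<alpha>) G) K I \<le> (M1 / \<rho> ^ \<alpha>) * (M2 / l ^ \<alpha>)"
    by (intro wt_mult_le wt_pderiv_iter wt_map_pderiv_iter F G)
  also have "\<dots> = M1 * M2 / (l * \<rho>) ^ \<alpha>" by (simp add: power_mult_distrib mult.commute)
  also have "\<dots> < M1 * M2 / 1"
    using M l\<rho> \<open>\<alpha> \<in> _\<close> by (intro divide_strict_left_mono) auto
  finally show "wt l \<rho> ([:[:1 / fact \<alpha>:]:] * (pderiv ^^ \<alpha>) F * map_poly (pderiv ^^ \<alpha>) G) K I < M1 * M2" by simp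
qed (use M in auto)

lemma wt_weyl_mult_le:
  assumes M: "0 < M1" "0 < M2" and F: "\<And>k i. wt l \<rho> F k i \<le> M1" and G: "\<And>k i. wt l \<rho> G k i \<le> M2"
  shows "wt l \<rho> (weyl_mult F G) K I \<le> M1 * M2"
  unfolding weyl_mult_split wt_bound_iff coeff_add
  by (rule av_add_le[OF wt_mult_le[OF F G, unfolded wt_bound_iff]
      less_imp_le[OF wt_correction[OF assms, unfolded wt_less_iff]]])

text \<open>As in Gauss's lemma: in the coefficient at the sum of the two least positions, every
  other pair has a member before its least position and hence strictly smaller weight.\<close>

lemma wt_mult_lex_least:
  assumes M: "0 < M1" "0 < M2"
    and F: "\<And>k i. wt l \<rho> F k i \<le> M1" "wt l \<rho> F k1 i1 = M1"
      "\<And>k i. k < k1 \<or> k = k1 \<and> i < i1 \<Longrightarrow> wt l \<rho> F k i < M1"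
    and G: "\<And>k i. wt l \<rho> G k i \<le> M2" "wt l \<rho> G k2 i2 = M2"
      "\<And>k i. k < k2 \<or> k = k2 \<and> i < i2 \<Longrightarrow> wt l \<rho> G k i < M2"
  shows "wt l \<rho> (F * G) (k1 + k2) (i1 + i2) = M1 * M2"
proof -
  let ?K = "k1 + k2" and ?I = "i1 + i2"
  let ?t = "\<lambda>(k, i). coeff (coeff F k) i * coeff (coeff G (?K - k)) (?I - i)"
  let ?A = "{..?K} \<times> {..?I}"
  have eq: "coeff (coeff (F * G) ?K) ?I = ?t (k1, i1) + sum ?t (?A - {(k1, i1)})"
    unfolding coeff2_mult by (rule sum.remove) auto
  have main: "av (?t (k1, i1)) = M1 * M2 / (l ^ ?I * \<rho> ^ ?K)"
    using term_weight[of k1 ?K i1 ?I F G] by (simp add: F(2) G(2))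
  have "av (sum ?t (?A - {(k1, i1)})) < M1 * M2 / (l ^ ?I * \<rho> ^ ?K)"
  proof (rule av_sum_less)
    fix x assume x: "x \<in> ?A - {(k1, i1)}"
    obtain k i where ki: "x = (k, i)" by (cases x) auto
    have le: "k \<le> ?K" "i \<le> ?I" and ne: "k \<noteq> k1 \<or> i \<noteq> i1" using x ki by auto
    have "wt l \<rho> F k i * wt l \<rho> G (?K - k) (?I - i) < M1 * M2"
    proof -
      consider "k < k1 \<or> k = k1 \<and> i < i1" | "?K - k < k2 \<or> ?K - k = k2 \<and> ?I - i < i2"
        using ne le by linarith
      thus ?thesis
      proof cases
        case 1
        hence "wt l \<rho> F k i * wt l \<rho> G (?K - k) (?I - i) \<le> wt l \<rho> F k i * M2"
          using G(1) wt_nonneg by (intro mult_left_mono) auto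
        also have "\<dots> < M1 * M2" using F(3)[OF 1] M by simp
        finally show ?thesis .
      next
        case 2
        hence "wt l \<rho> F k i * wt l \<rho> G (?K - k) (?I - i) \<le> M1 * wt l \<rho> G (?K - k) (?I - i)"
          using F(1) wt_nonneg by (intro mult_right_mono) auto
        also have "\<dots> < M1 * M2" using G(3)[OF 2] M by simp
        finally show ?thesis .
      qed
    qed
    thus "av (?t x) < M1 * M2 / (l ^ ?I * \<rho> ^ ?K)"
      unfolding ki prod.case term_weight[OF le] using l \<rho> by (intro divide_strict_right_mono) auto
  qed (use M l \<rho> in auto)
  hence "av (?t (k1, i1) + sum ?t (?A - {(k1, i1)})) = av (?t (k1, i1))"
    unfolding main[symmetric] by (rule av_add_eq)
  hence "av (coeff (coeff (F * G) ?K) ?I) = M1 * M2 / (l ^ ?I * \<rho> ^ ?K)"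
    unfolding eq main .
  thus ?thesis using l \<rho> by (simp add: wt_def)
qed

text \<open>The Gauss norm is multiplicative on the Weyl algebra because \<open>l \<rho> > 1\<close> makes the commutators
  \<open>[\<partial>, t]\<close> negligible.\<close>

lemma wt_weyl_mult_lex_least:
  assumes M: "0 < M1" "0 < M2"
    and F: "\<And>k i. wt l \<rho> F k i \<le> M1" "wt l \<rho> F k1 i1 = M1"
      "\<And>k i. k < k1 \<or> k = k1 \<and> i < i1 \<Longrightarrow> wt l \<rho> F k i < M1"
    and G: "\<And>k i. wt l \<rho> G k i \<le> M2" "wt l \<rho> G k2 i2 = M2"
      "\<And>k i. k < k2 \<or> k = k2 \<and> i < i2 \<Longrightarrow> wt l \<rho> G k i < M2"
  shows "wt l \<rho> (weyl_mult F G) (k1 + k2) (i1 + i2) = M1 * M2"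
proof -
  let ?K = "k1 + k2" and ?I = "i1 + i2"
  let ?E = "\<Sum>\<alpha>=1..degree F. [:[:1 / fact \<alpha>:]:] * (pderiv ^^ \<alpha>) F * map_poly (pderiv ^^ \<alpha>) G"
  have a: "av (coeff (coeff (F * G) ?K) ?I) = M1 * M2 / (l ^ ?I * \<rho> ^ ?K)"
    using wt_mult_lex_least[OF assms] l \<rho> by (simp add: wt_def field_simps)
  have "av (coeff (coeff ?E ?K) ?I) < M1 * M2 / (l ^ ?I * \<rho> ^ ?K)"
    using wt_correction[OF M F(1) G(1), of ?K ?I] unfolding wt_less_iff .
  hence "av (coeff (coeff (F * G) ?K) ?I + coeff (coeff ?E ?K) ?I) = av (coeff (coeff (F * G) ?K) ?I)"
    unfolding a[symmetric] by (rule av_add_eq)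
  hence "av (coeff (coeff (weyl_mult F G) ?K) ?I) = M1 * M2 / (l ^ ?I * \<rho> ^ ?K)"
    unfolding weyl_mult_split coeff_add a .
  thus ?thesis using l \<rho> by (simp add: wt_def)
qed

end

subsection \<open>Remainders modulo \<open>P\<close> after inverting \<open>t\<close>\<close>

lemma smult_weyl_mult: "Polynomial.smult a (weyl_mult F G) = weyl_mult (Polynomial.smult a F) G"
  unfolding weyl_mult_const_left[symmetric] weyl_mult_assoc ..

text \<open>The element t^(-N) a of the Robba ring.\<close>

definition laurent_shift :: "nat \<Rightarrow> 'k::nonarch_field poly \<Rightarrow> int \<Rightarrow> 'k" where
  "laurent_shift N a i = (if 0 \<le> i + int N then coeff a (nat (i + int N)) else 0)"

lemma laurent_shift_monom: "laurent_shift (N + M) (monom 1 M * a) = laurent_shift N a"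
proof
  fix i
  have "coeff (monom 1 M * a) n = (if M \<le> n then coeff a (n - M) else 0)" for n
    by (simp add: coeff_monom_mult)
  moreover have "nat (i + int (N + M)) - M = nat (i + int N)" "M \<le> nat (i + int (N + M)) \<longleftrightarrow> M = 0 \<or> 0 \<le> i + int N"
    by auto
  ultimately show "laurent_shift (N + M) (monom 1 M * a) i = laurent_shift N a i"
    unfolding laurent_shift_def by auto
qed

lemma laurent_shift_add: "laurent_shift N (a + b) = (\<lambda>i. laurent_shift N a i + laurent_shift N b i)"
  by (rule ext) (simp add: laurent_shift_def)

lemma laurent_shift_mult: "laurent_shift N (a * b) = robba_mult (poly_to_robba a) (laurent_shift N b)"
proof
  fix n
  have "robba_mult (poly_to_robba a) (laurent_shift N b) n =
      (\<Sum>i\<in>{0..int (degree a)}. poly_to_robba a i * laurent_shift N b (n - i))"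
    by (rule robba_mult_finite) (auto simp: poly_to_robba_def coeff_eq_0 not_le)
  also have "\<dots> = (\<Sum>i\<le>degree a. coeff a i * laurent_shift N b (n - int i))"
    by (rule sum.reindex_bij_witness[of _ int nat]) (auto simp: poly_to_robba_def)
  also have "\<dots> = laurent_shift N (a * b) n"
  proof (cases "0 \<le> n + int N")
    case True
    define m where "m = nat (n + int N)"
    have *: "laurent_shift N b (n - int i) = (if i \<le> m then coeff b (m - i) else 0)" for i
    proof -
      have "0 \<le> n - int i + int N \<longleftrightarrow> i \<le> m" "nat (n - int i + int N) = m - i"
        using True by (auto simp: m_def)
      thus ?thesis by (simp add: laurent_shift_def)
    qed
    have "(\<Sum>i\<le>degree a. coeff a i * laurent_shift N b (n - int i)) =
        (\<Sum>i\<le>max m (degree a). if i \<le> m then coeff a i * coeff b (m - i) else 0)"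
      unfolding * by (rule sum.mono_neutral_cong_left) (auto simp: coeff_eq_0)
    also have "\<dots> = (\<Sum>i\<le>m. coeff a i * coeff b (m - i))"
      by (rule sum.mono_neutral_cong_right) auto
    finally show ?thesis using True by (simp add: laurent_shift_def coeff_mult m_def)
  next
    case False
    hence "laurent_shift N b (n - int i) = 0" for i by (simp add: laurent_shift_def)
    thus ?thesis using False by (simp add: laurent_shift_def)
  qed
  finally show "laurent_shift N (a * b) n = robba_mult (poly_to_robba a) (laurent_shift N b) n" ..
qed

lemma laurent_shift_closed: "laurent_shift N a \<in> carrier robba"
proof -
  have "conv_at l (laurent_shift N a)" for l
    unfolding conv_at_def
  proof (intro allI impI)
    fix e :: real assume "0 < e"
    have "{i. e \<le> av (laurent_shift N a i) * l powi i} \<subseteq> {- int N..int (degree a)}"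
    proof (intro subsetI)
      fix i assume "i \<in> {i. e \<le> av (laurent_shift N a i) * l powi i}"
      hence "laurent_shift N a i \<noteq> 0" using \<open>0 < e\<close> by auto
      hence "0 \<le> i + int N" "nat (i + int N) \<le> degree a"
        by (auto simp: laurent_shift_def split: if_splits intro: le_degree)
      thus "i \<in> {- int N..int (degree a)}" by simp
    qed
    thus "finite {i. e \<le> av (laurent_shift N a i) * l powi i}" by (rule finite_subset) simp
  qed
  thus ?thesis by (simp add: robba_carrier_iff)
qed

locale laurent_remainder =
  fixes P :: "'k::nonarch_field weyl" and d \<delta> :: nat and \<alpha> :: 'k
  assumes degP: "degree P \<le> d" and top: "coeff P d = monom \<alpha> \<delta>" and \<alpha>0: "\<alpha> \<noteq> 0"
begin

text \<open>Over K[t, 1/t] the leading coefficient of P is a unit and division with remainder is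
  possible. Clearing denominators by t^N avoids a localised Weyl algebra; the actual remainder is
  t^(-N) R.\<close>

definition rem_rep :: "'k weyl \<Rightarrow> nat \<Rightarrow> 'k weyl \<Rightarrow> 'k weyl \<Rightarrow> bool" where
  "rem_rep G N Q R \<longleftrightarrow> Polynomial.smult (monom 1 N) G = weyl_mult Q P + R \<and> (\<forall>k\<ge>d. coeff R k = 0)"

lemma coeff_mult_P_top: "coeff (weyl_mult Q P) (degree Q + d) = lead_coeff Q * monom \<alpha> \<delta>"
  using weyl_mult_coeff_top(1)[OF order_refl degP, of Q] by (simp add: top)

lemma mult_P_eq_0:
  assumes "\<And>k. d \<le> k \<Longrightarrow> coeff (weyl_mult Q P) k = 0"
  shows "Q = 0"
proof (rule ccontr)
  assume "Q \<noteq> 0"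
  moreover have "lead_coeff Q * monom \<alpha> \<delta> = 0"
    using coeff_mult_P_top[of Q] assms[of "degree Q + d"] by simp
  ultimately show False using \<alpha>0 by (simp add: monom_eq_0_iff)
qed

lemma rem_rep_exists: "\<exists>N Q R. rem_rep G N Q R"
proof -
  have "(\<forall>k\<ge>n. coeff G k = 0) \<Longrightarrow> \<exists>N Q R. rem_rep G N Q R" for n
  proof (induction n arbitrary: G)
    case 0
    hence "G = 0" by (intro poly_eqI) simp
    thus ?case by (intro exI[of _ 0]) (simp add: rem_rep_def)
  next
    case (Suc n)
    show ?case
    proof (cases "n < d")
      case True
      hence "rem_rep G 0 0 G" using Suc.prems by (simp add: rem_rep_def monom_0 flip: one_pCons)
      thus ?thesis by blast
    next
      case False
      \<comment> \<open>X P has leading coefficient t^\<delta> times that of G at order n, so one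
        multiplication by t^\<delta> clears the division by the leading coefficient of P.\<close>
      define X where "X = monom (Polynomial.smult (1 / \<alpha>) (coeff G n)) (n - d)"
      define H where "H = Polynomial.smult (monom 1 \<delta>) G - weyl_mult X P"
      have dX: "degree X \<le> n - d" by (simp add: X_def degree_monom_le)
      have "coeff H k = 0" if k: "n \<le> k" for k
      proof (cases "k = n")
        case True
        have "coeff (weyl_mult X P) n = Polynomial.smult (1 / \<alpha>) (coeff G n) * monom \<alpha> \<delta>"
          using weyl_mult_coeff_top(1)[OF dX degP] False by (simp add: X_def top)
        also have "\<dots> = monom 1 \<delta> * coeff G n"
          using \<alpha>0 by (simp add: mult.commute smult_monom flip: mult_smult_left)
        finally show ?thesis using True by (simp add: H_def)
      next
        case ne: False
        have "degree (weyl_mult X P) \<le> n" using weyl_mult_coeff_top(2)[OF dX degP] False by simp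
        hence "coeff (weyl_mult X P) k = 0" using ne k by (intro coeff_eq_0) simp
        thus ?thesis using Suc.prems ne k by (simp add: H_def)
      qed
      then obtain N Q R where "rem_rep H N Q R" using Suc.IH by blast
      hence R: "Polynomial.smult (monom 1 N) H = weyl_mult Q P + R" "\<forall>k\<ge>d. coeff R k = 0"
        by (auto simp: rem_rep_def)
      have "Polynomial.smult (monom 1 (N + \<delta>)) G =
          Polynomial.smult (monom 1 N) H + Polynomial.smult (monom 1 N) (weyl_mult X P)"
        by (simp add: H_def smult_diff_right mult_monom)
      also have "\<dots> = weyl_mult (Q + Polynomial.smult (monom 1 N) X) P + R"
        unfolding R(1) smult_weyl_mult weyl_mult_distrib_right by simp
      finally have "rem_rep G (N + \<delta>) (Q + Polynomial.smult (monom 1 N) X) R"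
        using R(2) by (simp add: rem_rep_def)
      thus ?thesis by blast
    qed
  qed
  moreover have "\<forall>k\<ge>Suc (degree G). coeff G k = 0" by (simp add: coeff_eq_0)
  ultimately show ?thesis by blast
qed

text \<open>Multiplying each representation by the other's power of t, the two remainders differ by
  a left multiple of P of order below d. By \<open>mult_P_eq_0\<close> the multiplier is
  zero.\<close>

lemma rem_rep_unique:
  assumes "rem_rep G N Q R" "rem_rep G N' Q' R'"
  shows "laurent_shift N (coeff R k) = laurent_shift N' (coeff R' k)"
proof -
  let ?s = "\<lambda>M. Polynomial.smult (monom 1 M :: 'k poly)"
  have e: "?s N G = weyl_mult Q P + R" "?s N' G = weyl_mult Q' P + R'"
    and z: "\<And>k. d \<le> k \<Longrightarrow> coeff R k = 0" "\<And>k. d \<le> k \<Longrightarrow> coeff R' k = 0"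
    using assms by (auto simp: rem_rep_def)
  have "?s N' (?s N G) = ?s N (?s N' G)" by (simp add: mult.commute)
  hence "weyl_mult (?s N' Q - ?s N Q') P = ?s N R' - ?s N' R"
    unfolding e smult_add_right smult_weyl_mult weyl_mult_diff_right by (simp add: algebra_simps)
  moreover from this have "?s N' Q - ?s N Q' = 0" by (intro mult_P_eq_0) (simp add: z)
  ultimately have "?s N R' = ?s N' R" by simp
  hence "monom 1 N * coeff R' k = monom 1 N' * coeff R k" by (metis coeff_smult)
  thus ?thesis using laurent_shift_monom[of N N' "coeff R k"] laurent_shift_monom[of N' N "coeff R' k"]
    by (simp add: add.commute)
qed

text \<open>The k-th coordinate of G modulo P over K[t, 1/t], relative to the powers of the
  derivation below d. The choice is harmless by \<open>rem_rep_unique\<close>.\<close>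

definition psi :: "'k weyl \<Rightarrow> nat \<Rightarrow> int \<Rightarrow> 'k" where
  "psi G k = (SOME h. \<exists>N Q R. rem_rep G N Q R \<and> h = laurent_shift N (coeff R k))"

lemma psi_eq: "rem_rep G N Q R \<Longrightarrow> psi G k = laurent_shift N (coeff R k)"
proof -
  assume R: "rem_rep G N Q R"
  hence "\<exists>N Q R. rem_rep G N Q R \<and> psi G k = laurent_shift N (coeff R k)"
    unfolding psi_def by (intro someI_ex[of "\<lambda>h. \<exists>N Q R. rem_rep G N Q R \<and> h = laurent_shift N (coeff R k)"]) blast
  then obtain N' Q' R' where "rem_rep G N' Q' R'" "psi G k = laurent_shift N' (coeff R' k)" by blast
  thus ?thesis using rem_rep_unique[OF R, of N' Q' R' k] by simp
qed

lemma psi_add: "psi (F + G) k = (\<lambda>i. psi F k i + psi G k i)"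
proof -
  let ?s = "\<lambda>M. Polynomial.smult (monom 1 M :: 'k poly)"
  obtain N Q R N' Q' R' where r: "rem_rep F N Q R" "rem_rep G N' Q' R'" using rem_rep_exists by metis
  have "?s (N + N') (F + G) = ?s N' (?s N F) + ?s N (?s N' G)"
    by (simp add: smult_add_right mult_monom add.commute)
  also have "\<dots> = weyl_mult (?s N' Q + ?s N Q') P + (?s N' R + ?s N R')"
    using r by (simp add: rem_rep_def smult_add_right smult_weyl_mult weyl_mult_distrib_right)
  finally have "rem_rep (F + G) (N + N') (?s N' Q + ?s N Q') (?s N' R + ?s N R')"
    using r by (simp add: rem_rep_def)
  from psi_eq[OF this, of k] show ?thesis
    using psi_eq[OF r(1), of k] psi_eq[OF r(2), of k]
      laurent_shift_monom[of N N' "coeff R k"] laurent_shift_monom[of N' N "coeff R' k"]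
    by (simp add: laurent_shift_add add.commute)
qed

lemma psi_smult: "psi (Polynomial.smult a G) k = robba_mult (poly_to_robba a) (psi G k)"
proof -
  obtain N Q R where r: "rem_rep G N Q R" using rem_rep_exists by metis
  have "Polynomial.smult (monom 1 N) (Polynomial.smult a G) = Polynomial.smult a (Polynomial.smult (monom 1 N) G)"
    by (simp add: mult.commute)
  also have "\<dots> = weyl_mult (Polynomial.smult a Q) P + Polynomial.smult a R"
    using r by (simp add: rem_rep_def smult_add_right smult_weyl_mult)
  finally have "rem_rep (Polynomial.smult a G) N (Polynomial.smult a Q) (Polynomial.smult a R)"
    using r by (simp add: rem_rep_def)
  from psi_eq[OF this, of k] show ?thesis using psi_eq[OF r, of k] by (simp add: laurent_shift_mult)
qed

lemma psi_ideal: "psi (weyl_mult Q P) k = (\<lambda>_. 0)"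
proof -
  have "rem_rep (weyl_mult Q P) 0 Q 0" by (simp add: rem_rep_def monom_0 flip: one_pCons)
  from psi_eq[OF this, of k] show ?thesis by (auto simp: laurent_shift_def)
qed

lemma psi_closed: "psi G k \<in> carrier robba"
  using rem_rep_exists[of G] psi_eq laurent_shift_closed by metis

lemma psi_cong: "cyc P F = cyc P G \<Longrightarrow> psi F k = psi G k"
proof -
  assume "cyc P F = cyc P G"
  then obtain Q where "F - G = weyl_mult Q P" unfolding cyc_eq_iff by blast
  hence "F = weyl_mult Q P + G" by (simp add: algebra_simps)
  thus ?thesis by (simp add: psi_add psi_ideal)
qed

text \<open>If some coefficient of \<open>P\<close> dominates the leading one, then the quotient in
  \<open>t\<^sup>N \<partial>\<^sup>n = Q P + R\<close> creates in \<open>Q P\<close> a dominant monomial of order \<open>< n\<close>, which \<open>R\<close> has to cancel.\<close>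

lemma psi_lower_bound:
  assumes "gauss_weights l \<rho>" and k0: "k0 < d" "wt l \<rho> P d \<delta> \<le> wt l \<rho> P k0 i0" and n: "d \<le> n"
  shows "\<exists>k<d. \<exists>i. \<rho> ^ n \<le> av (psi (monom 1 n) k i) * l powi i * \<rho> ^ k"
proof -
  interpret gauss_weights l \<rho> by fact
  obtain N Q R where r: "rem_rep (monom 1 n) N Q R" using rem_rep_exists by metis
  hence e: "monom (monom 1 N) n = weyl_mult Q P + R" and z: "\<And>k. d \<le> k \<Longrightarrow> coeff R k = 0"
    by (auto simp: rem_rep_def smult_monom)
  have cQP: "coeff (weyl_mult Q P) k = (if k = n then monom 1 N else 0) - coeff R k" for k
  proof -
    have "coeff (monom (monom 1 N) n) k = coeff (weyl_mult Q P) k + coeff R k" unfolding e coeff_add ..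
    hence "coeff (weyl_mult Q P) k = coeff (monom (monom 1 N) n) k - coeff R k"
      by (simp only: add_diff_cancel_right')
    thus ?thesis by auto
  qed
  have Q0: "Q \<noteq> 0"
  proof
    assume "Q = 0"
    hence "monom 1 N = (0 :: 'k poly)" using cQP[of n] z[OF n] by simp
    thus False by (simp add: monom_eq_0_iff)
  qed
  \<comment> \<open>The leading coefficient of Q P cannot be cancelled by R, which has order below
    d, so it must be that of t^N times the n-th derivation.\<close>
  have degQ: "degree Q + d = n"
  proof (rule ccontr)
    assume "degree Q + d \<noteq> n"
    hence "lead_coeff Q * monom \<alpha> \<delta> = 0" using coeff_mult_P_top[of Q] cQP z by simp
    thus False using Q0 \<alpha>0 by (simp add: monom_eq_0_iff)
  qed
  have P0: "P \<noteq> 0" using top \<alpha>0 by (auto simp: monom_eq_0_iff)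
  obtain M1 k1 i1 where q: "0 < M1" "wt l \<rho> Q k1 i1 = M1" "\<And>k i. wt l \<rho> Q k i \<le> M1"
    "\<And>k i. k < k1 \<or> k = k1 \<and> i < i1 \<Longrightarrow> wt l \<rho> Q k i < M1" by (rule lex_least_maximum[OF Q0]) blast
  obtain M2 k2 i2 where p: "0 < M2" "wt l \<rho> P k2 i2 = M2" "\<And>k i. wt l \<rho> P k i \<le> M2"
    "\<And>k i. k < k2 \<or> k = k2 \<and> i < i2 \<Longrightarrow> wt l \<rho> P k i < M2" by (rule lex_least_maximum[OF P0]) blast
  have k1: "k1 \<le> degree Q"
  proof (rule ccontr)
    assume "\<not> k1 \<le> degree Q"
    hence "wt l \<rho> Q k1 i1 = 0" by (simp add: wt_def coeff_eq_0)
    thus False using q by simp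
  qed
  \<comment> \<open>A maximal monomial of order d would be t^\<delta>; the one at (k0, i0) weighs at
    least as much and has smaller order, against minimality.\<close>
  have k2: "k2 < d"
  proof (rule ccontr)
    assume "\<not> k2 < d"
    moreover have "coeff (coeff P k2) i2 \<noteq> 0" using p wt_0_iff[of P k2 i2] by force
    moreover from this have "k2 \<le> d" using degP by (metis coeff_0 coeff_eq_0 le_less_trans not_le)
    ultimately have "k2 = d" "i2 = \<delta>" using top by (auto split: if_splits simp: coeff_monom)
    hence "M2 \<le> wt l \<rho> P k0 i0" using k0(2) p(2) by simp
    thus False using p(4)[of k0 i0] k0(1) \<open>k2 = d\<close> by simp
  qed
  define K I where "K = k1 + k2" and "I = i1 + i2"
  have Kn: "K < n" using k1 k2 degQ by (simp add: K_def)
  have w: "wt l \<rho> (weyl_mult Q P) K I = M1 * M2"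
    unfolding K_def I_def using q p by (intro wt_weyl_mult_lex_least) auto
  \<comment> \<open>At order n the product is exactly t^N, since R has no term there.
    Submultiplicativity then bounds M1 M2 from below.\<close>
  have "wt l \<rho> (weyl_mult Q P) n N \<le> M1 * M2" using q p by (intro wt_weyl_mult_le) auto
  hence top_le: "l ^ N * \<rho> ^ n \<le> M1 * M2" using cQP[of n] z[OF n] by (simp add: wt_def)
  \<comment> \<open>The order of the monomial is below n, so nothing but R can cancel it; hence its
    order is even below d.\<close>
  have cR: "coeff (coeff (weyl_mult Q P) K) I = - coeff (coeff R K) I" using cQP[of K] Kn by simp
  have Kd: "K < d"
  proof (rule ccontr)
    assume "\<not> K < d"
    hence "wt l \<rho> (weyl_mult Q P) K I = 0" using cR z[of K] by (simp add: wt_def)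
    thus False using w q(1) p(1) by simp
  qed
  have "psi (monom 1 n) K (int I - int N) = coeff (coeff R K) I"
    using psi_eq[OF r, of K] by (simp add: laurent_shift_def)
  hence "av (psi (monom 1 n) K (int I - int N)) * l powi (int I - int N) * \<rho> ^ K = wt l \<rho> (weyl_mult Q P) K I / l ^ N"
    using l by (simp add: wt_def cR power_int_diff)
  also have "\<dots> \<ge> \<rho> ^ n" unfolding w using top_le l by (simp add: pos_le_divide_eq mult.commute)
  finally show ?thesis using Kd by blast
qed

end

section \<open>Connections on extensions of scalars\<close>

context scalar_extension
begin

text \<open>Neither summand D a \<otimes> m nor a \<otimes> \<delta> m respects balancing alone.
  Their defects cancel because D and \<delta> satisfy the Leibniz rule for the same derivation D' of
  T.\<close>

lemma tens_connection:
  assumes closed: "\<And>a m. a \<in> carrier R \<Longrightarrow> m \<in> carrier M \<Longrightarrow> \<phi> (a, m) \<in> carrier FR"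
    and cls: "\<And>a m. a \<in> carrier R \<Longrightarrow> m \<in> carrier M \<Longrightarrow> cls (\<phi> (a, m)) = tn (D a) m \<oplus>\<^bsub>E\<^esub> tn a (\<delta> m)"
    and D: "\<And>a. a \<in> carrier R \<Longrightarrow> D a \<in> carrier R"
      "\<And>a b. a \<in> carrier R \<Longrightarrow> b \<in> carrier R \<Longrightarrow> D (a \<oplus>\<^bsub>R\<^esub> b) = D a \<oplus>\<^bsub>R\<^esub> D b"
      "\<And>a b. a \<in> carrier R \<Longrightarrow> b \<in> carrier R \<Longrightarrow> D (a \<otimes>\<^bsub>R\<^esub> b) = D a \<otimes>\<^bsub>R\<^esub> b \<oplus>\<^bsub>R\<^esub> a \<otimes>\<^bsub>R\<^esub> D b"
    and \<delta>: "\<And>m. m \<in> carrier M \<Longrightarrow> \<delta> m \<in> carrier M"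
      "\<And>m n. m \<in> carrier M \<Longrightarrow> n \<in> carrier M \<Longrightarrow> \<delta> (m \<oplus>\<^bsub>M\<^esub> n) = \<delta> m \<oplus>\<^bsub>M\<^esub> \<delta> n"
    and Df: "\<And>t. D (f t) = f (D' t)"
    and \<delta>t: "\<And>t m. m \<in> carrier M \<Longrightarrow> \<delta> (t \<odot>\<^bsub>M\<^esub> m) = D' t \<odot>\<^bsub>M\<^esub> m \<oplus>\<^bsub>M\<^esub> t \<odot>\<^bsub>M\<^esub> \<delta> m"
  shows "additive_map E E (tens_lift R f M \<phi>)"
    and "\<And>a m. a \<in> carrier R \<Longrightarrow> m \<in> carrier M \<Longrightarrow> tens_lift R f M \<phi> (tn a m) = tn (D a) m \<oplus>\<^bsub>E\<^esub> tn a (\<delta> m)"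
    and "\<And>s x. s \<in> carrier R \<Longrightarrow> x \<in> carrier E \<Longrightarrow>
      tens_lift R f M \<phi> (s \<odot>\<^bsub>E\<^esub> x) = D s \<odot>\<^bsub>E\<^esub> x \<oplus>\<^bsub>E\<^esub> s \<odot>\<^bsub>E\<^esub> tens_lift R f M \<phi> x"
proof -
  have bal: "cls (\<phi> (a \<otimes>\<^bsub>R\<^esub> f t, m)) = cls (\<phi> (a, t \<odot>\<^bsub>M\<^esub> m))"
    if a: "a \<in> carrier R" and m: "m \<in> carrier M" for a t m
  proof -
    have "cls (\<phi> (a \<otimes>\<^bsub>R\<^esub> f t, m)) = tn (D a \<otimes>\<^bsub>R\<^esub> f t \<oplus>\<^bsub>R\<^esub> a \<otimes>\<^bsub>R\<^esub> f (D' t)) m \<oplus>\<^bsub>E\<^esub> tn (a \<otimes>\<^bsub>R\<^esub> f t) (\<delta> m)"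
      using a m by (simp add: cls D(3) Df)
    also have "\<dots> = tn (D a) (t \<odot>\<^bsub>M\<^esub> m) \<oplus>\<^bsub>E\<^esub> (tn a (D' t \<odot>\<^bsub>M\<^esub> m) \<oplus>\<^bsub>E\<^esub> tn a (t \<odot>\<^bsub>M\<^esub> \<delta> m))"
      using a m D(1) \<delta>(1) by (simp add: tens_add_left tens_balanced E.a_assoc)
    also have "\<dots> = cls (\<phi> (a, t \<odot>\<^bsub>M\<^esub> m))"
      using a m \<delta>(1) by (simp add: cls \<delta>t tens_add_right)
    finally show ?thesis .
  qed
  have left: "cls (\<phi> (a \<oplus>\<^bsub>R\<^esub> b, m)) = cls (\<phi> (a, m)) \<oplus>\<^bsub>E\<^esub> cls (\<phi> (b, m))"
    if "a \<in> carrier R" "b \<in> carrier R" "m \<in> carrier M" for a b m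
    using that D(1) \<delta>(1) by (simp add: cls D(2) tens_add_left E.a_ac)
  have right: "cls (\<phi> (a, m \<oplus>\<^bsub>M\<^esub> n)) = cls (\<phi> (a, m)) \<oplus>\<^bsub>E\<^esub> cls (\<phi> (a, n))"
    if "a \<in> carrier R" "m \<in> carrier M" "n \<in> carrier M" for a m n
    using that D(1) \<delta>(1) by (simp add: cls \<delta>(2) tens_add_right E.a_ac)
  note lift = tens_lift[of \<phi>, OF closed left right bal]
  show A: "additive_map E E (tens_lift R f M \<phi>)" by (rule lift(1))
  show T: "\<And>a m. a \<in> carrier R \<Longrightarrow> m \<in> carrier M \<Longrightarrow> tens_lift R f M \<phi> (tn a m) = tn (D a) m \<oplus>\<^bsub>E\<^esub> tn a (\<delta> m)"
    by (simp add: lift(2) cls)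
  show "\<And>s x. s \<in> carrier R \<Longrightarrow> x \<in> carrier E \<Longrightarrow>
      tens_lift R f M \<phi> (s \<odot>\<^bsub>E\<^esub> x) = D s \<odot>\<^bsub>E\<^esub> x \<oplus>\<^bsub>E\<^esub> s \<odot>\<^bsub>E\<^esub> tens_lift R f M \<phi> x"
    by (rule E_Leibniz[where D = D and \<delta> = \<delta>, OF A T D(1,3) \<delta>(1)])
qed

end

lemma finsum_pred:
  assumes "abelian_group G" "\<And>i. i \<in> I \<Longrightarrow> h i \<in> carrier G" "\<And>i. i \<in> I \<Longrightarrow> Q (h i)" "Q \<zero>\<^bsub>G\<^esub>"
    and add: "\<And>x y. x \<in> carrier G \<Longrightarrow> y \<in> carrier G \<Longrightarrow> Q x \<Longrightarrow> Q y \<Longrightarrow> Q (x \<oplus>\<^bsub>G\<^esub> y)"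
  shows "Q (finsum G h I)"
proof -
  interpret G: abelian_group G by fact
  show ?thesis
    using assms(2,3)
  proof (induction I rule: infinite_finite_induct)
    case (insert i I)
    have "h \<in> I \<rightarrow> carrier G" using insert.prems(1) by auto
    thus ?case using insert by (simp add: G.finsum_insert add)
  qed (simp_all add: assms(4) G.finsum_infinite)
qed

lemma pderiv_weyl_d: "weyl_mult weyl_d [:a:] = Polynomial.smult a weyl_d + [:pderiv a:]"
  unfolding weyl_mult_d by (simp add: weyl_d_def map_poly_pCons)

section \<open>Solubility bounds the coefficients\<close>

lemma prime_power_dvd_fact: "prime p \<Longrightarrow> p ^ q dvd (fact (p * q) :: nat)"
proof (induction q)
  case (Suc q)
  have "p dvd fact p" using prime_gt_0_nat[OF Suc.prems] by (intro dvd_fact) simp_all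
  hence "p * p ^ q dvd fact p * fact (p * q)" using Suc by (intro mult_dvd_mono) auto
  also have "\<dots> dvd fact (p + p * q)" by (rule fact_fact_dvd_fact)
  finally show ?case by simp
qed simp

text \<open>Some geometric rate below 1 suffices, so only the multiples of p up to m are counted,
  without higher powers. The factor p absorbs the rounding in m div p.\<close>

lemma av_fact_le:
  assumes p: "prime p" and av: "av (of_nat p :: 'k::nonarch_field) = 1 / real p"
  defines "\<theta> \<equiv> root p (1 / real p)"
  shows "av (fact m :: 'k) \<le> real p * \<theta> ^ m" "0 < \<theta>" "\<theta> < 1"
proof -
  have p2: "2 \<le> p" using p by (rule prime_ge_2_nat)
  show th: "0 < \<theta>" "\<theta> < 1" using p2 by (simp_all add: \<theta>_def)
  have thp: "\<theta> ^ p = 1 / real p" using p2 by (simp add: \<theta>_def)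
  define q where "q = m div p"
  have "p ^ q dvd fact m"
  proof -
    have "(fact (p * q) :: nat) dvd fact m" by (rule fact_dvd) (simp add: q_def)
    thus ?thesis using prime_power_dvd_fact[OF p] dvd_trans by blast
  qed
  then obtain b where b: "fact m = p ^ q * b" by blast
  have "(fact m :: 'k) = of_nat p ^ q * of_nat b"
    using arg_cong[OF b, of "of_nat :: nat \<Rightarrow> 'k"] by simp
  hence "av (fact m :: 'k) = (1 / real p) ^ q * av (of_nat b :: 'k)" by (simp add: av_mult av_power av)
  also have "\<dots> \<le> (1 / real p) ^ q * 1" by (intro mult_left_mono av_of_nat_le_1) auto
  also have "\<dots> = \<theta> ^ (p * q)" by (simp add: power_mult thp)
  also have "\<dots> = (real p * \<theta> ^ p) * \<theta> ^ (p * q)" using p2 by (simp add: thp)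
  also have "\<dots> = real p * \<theta> ^ (p + p * q)" by (simp add: power_add)
  also have "\<dots> \<le> real p * \<theta> ^ m"
  proof (intro mult_left_mono power_decreasing)
    have "m mod p < p" using p2 by simp
    thus "m \<le> p + p * q" using mult_div_mod_eq[of p m] unfolding q_def by linarith
  qed (use th in auto)
  finally show "av (fact m :: 'k) \<le> real p * \<theta> ^ m" .
qed

lemma eventually_geometric_bound:
  fixes x :: "nat \<Rightarrow> real"
  assumes "0 < \<tau>" "0 \<le> A" "eventually (\<lambda>n. x n \<le> A * \<tau> ^ n) sequentially"
  shows "\<exists>C>0. \<forall>n. x n \<le> C * \<tau> ^ n"
proof -
  obtain N where N: "\<And>n. N \<le> n \<Longrightarrow> x n \<le> A * \<tau> ^ n" using assms(3) unfolding eventually_sequentially by blast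
  define C where "C = A + 1 + (\<Sum>n<N. \<bar>x n\<bar> / \<tau> ^ n)"
  have S: "0 \<le> (\<Sum>n<N. \<bar>x n\<bar> / \<tau> ^ n)" using assms(1) by (intro sum_nonneg) auto
  have "x n \<le> C * \<tau> ^ n" for n
  proof (cases "n < N")
    case True
    have "\<bar>x n\<bar> / \<tau> ^ n \<le> (\<Sum>n<N. \<bar>x n\<bar> / \<tau> ^ n)"
      using True assms(1) by (intro member_le_sum) auto
    hence "\<bar>x n\<bar> / \<tau> ^ n \<le> C" using assms(2) by (simp add: C_def)
    hence "\<bar>x n\<bar> \<le> C * \<tau> ^ n" using assms(1) by (simp add: pos_divide_le_eq)
    thus ?thesis by simp
  next
    case False
    hence "x n \<le> A * \<tau> ^ n" using N by simp
    also have "\<dots> \<le> C * \<tau> ^ n" using S assms(1) by (intro mult_right_mono) (auto simp: C_def)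
    finally show ?thesis .
  qed
  moreover have "0 < C" using S assms(2) by (simp add: C_def)
  ultimately show ?thesis by blast
qed

lemma inv_root_gt:
  assumes "ereal s < inv_root n x" "0 < s" "0 < n" "0 \<le> x"
  shows "x \<le> (1 / s) ^ n"
proof (cases "x = 0")
  case False
  hence x: "0 < x" using assms(4) by simp
  have "s < x powr (- 1 / real n)" using assms(1) False by (simp add: inv_root_def)
  hence "s ^ n \<le> (x powr (- 1 / real n)) ^ n" using assms(2) by (intro power_mono) auto
  also have "(x powr (- 1 / real n)) ^ n = x powr (- 1)"
    using x assms(3) by (simp add: powr_powr flip: powr_realpow)
  also have "\<dots> = 1 / x" using x by (simp add: powr_minus_divide)
  finally show ?thesis using x assms(2) by (simp add: power_divide field_simps)
qed (use assms in simp)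

lemma matrix_norm_ge:
  assumes "i < r" "j < r" "0 < l" "conv_at l (H i j)"
  shows "bnd_at l (matrix_norm r l H) (H i j)"
  unfolding bnd_at_def
proof
  fix n
  obtain C where C: "bnd_at l C (H i j)" using conv_at_bnd[OF assms(4,3)] by blast
  hence "bdd_above (range (\<lambda>n. av (H i j n) * l powi n))"
    by (intro bdd_aboveI[of _ C]) (auto simp: bnd_at_def)
  hence "av (H i j n) * l powi n \<le> robba_norm l (H i j)"
    unfolding robba_norm_def by (intro cSUP_upper) auto
  also have "\<dots> \<le> matrix_norm r l H"
  proof -
    have "{robba_norm l (H i j) | i j. i < r \<and> j < r} = (\<lambda>(i, j). robba_norm l (H i j)) ` ({..<r} \<times> {..<r})" by auto
    hence "finite {robba_norm l (H i j) | i j. i < r \<and> j < r}" by simp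
    thus ?thesis unfolding matrix_norm_def using assms(1,2) by (intro Max_ge) auto
  qed
  finally show "av (H i j n) * l powi n \<le> matrix_norm r l H" .
qed

lemma common_bound:
  assumes "\<And>i. i < (r::nat) \<Longrightarrow> \<exists>K>0::real. Q i K" "\<And>i K K'. Q i K \<Longrightarrow> K \<le> K' \<Longrightarrow> Q i K'"
  shows "\<exists>K>0. \<forall>i<r. Q i K"
  using assms(1)
proof (induction r)
  case (Suc r)
  obtain K1 where "K1 > 0" "\<forall>i<r. Q i K1" using Suc by force
  moreover obtain K2 where "K2 > 0" "Q r K2" using Suc.prems by blast
  ultimately show ?case
    using assms(2) by (intro exI[of _ "max K1 K2"]) (auto simp: less_Suc_eq)
qed (auto intro: exI[of _ 1])

lemma cyclic_scalar_extension:
  assumes "ring R" "\<And>t. f t \<in> carrier R"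
  shows "scalar_extension R f (as_poly_module (cyclic_module P))"
proof (intro scalar_extension.intro scalar_extension_axioms.intro assms)
  show "abelian_group (as_poly_module (cyclic_module P))"
    unfolding as_poly_module_def by (intro restrict_scalars_abelian_group cyclic_abelian_group)
  show "t \<odot>\<^bsub>as_poly_module (cyclic_module P)\<^esub> m \<in> carrier (as_poly_module (cyclic_module P))"
    if "m \<in> carrier (as_poly_module (cyclic_module P))" for m t
    using that by (auto simp: cyclic_carrier cyclic_smult)
qed

lemma weyl_d_poly_action:
  "weyl_d \<odot>\<^bsub>cyclic_module P\<^esub> ([:a:] \<odot>\<^bsub>cyclic_module P\<^esub> cyc P F) =
    ([:pderiv a:] \<odot>\<^bsub>cyclic_module P\<^esub> cyc P F) \<oplus>\<^bsub>cyclic_module P\<^esub>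
    ([:a:] \<odot>\<^bsub>cyclic_module P\<^esub> (weyl_d \<odot>\<^bsub>cyclic_module P\<^esub> cyc P F))"
proof -
  have "weyl_mult weyl_d (weyl_mult [:a:] F) = weyl_mult [:pderiv a:] F + weyl_mult [:a:] (weyl_mult weyl_d F)"
    unfolding weyl_mult_assoc[symmetric] weyl_mult_distrib_right[symmetric] pderiv_weyl_d
    by (simp add: weyl_mult_const_left add.commute)
  thus ?thesis by (simp add: cyclic_smult cyclic_add)
qed

context laurent_remainder
begin

text \<open>In the soluble basis e one has 1 \<otimes> 1 = \<Sum> c_i e_i. Its n-th derivative is
  estimated through the Leibniz rule and the matrices G n, while its coordinates \<open>psi\<close>
  are bounded below by \<open>psi_lower_bound\<close>. The functionals \<open>U k\<close> translate
  between the two descriptions, which makes the rank r and the order d comparable without relating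
  them.\<close>

theorem soluble_coeff_bound:
  assumes p: "prime p" and avp: "av (of_nat p :: 'k) = 1 / real p"
    and sc: "spherically_complete TYPE('k)"
    and sol: "soluble_at_1 (robba_module (cyclic_module P)) (robba_connection (cyclic_module P))"
  shows "av (coeff (coeff P k0) i0) \<le> av \<alpha>"
proof (rule ccontr)
  define a where "a = coeff (coeff P k0) i0"
  assume "\<not> av (coeff (coeff P k0) i0) \<le> av \<alpha>"
  hence a: "av \<alpha> < av a" by (simp add: a_def)
  \<comment> \<open>The coefficients of the leading term are \<alpha> and 0, neither of which
    exceeds \<alpha>.\<close>
  have k0: "k0 < d"
  proof (rule ccontr)
    assume "\<not> k0 < d"
    moreover have "coeff P k0 \<noteq> 0" using a av_nonneg[of \<alpha>] by (intro notI) (simp add: a_def)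
    hence "k0 \<le> degree P" by (rule le_degree)
    ultimately have "k0 = d" using degP by simp
    thus False using a by (simp add: a_def top not_less[THEN iffD2, OF av_nonneg] split: if_splits)
  qed
  define M where "M = cyclic_module P"
  interpret RR: cring "robba :: (int \<Rightarrow> 'k) ring" by (rule robba_cring[OF sc])
  interpret X: scalar_extension "robba :: (int \<Rightarrow> 'k) ring" poly_to_robba "as_poly_module M"
    unfolding M_def by (rule cyclic_scalar_extension[OF RR.ring_axioms poly_to_robba_closed])
  have Xmod: "Module.module robba X.E" by (rule X.E_module[OF RR.cring_axioms])
  define conn where "conn = robba_connection M"
  note robba_closed' = robba_closed[OF sc]
  let ?\<phi> = "\<lambda>(f, m). frag_of (robba_deriv f, m) + frag_of (f, weyl_d \<odot>\<^bsub>M\<^esub> m)"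
  have dM: "weyl_d \<odot>\<^bsub>M\<^esub> m \<in> carrier (as_poly_module M)" if "m \<in> carrier (as_poly_module M)" for m
    using that by (auto simp: M_def cyclic_carrier cyclic_smult)
  have phi_closed: "?\<phi> (f, m) \<in> carrier X.FR"
    and phi_cls: "X.cls (?\<phi> (f, m)) = X.tn (robba_deriv f) m \<oplus>\<^bsub>X.E\<^esub> X.tn f (weyl_d \<odot>\<^bsub>M\<^esub> m)"
    if "f \<in> carrier robba" "m \<in> carrier (as_poly_module M)" for f :: "int \<Rightarrow> 'k" and m
    using that dM[OF that(2)] robba_deriv_closed[OF that(1)] by (simp_all add: tens_def X.E_add)
  have D_mult: "robba_deriv (f \<otimes>\<^bsub>robba\<^esub> g) = robba_deriv f \<otimes>\<^bsub>robba\<^esub> g \<oplus>\<^bsub>robba\<^esub> f \<otimes>\<^bsub>robba\<^esub> robba_deriv g"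
    if fg: "f \<in> carrier robba" "g \<in> carrier robba" for f g :: "int \<Rightarrow> 'k"
  proof -
    obtain l where "0 < l" "conv_at l f" "conv_at l g" by (rule robba_common_radius[OF sc fg fg(2)])
    thus ?thesis by (simp add: robba_deriv_mult[OF sc])
  qed
  have d_add: "weyl_d \<odot>\<^bsub>M\<^esub> (m \<oplus>\<^bsub>as_poly_module M\<^esub> n) = (weyl_d \<odot>\<^bsub>M\<^esub> m) \<oplus>\<^bsub>as_poly_module M\<^esub> (weyl_d \<odot>\<^bsub>M\<^esub> n)"
    if "m \<in> carrier (as_poly_module M)" "n \<in> carrier (as_poly_module M)" for m n
    using that by (auto simp: M_def cyclic_carrier cyclic_smult cyclic_add weyl_mult_distrib_left)
  have d_poly: "weyl_d \<odot>\<^bsub>M\<^esub> (t \<odot>\<^bsub>as_poly_module M\<^esub> m) =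
      pderiv t \<odot>\<^bsub>as_poly_module M\<^esub> m \<oplus>\<^bsub>as_poly_module M\<^esub> t \<odot>\<^bsub>as_poly_module M\<^esub> (weyl_d \<odot>\<^bsub>M\<^esub> m)"
    if m: "m \<in> carrier (as_poly_module M)" for t m
  proof -
    obtain F where "m = cyc P F" using m by (auto simp: M_def cyclic_carrier)
    thus ?thesis using weyl_d_poly_action[of P t F] by (simp add: M_def)
  qed
  note tc = X.tens_connection[where D = robba_deriv and \<delta> = "\<lambda>m. weyl_d \<odot>\<^bsub>M\<^esub> m" and D' = pderiv,
      OF phi_closed phi_cls robba_deriv_closed _ D_mult dM d_add _ d_poly, folded robba_connection_def, folded conn_def]
  have conn: "additive_map X.E X.E conn"
    and conn_tn: "\<And>f m. f \<in> carrier robba \<Longrightarrow> m \<in> carrier M \<Longrightarrow>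
      conn (X.tn f m) = X.tn (robba_deriv f) m \<oplus>\<^bsub>X.E\<^esub> X.tn f (weyl_d \<odot>\<^bsub>M\<^esub> m)"
    and conn_smult: "\<And>s x. s \<in> carrier robba \<Longrightarrow> x \<in> carrier X.E \<Longrightarrow>
      conn (s \<odot>\<^bsub>X.E\<^esub> x) = robba_deriv s \<odot>\<^bsub>X.E\<^esub> x \<oplus>\<^bsub>X.E\<^esub> s \<odot>\<^bsub>X.E\<^esub> conn x"
    by (rule tc; simp add: robba_deriv_add robba_deriv_poly)+
  have connN: "additive_map X.E X.E (conn ^^ n)" for n
  proof (induction n)
    case (Suc n)
    thus ?case using additive_map_comp[OF Suc conn] by (simp add: comp_def)
  qed (simp add: additive_map_def)
  note Eab = X.E.abelian_group_axioms
  note Rab = RR.abelian_group_axioms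

  \<comment> \<open>\<open>psi\<close> on classes modulo P; by \<open>psi_cong\<close> the
    representative is immaterial.\<close>
  define psc where "psc = (\<lambda>k m. psi (SOME G. cyc P G = m) k)"
  have psc: "psc k (cyc P F) = psi F k" for k F
    unfolding psc_def by (rule psi_cong) (rule someI[of "\<lambda>G. cyc P G = cyc P F" F], rule refl)
  \<comment> \<open>Extended linearly over the Robba ring, the coordinates can be evaluated on any
    element, in particular on the basis provided by solubility.\<close>
  have "\<exists>U. additive_map X.E robba U \<and> (\<forall>f\<in>carrier robba. \<forall>m\<in>carrier M. U (X.tn f m) = robba_mult f (psc k m))" for k
  proof -
    have pc: "psc k m \<in> carrier robba" for m by (simp add: psc_def psi_closed)
    obtain U where "additive_map X.E robba U"
      "\<And>f m. f \<in> carrier robba \<Longrightarrow> m \<in> carrier (as_poly_module M) \<Longrightarrow> U (X.tn f m) = robba_mult f (psc k m)"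
    proof (rule X.tens_universal[OF Rab, of "\<lambda>f m. robba_mult f (psc k m)"])
      fix f g :: "int \<Rightarrow> 'k" and m assume "f \<in> carrier robba" "g \<in> carrier robba"
      thus "robba_mult (f \<oplus>\<^bsub>robba\<^esub> g) (psc k m) = robba_mult f (psc k m) \<oplus>\<^bsub>robba\<^esub> robba_mult g (psc k m)"
        using RR.l_distr[OF _ _ pc, of f g m] by simp
    next
      fix f :: "int \<Rightarrow> 'k" and m n assume f: "f \<in> carrier robba" and "m \<in> carrier (as_poly_module M)" "n \<in> carrier (as_poly_module M)"
      then obtain F G where "m = cyc P F" "n = cyc P G" by (auto simp: M_def cyclic_carrier)
      hence "psc k (m \<oplus>\<^bsub>as_poly_module M\<^esub> n) = psc k m \<oplus>\<^bsub>robba\<^esub> psc k n"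
        by (simp add: M_def cyclic_add psc psi_add)
      thus "robba_mult f (psc k (m \<oplus>\<^bsub>as_poly_module M\<^esub> n)) = robba_mult f (psc k m) \<oplus>\<^bsub>robba\<^esub> robba_mult f (psc k n)"
        using RR.r_distr[OF pc pc f, of m n] by simp
    next
      fix f :: "int \<Rightarrow> 'k" and t m assume f: "f \<in> carrier robba" and "m \<in> carrier (as_poly_module M)"
      then obtain F where "m = cyc P F" by (auto simp: M_def cyclic_carrier)
      hence "psc k (t \<odot>\<^bsub>as_poly_module M\<^esub> m) = robba_mult (poly_to_robba t) (psc k m)"
        by (simp add: M_def cyclic_smult psc weyl_mult_const_left psi_smult)
      thus "robba_mult (f \<otimes>\<^bsub>robba\<^esub> poly_to_robba t) (psc k m) = robba_mult f (psc k (t \<odot>\<^bsub>as_poly_module M\<^esub> m))"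
        using RR.m_assoc[OF f poly_to_robba_closed pc, of t m] by simp
    qed (auto simp: robba_closed' pc)
    thus ?thesis by auto
  qed
  then obtain U where U: "\<And>k. additive_map X.E robba (U k)"
    and U_tn: "\<And>k f m. f \<in> carrier robba \<Longrightarrow> m \<in> carrier M \<Longrightarrow> U k (X.tn f m) = robba_mult f (psc k m)"
    by metis
  have U_smult: "U k (g \<odot>\<^bsub>X.E\<^esub> x) = robba_mult g (U k x)" if g: "g \<in> carrier robba" and x: "x \<in> carrier X.E" for k g x
  proof (rule X.tens_ext[OF additive_map_comp[OF X.E_smult(1)[OF g] U] _ _ x])
    show "additive_map X.E robba (\<lambda>x. robba_mult g (U k x))"
      using additive_mapD[OF U] RR.r_distr[OF _ _ g] by (auto simp: additive_map_def robba_closed' g)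
    fix f :: "int \<Rightarrow> 'k" and m assume f: "f \<in> carrier robba" and m: "m \<in> carrier (as_poly_module M)"
    have "robba_mult g f \<in> carrier robba" using f g by (simp add: robba_closed')
    thus "U k (g \<odot>\<^bsub>X.E\<^esub> X.tn f m) = robba_mult g (U k (X.tn f m))"
      using f g m RR.m_assoc[OF g f, of "psc k m"] by (simp add: X.E_smult(2) U_tn psc_def psi_closed)
  qed

  obtain r e G where basis: "is_basis robba X.E r e"
    and Gc: "\<And>n i j. i < r \<Longrightarrow> j < r \<Longrightarrow> G n i j \<in> carrier robba"
    and Ge: "\<And>n j. j < r \<Longrightarrow> (conn ^^ n) (e j) = (\<Oplus>\<^bsub>X.E\<^esub>i\<in>{..<r}. G n i j \<odot>\<^bsub>X.E\<^esub> e i)"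
    and Ray: "(Ray r G \<longlongrightarrow> 1) (at_left 1)"
    using sol unfolding soluble_at_1_def robba_module_def conn_def M_def by blast
  have e: "e i \<in> carrier X.E" if "i < r" for i using basis that by (simp add: is_basis_def)
  define v where "v = X.tn \<one>\<^bsub>robba\<^esub> (cyc P 1)"
  have cycM: "cyc P F \<in> carrier M" for F by (simp add: M_def cyclic_carrier)
  have vE: "v \<in> carrier X.E" unfolding v_def by (rule X.tens_closed) (simp_all add: cycM del: robba_simps)
  obtain c where c0: "c \<in> {..<r} \<rightarrow>\<^sub>E carrier robba" and v: "v = (\<Oplus>\<^bsub>X.E\<^esub>i\<in>{..<r}. c i \<odot>\<^bsub>X.E\<^esub> e i)"
    using basis vE unfolding is_basis_def by blast
  have c: "c i \<in> carrier robba" if "i < r" for i using c0 that by auto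

  define \<theta> where "\<theta> = root p (1 / real p)"
  note fact_le = av_fact_le[OF p avp, folded \<theta>_def]
  \<comment> \<open>s is to bound both l and the radius of convergence from below; s > \<theta>
    makes the rate \<theta> / s smaller than 1.\<close>
  obtain s where s: "\<theta> < s" "s < 1" using dense[OF fact_le(3)] by blast
  have s0: "0 < s" using s fact_le(2) by simp
  \<comment> \<open>At l = 1 this reads |\<alpha>| < |a|. Since the weight 1/l^2 of the derivation
    tends to 1, continuity gives it near 1.\<close>
  have "eventually (\<lambda>l. av \<alpha> * l ^ \<delta> * (1 / l\<^sup>2) ^ d < av a * l ^ i0 * (1 / l\<^sup>2) ^ k0) (at_left 1)"
  proof -
    have "((\<lambda>l. av a * l ^ i0 * (1 / l\<^sup>2) ^ k0 - av \<alpha> * l ^ \<delta> * (1 / l\<^sup>2) ^ d) \<longlongrightarrow>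
        av a * 1 ^ i0 * (1 / 1\<^sup>2) ^ k0 - av \<alpha> * 1 ^ \<delta> * (1 / 1\<^sup>2) ^ d) (at_left (1::real))"
      by (intro tendsto_intros) auto
    hence "eventually (\<lambda>l. 0 < av a * l ^ i0 * (1 / l\<^sup>2) ^ k0 - av \<alpha> * l ^ \<delta> * (1 / l\<^sup>2) ^ d) (at_left (1::real))"
      by (rule order_tendstoD(1)) (use a in simp)
    thus ?thesis by eventually_elim simp
  qed
  moreover have "eventually (\<lambda>l. s < l) (at_left (1::real))" using s(2) by (rule eventually_at_leftI[rotated]) simp
  moreover have "eventually (\<lambda>l. ereal s < Ray r G l) (at_left 1)"
    using s(2) by (intro order_tendstoD(1)[OF Ray]) simp
  moreover have "eventually (\<lambda>l. \<forall>i\<in>{..<r}. conv_at l (c i)) (at_left 1)"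
    using c robba_carrier_iff by (intro eventually_ball_finite) auto
  moreover have "eventually (\<lambda>l. \<forall>i\<in>{..<r}. \<forall>j\<in>{..<r}. conv_at l (G 1 i j)) (at_left 1)"
    using Gc robba_carrier_iff by (intro eventually_ball_finite ballI) auto
  moreover have "eventually (\<lambda>l. \<forall>k\<in>{..<d}. \<forall>i\<in>{..<r}. conv_at l (U k (e i))) (at_left 1)"
    using additive_mapD(1)[OF U e] robba_carrier_iff by (intro eventually_ball_finite ballI) auto
  ultimately have "eventually (\<lambda>l. 0 < l \<and> l < 1 \<and> av \<alpha> * l ^ \<delta> * (1 / l\<^sup>2) ^ d < av a * l ^ i0 * (1 / l\<^sup>2) ^ k0 \<and>
      s < l \<and> ereal s < Ray r G l \<and> (\<forall>i\<in>{..<r}. conv_at l (c i)) \<and>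
      (\<forall>i\<in>{..<r}. \<forall>j\<in>{..<r}. conv_at l (G 1 i j)) \<and> (\<forall>k\<in>{..<d}. \<forall>i\<in>{..<r}. conv_at l (U k (e i)))) (at_left (1::real))"
    using eventually_at_left_1_pos by eventually_elim blast
  from eventually_happens[OF this] obtain l where l: "0 < l" "l < 1"
    and la: "av \<alpha> * l ^ \<delta> * (1 / l\<^sup>2) ^ d < av a * l ^ i0 * (1 / l\<^sup>2) ^ k0"
    and sl: "s < l" and Rl: "ereal s < Ray r G l" and cl: "\<And>i. i < r \<Longrightarrow> conv_at l (c i)"
    and G1: "\<And>i j. i < r \<Longrightarrow> j < r \<Longrightarrow> conv_at l (G 1 i j)"
    and Ul: "\<And>k i. k < d \<Longrightarrow> i < r \<Longrightarrow> conv_at l (U k (e i))"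
    by (auto simp: trivial_limit_at_left_real)

  text \<open>All \<open>G n\<close> converge on \<open>|t| = l\<close>, as \<open>G 1\<close> does.\<close>
  define S where "S = (\<lambda>x. \<exists>h. (\<forall>i<r. h i \<in> carrier robba \<and> conv_at l (h i)) \<and> x = (\<Oplus>\<^bsub>X.E\<^esub>i\<in>{..<r}. h i \<odot>\<^bsub>X.E\<^esub> e i))"
  have S_add: "S (x \<oplus>\<^bsub>X.E\<^esub> y)" if xy: "S x" "S y" for x y
  proof -
    obtain h h' where h: "\<forall>i<r. h i \<in> carrier robba \<and> conv_at l (h i)" "x = (\<Oplus>\<^bsub>X.E\<^esub>i\<in>{..<r}. h i \<odot>\<^bsub>X.E\<^esub> e i)"
      and h': "\<forall>i<r. h' i \<in> carrier robba \<and> conv_at l (h' i)" "y = (\<Oplus>\<^bsub>X.E\<^esub>i\<in>{..<r}. h' i \<odot>\<^bsub>X.E\<^esub> e i)"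
      using xy unfolding S_def by blast
    have "(\<Oplus>\<^bsub>X.E\<^esub>i\<in>{..<r}. (h i \<oplus>\<^bsub>robba\<^esub> h' i) \<odot>\<^bsub>X.E\<^esub> e i) =
        (\<Oplus>\<^bsub>X.E\<^esub>i\<in>{..<r}. h i \<odot>\<^bsub>X.E\<^esub> e i \<oplus>\<^bsub>X.E\<^esub> h' i \<odot>\<^bsub>X.E\<^esub> e i)"
      using h h' e by (intro X.E.finsum_cong') (auto simp: X.E_smult_l_distr simp del: robba_simps)
    also have "\<dots> = x \<oplus>\<^bsub>X.E\<^esub> y" unfolding h(2) h'(2) using h h' e by (intro X.E.finsum_addf) auto
    finally show ?thesis unfolding S_def
      using h h' l by (intro exI[of _ "\<lambda>i. h i \<oplus>\<^bsub>robba\<^esub> h' i"]) (auto simp: robba_closed' conv_at_add)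
  qed
  have S_smult: "S (g \<odot>\<^bsub>X.E\<^esub> x)" if g: "g \<in> carrier robba" "conv_at l g" and x: "S x" for g x
  proof -
    obtain h where h: "\<forall>i<r. h i \<in> carrier robba \<and> conv_at l (h i)" "x = (\<Oplus>\<^bsub>X.E\<^esub>i\<in>{..<r}. h i \<odot>\<^bsub>X.E\<^esub> e i)"
      using x unfolding S_def by blast
    have "g \<odot>\<^bsub>X.E\<^esub> x = (\<Oplus>\<^bsub>X.E\<^esub>i\<in>{..<r}. g \<odot>\<^bsub>X.E\<^esub> (h i \<odot>\<^bsub>X.E\<^esub> e i))"
      unfolding h(2) using h e by (intro additive_map_finsum[OF X.E_smult(1)[OF g(1)] Eab Eab]) auto
    also have "\<dots> = (\<Oplus>\<^bsub>X.E\<^esub>i\<in>{..<r}. (g \<otimes>\<^bsub>robba\<^esub> h i) \<odot>\<^bsub>X.E\<^esub> e i)"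
      using h e g by (intro X.E.finsum_cong') (auto simp: X.E_smult_assoc simp del: robba_simps)
    finally show ?thesis unfolding S_def
      using h g l by (intro exI[of _ "\<lambda>i. g \<otimes>\<^bsub>robba\<^esub> h i"]) (auto simp: robba_closed' conv_at_mult)
  qed
  have one_conv: "conv_at l (\<one>\<^bsub>robba\<^esub> :: int \<Rightarrow> 'k)" "conv_at l (\<zero>\<^bsub>robba\<^esub> :: int \<Rightarrow> 'k)"
    by (rule conv_at_finite[OF sc, of "{0}"]; simp)+
  have null: "\<zero>\<^bsub>robba\<^esub> \<odot>\<^bsub>X.E\<^esub> x = \<zero>\<^bsub>X.E\<^esub>" if "x \<in> carrier X.E" for x
    using Module.module.smult_l_null[OF Xmod that] .
  have S_e: "S (e i)" if i: "i < r" for i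
  proof -
    have "(\<Oplus>\<^bsub>X.E\<^esub>j\<in>{..<r}. (if i = j then \<one>\<^bsub>robba\<^esub> else \<zero>\<^bsub>robba\<^esub>) \<odot>\<^bsub>X.E\<^esub> e j) =
        (\<Oplus>\<^bsub>X.E\<^esub>j\<in>{..<r}. if i = j then e j else \<zero>\<^bsub>X.E\<^esub>)"
      using e by (intro X.E.finsum_cong') (auto simp: X.E_smult_one null simp del: robba_simps)
    also have "\<dots> = e i" using i e by (intro X.E.finsum_singleton) auto
    finally have "e i = (\<Oplus>\<^bsub>X.E\<^esub>j\<in>{..<r}. (if i = j then \<one>\<^bsub>robba\<^esub> else \<zero>\<^bsub>robba\<^esub>) \<odot>\<^bsub>X.E\<^esub> e j)" ..
    thus ?thesis unfolding S_def
      using one_conv by (intro exI[of _ "\<lambda>j. if i = j then \<one>\<^bsub>robba\<^esub> else \<zero>\<^bsub>robba\<^esub>"]) (auto simp del: robba_simps)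
  qed
  have S_0: "S \<zero>\<^bsub>X.E\<^esub>"
  proof -
    have "(\<Oplus>\<^bsub>X.E\<^esub>j\<in>{..<r}. \<zero>\<^bsub>robba\<^esub> \<odot>\<^bsub>X.E\<^esub> e j) = \<zero>\<^bsub>X.E\<^esub>"
      by (rule finsum_pred[OF Eab, where Q = "\<lambda>x. x = \<zero>\<^bsub>X.E\<^esub>"]) (use e in \<open>auto simp: null simp del: robba_simps\<close>)
    thus ?thesis unfolding S_def using one_conv by (intro exI[of _ "\<lambda>_. \<zero>\<^bsub>robba\<^esub>"]) (auto simp del: robba_simps)
  qed
  have S_conn: "S (conn x)" if x: "S x" for x
  proof -
    obtain h where h: "\<forall>i<r. h i \<in> carrier robba \<and> conv_at l (h i)" "x = (\<Oplus>\<^bsub>X.E\<^esub>i\<in>{..<r}. h i \<odot>\<^bsub>X.E\<^esub> e i)"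
      using x unfolding S_def by blast
    have eqc: "conn x = (\<Oplus>\<^bsub>X.E\<^esub>i\<in>{..<r}. conn (h i \<odot>\<^bsub>X.E\<^esub> e i))"
      unfolding h(2) using h e by (intro additive_map_finsum[OF conn Eab Eab]) auto
    show ?thesis unfolding eqc
    proof (rule finsum_pred[OF Eab _ _ S_0 S_add])
      fix i assume "i \<in> {..<r}"
      hence i: "i < r" by simp
      show "conn (h i \<odot>\<^bsub>X.E\<^esub> e i) \<in> carrier X.E" using h e i additive_mapD(1)[OF conn] by auto
      have "S (conn (e i))"
        using Ge[OF i, of 1] Gc G1 i unfolding S_def by (intro exI[of _ "\<lambda>j. G 1 j i"]) auto
      hence "S (robba_deriv (h i) \<odot>\<^bsub>X.E\<^esub> e i \<oplus>\<^bsub>X.E\<^esub> h i \<odot>\<^bsub>X.E\<^esub> conn (e i))"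
        using h i l by (intro S_add S_smult S_e) (auto intro: robba_deriv_closed conv_at_deriv)
      thus "S (conn (h i \<odot>\<^bsub>X.E\<^esub> e i))" using conn_smult h e i by simp
    qed
  qed
  \<comment> \<open>Membership of G n in the Robba ring only gives an annulus that may shrink with
    n. On the fixed circle, convergence is needed for the supremum in \<open>matrix_norm\<close> to
    bound the entries.\<close>
  have Gl: "conv_at l (G n i j)" if ij: "i < r" "j < r" for n i j
  proof -
    have "S ((conn ^^ n) (e j))" by (induction n) (auto simp: S_e ij S_conn)
    then obtain h where h: "\<forall>i<r. h i \<in> carrier robba \<and> conv_at l (h i)"
      "(conn ^^ n) (e j) = (\<Oplus>\<^bsub>X.E\<^esub>i\<in>{..<r}. h i \<odot>\<^bsub>X.E\<^esub> e i)" unfolding S_def by blast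
    have x: "(conn ^^ n) (e j) \<in> carrier X.E" using additive_mapD(1)[OF connN e[OF ij(2)]] .
    \<comment> \<open>\<open>is_basis\<close> gives uniqueness among extensional functions, so both
      families are restricted first.\<close>
    have "restrict h {..<r} \<in> {..<r} \<rightarrow>\<^sub>E carrier robba" "restrict (\<lambda>i. G n i j) {..<r} \<in> {..<r} \<rightarrow>\<^sub>E carrier robba"
      using h(1) Gc ij by auto
    moreover have "(conn ^^ n) (e j) = (\<Oplus>\<^bsub>X.E\<^esub>i\<in>{..<r}. restrict h {..<r} i \<odot>\<^bsub>X.E\<^esub> e i)"
      unfolding h(2) using h(1) e by (intro X.E.finsum_cong') auto
    moreover have "(conn ^^ n) (e j) = (\<Oplus>\<^bsub>X.E\<^esub>i\<in>{..<r}. restrict (\<lambda>i. G n i j) {..<r} i \<odot>\<^bsub>X.E\<^esub> e i)"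
      unfolding Ge[OF ij(2)] using Gc e ij by (intro X.E.finsum_cong') auto
    ultimately have "restrict h {..<r} = restrict (\<lambda>i. G n i j) {..<r}"
      using basis x unfolding is_basis_def by blast
    hence "h i = G n i j" using ij(1) by (metis lessThan_iff restrict_apply')
    thus ?thesis using h(1) ij(1) by auto
  qed

  \<comment> \<open>G n is n! times G n / n!: the factorial contributes a multiple of \<theta>^n and
    solubility contributes s^(-n).\<close>
  define \<tau> where "\<tau> = \<theta> / s"
  have \<tau>: "0 < \<tau>" "\<tau> < 1" using fact_le(2) s s0 by (simp_all add: \<tau>_def)
  define x where "x = (\<lambda>n. matrix_norm r l (\<lambda>i j k. G n i j k / fact n))"
  have Gx: "bnd_at l (av (fact n :: 'k) * x n) (G n i j)" if ij: "i < r" "j < r" for n i j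
  proof -
    have f0: "0 < av (fact n :: 'k)" by simp
    have "conv_at l (\<lambda>k. G n i j k / fact n)"
      by (rule conv_at_le[OF Gl[OF ij, of n], where D = "1 / av (fact n :: 'k)" and h = "\<lambda>i. i"]) (use l in \<open>auto simp: av_divide\<close>)
    from matrix_norm_ge[OF ij l(1), of "\<lambda>i j k. G n i j k / fact n", OF this]
    have "av (G n i j k) / av (fact n :: 'k) * l powi k \<le> x n" for k by (simp add: bnd_at_def x_def av_divide)
    thus ?thesis using f0 by (simp add: bnd_at_def field_simps)
  qed
  have x0: "0 \<le> x n" for n
  proof -
    have "{robba_norm l (\<lambda>k. G n i j k / fact n) | i j. i < r \<and> j < r} =
      (\<lambda>(i, j). robba_norm l (\<lambda>k. G n i j k / fact n)) ` ({..<r} \<times> {..<r})" by auto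
    thus ?thesis unfolding x_def matrix_norm_def by (intro Max_ge) auto
  qed
  have "ereal s < liminf (\<lambda>n. inv_root n (x n))" using Rl by (simp add: Ray_def x_def)
  hence "eventually (\<lambda>n. ereal s < inv_root n (x n)) sequentially" by (rule less_LiminfD)
  hence "eventually (\<lambda>n. av (fact n :: 'k) * x n \<le> real p * \<tau> ^ n) sequentially"
    using eventually_gt_at_top[of 0]
  proof eventually_elim
    case (elim n)
    have "x n \<le> (1 / s) ^ n" using inv_root_gt[OF elim(1) s0 elim(2) x0] .
    hence "av (fact n :: 'k) * x n \<le> (real p * \<theta> ^ n) * (1 / s) ^ n"
      using fact_le(1)[of n] fact_le(2) x0 by (intro mult_mono) auto
    thus ?case by (simp add: \<tau>_def power_divide)
  qed
  from eventually_geometric_bound[OF \<tau>(1) _ this] obtain C where C: "0 < C" "\<And>n. av (fact n :: 'k) * x n \<le> C * \<tau> ^ n"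
    by auto
  have Gb: "bnd_at l (C * \<tau> ^ n) (G n i j)" if "i < r" "j < r" for n i j
    using bnd_at_mono[OF Gx[OF that] C(2)] .

  have "\<exists>K>0. \<forall>k<d. \<forall>n. bnd_at l (K * \<tau> ^ n) (psi (monom 1 n) k)"
  proof (rule common_bound)
    fix k assume k: "k < d"
    have UE: "U k x \<in> carrier robba" if "x \<in> carrier X.E" for x using additive_mapD(1)[OF U that] .
    have "\<exists>D>0. \<forall>i<r. bnd_at l D (U k (e i))"
      by (rule common_bound) (use conv_at_bnd Ul[OF k] l bnd_at_mono in blast)+
    then obtain D where D: "D > 0" "\<And>i. i < r \<Longrightarrow> bnd_at l D (U k (e i))" by blast
    have "\<exists>B>0. \<forall>i<r. bnd_at l B (c i)"
      by (rule common_bound) (use conv_at_bnd cl l bnd_at_mono in blast)+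
    then obtain B where B: "B > 0" "\<And>i. i < r \<Longrightarrow> bnd_at l B (c i)" by blast
    define K where "K = real p * B * (C * D)"
    have p0: "0 < real p" using p prime_gt_0_nat by simp
    have K: "0 < K" using p0 B C D by (simp add: K_def)
    have cD: "(robba_deriv ^^ q) (c i) \<in> carrier robba" if "i < r" for q i
      by (induction q) (auto simp: c that robba_deriv_closed)
    \<comment> \<open>Of all derivations, n are still to be distributed, m have fallen on the
      coefficient and q on the basis vector. Each kind yields a factor \<tau>, so the bound depends
      on n + m + q alone; the Leibniz expansion takes a maximum and needs no binomial
      coefficients.\<close>
    have main: "bnd_at l (K * \<tau> ^ (n + m + q)) (U k ((conn ^^ n) ((robba_deriv ^^ m) (c i) \<odot>\<^bsub>X.E\<^esub> (conn ^^ q) (e i))))"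
      if i: "i < r" for i n m q
    proof (induction n arbitrary: m q)
      case 0
      have eq: "(conn ^^ q) (e i) \<in> carrier X.E" using additive_mapD(1)[OF connN e[OF i]] .
      have eqU: "U k ((conn ^^ q) (e i)) = finsum robba (\<lambda>j. U k (G q j i \<odot>\<^bsub>X.E\<^esub> e j)) {..<r}"
        unfolding Ge[OF i] using Gc e i by (intro additive_map_finsum[OF U Eab Rab]) auto
      have b1: "bnd_at l (C * \<tau> ^ q * D) (U k ((conn ^^ q) (e i)))"
        unfolding eqU
      proof (rule finsum_pred[OF Rab])
        fix j assume "j \<in> {..<r}"
        hence j: "j < r" by simp
        show "U k (G q j i \<odot>\<^bsub>X.E\<^esub> e j) \<in> carrier robba" using Gc e i j by (intro UE) auto
        show "bnd_at l (C * \<tau> ^ q * D) (U k (G q j i \<odot>\<^bsub>X.E\<^esub> e j))"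
          unfolding U_smult[OF Gc[OF j i] e[OF j]] by (rule bnd_at_mult[OF l(1) Gb[OF j i] D(2)[OF j]])
      qed (use C D \<tau> in \<open>auto simp: bnd_at_def intro: bnd_at_add[OF l(1), unfolded bnd_at_def, rule_format]\<close>)
      have "bnd_at l (real p * B * \<tau> ^ m) ((robba_deriv ^^ m) (c i))"
      proof (rule bnd_at_mono[OF bnd_at_deriv_iter[OF l(1) B(2)[OF i]]])
        have "av (fact m :: 'k) * B / l ^ m \<le> (real p * \<theta> ^ m) * B / s ^ m"
          using fact_le(1)[of m] fact_le(2) B(1) p0 s0 sl by (intro frac_le mult_right_mono power_mono) auto
        thus "av (fact m :: 'k) * B / l ^ m \<le> real p * B * \<tau> ^ m" by (simp add: \<tau>_def power_divide mult_ac)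
      qed
      from bnd_at_mult[OF l(1) this b1]
      have "bnd_at l (K * \<tau> ^ (m + q)) (robba_mult ((robba_deriv ^^ m) (c i)) (U k ((conn ^^ q) (e i))))"
        by (simp add: K_def power_add mult_ac)
      thus ?case using U_smult[OF cD[OF i] eq] by simp
    next
      case (Suc n)
      have eq: "(conn ^^ q) (e i) \<in> carrier X.E" for q using additive_mapD(1)[OF connN e[OF i]] .
      let ?y = "\<lambda>m q. (robba_deriv ^^ m) (c i) \<odot>\<^bsub>X.E\<^esub> (conn ^^ q) (e i)"
      have y: "?y m q \<in> carrier X.E" for m q by (rule X.E_smult_closed[OF cD[OF i] eq])
      have "conn (?y m q) = ?y (Suc m) q \<oplus>\<^bsub>X.E\<^esub> ?y m (Suc q)"
        using conn_smult[OF cD[OF i] eq] by simp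
      hence "(conn ^^ Suc n) (?y m q) = (conn ^^ n) (?y (Suc m) q) \<oplus>\<^bsub>X.E\<^esub> (conn ^^ n) (?y m (Suc q))"
        using additive_mapD(2)[OF connN[of n] y[of "Suc m" q] y[of m "Suc q"]]
        by (simp only: funpow_Suc_right comp_apply)
      hence "U k ((conn ^^ Suc n) (?y m q)) = (\<lambda>z. U k ((conn ^^ n) (?y (Suc m) q)) z + U k ((conn ^^ n) (?y m (Suc q))) z)"
        using additive_mapD(2)[OF U additive_mapD(1)[OF connN y] additive_mapD(1)[OF connN y]]
        by (simp only: robba_simps)
      moreover have "bnd_at l (K * \<tau> ^ (Suc n + m + q)) \<dots>"
        using Suc.IH[of "Suc m" q] Suc.IH[of m "Suc q"] by (intro bnd_at_add[OF l(1)]) (simp_all only: add_Suc add_Suc_right)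
      ultimately show ?case by simp
    qed
    have "bnd_at l (K * \<tau> ^ n) (psi (monom 1 n) k)" for n
    proof -
      \<comment> \<open>The derivation kills the unit of the Robba ring, so iterating the connection
        on 1 \<otimes> 1 only raises the power of the derivation in the second factor.\<close>
      have vn: "(conn ^^ n) v = X.tn \<one>\<^bsub>robba\<^esub> (cyc P (monom 1 n))"
      proof (induction n)
        case (Suc n)
        have "robba_deriv \<one>\<^bsub>robba\<^esub> = (\<zero>\<^bsub>robba\<^esub> :: int \<Rightarrow> 'k)" by (rule ext) (simp add: robba_deriv_def del: of_int_add)
        hence "X.tn (robba_deriv \<one>\<^bsub>robba\<^esub>) (cyc P (monom 1 n)) = \<zero>\<^bsub>X.E\<^esub>"
          using additive_map_0[OF X.additive_map_tens_left Rab Eab, of "cyc P (monom 1 n)"] cycM by simp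
        moreover have "weyl_d \<odot>\<^bsub>M\<^esub> cyc P (monom 1 n) = cyc P (monom 1 (Suc n))"
          by (simp add: M_def cyclic_smult weyl_mult_d monom_Suc map_poly_monom)
        moreover have "X.tn \<one>\<^bsub>robba\<^esub> (cyc P (monom 1 (Suc n))) \<in> carrier X.E"
          by (rule X.tens_closed) (simp_all add: cycM del: robba_simps)
        ultimately show ?case using Suc.IH conn_tn[OF RR.one_closed cycM] by (simp del: robba_simps)
      qed (simp add: v_def)
      have "psi (monom 1 n) k = U k ((conn ^^ n) v)"
        unfolding vn U_tn[OF RR.one_closed cycM] psc using robba_mult_1 by (simp add: robba_mult_1)
      also have "(conn ^^ n) v = (\<Oplus>\<^bsub>X.E\<^esub>i\<in>{..<r}. (conn ^^ n) (c i \<odot>\<^bsub>X.E\<^esub> e i))"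
        unfolding v using c e by (intro additive_map_finsum[OF connN Eab Eab]) auto
      also have "U k (\<Oplus>\<^bsub>X.E\<^esub>i\<in>{..<r}. (conn ^^ n) (c i \<odot>\<^bsub>X.E\<^esub> e i)) = finsum robba (\<lambda>i. U k ((conn ^^ n) (c i \<odot>\<^bsub>X.E\<^esub> e i))) {..<r}"
        using c e additive_mapD(1)[OF connN] by (intro additive_map_finsum[OF U Eab Rab]) auto
      finally have eqF: "psi (monom 1 n) k = finsum robba (\<lambda>i. U k ((conn ^^ n) (c i \<odot>\<^bsub>X.E\<^esub> e i))) {..<r}" .
      show ?thesis unfolding eqF
      proof (rule finsum_pred[OF Rab])
        fix i assume "i \<in> {..<r}"
        hence i: "i < r" by simp
        show "U k ((conn ^^ n) (c i \<odot>\<^bsub>X.E\<^esub> e i)) \<in> carrier robba"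
          using c e i additive_mapD(1)[OF connN] by (intro UE) auto
        show "bnd_at l (K * \<tau> ^ n) (U k ((conn ^^ n) (c i \<odot>\<^bsub>X.E\<^esub> e i)))"
          using main[OF i, of n 0 0] by simp
      qed (use K \<tau> in \<open>auto simp: bnd_at_def intro: bnd_at_add[OF l(1), unfolded bnd_at_def, rule_format]\<close>)
    qed
    thus "\<exists>K>0. \<forall>n. bnd_at l (K * \<tau> ^ n) (psi (monom 1 n) k)" using K by blast
  next
    fix k and K K' :: real assume K: "\<forall>n. bnd_at l (K * \<tau> ^ n) (psi (monom 1 n) k)" "K \<le> K'"
    have "K * \<tau> ^ n \<le> K' * \<tau> ^ n" for n using K(2) \<tau>(1) by (intro mult_right_mono) simp_all
    thus "\<forall>n. bnd_at l (K' * \<tau> ^ n) (psi (monom 1 n) k)"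
      using bnd_at_mono[OF spec[OF K(1)]] by blast
  qed
  then obtain K where K: "0 < K" "\<And>k n. k < d \<Longrightarrow> bnd_at l (K * \<tau> ^ n) (psi (monom 1 n) k)" by blast

  \<comment> \<open>This weight exceeds 1 and satisfies l \<rho> = 1/l > 1, as
    \<open>gauss_weights\<close> and the growth of \<rho>^n require.\<close>
  define \<rho> where "\<rho> = 1 / l\<^sup>2"
  have \<rho>1: "1 < \<rho>" using l by (simp add: \<rho>_def power_less_one_iff)
  have gw: "gauss_weights l \<rho>"
    by unfold_locales (use l \<rho>1 in \<open>auto simp: \<rho>_def power2_eq_square\<close>)
  have "wt l \<rho> P d \<delta> \<le> wt l \<rho> P k0 i0" using la by (simp add: wt_def top a_def \<rho>_def)
  note lower = psi_lower_bound[OF gw k0 this]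
  have "(\<lambda>n. K * \<tau> ^ n) \<longlonglongrightarrow> 0" using \<tau> by (intro tendsto_mult_right_zero LIMSEQ_realpow_zero) auto
  hence "eventually (\<lambda>n. K * \<tau> ^ n < 1) sequentially" by (rule order_tendstoD(2)) simp
  then obtain N where N: "\<And>n. N \<le> n \<Longrightarrow> K * \<tau> ^ n < 1" unfolding eventually_sequentially by blast
  define n where "n = max N d"
  obtain k i where ki: "k < d" "\<rho> ^ n \<le> av (psi (monom 1 n) k i) * l powi i * \<rho> ^ k"
    using lower[of n] by (auto simp: n_def)
  \<comment> \<open>As n is at least d > k and \<rho> > 1, a factor below 1 on \<rho>^k contradicts
    \<rho>^k \<le> \<rho>^n.\<close>
  have "\<rho> ^ n \<le> (K * \<tau> ^ n) * \<rho> ^ k"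
    by (rule order_trans[OF ki(2) mult_right_mono[OF bnd_atD[OF K(2)[OF ki(1)]]]]) (use \<rho>1 in simp)
  also have "\<dots> < 1 * \<rho> ^ k" using N[of n] \<rho>1 by (intro mult_strict_right_mono) (auto simp: n_def)
  also have "\<dots> \<le> \<rho> ^ n" using \<rho>1 ki(1) by (simp add: n_def power_increasing)
  finally show False by simp
qed

end

section \<open>The Fourier transform on symbols\<close>

lemma symb_mult_const: "symb_mult (symb_const c) F = symb_const c * F"
  by (simp add: symb_const_def symb_mult_fls_const)

lemma symb_mult_const_right: "symb_mult F (symb_const c) = symb_const c * F"
  by (subst symb_mult_const_coeffs) (simp_all add: symb_const_def mult.commute)

lemma symb_mult_0 [simp]: "symb_mult 0 F = 0" "symb_mult F 0 = 0"
  using symb_mult_const[of 0 F] symb_mult_const_right[of F 0] by (simp_all add: symb_const_def)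

lemma symb_mult_uminus: "symb_mult (- F) G = - symb_mult F G" "symb_mult F (- G) = - symb_mult F G"
proof -
  have "symb_mult (- F) G + symb_mult F G = 0" by (simp flip: symb_mult_distrib_right)
  thus "symb_mult (- F) G = - symb_mult F G" by (simp add: eq_neg_iff_add_eq_0)
  have "symb_mult F (- G) + symb_mult F G = 0" by (simp flip: symb_mult_distrib_left)
  thus "symb_mult F (- G) = - symb_mult F G" by (simp add: eq_neg_iff_add_eq_0)
qed

lemma symb_mult_eta_t: "symb_mult symb_eta symb_t = symb_t * symb_eta + 1"
proof -
  have "symb_d_eta symb_eta = (1 :: 'a fps fls)"
    by (rule fls_eqI) (simp add: nth_symb_d_eta symb_eta_def)
  thus ?thesis by (simp add: symb_mult_t)
qed

lemma symb_mult_t_left: "symb_mult symb_t F = symb_t * F"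
  by (simp add: symb_t_def symb_mult_fls_const)

lemma symb_const_mult: "symb_const (a * b) = symb_const a * symb_const b"
  by (simp add: symb_const_def)

lemma symb_const_add: "symb_const (a + b) = symb_const a + symb_const b"
  by (rule fls_eqI) (simp add: symb_const_def)

lemma symb_const_uminus: "symb_const (- a) = - symb_const a"
  by (rule fls_eqI) (simp add: symb_const_def)

lemma symb_const_1 [simp]: "symb_const 1 = 1"
  by (simp add: symb_const_def)

lemma symb_mult_consts:
  "symb_mult (symb_mult (symb_const a) F) (symb_mult (symb_const b) G) = symb_const (a * b) * symb_mult F G"
proof -
  have "symb_mult (symb_mult (symb_const a) F) (symb_mult (symb_const b) G) =
      symb_mult (symb_const a) (symb_mult (symb_mult F (symb_const b)) G)"
    by (simp only: symb_mult_assoc)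
  also have "symb_mult F (symb_const b) = symb_mult (symb_const b) F"
    by (simp add: symb_mult_const symb_mult_const_right)
  also have "symb_mult (symb_const a) (symb_mult (symb_mult (symb_const b) F) G) =
      symb_const a * (symb_const b * symb_mult F G)"
    unfolding symb_mult_assoc unfolding symb_mult_const ..
  finally show ?thesis by (simp only: symb_const_mult mult.assoc)
qed

lemma weyl_mult_const_right: "weyl_mult F [:[:c:]:] = Polynomial.smult [:c:] F"
proof (induction F rule: weyl_generated)
  case (mult F G)
  have "weyl_mult (weyl_mult F G) [:[:c:]:] = weyl_mult F (weyl_mult [:[:c:]:] G)"
    by (simp only: weyl_mult_assoc mult weyl_mult_const_left)
  also have "\<dots> = weyl_mult (weyl_mult F [:[:c:]:]) G" by (simp only: weyl_mult_assoc)
  also have "\<dots> = weyl_mult [:[:c:]:] (weyl_mult F G)" by (simp only: mult weyl_mult_const_left[symmetric] weyl_mult_assoc)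
  finally show ?case by (simp only: weyl_mult_const_left)
next
  case d
  show ?case unfolding weyl_mult_d by (simp add: weyl_d_def map_poly_pCons)
qed (simp_all add: weyl_mult_const_left weyl_mult_d weyl_var_def weyl_d_def weyl_mult_distrib_right smult_add_right
      map_poly_pCons pderiv_pCons mult.commute)

lemma weyl_mult_uminus: "weyl_mult (- F) G = - weyl_mult F G"
  using weyl_mult_diff_right[of 0 F G] by simp

lemma poly_in_eta_pCons: "poly_in_eta (pCons a q) = fls_const a + fls_X_inv * poly_in_eta q"
  by (simp add: poly_in_eta_def map_poly_pCons)

lemma poly_in_eta_0 [simp]: "poly_in_eta 0 = 0"
  by (simp add: poly_in_eta_def)

lemma nth_poly_in_eta: "fls_nth (poly_in_eta q) n = (if n \<le> 0 then coeff q (nat (- n)) else 0)"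
proof (induction q arbitrary: n)
  case (pCons a q)
  show ?case
  proof (cases "n \<le> 0")
    case True
    then obtain k where n: "n = - int k" by (metis nonpos_int_cases)
    show ?thesis
      by (cases k) (simp_all add: n poly_in_eta_pCons fls_X_inv_times_conv_shift pCons.IH nat_add_distrib)
  qed (simp add: poly_in_eta_pCons fls_X_inv_times_conv_shift pCons.IH)
qed simp

lemma fls_deriv_poly_in_eta:
  "fls_deriv (poly_in_eta q) = poly_in_eta (- pCons 0 (pCons 0 (pderiv (q :: 'k::field_char_0 poly))))"
proof (rule fls_eqI)
  fix n :: int
  consider "n > 0" | "n = 0" | "n = - 1" | k where "n = - 2 - int k"
  proof -
    assume *: "n > 0 \<Longrightarrow> thesis" "n = 0 \<Longrightarrow> thesis" "n = - 1 \<Longrightarrow> thesis" "\<And>k. n = - 2 - int k \<Longrightarrow> thesis"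
    have "thesis" if "n \<le> - 2" by (rule *(4)[of "nat (- 2 - n)"]) (use that in simp)
    moreover have "n > 0 \<or> n = 0 \<or> n = - 1 \<or> n \<le> - 2" by arith
    ultimately show thesis using *(1-3) by auto
  qed
  thus "fls_nth (fls_deriv (poly_in_eta q)) n = fls_nth (poly_in_eta (- pCons 0 (pCons 0 (pderiv q)))) n"
  proof cases
    case 4
    have "nat (2 + int k) = Suc (Suc k)" "nat (1 + int k) = Suc k" by simp_all
    thus ?thesis by (simp add: 4 nth_poly_in_eta) (simp add: coeff_pderiv algebra_simps)
  qed (simp_all add: nth_poly_in_eta)
qed

lemma poly_in_eta_closed:
  assumes om: "0 < omega p" "omega p < 1" shows "poly_in_eta q \<in> carrier (A_eta p)"
  by (induction q) (simp_all add: poly_in_eta_pCons A_eta_0_1_closed[OF om] A_eta_add_closed[OF om] A_eta_mult_closed[OF om]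
      A_eta_const_closed[OF om] A_eta_X_inv_closed[OF om])

lemma symb_eta_mult_A_to_Phi: "symb_mult symb_eta (A_to_Phi b) = A_to_Phi (fls_X_inv * b)"
proof -
  have "A_to_Phi fls_X_inv = (symb_eta :: 'a fps fls)" by (rule fls_eqI) (simp add: symb_eta_def)
  thus ?thesis by (simp add: symb_mult_A_to_Phi_right A_to_Phi_mult)
qed

lemma A_to_Phi_const: "A_to_Phi (fls_const c) = symb_const c"
  by (rule fls_eqI) (simp add: symb_const_def)

text \<open>The action of \<open>\<eta>\<^sup>2 \<cdot> t\<close> on \<open>\<Phi>\<close> is a connection over \<open>\<partial>\<^bsub>\<eta>\<^sup>-\<^sup>1\<^esub>\<close>.\<close>

lemma symb_eta2_t_commutator:
  "symb_mult (symb_mult (symb_mult symb_eta symb_eta) symb_t) (A_to_Phi a) =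
   A_to_Phi (fls_deriv a) + symb_mult (A_to_Phi a) (symb_mult (symb_mult symb_eta symb_eta) symb_t)"
proof -
  have eta2: "symb_mult (symb_mult symb_eta symb_eta) (A_to_Phi b) = A_to_Phi (fls_X_inv * (fls_X_inv * b))" for b :: "'a fls"
    by (simp only: symb_mult_assoc symb_eta_mult_A_to_Phi)
  have eta2_1: "symb_mult symb_eta symb_eta = A_to_Phi (fls_X_inv * fls_X_inv :: 'a fls)"
    using eta2[of 1] by simp
  have cancel: "fls_X_inv * (fls_X_inv * (fls_X\<^sup>2 * fls_deriv a)) = fls_deriv a"
    by (rule fls_eqI) (simp add: fls_X_inv_times_conv_shift fls_X_power_times_conv_shift)
  have "symb_mult (A_to_Phi a) symb_t = symb_mult symb_t (A_to_Phi a) - A_to_Phi (fls_X\<^sup>2 * fls_deriv a)"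
    by (simp add: symb_mult_t symb_mult_t_left symb_d_eta_A_to_Phi)
  hence t: "symb_mult symb_t (A_to_Phi a) = A_to_Phi (fls_X\<^sup>2 * fls_deriv a) + symb_mult (A_to_Phi a) symb_t" by simp
  have c: "symb_mult (symb_mult symb_eta symb_eta) (A_to_Phi a) = symb_mult (A_to_Phi a) (symb_mult symb_eta symb_eta)"
    unfolding eta2_1 symb_mult_A_to_Phi_right by (rule mult.commute)
  have "symb_mult (symb_mult (symb_mult symb_eta symb_eta) symb_t) (A_to_Phi a) =
      symb_mult (symb_mult symb_eta symb_eta) (symb_mult symb_t (A_to_Phi a))"
    by (simp only: symb_mult_assoc)
  also have "\<dots> = A_to_Phi (fls_deriv a) + symb_mult (symb_mult (symb_mult symb_eta symb_eta) (A_to_Phi a)) symb_t"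
    unfolding t symb_mult_distrib_left eta2[of "fls_X\<^sup>2 * fls_deriv a"] cancel by (simp only: symb_mult_assoc)
  finally show ?thesis unfolding c by (simp only: symb_mult_assoc)
qed

locale fourier_symbols =
  fixes p :: nat and \<pi> :: "'k::nonarch_field"
  assumes om: "0 < omega p" "omega p < 1" and \<pi>0: "\<pi> \<noteq> 0"
begin

sublocale W: weyl_rep weyl weyl_const "weyl_const (- 1 / \<pi>) \<otimes>\<^bsub>weyl\<^esub> weyl_d" "weyl_const \<pi> \<otimes>\<^bsub>weyl\<^esub> weyl_var"
proof (intro weyl_rep.intro weyl_rep_axioms.intro weyl_ring)
  show "(weyl_const \<pi> \<otimes>\<^bsub>weyl\<^esub> weyl_var) \<otimes>\<^bsub>weyl\<^esub> (weyl_const (- 1 / \<pi>) \<otimes>\<^bsub>weyl\<^esub> weyl_d) =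
      (weyl_const (- 1 / \<pi>) \<otimes>\<^bsub>weyl\<^esub> weyl_d) \<otimes>\<^bsub>weyl\<^esub> (weyl_const \<pi> \<otimes>\<^bsub>weyl\<^esub> weyl_var) + \<one>\<^bsub>weyl\<^esub>"
  proof -
    have y: "weyl_mult (weyl_const \<pi>) weyl_var = [:[:0, \<pi>:]:]"
      by (simp add: weyl_const_def weyl_mult_const_left weyl_var_def)
    have x: "weyl_mult (weyl_const (- 1 / \<pi>)) weyl_d = [:0, [:- 1 / \<pi>:]:]"
      by (simp add: weyl_const_def weyl_mult_const_left weyl_d_def)
    have "weyl_mult [:[:0, \<pi>:]:] [:0, [:- 1 / \<pi>:]:] = [:0, [:0, - 1:]:]"
      using \<pi>0 by (simp add: weyl_mult_const_left)
    moreover have "weyl_mult [:0, [:- 1 / \<pi>:]:] [:[:0, \<pi>:]:] = [:[:- 1:], [:0, - 1:]:]"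
      unfolding x[symmetric] weyl_mult_assoc weyl_mult_d unfolding weyl_const_def weyl_mult_const_left
      using \<pi>0 by (simp add: map_poly_pCons pderiv_pCons)
    ultimately show ?thesis unfolding weyl_simps x y by (simp add: one_pCons)
  qed
qed (simp_all add: weyl_const_def weyl_mult_const_left weyl_mult_const_right one_pCons)

text \<open>This representation sends \<eta> to \<eta> and the derivation to -t. Since [-t, \<eta>]
  = [\<eta>, t] = 1 in \<open>Phi\<close>, it is a morphism; it carries the Fourier transform into
  \<open>Phi\<close>.\<close>

sublocale H: weyl_rep "Phi p" symb_const symb_eta "- symb_t"
  by (intro weyl_rep.intro weyl_rep_axioms.intro Phi_ring[OF om])
     (simp_all add: symb_const_closed[OF om] symb_eta_closed[OF om] Phi_uminus_closed[OF om] symb_t_closed[OF om]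
       symb_mult_const symb_mult_const_right symb_mult_uminus symb_mult_eta_t symb_mult_t_left
       symb_const_mult symb_const_add)

sublocale T: weyl_rep "Phi p" symb_const "symb_const (1 / \<pi>) \<otimes>\<^bsub>Phi p\<^esub> symb_t" "symb_const \<pi> \<otimes>\<^bsub>Phi p\<^esub> symb_eta"
proof (intro weyl_rep.intro weyl_rep_axioms.intro Phi_ring[OF om])
  show "(symb_const \<pi> \<otimes>\<^bsub>Phi p\<^esub> symb_eta) \<otimes>\<^bsub>Phi p\<^esub> (symb_const (1 / \<pi>) \<otimes>\<^bsub>Phi p\<^esub> symb_t) =
      (symb_const (1 / \<pi>) \<otimes>\<^bsub>Phi p\<^esub> symb_t) \<otimes>\<^bsub>Phi p\<^esub> (symb_const \<pi> \<otimes>\<^bsub>Phi p\<^esub> symb_eta) + \<one>\<^bsub>Phi p\<^esub>"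
    using \<pi>0 by (simp add: symb_mult_consts symb_mult_eta_t symb_mult_t_left)
  show "symb_const (1 / \<pi>) \<otimes>\<^bsub>Phi p\<^esub> symb_t \<in> carrier (Phi p)" "symb_const \<pi> \<otimes>\<^bsub>Phi p\<^esub> symb_eta \<in> carrier (Phi p)"
    by (simp_all add: symb_const_closed[OF om] symb_eta_closed[OF om] Phi_mult_closed[OF om] symb_t_closed[OF om])
qed (simp_all add: symb_const_closed[OF om]
       symb_mult_const symb_mult_const_right symb_const_mult symb_const_add)

lemma fourier_hom_mult: "fourier_hom \<pi> (weyl_mult F G) = weyl_mult (fourier_hom \<pi> F) (fourier_hom \<pi> G)"
  using W.ev_mult[of F G] by (simp add: fourier_hom_def)

lemma Phi_hom_mult: "Phi_hom p \<pi> (weyl_mult F G) = symb_mult (Phi_hom p \<pi> F) (Phi_hom p \<pi> G)"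
  using T.ev_mult[of F G] by (simp add: Phi_hom_def)

lemma Phi_hom_add: "Phi_hom p \<pi> (F + G) = Phi_hom p \<pi> F + Phi_hom p \<pi> G"
  using T.ev_add[of F G] by (simp add: Phi_hom_def)

lemma Phi_hom_closed: "Phi_hom p \<pi> F \<in> carrier (Phi p)"
  using T.ev_closed[of F] by (simp only: Phi_hom_def)

lemma Phi_hom_1: "Phi_hom p \<pi> 1 = 1"
  using T.ev_1 by (simp add: Phi_hom_def)

lemma H_mult: "H.ev (weyl_mult F G) = symb_mult (H.ev F) (H.ev G)"
  using H.ev_mult[of F G] by simp

lemma H_1: "H.ev 1 = 1"
  using H.ev_1 by simp

text \<open>On generators: t goes to -1/\<pi> times the derivation and then to t/\<pi>, and the
  derivation goes to \<pi> \<eta>. This identity makes the comparison map respect the balancing over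
  the Weyl algebra in t.\<close>

lemma H_fourier: "H.ev (fourier_hom \<pi> F) = Phi_hom p \<pi> F"
  unfolding Phi_hom_def
proof (rule T.ev_unique)
  show "H.ev (fourier_hom \<pi> weyl_var) = symb_const (1 / \<pi>) \<otimes>\<^bsub>Phi p\<^esub> symb_t"
  proof -
    have "H.ev (fourier_hom \<pi> weyl_var) = symb_mult (symb_const (- 1 / \<pi>)) (- symb_t)"
      unfolding fourier_hom_def W.ev_var by (simp only: weyl_simps H_mult H.ev_d weyl_const_def H.ev_const)
    thus ?thesis by (simp add: symb_mult_uminus symb_mult_const symb_const_uminus)
  qed
  show "H.ev (fourier_hom \<pi> weyl_d) = symb_const \<pi> \<otimes>\<^bsub>Phi p\<^esub> symb_eta"
    unfolding fourier_hom_def W.ev_d by (simp only: weyl_simps Phi_simps H_mult H.ev_var weyl_const_def H.ev_const)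
  show "H.ev (fourier_hom \<pi> [:[:c:]:]) = symb_const c" for c
    unfolding fourier_hom_def W.ev_const by (simp only: weyl_const_def H.ev_const)
  show "H.ev (fourier_hom \<pi> (F + G)) = H.ev (fourier_hom \<pi> F) + H.ev (fourier_hom \<pi> G)" for F G
    unfolding fourier_hom_def W.ev_add by (rule H.ev_add)
  show "H.ev (fourier_hom \<pi> (weyl_mult F G)) = H.ev (fourier_hom \<pi> F) \<otimes>\<^bsub>Phi p\<^esub> H.ev (fourier_hom \<pi> G)" for F G
    by (simp only: Phi_simps fourier_hom_mult H_mult)
qed

lemma H_poly: "H.ev [:q:] = A_to_Phi (poly_in_eta q)"
proof (induction q)
  case (pCons a q)
  have e: "[:pCons a q:] = [:[:a:]:] + weyl_mult weyl_var [:q:]"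
    by (simp add: weyl_var_def weyl_mult_const_left)
  show ?case unfolding e H.ev_add H_mult pCons.IH H.ev_const H.ev_var
    by (simp add: poly_in_eta_pCons A_to_Phi_add symb_eta_mult_A_to_Phi A_to_Phi_const)
qed simp

text \<open>Powers of minus the derivation, so that \<open>H.ev\<close> sends them to t^i without
  signs.\<close>

definition dn :: "nat \<Rightarrow> 'k weyl" where "dn i = monom ((- 1) ^ i) i"

lemma dn_0: "dn 0 = 1"
  by (simp add: dn_def monom_0 one_pCons)

lemma dn_Suc: "dn (Suc i) = weyl_mult (- weyl_d) (dn i)"
proof -
  have "pderiv ((- 1) ^ i :: 'k poly) = 0"
    by (cases "even i") (simp_all add: pderiv_minus)
  thus ?thesis by (simp add: dn_def weyl_mult_uminus weyl_mult_d map_poly_monom monom_Suc flip: minus_monom)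
qed

lemma H_dn: "H.ev (dn i) = fls_const (fps_X ^ i)"
proof (induction i)
  case 0
  show ?case using H_1 by (simp add: dn_0)
next
  case (Suc i)
  have d: "H.ev (- weyl_d :: 'k weyl) = symb_t"
  proof -
    have "(- weyl_d :: 'k weyl) = weyl_mult [:[:- 1:]:] weyl_d" by (simp add: weyl_mult_const_left weyl_d_def one_pCons)
    hence "H.ev (- weyl_d :: 'k weyl) = symb_mult (symb_const (- 1)) (- symb_t)" by (simp only: H_mult H.ev_d H.ev_const)
    thus ?thesis by (simp add: symb_mult_uminus symb_mult_const symb_const_uminus)
  qed
  show ?case unfolding dn_Suc H_mult d Suc.IH by (simp add: symb_t_def symb_mult_fls_const)
qed

lemma H_eta2_d: "H.ev (- weyl_mult (weyl_mult weyl_var weyl_var) weyl_d :: 'k weyl) =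
    symb_mult (symb_mult symb_eta symb_eta) symb_t"
proof -
  have e: "(- weyl_mult (weyl_mult weyl_var weyl_var) weyl_d :: 'k weyl) =
      weyl_mult (weyl_mult weyl_var weyl_var) (weyl_mult [:[:- 1:]:] weyl_d)"
    by (simp add: weyl_var_def weyl_d_def weyl_mult_const_left one_pCons)
  have "H.ev (weyl_mult (weyl_mult weyl_var weyl_var) (weyl_mult [:[:- 1:]:] weyl_d :: 'k weyl)) =
      symb_mult (symb_mult symb_eta symb_eta) (symb_mult (symb_const (- 1)) (- symb_t))"
    by (simp only: H_mult H.ev_var H.ev_const H.ev_d)
  also have "symb_mult (symb_const (- 1)) (- symb_t) = (symb_t :: 'k fps fls)"
    by (simp add: symb_mult_uminus symb_mult_const symb_const_uminus)
  finally show ?thesis by (simp only: e)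
qed

text \<open>The morphism places t to the left of \<eta>, where the product has no corrections, so
  t^i times the k-th derivation becomes \<pi>^(k-i) t^i \<eta>^k.\<close>

lemma nth_Phi_hom:
  "fps_nth (fls_nth (Phi_hom p \<pi> F) n) i =
    (if n \<le> 0 then coeff (coeff F (nat (- n))) i * \<pi> ^ nat (- n) / \<pi> ^ i else 0)"
proof (induction F arbitrary: n i rule: weyl_induct)
  case (monom c j k)
  let ?x = "symb_const (1 / \<pi>) \<otimes>\<^bsub>Phi p\<^esub> symb_t" and ?y = "symb_const \<pi> \<otimes>\<^bsub>Phi p\<^esub> symb_eta"
  have x: "?x [^]\<^bsub>Phi p\<^esub> (m::nat) = fls_const (fps_const (1 / \<pi> ^ m) * fps_X ^ m)" for m
  proof (induction m)
    case (Suc m)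
    have "(fps_const (1 / \<pi> ^ m) * fps_X ^ m) * (fps_const (1 / \<pi>) * fps_X) = (fps_const (1 / \<pi> ^ m) * fps_const (1 / \<pi>)) * (fps_X ^ m * fps_X)"
      by (simp only: mult_ac)
    hence e: "(fps_const (1 / \<pi> ^ m) * fps_X ^ m) * (fps_const (1 / \<pi>) * fps_X) = fps_const (1 / \<pi> ^ Suc m) * fps_X ^ Suc m"
      by (simp add: mult.commute)
    have x1: "?x = fls_const (fps_const (1 / \<pi>) * fps_X)"
      by (simp only: Phi_simps symb_mult_const) (simp add: symb_t_def symb_const_def)
    show ?case unfolding H.nat_pow_Suc unfolding Suc.IH unfolding x1 by (simp only: Phi_simps symb_mult_fls_const fls_const_mult_const e)
  qed simp
  have y1: "?y = A_to_Phi (fls_const \<pi> * fls_X_inv)"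
    by (simp add: symb_mult_const A_to_Phi_mult A_to_Phi_const A_to_Phi_X_inv[OF om])
  have y: "?y [^]\<^bsub>Phi p\<^esub> (m::nat) = A_to_Phi (fls_const (\<pi> ^ m) * fls_X_inv ^ m)" for m
  proof (induction m)
    case (Suc m)
    have e: "fls_const (\<pi> ^ Suc m) * fls_X_inv ^ Suc m = (fls_const (\<pi> ^ m) * fls_X_inv ^ m) * (fls_const \<pi> * fls_X_inv)"
      by (simp add: mult_ac flip: fls_const_mult_const)
    show ?case unfolding H.nat_pow_Suc unfolding Suc.IH unfolding y1 e unfolding Phi_simps symb_mult_A_to_Phi_right by (rule A_to_Phi_mult[symmetric])
  qed simp
  have "Phi_hom p \<pi> (monom (monom c j) k) = fls_const (fps_const c * (fps_const (1 / \<pi> ^ j) * fps_X ^ j)) *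
      A_to_Phi (fls_const (\<pi> ^ k) * fls_X_inv ^ k)"
    unfolding Phi_hom_def T.ev_monom T.tm_def x y
    by (simp add: symb_mult_const symb_const_def symb_mult_fls_const)
  thus ?case by (auto simp: mult.assoc)
next
  case (add F G)
  thus ?case by (simp add: Phi_hom_add add_divide_distrib ring_distribs)
qed

text \<open>Multiplication by t becomes a derivation, so degree in t becomes order. Reordering
  produces lower order only; the top coefficient therefore collects the coefficients of t^\<delta>
  of all the coefficients of F.\<close>

lemma fourier_hom_top:
  assumes "\<And>k. degree (coeff F k) \<le> \<delta>"
  shows "degree (fourier_hom \<pi> F) \<le> \<delta>"
    and "coeff (coeff (fourier_hom \<pi> F) \<delta>) k = coeff (coeff F k) \<delta> * (- 1 / \<pi>) ^ \<delta> * \<pi> ^ k"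
proof -
  let ?x = "monom [:- 1 / \<pi>:] 1 :: 'k weyl" and ?y = "weyl_const \<pi> \<otimes>\<^bsub>weyl\<^esub> weyl_var"
  have x1: "weyl_const (- 1 / \<pi>) \<otimes>\<^bsub>weyl\<^esub> weyl_d = ?x"
    by (simp add: weyl_const_def weyl_mult_const_left weyl_d_def monom_altdef)
  have x: "degree (?x [^]\<^bsub>weyl\<^esub> (m::nat)) \<le> m \<and> coeff (?x [^]\<^bsub>weyl\<^esub> m) m = [:(- 1 / \<pi>) ^ m:]" for m
  proof (induction m)
    case (Suc m)
    have "degree (monom [:- 1 / \<pi>:] 1 :: 'k weyl) \<le> 1" by (rule degree_monom_le)
    from weyl_mult_coeff_top[OF conjunct1[OF Suc] this] conjunct2[OF Suc] show ?case
      by simp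
  qed (simp add: one_pCons)
  have y1: "?y = [:monom \<pi> 1:]"
    by (simp add: weyl_const_def weyl_mult_const_left weyl_var_def monom_altdef)
  have y: "?y [^]\<^bsub>weyl\<^esub> (m::nat) = [:monom (\<pi> ^ m) m:]" for m
    by (induction m) (simp_all only: W.nat_pow_Suc W.nat_pow_0 y1, simp_all add: weyl_mult_const_left mult_monom one_pCons monom_0 mult.commute)
  have tm: "degree (W.tm c i j) \<le> i \<and> coeff (W.tm c i j) i = monom (c * (- 1 / \<pi>) ^ i * \<pi> ^ j) j" for c i j
  proof -
    let ?z = "weyl_mult (?x [^]\<^bsub>weyl\<^esub> i) [:monom (\<pi> ^ j) j:]"
    have z: "coeff ?z i = [:(- 1 / \<pi>) ^ i:] * monom (\<pi> ^ j) j" "degree ?z \<le> i"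
      using weyl_mult_coeff_top[OF conjunct1[OF x[of i]], of "[:monom (\<pi> ^ j) j:]" 0] conjunct2[OF x[of i]] by simp_all
    have "W.tm c i j = Polynomial.smult [:c:] ?z"
      unfolding W.tm_def unfolding y unfolding x1 unfolding weyl_simps weyl_mult_assoc
      unfolding weyl_const_def weyl_mult_const_left ..
    thus ?thesis using z
      by (simp add: smult_monom mult.assoc)
  qed
  have ev: "fourier_hom \<pi> F = (\<Sum>k\<le>degree F. \<Sum>i\<le>\<delta>. W.tm (coeff (coeff F k) i) i k)"
    unfolding fourier_hom_def by (rule W.ev_sum[OF order_refl assms])
  show "degree (fourier_hom \<pi> F) \<le> \<delta>"
    unfolding ev using tm by (intro degree_sum_le order_trans[OF conjunct1[OF tm]]) auto
  have "coeff (\<Sum>i\<le>\<delta>. W.tm (coeff (coeff F j) i) i j) \<delta> = monom (coeff (coeff F j) \<delta> * (- 1 / \<pi>) ^ \<delta> * \<pi> ^ j) j" for j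
  proof -
    have "coeff (W.tm (coeff (coeff F j) i) i j) \<delta> = 0" if "i < \<delta>" for i
      using tm[of "coeff (coeff F j) i" i j] that by (intro coeff_eq_0) simp
    hence "coeff (\<Sum>i<\<delta>. W.tm (coeff (coeff F j) i) i j) \<delta> = 0" by (simp add: coeff_sum)
    moreover have "{..\<delta>} = insert \<delta> {..<\<delta>}" by auto
    ultimately show ?thesis using tm[of "coeff (coeff F j) \<delta>" \<delta> j] by simp
  qed
  hence "coeff (coeff (fourier_hom \<pi> F) \<delta>) k =
      (\<Sum>j\<le>degree F. if j = k then coeff (coeff F j) \<delta> * (- 1 / \<pi>) ^ \<delta> * \<pi> ^ j else 0)"
    unfolding ev by (simp add: coeff_sum coeff_monom)
  also have "\<dots> = coeff (coeff F k) \<delta> * (- 1 / \<pi>) ^ \<delta> * \<pi> ^ k"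
    by (cases "k \<le> degree F") (simp_all add: coeff_eq_0)
  finally show "coeff (coeff (fourier_hom \<pi> F) \<delta>) k = coeff (coeff F k) \<delta> * (- 1 / \<pi>) ^ \<delta> * \<pi> ^ k" .
qed

end

section \<open>The comparison map\<close>

context scalar_extension
begin

lemma tens_universal_ex:
  fixes G :: "('g, 'y) ring_scheme"
  assumes "abelian_group G"
    and "\<And>a m. a \<in> carrier R \<Longrightarrow> m \<in> carrier M \<Longrightarrow> \<phi> a m \<in> carrier G"
    and "\<And>a b m. a \<in> carrier R \<Longrightarrow> b \<in> carrier R \<Longrightarrow> m \<in> carrier M \<Longrightarrow>
      \<phi> (a \<oplus>\<^bsub>R\<^esub> b) m = \<phi> a m \<oplus>\<^bsub>G\<^esub> \<phi> b m"
    and "\<And>a m n. a \<in> carrier R \<Longrightarrow> m \<in> carrier M \<Longrightarrow> n \<in> carrier M \<Longrightarrow>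
      \<phi> a (m \<oplus>\<^bsub>M\<^esub> n) = \<phi> a m \<oplus>\<^bsub>G\<^esub> \<phi> a n"
    and "\<And>a t m. a \<in> carrier R \<Longrightarrow> m \<in> carrier M \<Longrightarrow> \<phi> (a \<otimes>\<^bsub>R\<^esub> f t) m = \<phi> a (t \<odot>\<^bsub>M\<^esub> m)"
  shows "\<exists>U. additive_map E G U \<and> (\<forall>a\<in>carrier R. \<forall>m\<in>carrier M. U (tn a m) = \<phi> a m)"
  by (rule tens_universal[of G \<phi>, OF assms]) blast+

lemma E_smult_zero: "x \<in> carrier E \<Longrightarrow> \<zero>\<^bsub>R\<^esub> \<odot>\<^bsub>E\<^esub> x = \<zero>\<^bsub>E\<^esub>"
proof -
  assume x: "x \<in> carrier E"
  have "additive_map R E (\<lambda>s. s \<odot>\<^bsub>E\<^esub> x)" using x by (simp add: additive_map_def E_smult_l_distr)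
  from additive_map_0[OF this R.abelian_group_axioms E.abelian_group_axioms] show ?thesis .
qed

lemma tens_zero_right: "a \<in> carrier R \<Longrightarrow> tn a \<zero>\<^bsub>M\<^esub> = \<zero>\<^bsub>E\<^esub>"
  by (rule additive_map_0[OF additive_map_tens_right M.abelian_group_axioms E.abelian_group_axioms])

lemma tens_zero_left: "m \<in> carrier M \<Longrightarrow> tn \<zero>\<^bsub>R\<^esub> m = \<zero>\<^bsub>E\<^esub>"
  by (rule additive_map_0[OF additive_map_tens_left R.abelian_group_axioms E.abelian_group_axioms])

end

lemma symb_mult_diff_right: "symb_mult (F - G) K = symb_mult F K - symb_mult G K"
  using symb_mult_distrib_right[of F "- G" K] by (simp add: symb_mult_uminus)

lemma A_to_Phi_symb_mult: "A_to_Phi (a * b) = symb_mult (A_to_Phi a) (A_to_Phi b)"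
  by (simp add: symb_mult_A_to_Phi_right A_to_Phi_mult)

text \<open>The source connection acts on the module factor by this operator. Its image under
  \<open>H.ev\<close> is \<eta>^2 t, whose action is the target connection.\<close>

definition minus_eta2_d :: "'k::field_char_0 weyl" where
  "minus_eta2_d = - weyl_mult (weyl_mult weyl_var weyl_var) weyl_d"

lemma minus_eta2_d_poly:
  "weyl_mult minus_eta2_d [:q:] = [:- pCons 0 (pCons 0 (pderiv q)):] + weyl_mult [:q:] minus_eta2_d"
proof -
  have w: "weyl_mult (weyl_mult weyl_var weyl_var) G = Polynomial.smult [:0, 1:] (Polynomial.smult [:0, 1:] G)" for G :: "'a weyl"
    by (simp only: weyl_mult_assoc) (simp only: weyl_var_def weyl_mult_const_left)
  have "weyl_mult minus_eta2_d [:q:] = - Polynomial.smult [:0, 1:] (Polynomial.smult [:0, 1:] (Polynomial.smult q weyl_d + [:pderiv q:]))"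
    unfolding minus_eta2_d_def weyl_mult_uminus
    unfolding weyl_mult_assoc[of "weyl_mult weyl_var weyl_var" weyl_d "[:q:]"] unfolding w pderiv_weyl_d ..
  moreover have "weyl_mult [:q:] minus_eta2_d = - Polynomial.smult q (Polynomial.smult [:0, 1:] (Polynomial.smult [:0, 1:] weyl_d))"
    unfolding minus_eta2_d_def w weyl_mult_const_left by simp
  ultimately show ?thesis by (simp add: weyl_d_def)
qed

locale fourier_comparison = fourier_symbols p \<pi> for p and \<pi> :: "'k::nonarch_field" +
  fixes P :: "'k weyl"
begin

abbreviation "M \<equiv> cyclic_module P"
abbreviation "A \<equiv> (A_eta p :: 'k fls ring)"
abbreviation "c1 \<equiv> cyc P 1"

lemma cyc_mem [simp]: "cyc P F \<in> carrier M"
  by (simp add: cyclic_carrier)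

sublocale N: scalar_extension weyl "fourier_hom \<pi>" "cyclic_module P"
  by (intro scalar_extension.intro scalar_extension_axioms.intro weyl_ring cyclic_abelian_group)
     (auto simp: cyclic_carrier cyclic_smult)

sublocale X: scalar_extension "Phi p" "Phi_hom p \<pi>" "cyclic_module P"
  by (intro scalar_extension.intro scalar_extension_axioms.intro Phi_ring[OF om] cyclic_abelian_group)
     (auto simp: cyclic_carrier cyclic_smult Phi_hom_closed)

sublocale A: cring "A_eta p :: 'k fls ring"
  by (rule A_eta_cring[OF om])

sublocale L: scalar_extension "A_eta p :: 'k fls ring" poly_in_eta
    "as_poly_module (ext_scalars weyl (fourier_hom \<pi>) (cyclic_module P))"
proof (intro scalar_extension.intro scalar_extension_axioms.intro A.ring_axioms)
  show "abelian_group (as_poly_module (ext_scalars weyl (fourier_hom \<pi>) (cyclic_module P)))"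
    unfolding as_poly_module_def by (rule restrict_scalars_abelian_group[OF N.E.abelian_group_axioms])
qed (simp_all add: poly_in_eta_closed[OF om])

lemma fourier_eq: "fourier \<pi> M = N.E"
  by (simp add: fourier_def)

lemma A_to_Phi_closed [simp]: "a \<in> carrier A \<Longrightarrow> A_to_Phi a \<in> carrier (Phi p)"
  by (simp add: A_eta_mem[OF om])

lemma H_closed [simp]: "H.ev (Q :: 'k weyl) \<in> carrier (Phi p)"
  by (rule H.ev_closed)

lemma symb_mult_closed [simp]: "F \<in> carrier (Phi p) \<Longrightarrow> G \<in> carrier (Phi p) \<Longrightarrow> symb_mult F G \<in> carrier (Phi p)"
  by (rule Phi_mult_closed[OF om])

lemma P_zero: "cyc P P = \<zero>\<^bsub>M\<^esub>"
  unfolding cyclic_zero cyc_eq_iff by (rule exI[of _ 1]) simp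

text \<open>Since the module is cyclic, balancing moves every class into the first factor, leaving
  the generator \<open>c1\<close>. The relations become left multiples of the transform of
  P.\<close>

lemma N_tn_cyc: "N.tn Q (cyc P G) = N.tn (weyl_mult Q (fourier_hom \<pi> G)) c1"
  using N.tens_balanced[of Q c1 G] by (simp add: cyclic_smult)

lemma N_tn_P: "N.tn (weyl_mult Q (fourier_hom \<pi> P)) c1 = \<zero>\<^bsub>N.E\<^esub>"
  unfolding N_tn_cyc[symmetric] P_zero by (rule N.tens_zero_right) simp

lemma X_tn_cyc: "F \<in> carrier (Phi p) \<Longrightarrow> X.tn F (cyc P G) = X.tn (symb_mult F (Phi_hom p \<pi> G)) c1"
  using X.tens_balanced[of F c1 G] by (simp add: cyclic_smult)

lemma X_tn_P: "F \<in> carrier (Phi p) \<Longrightarrow> X.tn (symb_mult F (Phi_hom p \<pi> P)) c1 = \<zero>\<^bsub>X.E\<^esub>"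
  unfolding X_tn_cyc[symmetric] P_zero by (rule X.tens_zero_right)

lemma L_tn_add:
  "\<alpha> \<in> carrier A \<Longrightarrow> x \<in> carrier N.E \<Longrightarrow> y \<in> carrier N.E \<Longrightarrow>
    L.tn \<alpha> (x \<oplus>\<^bsub>N.E\<^esub> y) = L.tn \<alpha> x \<oplus>\<^bsub>L.E\<^esub> L.tn \<alpha> y"
  using L.tens_add_right[of \<alpha> x y] by simp

lemma L_tn_closed [simp]: "\<alpha> \<in> carrier A \<Longrightarrow> x \<in> carrier N.E \<Longrightarrow> L.tn \<alpha> x \<in> carrier L.E"
  using L.tens_closed[of \<alpha> x] by simp

lemma L_induct [consumes 1, case_names pure add]:
  assumes "x \<in> carrier L.E"
    and pure: "\<And>\<alpha> Q m. \<alpha> \<in> carrier A \<Longrightarrow> m \<in> carrier M \<Longrightarrow> Z (L.tn \<alpha> (N.tn Q m))"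
    and add: "\<And>x y. x \<in> carrier L.E \<Longrightarrow> y \<in> carrier L.E \<Longrightarrow> Z x \<Longrightarrow> Z y \<Longrightarrow> Z (x \<oplus>\<^bsub>L.E\<^esub> y)"
  shows "Z x"
  using assms(1)
proof (induction rule: L.tens_induct)
  case (pure \<alpha> n)
  from pure(2) have "n \<in> carrier N.E" by simp
  thus ?case
  proof (induction rule: N.tens_induct)
    case (pure Q m)
    thus ?case using \<open>\<alpha> \<in> carrier A\<close> by (intro assms(2))
  next
    case (add x y)
    thus ?case using \<open>\<alpha> \<in> carrier A\<close> by (simp add: L_tn_add assms(3))
  qed
qed (rule add)

lemma L_ext:
  assumes "additive_map L.E G U" "additive_map L.E G V"
    and "\<And>\<alpha> Q m. \<alpha> \<in> carrier A \<Longrightarrow> m \<in> carrier M \<Longrightarrow> U (L.tn \<alpha> (N.tn Q m)) = V (L.tn \<alpha> (N.tn Q m))"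
    and "x \<in> carrier L.E"
  shows "U x = V x"
  using assms(4)
  by (induction rule: L_induct) (simp_all add: assms(3) additive_mapD[OF assms(1)] additive_mapD[OF assms(2)])

section \<open>The connections on the source and the target\<close>

abbreviation "conn \<equiv> at_infinity_connection p (fourier \<pi> M)"
abbreviation "conn' \<equiv> Phi_connection p \<pi> M"

lemma L_connection:
  shows "additive_map L.E L.E conn"
    and "\<And>\<alpha> n. \<alpha> \<in> carrier A \<Longrightarrow> n \<in> carrier N.E \<Longrightarrow>
      conn (L.tn \<alpha> n) = L.tn (fls_deriv \<alpha>) n \<oplus>\<^bsub>L.E\<^esub> L.tn \<alpha> (minus_eta2_d \<odot>\<^bsub>N.E\<^esub> n)"
    and "\<And>s x. s \<in> carrier A \<Longrightarrow> x \<in> carrier L.E \<Longrightarrow>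
      conn (s \<odot>\<^bsub>L.E\<^esub> x) = fls_deriv s \<odot>\<^bsub>L.E\<^esub> x \<oplus>\<^bsub>L.E\<^esub> s \<odot>\<^bsub>L.E\<^esub> conn x"
proof -
  let ?w = "weyl_var \<otimes>\<^bsub>weyl\<^esub> weyl_var \<otimes>\<^bsub>weyl\<^esub> weyl_d :: 'k weyl"
  let ?\<phi> = "\<lambda>(\<alpha>, n). frag_of (fls_deriv \<alpha>, n) - frag_of (\<alpha>, ?w \<odot>\<^bsub>N.E\<^esub> n)"
  let ?Q = "as_poly_module N.E"
  have NE: "Q \<odot>\<^bsub>N.E\<^esub> n \<in> carrier ?Q" if "n \<in> carrier ?Q" for Q :: "'k weyl" and n
    using that N.E_smult_closed[of Q n] by simp
  have phi_closed: "?\<phi> (\<alpha>, n) \<in> carrier L.FR"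
    and phi_cls: "L.cls (?\<phi> (\<alpha>, n)) = L.tn (fls_deriv \<alpha>) n \<oplus>\<^bsub>L.E\<^esub> L.tn \<alpha> (minus_eta2_d \<odot>\<^bsub>N.E\<^esub> n)"
    if an: "\<alpha> \<in> carrier A" "n \<in> carrier ?Q" for \<alpha> n
  proof -
    have d: "fls_deriv \<alpha> \<in> carrier A" using an(1) by (rule A_eta_deriv_closed[OF om])
    have n: "n \<in> carrier N.E" using an(2) by simp
    have c: "frag_of (fls_deriv \<alpha>, n) \<in> carrier L.FR" "frag_of (\<alpha>, ?w \<odot>\<^bsub>N.E\<^esub> n) \<in> carrier L.FR"
      using d an NE[OF an(2), of ?w] by simp_all
    show "?\<phi> (\<alpha>, n) \<in> carrier L.FR" using L.FR_diff[OF c] by simp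
    \<comment> \<open>The defining formula subtracts; it is rewritten with the negated operator so
      that the additive form in \<open>tens_connection\<close> applies.\<close>
    have "minus_eta2_d \<odot>\<^bsub>N.E\<^esub> n \<oplus>\<^bsub>N.E\<^esub> ?w \<odot>\<^bsub>N.E\<^esub> n = \<zero>\<^bsub>N.E\<^esub>"
      using N.E_smult_l_distr[of minus_eta2_d ?w n] N.E_smult_zero[OF n] n by (simp add: minus_eta2_d_def)
    hence "L.tn \<alpha> (minus_eta2_d \<odot>\<^bsub>N.E\<^esub> n) \<oplus>\<^bsub>L.E\<^esub> L.tn \<alpha> (?w \<odot>\<^bsub>N.E\<^esub> n) = \<zero>\<^bsub>L.E\<^esub>"
      using L_tn_add[OF an(1), of "minus_eta2_d \<odot>\<^bsub>N.E\<^esub> n" "?w \<odot>\<^bsub>N.E\<^esub> n"] L.tens_zero_right[OF an(1)] N.E_smult_closed n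
      by simp
    hence m: "\<ominus>\<^bsub>L.E\<^esub> L.tn \<alpha> (?w \<odot>\<^bsub>N.E\<^esub> n) = L.tn \<alpha> (minus_eta2_d \<odot>\<^bsub>N.E\<^esub> n)"
      using an n N.E_smult_closed by (intro L.E.minus_equality) simp_all
    have "L.cls (frag_of (fls_deriv \<alpha>, n) - frag_of (\<alpha>, ?w \<odot>\<^bsub>N.E\<^esub> n)) =
        L.cls (frag_of (fls_deriv \<alpha>, n)) \<oplus>\<^bsub>L.E\<^esub> \<ominus>\<^bsub>L.E\<^esub> L.cls (frag_of (\<alpha>, ?w \<odot>\<^bsub>N.E\<^esub> n))"
      using L.E_add[OF c(1) L.FR_uminus[OF c(2)]] L.cls_minus[OF c(2)] by simp
    thus "L.cls (?\<phi> (\<alpha>, n)) = L.tn (fls_deriv \<alpha>) n \<oplus>\<^bsub>L.E\<^esub> L.tn \<alpha> (minus_eta2_d \<odot>\<^bsub>N.E\<^esub> n)"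
      using m by (simp add: tens_def)
  qed
  have D_add: "fls_deriv (a \<oplus>\<^bsub>A\<^esub> b) = fls_deriv a \<oplus>\<^bsub>A\<^esub> fls_deriv b"
    and D_mult: "fls_deriv (a \<otimes>\<^bsub>A\<^esub> b) = fls_deriv a \<otimes>\<^bsub>A\<^esub> b \<oplus>\<^bsub>A\<^esub> a \<otimes>\<^bsub>A\<^esub> fls_deriv b" for a b
    by simp_all
  have \<delta>_add: "minus_eta2_d \<odot>\<^bsub>N.E\<^esub> (m \<oplus>\<^bsub>?Q\<^esub> n) = (minus_eta2_d \<odot>\<^bsub>N.E\<^esub> m) \<oplus>\<^bsub>?Q\<^esub> (minus_eta2_d \<odot>\<^bsub>N.E\<^esub> n)"
    if "m \<in> carrier ?Q" "n \<in> carrier ?Q" for m n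
    using that N.E_smult_r_distr[of minus_eta2_d m n] by simp
  have \<delta>_poly: "minus_eta2_d \<odot>\<^bsub>N.E\<^esub> (q \<odot>\<^bsub>?Q\<^esub> n) =
      (- pCons 0 (pCons 0 (pderiv q))) \<odot>\<^bsub>?Q\<^esub> n \<oplus>\<^bsub>?Q\<^esub> q \<odot>\<^bsub>?Q\<^esub> (minus_eta2_d \<odot>\<^bsub>N.E\<^esub> n)"
    if n: "n \<in> carrier ?Q" for q n
  proof -
    have n': "n \<in> carrier N.E" using n by simp
    have "minus_eta2_d \<odot>\<^bsub>N.E\<^esub> ([:q:] \<odot>\<^bsub>N.E\<^esub> n) = weyl_mult minus_eta2_d [:q:] \<odot>\<^bsub>N.E\<^esub> n"
      using N.E_smult_assoc[of minus_eta2_d "[:q:]" n] n' by simp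
    also have "\<dots> = ([:- pCons 0 (pCons 0 (pderiv q)):] \<odot>\<^bsub>N.E\<^esub> n) \<oplus>\<^bsub>N.E\<^esub> (weyl_mult [:q:] minus_eta2_d \<odot>\<^bsub>N.E\<^esub> n)"
      unfolding minus_eta2_d_poly using N.E_smult_l_distr[of "[:- pCons 0 (pCons 0 (pderiv q)):]" "weyl_mult [:q:] minus_eta2_d" n] n'
      by (simp only: weyl_simps UNIV_I)
    also have "weyl_mult [:q:] minus_eta2_d \<odot>\<^bsub>N.E\<^esub> n = [:q:] \<odot>\<^bsub>N.E\<^esub> (minus_eta2_d \<odot>\<^bsub>N.E\<^esub> n)"
      using N.E_smult_assoc[of "[:q:]" minus_eta2_d n] n' by simp
    finally show ?thesis by (simp only: as_poly_module_simps)
  qed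
  note tc = L.tens_connection[where D = fls_deriv and \<delta> = "\<lambda>n. minus_eta2_d \<odot>\<^bsub>N.E\<^esub> n" and D' = "\<lambda>q. - pCons 0 (pCons 0 (pderiv q))",
      OF phi_closed phi_cls A_eta_deriv_closed[OF om] D_add D_mult NE \<delta>_add fls_deriv_poly_in_eta \<delta>_poly,
      folded at_infinity_connection_def]
  show "additive_map L.E L.E conn" unfolding fourier_eq by (rule tc(1))
  show "\<And>\<alpha> n. \<alpha> \<in> carrier A \<Longrightarrow> n \<in> carrier N.E \<Longrightarrow>
      conn (L.tn \<alpha> n) = L.tn (fls_deriv \<alpha>) n \<oplus>\<^bsub>L.E\<^esub> L.tn \<alpha> (minus_eta2_d \<odot>\<^bsub>N.E\<^esub> n)"
    using tc(2) by (simp add: fourier_def)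
  show "\<And>s x. s \<in> carrier A \<Longrightarrow> x \<in> carrier L.E \<Longrightarrow>
      conn (s \<odot>\<^bsub>L.E\<^esub> x) = fls_deriv s \<odot>\<^bsub>L.E\<^esub> x \<oplus>\<^bsub>L.E\<^esub> s \<odot>\<^bsub>L.E\<^esub> conn x"
    using tc(3) by (simp add: fourier_def)
qed

abbreviation "e2t \<equiv> symb_mult (symb_mult symb_eta symb_eta) symb_t :: 'k fps fls"

lemma e2t_closed [simp]: "e2t \<in> carrier (Phi p)"
  by (simp add: symb_eta_closed[OF om] symb_t_closed[OF om])

lemma conn'_eq: "conn' x = e2t \<odot>\<^bsub>X.E\<^esub> x"
  by (simp add: Phi_connection_def)

lemma Phi_module_simps:
  "carrier (Phi_module p \<pi> M) = carrier X.E" "\<zero>\<^bsub>Phi_module p \<pi> M\<^esub> = \<zero>\<^bsub>X.E\<^esub>"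
  "x \<oplus>\<^bsub>Phi_module p \<pi> M\<^esub> y = x \<oplus>\<^bsub>X.E\<^esub> y" "s \<odot>\<^bsub>Phi_module p \<pi> M\<^esub> x = A_to_Phi s \<odot>\<^bsub>X.E\<^esub> x"
  by (simp_all add: Phi_module_def)

lemma X_smult_assoc: "F \<in> carrier (Phi p) \<Longrightarrow> G \<in> carrier (Phi p) \<Longrightarrow> x \<in> carrier X.E \<Longrightarrow>
    symb_mult F G \<odot>\<^bsub>X.E\<^esub> x = F \<odot>\<^bsub>X.E\<^esub> (G \<odot>\<^bsub>X.E\<^esub> x)"
  using X.E_smult_assoc[of F G x] by simp

lemma X_smult_add: "F \<in> carrier (Phi p) \<Longrightarrow> G \<in> carrier (Phi p) \<Longrightarrow> x \<in> carrier X.E \<Longrightarrow>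
    (F + G) \<odot>\<^bsub>X.E\<^esub> x = F \<odot>\<^bsub>X.E\<^esub> x \<oplus>\<^bsub>X.E\<^esub> G \<odot>\<^bsub>X.E\<^esub> x"
  using X.E_smult_l_distr[of F G x] by simp

lemma Phi_module_module: "Module.module A (Phi_module p \<pi> M)"
proof (rule Module.moduleI)
  show "cring A" by (rule A.cring_axioms)
  show "abelian_group (Phi_module p \<pi> M)"
    unfolding Phi_module_def by (rule restrict_scalars_abelian_group[OF X.E.abelian_group_axioms])
  fix x assume "x \<in> carrier (Phi_module p \<pi> M)"
  thus "\<one>\<^bsub>A\<^esub> \<odot>\<^bsub>Phi_module p \<pi> M\<^esub> x = x"
    using X.E_smult_one[of x] by (simp add: Phi_module_simps)
qed (simp_all add: Phi_module_simps A_to_Phi_add A_to_Phi_symb_mult X_smult_assoc X_smult_add X.E_smult_r_distr)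

lemma conn'_Leibniz:
  assumes "s \<in> carrier A" "x \<in> carrier X.E"
  shows "conn' (A_to_Phi s \<odot>\<^bsub>X.E\<^esub> x) = A_to_Phi (fls_deriv s) \<odot>\<^bsub>X.E\<^esub> x \<oplus>\<^bsub>X.E\<^esub> A_to_Phi s \<odot>\<^bsub>X.E\<^esub> conn' x"
proof -
  have "conn' (A_to_Phi s \<odot>\<^bsub>X.E\<^esub> x) = symb_mult e2t (A_to_Phi s) \<odot>\<^bsub>X.E\<^esub> x"
    unfolding conn'_eq using assms X_smult_assoc[of e2t "A_to_Phi s" x] by simp
  also have "\<dots> = A_to_Phi (fls_deriv s) \<odot>\<^bsub>X.E\<^esub> x \<oplus>\<^bsub>X.E\<^esub> symb_mult (A_to_Phi s) e2t \<odot>\<^bsub>X.E\<^esub> x"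
    unfolding symb_eta2_t_commutator using assms A_to_Phi_closed[OF A_eta_deriv_closed[OF om assms(1)]] by (intro X_smult_add) simp_all
  also have "symb_mult (A_to_Phi s) e2t \<odot>\<^bsub>X.E\<^esub> x = A_to_Phi s \<odot>\<^bsub>X.E\<^esub> conn' x"
    unfolding conn'_eq using assms by (intro X_smult_assoc) simp_all
  finally show ?thesis .
qed

lemma L_module_with_connection: "module_with_connection A fls_const fls_deriv (at_infinity_module p (fourier \<pi> M)) conn"
  unfolding module_with_connection_def at_infinity_module_def fourier_eq
proof (intro conjI ballI allI)
  show "Module.module A L.E" by (rule L.E_module[OF A.cring_axioms])
  show "at_infinity_connection p N.E \<in> carrier L.E \<rightarrow> carrier L.E"
    using additive_mapD(1)[OF L_connection(1)] by (auto simp: fourier_def)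
  show "at_infinity_connection p N.E (u \<oplus>\<^bsub>L.E\<^esub> v) = at_infinity_connection p N.E u \<oplus>\<^bsub>L.E\<^esub> at_infinity_connection p N.E v"
    if "u \<in> carrier L.E" "v \<in> carrier L.E" for u v
    using additive_mapD(2)[OF L_connection(1) that] by (simp add: fourier_def)
  show Lb: "at_infinity_connection p N.E (\<alpha> \<odot>\<^bsub>L.E\<^esub> v) = fls_deriv \<alpha> \<odot>\<^bsub>L.E\<^esub> v \<oplus>\<^bsub>L.E\<^esub> \<alpha> \<odot>\<^bsub>L.E\<^esub> at_infinity_connection p N.E v"
    if "\<alpha> \<in> carrier A" "v \<in> carrier L.E" for \<alpha> v
    using L_connection(3)[OF that] by (simp add: fourier_def)
  show "at_infinity_connection p N.E (fls_const c \<odot>\<^bsub>L.E\<^esub> v) = fls_const c \<odot>\<^bsub>L.E\<^esub> at_infinity_connection p N.E v"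
    if "v \<in> carrier L.E" for c v
    using Lb[OF A_eta_const_closed[OF om] that, of c] L.E_smult_zero[OF that] L.E_smult_closed[OF A_eta_const_closed[OF om, of c]]
      additive_mapD(1)[OF L_connection(1) that] by (simp add: fourier_def)
qed

lemma Phi_module_with_connection: "module_with_connection A fls_const fls_deriv (Phi_module p \<pi> M) conn'"
  unfolding module_with_connection_def Phi_module_simps
proof (intro conjI ballI allI Phi_module_module)
  show "conn' \<in> carrier X.E \<rightarrow> carrier X.E" by (simp add: conn'_eq)
  show "conn' (u \<oplus>\<^bsub>X.E\<^esub> v) = conn' u \<oplus>\<^bsub>X.E\<^esub> conn' v" if "u \<in> carrier X.E" "v \<in> carrier X.E" for u v
    using that by (simp add: conn'_eq X.E_smult_r_distr)
  show Lb: "conn' (A_to_Phi \<alpha> \<odot>\<^bsub>X.E\<^esub> v) = A_to_Phi (fls_deriv \<alpha>) \<odot>\<^bsub>X.E\<^esub> v \<oplus>\<^bsub>X.E\<^esub> A_to_Phi \<alpha> \<odot>\<^bsub>X.E\<^esub> conn' v"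
    if "\<alpha> \<in> carrier A" "v \<in> carrier X.E" for \<alpha> v
    using that by (rule conn'_Leibniz)
  show "conn' (A_to_Phi (fls_const c) \<odot>\<^bsub>X.E\<^esub> v) = A_to_Phi (fls_const c) \<odot>\<^bsub>X.E\<^esub> conn' v" if "v \<in> carrier X.E" for c v
    using Lb[OF A_eta_const_closed[OF om] that, of c] X.E_smult_zero[OF that] that
      A_to_Phi_closed[OF A_eta_const_closed[OF om, of c]] by (simp add: conn'_eq)
qed

text \<open>Two stages: first \<open>H.ev\<close> induces U on the Fourier transform, well defined
  by \<open>H_fourier\<close>; then U, which is semilinear along \<open>H.ev\<close>, is extended
  over \<open>A_eta\<close>. Balancing over K[\<eta>] holds because \<open>H_poly\<close> identifies
  the two embeddings of polynomials.\<close>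

lemma comparison_map_exists:
  "\<exists>\<Upsilon>. additive_map L.E X.E \<Upsilon> \<and> (\<forall>\<alpha>\<in>carrier A. \<forall>Q. \<forall>m\<in>carrier M.
      \<Upsilon> (L.tn \<alpha> (N.tn Q m)) = X.tn (symb_mult (A_to_Phi \<alpha>) (H.ev Q)) m)"
proof -
  note Xab = X.E.abelian_group_axioms
  have "\<exists>U. additive_map N.E X.E U \<and> (\<forall>Q\<in>carrier weyl. \<forall>m\<in>carrier M. U (N.tn Q m) = X.tn (H.ev Q) m)"
  proof (rule N.tens_universal_ex[OF Xab])
    fix Q t :: "'k weyl" and m assume "m \<in> carrier M"
    thus "X.tn (H.ev (Q \<otimes>\<^bsub>weyl\<^esub> fourier_hom \<pi> t)) m = X.tn (H.ev Q) (t \<odot>\<^bsub>M\<^esub> m)"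
      using X.tens_balanced[of "H.ev Q" m t] by (simp add: H_mult H_fourier)
  next
    fix Q Q' :: "'k weyl" and m assume "m \<in> carrier M"
    thus "X.tn (H.ev (Q \<oplus>\<^bsub>weyl\<^esub> Q')) m = X.tn (H.ev Q) m \<oplus>\<^bsub>X.E\<^esub> X.tn (H.ev Q') m"
      using X.tens_add_left[of "H.ev Q" "H.ev Q'" m] by (simp add: H.ev_add)
  qed (simp_all add: X.tens_add_right)
  then obtain U where U: "additive_map N.E X.E U"
    and U_tn: "\<And>Q m. m \<in> carrier M \<Longrightarrow> U (N.tn Q m) = X.tn (H.ev Q) m" by auto
  have U_smult: "U (Q \<odot>\<^bsub>N.E\<^esub> n) = H.ev Q \<odot>\<^bsub>X.E\<^esub> U n" if n: "n \<in> carrier N.E" for Q n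
  proof (rule N.tens_ext[OF additive_map_comp[OF N.E_smult(1) U] additive_map_comp[OF U X.E_smult(1)] _ n])
    fix R :: "'k weyl" and m assume "m \<in> carrier M"
    thus "U (Q \<odot>\<^bsub>N.E\<^esub> N.tn R m) = H.ev Q \<odot>\<^bsub>X.E\<^esub> U (N.tn R m)"
      by (simp add: N.E_smult(2) U_tn X.E_smult(2) H_mult)
  qed simp_all
  let ?Q = "as_poly_module N.E"
  have Ucl: "U n \<in> carrier X.E" if "n \<in> carrier N.E" for n using additive_mapD(1)[OF U that] .
  have "\<exists>V. additive_map L.E X.E V \<and> (\<forall>\<alpha>\<in>carrier A. \<forall>n\<in>carrier ?Q. V (L.tn \<alpha> n) = A_to_Phi \<alpha> \<odot>\<^bsub>X.E\<^esub> U n)"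
  proof (rule L.tens_universal_ex[OF Xab])
    fix \<alpha> and q and n assume \<alpha>: "\<alpha> \<in> carrier A" and "n \<in> carrier ?Q"
    hence n: "n \<in> carrier N.E" by simp
    have "A_to_Phi (\<alpha> * poly_in_eta q) \<odot>\<^bsub>X.E\<^esub> U n = A_to_Phi \<alpha> \<odot>\<^bsub>X.E\<^esub> (H.ev [:q:] \<odot>\<^bsub>X.E\<^esub> U n)"
      unfolding A_to_Phi_symb_mult H_poly[symmetric] using \<alpha> n by (intro X_smult_assoc) (simp_all add: Ucl)
    thus "A_to_Phi (\<alpha> \<otimes>\<^bsub>A\<^esub> poly_in_eta q) \<odot>\<^bsub>X.E\<^esub> U n = A_to_Phi \<alpha> \<odot>\<^bsub>X.E\<^esub> U (q \<odot>\<^bsub>?Q\<^esub> n)"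
      using n by (simp add: U_smult)
  qed (simp_all add: Ucl A_to_Phi_add X_smult_add additive_mapD(2)[OF U] X.E_smult_r_distr)
  then obtain V where V: "additive_map L.E X.E V"
    and V_tn: "\<And>\<alpha> n. \<alpha> \<in> carrier A \<Longrightarrow> n \<in> carrier N.E \<Longrightarrow> V (L.tn \<alpha> n) = A_to_Phi \<alpha> \<odot>\<^bsub>X.E\<^esub> U n" by auto
  show ?thesis
    by (rule exI[of _ V]) (simp add: V V_tn U_tn X.E_smult(2))
qed

end

section \<open>The comparison map is bijective\<close>

text \<open>\<open>degs\<close> is the slope condition at infinity; \<open>coeffs\<close> is the
  conclusion of \<open>soluble_coeff_bound\<close>.\<close>

locale slope_condition = fourier_comparison p \<pi> P for p and \<pi> :: "'k::nonarch_field" and P +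
  fixes d \<delta> :: nat and \<alpha> :: 'k
  assumes av_pi: "av \<pi> = omega p"
    and degP: "degree P \<le> d" and topP: "coeff P d = monom \<alpha> \<delta>" and \<alpha>0: "\<alpha> \<noteq> 0"
    and degs: "degree (coeff P k) \<le> \<delta>"
    and coeffs: "av (coeff (coeff P k) i) \<le> av \<alpha>"
begin

lemma A_closed [simp]:
  "0 \<in> carrier A" "1 \<in> carrier A" "a \<in> carrier A \<Longrightarrow> b \<in> carrier A \<Longrightarrow> a + b \<in> carrier A"
  "a \<in> carrier A \<Longrightarrow> b \<in> carrier A \<Longrightarrow> a * b \<in> carrier A"
  by (rule A_eta_0_1_closed[OF om] A_eta_add_closed[OF om] A_eta_mult_closed[OF om]; assumption?)+

sublocale D: symbol_division p d \<delta> "\<alpha> * \<pi> ^ d / \<pi> ^ \<delta>" "Phi_hom p \<pi> P"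
proof
  show "vanishes_below (- int d) (Phi_hom p \<pi> P)"
    unfolding vanishes_below_def
  proof (intro allI impI)
    fix n assume n: "n < - int d"
    hence "degree P < nat (- n)" using degP by linarith
    thus "fls_nth (Phi_hom p \<pi> P) n = 0" using n by (intro fps_ext) (simp add: nth_Phi_hom coeff_eq_0)
  qed
  show "fls_nth (Phi_hom p \<pi> P) (- int d) = fps_const (\<alpha> * \<pi> ^ d / \<pi> ^ \<delta>) * fps_X ^ \<delta>"
    by (rule fps_ext) (auto simp: nth_Phi_hom topP)
  show "\<alpha> * \<pi> ^ d / \<pi> ^ \<delta> \<noteq> 0" using \<alpha>0 \<pi>0 by simp
  fix l j assume l: "omega p < l" "l < 1"
  have l0: "0 < l" using l om by simp
  show "disc_bounded l (av (\<alpha> * \<pi> ^ d / \<pi> ^ \<delta>) * l ^ \<delta> / omega p ^ j) (fls_nth (Phi_hom p \<pi> P) (- int d + int j))"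
    unfolding disc_bounded_def
  proof
    fix i
    let ?B = "av (\<alpha> * \<pi> ^ d / \<pi> ^ \<delta>) * l ^ \<delta> / omega p ^ j"
    have B: "0 \<le> ?B" using l0 om by simp
    show "av (fps_nth (fls_nth (Phi_hom p \<pi> P) (- int d + int j)) i) * l ^ i \<le> ?B"
    proof (cases "j \<le> d \<and> i \<le> \<delta>")
      case True
      hence n: "- int d + int j \<le> 0" "nat (- (- int d + int j)) = d - j" by simp_all
      \<comment> \<open>Here l > \<omega> and the slope condition meet: t/\<pi> has norm above 1 and
        no coefficient exceeds degree \<delta>, so t^\<delta> carries the largest power.\<close>
      have pw: "(l / omega p) ^ i \<le> (l / omega p) ^ \<delta>"
        using True l om by (intro power_increasing) simp_all
      have "av (fps_nth (fls_nth (Phi_hom p \<pi> P) (- int d + int j)) i) * l ^ i =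
          av (coeff (coeff P (d - j)) i) * omega p ^ (d - j) * (l / omega p) ^ i"
        unfolding nth_Phi_hom n(2) using n(1) by (simp add: av_mult av_divide av_power av_pi power_divide)
      also have "\<dots> \<le> av \<alpha> * omega p ^ (d - j) * (l / omega p) ^ \<delta>"
        using om l0 by (intro mult_mono coeffs pw order_refl) simp_all
      also have "omega p ^ (d - j) = omega p ^ d / omega p ^ j" using True om by (simp add: power_diff)
      also have "av \<alpha> * (omega p ^ d / omega p ^ j) * (l / omega p) ^ \<delta> = ?B"
        by (simp add: av_mult av_divide av_power av_pi power_divide)
      finally show ?thesis .
    next
      case False
      hence "fps_nth (fls_nth (Phi_hom p \<pi> P) (- int d + int j)) i = 0"
        using degs[of "d - j"] by (auto simp: nth_Phi_hom not_le coeff_eq_0 nat_diff_distrib)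
      thus ?thesis using B by simp
    qed
  qed
qed (rule om)+

subsection \<open>The remainder modulo \<open>P\<close>\<close>

definition symb_rem :: "'k fps fls \<Rightarrow> 'k fps fls" where
  "symb_rem F = (SOME R. R \<in> carrier (Phi p) \<and> t_degree_less \<delta> R \<and> (\<exists>Q. F = symb_mult Q (Phi_hom p \<pi> P) + R))"

lemma symb_rem:
  assumes "F \<in> carrier (Phi p)"
  shows "symb_rem F \<in> carrier (Phi p)" "t_degree_less \<delta> (symb_rem F)" "\<exists>Q. F = symb_mult Q (Phi_hom p \<pi> P) + symb_rem F"
proof -
  have "\<exists>R. R \<in> carrier (Phi p) \<and> t_degree_less \<delta> R \<and> (\<exists>Q. F = symb_mult Q (Phi_hom p \<pi> P) + R)"
    using D.division[OF assms] by blast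
  from someI_ex[OF this] show "symb_rem F \<in> carrier (Phi p)" "t_degree_less \<delta> (symb_rem F)"
    "\<exists>Q. F = symb_mult Q (Phi_hom p \<pi> P) + symb_rem F" unfolding symb_rem_def by simp_all
qed

lemma symb_rem_eq:
  assumes F: "F \<in> carrier (Phi p)" and R: "t_degree_less \<delta> R" "F = symb_mult Q (Phi_hom p \<pi> P) + R"
  shows "symb_rem F = R"
proof -
  obtain Q' where Q': "F = symb_mult Q' (Phi_hom p \<pi> P) + symb_rem F" using symb_rem(3)[OF F] by blast
  have "symb_mult (Q' - Q) (Phi_hom p \<pi> P) + (symb_rem F - R) = (symb_mult Q' (Phi_hom p \<pi> P) + symb_rem F) - (symb_mult Q (Phi_hom p \<pi> P) + R)"
    by (simp add: symb_mult_diff_right)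
  also have "\<dots> = 0" unfolding Q'[symmetric] R(2)[symmetric] by simp
  finally have "symb_mult (Q' - Q) (Phi_hom p \<pi> P) + (symb_rem F - R) = 0" .
  moreover have "t_degree_less \<delta> (symb_rem F - R)"
    using symb_rem(2)[OF F] R(1) by (simp add: t_degree_less_def)
  ultimately have "symb_rem F - R = 0" by (rule D.division_unique)
  thus ?thesis by simp
qed

lemma symb_rem_add:
  assumes "F \<in> carrier (Phi p)" "G \<in> carrier (Phi p)"
  shows "symb_rem (F + G) = symb_rem F + symb_rem G"
proof -
  obtain Q Q' where Q: "F = symb_mult Q (Phi_hom p \<pi> P) + symb_rem F" "G = symb_mult Q' (Phi_hom p \<pi> P) + symb_rem G"
    using symb_rem(3)[OF assms(1)] symb_rem(3)[OF assms(2)] by blast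
  have "F + G = (symb_mult Q (Phi_hom p \<pi> P) + symb_rem F) + (symb_mult Q' (Phi_hom p \<pi> P) + symb_rem G)"
    using Q by (rule arg_cong2)
  also have "\<dots> = symb_mult (Q + Q') (Phi_hom p \<pi> P) + (symb_rem F + symb_rem G)"
    by (simp add: symb_mult_distrib_right)
  finally show ?thesis
    using assms symb_rem(2) by (intro symb_rem_eq[of _ _ "Q + Q'"] Phi_add_closed[OF om] t_degree_less_add)
qed

lemma symb_rem_cong:
  assumes "F \<in> carrier (Phi p)" "G \<in> carrier (Phi p)" "F - G = symb_mult Q (Phi_hom p \<pi> P)"
  shows "symb_rem F = symb_rem G"
proof -
  obtain Q' where Q': "G = symb_mult Q' (Phi_hom p \<pi> P) + symb_rem G" using symb_rem(3)[OF assms(2)] by blast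
  have "F = symb_mult Q (Phi_hom p \<pi> P) + G" unfolding assms(3)[symmetric] by simp
  also have "\<dots> = symb_mult Q (Phi_hom p \<pi> P) + (symb_mult Q' (Phi_hom p \<pi> P) + symb_rem G)"
    using Q' by (rule arg_cong)
  also have "\<dots> = symb_mult (Q + Q') (Phi_hom p \<pi> P) + symb_rem G" by (simp add: symb_mult_distrib_right)
  finally show ?thesis by (rule symb_rem_eq[OF assms(1) symb_rem(2)[OF assms(2)]])
qed

text \<open>The remainder of F times the image of G is additive in both arguments, balanced and
  independent of the representative G. It therefore defines a map on the tensor product, and that
  map sends the class of R to R itself.\<close>

lemma tens_eq_zero:
  assumes R: "R \<in> carrier (Phi p)" "t_degree_less \<delta> R" and z: "X.tn R c1 = \<zero>\<^bsub>X.E\<^esub>"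
  shows "R = 0"
proof -
  define \<phi> where "\<phi> = (\<lambda>F m. symb_rem (symb_mult F (Phi_hom p \<pi> (SOME G. cyc P G = m))))"
  have \<phi>: "\<phi> F (cyc P G) = symb_rem (symb_mult F (Phi_hom p \<pi> G))" if F: "F \<in> carrier (Phi p)" for F G
  proof -
    define G' where "G' = (SOME G'. cyc P G' = cyc P G)"
    have "cyc P G' = cyc P G" unfolding G'_def by (rule someI[of "\<lambda>G'. cyc P G' = cyc P G" G]) (rule refl)
    then obtain Q where Q: "G' - G = weyl_mult Q P" unfolding cyc_eq_iff by blast
    have "G' = weyl_mult Q P + G" unfolding Q[symmetric] by simp
    hence "Phi_hom p \<pi> G' = symb_mult (Phi_hom p \<pi> Q) (Phi_hom p \<pi> P) + Phi_hom p \<pi> G"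
      by (simp add: Phi_hom_add Phi_hom_mult)
    hence "symb_mult F (Phi_hom p \<pi> G') - symb_mult F (Phi_hom p \<pi> G) = symb_mult (symb_mult F (Phi_hom p \<pi> Q)) (Phi_hom p \<pi> P)"
      by (simp add: symb_mult_distrib_left symb_mult_assoc)
    from symb_rem_cong[OF _ _ this] show ?thesis
      unfolding \<phi>_def G'_def[symmetric] using F by (simp add: Phi_hom_closed)
  qed
  have "\<exists>U. additive_map X.E (Phi p) U \<and> (\<forall>F\<in>carrier (Phi p). \<forall>m\<in>carrier M. U (X.tn F m) = \<phi> F m)"
  proof (rule X.tens_universal_ex[OF Phi_abelian_group[OF om]])
    fix F :: "'k fps fls" and m assume F: "F \<in> carrier (Phi p)" and "m \<in> carrier M"
    then obtain G where "m = cyc P G" by (auto simp: cyclic_carrier)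
    thus "\<phi> F m \<in> carrier (Phi p)" using F by (simp add: \<phi> symb_rem(1) Phi_hom_closed)
  next
    fix F F' :: "'k fps fls" and m assume F: "F \<in> carrier (Phi p)" "F' \<in> carrier (Phi p)" and "m \<in> carrier M"
    then obtain G where "m = cyc P G" by (auto simp: cyclic_carrier)
    thus "\<phi> (F \<oplus>\<^bsub>Phi p\<^esub> F') m = \<phi> F m \<oplus>\<^bsub>Phi p\<^esub> \<phi> F' m"
      using F Phi_add_closed[OF om F] by (simp add: \<phi> symb_mult_distrib_right symb_rem_add Phi_hom_closed)
  next
    fix F :: "'k fps fls" and m n assume F: "F \<in> carrier (Phi p)" and "m \<in> carrier M" "n \<in> carrier M"
    then obtain G G' where "m = cyc P G" "n = cyc P G'" by (auto simp: cyclic_carrier)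
    thus "\<phi> F (m \<oplus>\<^bsub>M\<^esub> n) = \<phi> F m \<oplus>\<^bsub>Phi p\<^esub> \<phi> F n"
      using F by (simp add: \<phi> cyclic_add Phi_hom_add symb_mult_distrib_left symb_rem_add Phi_hom_closed)
  next
    fix F :: "'k fps fls" and t m assume F: "F \<in> carrier (Phi p)" and "m \<in> carrier M"
    then obtain G where "m = cyc P G" by (auto simp: cyclic_carrier)
    thus "\<phi> (F \<otimes>\<^bsub>Phi p\<^esub> Phi_hom p \<pi> t) m = \<phi> F (t \<odot>\<^bsub>M\<^esub> m)"
      using F by (simp add: \<phi> cyclic_smult Phi_hom_mult symb_mult_assoc Phi_hom_closed)
  qed
  then obtain U where U: "additive_map X.E (Phi p) U"
    and U_tn: "\<And>F m. F \<in> carrier (Phi p) \<Longrightarrow> m \<in> carrier M \<Longrightarrow> U (X.tn F m) = \<phi> F m" by blast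
  have "U (X.tn R c1) = symb_rem R" using R(1) by (simp add: U_tn \<phi> Phi_hom_1)
  also have "symb_rem R = R" by (rule symb_rem_eq[OF R, of 0]) simp
  finally show ?thesis
    unfolding z using additive_map_0[OF U X.E.abelian_group_axioms Phi_abelian_group[OF om]] by simp
qed

subsection \<open>Generators of the Fourier transform\<close>

definition gen :: "nat \<Rightarrow> ('k weyl \<times> 'k weyl set \<Rightarrow>\<^sub>0 int) set" where
  "gen i = N.tn (dn i) c1"

lemma gen_closed [simp]: "gen i \<in> carrier N.E"
  by (simp add: gen_def)

definition lin where "lin r = (\<Oplus>\<^bsub>L.E\<^esub>i\<in>{..<\<delta>}. L.tn (r i) (gen i))"

definition spn where "spn v \<longleftrightarrow> (\<exists>r. (\<forall>i. r i \<in> carrier A) \<and> v = lin r)"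

lemma spn_add: "spn u \<Longrightarrow> spn v \<Longrightarrow> spn (u \<oplus>\<^bsub>L.E\<^esub> v)"
proof -
  assume "spn u" "spn v"
  then obtain r s where r: "\<And>i. r i \<in> carrier A" "u = lin r" and s: "\<And>i. s i \<in> carrier A" "v = lin s"
    unfolding spn_def by blast
  have "lin (\<lambda>i. r i + s i) = (\<Oplus>\<^bsub>L.E\<^esub>i\<in>{..<\<delta>}. L.tn (r i) (gen i) \<oplus>\<^bsub>L.E\<^esub> L.tn (s i) (gen i))"
    unfolding lin_def
  proof (rule L.E.finsum_cong')
    fix i
    show "L.tn (r i + s i) (gen i) = L.tn (r i) (gen i) \<oplus>\<^bsub>L.E\<^esub> L.tn (s i) (gen i)"
      using L.tens_add_left[of "r i" "s i" "gen i"] r(1) s(1) by simp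
  qed (auto simp: r s)
  also have "\<dots> = u \<oplus>\<^bsub>L.E\<^esub> v"
    unfolding r(2) s(2) lin_def by (rule L.E.finsum_addf) (auto simp: r(1) s(1))
  finally show ?thesis unfolding spn_def
    using r(1) s(1) by (intro exI[of _ "\<lambda>i. r i + s i"]) auto
qed

lemma spn_smult: "\<beta> \<in> carrier A \<Longrightarrow> spn v \<Longrightarrow> spn (\<beta> \<odot>\<^bsub>L.E\<^esub> v)"
proof -
  assume b: "\<beta> \<in> carrier A" and "spn v"
  then obtain r where r: "\<And>i. r i \<in> carrier A" "v = lin r" unfolding spn_def by blast
  have "\<beta> \<odot>\<^bsub>L.E\<^esub> v = (\<Oplus>\<^bsub>L.E\<^esub>i\<in>{..<\<delta>}. \<beta> \<odot>\<^bsub>L.E\<^esub> L.tn (r i) (gen i))"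
    unfolding r(2) lin_def
    by (rule additive_map_finsum[OF L.E_smult(1)[OF b] L.E.abelian_group_axioms L.E.abelian_group_axioms]) (auto simp: r(1))
  also have "\<dots> = lin (\<lambda>i. \<beta> * r i)"
    unfolding lin_def
  proof (rule L.E.finsum_cong')
    fix i
    show "\<beta> \<odot>\<^bsub>L.E\<^esub> L.tn (r i) (gen i) = L.tn (\<beta> * r i) (gen i)"
      using L.E_smult(2)[OF b r(1), of "gen i"] by simp
  qed (auto simp: b r)
  finally show ?thesis unfolding spn_def
    using r(1) b by (intro exI[of _ "\<lambda>i. \<beta> * r i"]) auto
qed

lemma lin_0: "(\<And>i. i < \<delta> \<Longrightarrow> r i = 0) \<Longrightarrow> lin r = \<zero>\<^bsub>L.E\<^esub>"
  unfolding lin_def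
  by (rule finsum_pred[OF L.E.abelian_group_axioms, where Q = "\<lambda>v. v = \<zero>\<^bsub>L.E\<^esub>"])
     (use L.tens_zero_left in auto)

lemma spn_0: "spn \<zero>\<^bsub>L.E\<^esub>"
  unfolding spn_def using lin_0[of "\<lambda>_. 0"] by (intro exI[of _ "\<lambda>_. 0"]) simp

lemma spn_gen: "i < \<delta> \<Longrightarrow> spn (L.tn 1 (gen i))"
proof -
  assume i: "i < \<delta>"
  define r :: "nat \<Rightarrow> 'k fls" where "r = (\<lambda>j. if i = j then 1 else 0)"
  have c: "r j \<in> carrier A" for j by (simp add: r_def)
  have one: "L.tn 1 (gen j) \<in> carrier L.E" for j by simp
  have "lin r = (\<Oplus>\<^bsub>L.E\<^esub>j\<in>{..<\<delta>}. if i = j then L.tn 1 (gen j) else \<zero>\<^bsub>L.E\<^esub>)"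
    unfolding lin_def by (rule L.E.finsum_cong') (use L.tens_zero_left one in \<open>auto simp: r_def\<close>)
  also have "\<dots> = L.tn 1 (gen i)" using i one by (intro L.E.finsum_singleton) auto
  finally show ?thesis unfolding spn_def using c by metis
qed

lemma spn_uminus:
  assumes "u \<in> carrier L.E" "v \<in> carrier L.E" "u \<oplus>\<^bsub>L.E\<^esub> v = \<zero>\<^bsub>L.E\<^esub>" "spn v"
  shows "spn u"
proof -
  have m: "\<ominus>\<^bsub>A\<^esub> \<one>\<^bsub>A\<^esub> \<in> carrier A" by (rule A.a_inv_closed[OF A.one_closed])
  have "(\<ominus>\<^bsub>A\<^esub> \<one>\<^bsub>A\<^esub>) \<odot>\<^bsub>L.E\<^esub> v \<oplus>\<^bsub>L.E\<^esub> v = (\<ominus>\<^bsub>A\<^esub> \<one>\<^bsub>A\<^esub> \<oplus>\<^bsub>A\<^esub> \<one>\<^bsub>A\<^esub>) \<odot>\<^bsub>L.E\<^esub> v"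
    using L.E_smult_l_distr[OF m A.one_closed assms(2)] L.E_smult_one[OF assms(2)] by simp
  also have "\<dots> = \<zero>\<^bsub>L.E\<^esub>" unfolding A.l_neg[OF A.one_closed] by (rule L.E_smult_zero[OF assms(2)])
  finally have "\<ominus>\<^bsub>L.E\<^esub> v = (\<ominus>\<^bsub>A\<^esub> \<one>\<^bsub>A\<^esub>) \<odot>\<^bsub>L.E\<^esub> v"
    using L.E_smult_closed[OF m] assms(2) by (intro L.E.minus_equality) auto
  moreover have "\<ominus>\<^bsub>L.E\<^esub> v = u" using assms by (intro L.E.minus_equality) auto
  ultimately show ?thesis using spn_smult[OF m assms(4)] by simp
qed

lemma tens_monom:
  assumes "\<beta> \<in> carrier A"
  shows "L.tn \<beta> (N.tn (monom q k) c1) = (\<beta> * poly_in_eta ((- 1) ^ k * q)) \<odot>\<^bsub>L.E\<^esub> L.tn 1 (gen k)"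
proof -
  let ?q = "(- 1) ^ k * q"
  have "?q * (- 1) ^ k = ((- 1) ^ k * (- 1) ^ k) * q" by (simp only: mult_ac)
  hence "?q * (- 1) ^ k = q" by (simp flip: power_mult_distrib)
  hence "monom q k = weyl_mult [:?q:] (dn k)"
    by (simp only: weyl_mult_const_left dn_def smult_monom)
  hence "N.tn (monom q k) c1 = [:?q:] \<odot>\<^bsub>N.E\<^esub> gen k"
    using N.E_smult(2)[of "[:?q:]" "dn k" c1] by (simp add: gen_def)
  hence "L.tn \<beta> (N.tn (monom q k) c1) = L.tn (\<beta> * poly_in_eta ?q) (gen k)"
    using L.tens_balanced[of \<beta> "gen k" ?q] assms by simp
  also have "\<dots> = (\<beta> * poly_in_eta ?q) \<odot>\<^bsub>L.E\<^esub> L.tn 1 (gen k)"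
    using L.E_smult(2)[of "\<beta> * poly_in_eta ?q" 1 "gen k"]
      A_eta_mult_closed[OF om assms poly_in_eta_closed[OF om, of ?q]] by simp
  finally show ?thesis .
qed

text \<open>Polynomial coefficients pass through the tensor sign into \<open>A_eta\<close>, so an
  operator of order below n needs only the first n generators.\<close>

lemma spn_low:
  assumes "\<And>k. k < n \<Longrightarrow> spn (L.tn 1 (gen k))" "\<And>k. n \<le> k \<Longrightarrow> coeff Q k = 0" "\<beta> \<in> carrier A"
  shows "spn (L.tn \<beta> (N.tn Q c1))"
  using assms(1,2)
proof (induction n arbitrary: Q)
  case 0
  hence "Q = 0" by (intro poly_eqI) simp
  moreover have "N.tn 0 c1 = \<zero>\<^bsub>N.E\<^esub>" using N.tens_zero_left[of c1] by simp
  ultimately show ?case using L.tens_zero_right[OF assms(3)] spn_0 by simp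
next
  case (Suc n)
  let ?m = "monom (coeff Q n) n"
  have low: "spn (L.tn \<beta> (N.tn (Q - ?m) c1))"
  proof (rule Suc.IH)
    show "coeff (Q - ?m) k = 0" if "n \<le> k" for k using Suc.prems(2)[of k] that by (cases "k = n") simp_all
  qed (simp add: Suc.prems(1))
  have "N.tn Q c1 = N.tn ?m c1 \<oplus>\<^bsub>N.E\<^esub> N.tn (Q - ?m) c1"
    using N.tens_add_left[of ?m "Q - ?m" c1] by simp
  hence "L.tn \<beta> (N.tn Q c1) = L.tn \<beta> (N.tn ?m c1) \<oplus>\<^bsub>L.E\<^esub> L.tn \<beta> (N.tn (Q - ?m) c1)"
    using assms(3) by (simp add: L_tn_add)
  moreover have "spn (L.tn \<beta> (N.tn ?m c1))"
    unfolding tens_monom[OF assms(3)]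
    by (intro spn_smult A_eta_mult_closed[OF om assms(3) poly_in_eta_closed[OF om]] Suc.prems(1)) simp
  ultimately show ?case using spn_add low by simp
qed

text \<open>Both signs are covered because the generators use minus the derivation. By
  \<open>coeffs\<close> and |\<pi>| = \<omega>, the coefficient of \<eta>^(d-j) is at most that of
  \<eta>^d divided by \<omega>^j, as \<open>A_eta_invertible\<close> requires.\<close>

lemma top_coeff_invertible:
  assumes "q = coeff (fourier_hom \<pi> P) \<delta> \<or> q = - coeff (fourier_hom \<pi> P) \<delta>"
  shows "\<exists>g\<in>carrier A. g * poly_in_eta q = 1"
proof -
  have c: "av (coeff q k) = av (coeff (coeff P k) \<delta>) * (1 / omega p) ^ \<delta> * omega p ^ k" for k
    using assms fourier_hom_top(2)[OF degs, of k] by (auto simp: av_mult av_power av_divide av_pi)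
  have d: "av (coeff q d) = av \<alpha> * (1 / omega p) ^ \<delta> * omega p ^ d" by (simp add: c topP)
  have nd: "fls_nth (poly_in_eta q) (- int d) = coeff q d" by (simp add: nth_poly_in_eta)
  show ?thesis
  proof (rule A_eta_invertible[OF om])
    show "vanishes_below (- int d) (poly_in_eta q)"
      unfolding vanishes_below_def
    proof (intro allI impI)
      fix n assume n: "n < - int d"
      hence "degree P < nat (- n)" using degP by linarith
      hence "av (coeff q (nat (- n))) = 0" by (simp add: c coeff_eq_0)
      thus "fls_nth (poly_in_eta q) n = 0" by (simp add: nth_poly_in_eta)
    qed
    have "0 < av (coeff q d)" using \<alpha>0 om by (simp add: d)
    thus "fls_nth (poly_in_eta q) (- int d) \<noteq> 0" unfolding nd by auto
    show "av (fls_nth (poly_in_eta q) (- int d + int j)) \<le> av (fls_nth (poly_in_eta q) (- int d)) / omega p ^ j" for j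
    proof (cases "j \<le> d")
      case True
      hence n: "- int d + int j \<le> 0" "nat (- (- int d + int j)) = d - j" by simp_all
      have "av (fls_nth (poly_in_eta q) (- int d + int j)) = av (coeff (coeff P (d - j)) \<delta>) * (1 / omega p) ^ \<delta> * omega p ^ (d - j)"
        unfolding nth_poly_in_eta n(2) using n(1) by (simp add: c)
      also have "\<dots> \<le> av \<alpha> * (1 / omega p) ^ \<delta> * omega p ^ (d - j)"
        using om by (intro mult_right_mono coeffs) simp_all
      also have "\<dots> = av (coeff q d) / omega p ^ j" using True om by (simp add: d power_diff)
      finally show ?thesis unfolding nd .
    next
      case False
      thus ?thesis using om by (simp add: nth_poly_in_eta)
    qed
  qed
qed

text \<open>The transform of \<open>P\<close> has degree \<open>\<delta>\<close> in \<open>\<partial>\<^sub>\<eta>\<close> and an invertible leading coefficient.\<close>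

lemma spn_all_gen: "spn (L.tn 1 (gen k))"
proof (induction k rule: less_induct)
  case (less k)
  show ?case
  proof (cases "k < \<delta>")
    case False
    define j where "j = k - \<delta>"
    have k: "k = j + \<delta>" using False by (simp add: j_def)
    \<comment> \<open>Z has order at most k and kills the generator \<open>c1\<close>, so its term
      of order k can be expressed through lower generators.\<close>
    define Z where "Z = weyl_mult (dn j) (fourier_hom \<pi> P)"
    define b where "b = coeff (fourier_hom \<pi> P) \<delta>"
    have dj: "degree (dn j) \<le> j" by (simp add: dn_def degree_monom_le)
    have Zk: "coeff Z k = (- 1) ^ j * b" and degZ: "degree Z \<le> k"
      unfolding k Z_def using weyl_mult_coeff_top[OF dj fourier_hom_top(1)[OF degs]] by (simp_all add: dn_def b_def)
    define q where "q = (- 1) ^ k * coeff Z k"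
    have "q = (- 1) ^ (k + j) * b" unfolding q_def Zk power_add by (simp only: mult.assoc)
    hence "q = b \<or> q = - b" by (cases "even (k + j)") simp_all
    then obtain g where g: "g \<in> carrier A" "g * poly_in_eta q = 1"
      using top_coeff_invertible[of q] by (auto simp: b_def)
    let ?m = "monom (coeff Z k) k"
    have low: "spn (L.tn g (N.tn (Z - ?m) c1))"
    proof (rule spn_low[OF less.IH _ g(1)])
      show "coeff (Z - ?m) i = 0" if "k \<le> i" for i
        using degZ that by (cases "i = k") (simp_all add: coeff_eq_0)
    qed
    have "N.tn ?m c1 \<oplus>\<^bsub>N.E\<^esub> N.tn (Z - ?m) c1 = \<zero>\<^bsub>N.E\<^esub>"
      using N.tens_add_left[of ?m "Z - ?m" c1] N_tn_P[of "dn j"] by (simp add: Z_def)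
    hence z: "L.tn g (N.tn ?m c1) \<oplus>\<^bsub>L.E\<^esub> L.tn g (N.tn (Z - ?m) c1) = \<zero>\<^bsub>L.E\<^esub>"
      using L_tn_add[OF g(1), of "N.tn ?m c1" "N.tn (Z - ?m) c1"] L.tens_zero_right[OF g(1)] by simp
    have "spn (L.tn g (N.tn ?m c1))" by (rule spn_uminus[OF _ _ z low]) (simp_all add: g(1))
    moreover have "L.tn g (N.tn ?m c1) = \<one>\<^bsub>A\<^esub> \<odot>\<^bsub>L.E\<^esub> L.tn 1 (gen k)"
      using tens_monom[OF g(1), of "coeff Z k" k] g(2) by (simp add: q_def)
    moreover have "\<dots> = L.tn 1 (gen k)" by (intro L.E_smult_one) simp
    ultimately show ?thesis by simp
  qed (rule spn_gen)
qed

lemma spn_total: "x \<in> carrier L.E \<Longrightarrow> spn x"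
proof (induction rule: L_induct)
  case (pure \<beta> Q m)
  then obtain G where m: "m = cyc P G" by (auto simp: cyclic_carrier)
  have "L.tn \<beta> (N.tn Q m) = L.tn \<beta> (N.tn (weyl_mult Q (fourier_hom \<pi> G)) c1)"
    unfolding m by (rule arg_cong[OF N_tn_cyc])
  moreover have "spn \<dots>"
    by (rule spn_low[OF spn_all_gen _ pure(1), of "Suc (degree (weyl_mult Q (fourier_hom \<pi> G)))"]) (simp add: coeff_eq_0)
  ultimately show ?case by (simp only:)
next
  case (add x y)
  thus ?case by (intro spn_add)
qed

text \<open>Injectivity: an element of the kernel is a combination of generators, so the
  corresponding polynomial in t has zero class; \<open>tens_eq_zero\<close> and
  \<open>t_poly_unique\<close> make all coefficients vanish. Surjectivity: division by the image of
  P leaves a remainder that is such a polynomial.\<close>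

lemma comparison_bij:
  assumes \<Upsilon>: "additive_map L.E X.E \<Upsilon>"
    and \<Upsilon>_tn: "\<And>\<beta> Q m. \<beta> \<in> carrier A \<Longrightarrow> m \<in> carrier M \<Longrightarrow>
      \<Upsilon> (L.tn \<beta> (N.tn Q m)) = X.tn (symb_mult (A_to_Phi \<beta>) (H.ev Q)) m"
  shows "bij_betw \<Upsilon> (carrier L.E) (carrier X.E)"
proof -
  note Lab = L.E.abelian_group_axioms and Xab = X.E.abelian_group_axioms
  have tpow: "(fls_const (fps_X ^ i) :: 'k fps fls) \<in> carrier (Phi p)" for i
    using H_closed[of "dn i"] by (simp add: H_dn)
  have \<Upsilon>_gen: "\<Upsilon> (L.tn \<beta> (gen i)) = X.tn (symb_mult (A_to_Phi \<beta>) (fls_const (fps_X ^ i))) c1" if "\<beta> \<in> carrier A" for \<beta> i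
    using \<Upsilon>_tn[OF that, of c1 "dn i"] by (simp add: gen_def H_dn)
  have kernel: "v = \<zero>\<^bsub>L.E\<^esub>" if v: "v \<in> carrier L.E" "\<Upsilon> v = \<zero>\<^bsub>X.E\<^esub>" for v
  proof -
    obtain r where r: "\<And>i. r i \<in> carrier A" "v = lin r" using spn_total[OF v(1)] unfolding spn_def by blast
    let ?f = "\<lambda>i. symb_mult (A_to_Phi (r i)) (fls_const (fps_X ^ i))"
    have f: "?f i \<in> carrier (Phi p)" for i using r(1) tpow by simp
    have "\<Upsilon> v = (\<Oplus>\<^bsub>X.E\<^esub>i\<in>{..<\<delta>}. \<Upsilon> (L.tn (r i) (gen i)))"
      unfolding r(2) lin_def by (rule additive_map_finsum[OF \<Upsilon> Lab Xab]) (auto simp: r(1))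
    also have "\<dots> = (\<Oplus>\<^bsub>X.E\<^esub>i\<in>{..<\<delta>}. X.tn (?f i) c1)" by (simp only: \<Upsilon>_gen[OF r(1)])
    also have "\<dots> = X.tn (finsum (Phi p) ?f {..<\<delta>}) c1"
      by (rule additive_map_finsum[OF X.additive_map_tens_left[OF cyc_mem] Phi_abelian_group[OF om] Xab, symmetric]) (auto simp: f)
    also have "finsum (Phi p) ?f {..<\<delta>} = sum ?f {..<\<delta>}"
      by (rule finsum_eq_sum) (use f abelian_group.axioms(1)[OF Phi_abelian_group[OF om]] in \<open>auto simp: fun_eq_iff\<close>)
    finally have z: "X.tn (sum ?f {..<\<delta>}) c1 = \<zero>\<^bsub>X.E\<^esub>" using v(2) by simp
    have "sum ?f {..<\<delta>} \<in> carrier (Phi p)" by (rule H.sum_closed) (rule f)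
    from tens_eq_zero[OF this t_degree_less_sum_A z] have "r i = 0" if "i < \<delta>" for i
      using t_poly_unique that by blast
    thus ?thesis unfolding r(2) by (rule lin_0)
  qed
  have "inj_on \<Upsilon> (carrier L.E)"
  proof (rule inj_onI)
    fix u v assume uv: "u \<in> carrier L.E" "v \<in> carrier L.E" "\<Upsilon> u = \<Upsilon> v"
    have "\<Upsilon> (u \<oplus>\<^bsub>L.E\<^esub> (\<ominus>\<^bsub>L.E\<^esub> v)) = \<Upsilon> v \<oplus>\<^bsub>X.E\<^esub> (\<ominus>\<^bsub>X.E\<^esub> \<Upsilon> v)"
      using uv additive_mapD(2)[OF \<Upsilon>] additive_map_minus[OF \<Upsilon> Lab Xab] by simp
    also have "\<dots> = \<zero>\<^bsub>X.E\<^esub>" using additive_mapD(1)[OF \<Upsilon> uv(2)] by (rule X.E.r_neg)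
    finally have "u \<oplus>\<^bsub>L.E\<^esub> (\<ominus>\<^bsub>L.E\<^esub> v) = \<zero>\<^bsub>L.E\<^esub>" using uv by (intro kernel) simp_all
    hence "\<ominus>\<^bsub>L.E\<^esub> (\<ominus>\<^bsub>L.E\<^esub> v) = u" using uv by (intro L.E.minus_equality) simp_all
    thus "u = v" using uv by simp
  qed
  moreover have "\<Upsilon> ` carrier L.E = carrier X.E"
  proof
    show "\<Upsilon> ` carrier L.E \<subseteq> carrier X.E" using additive_mapD(1)[OF \<Upsilon>] by blast
    let ?I = "\<Upsilon> ` carrier L.E"
    have I_add: "x \<oplus>\<^bsub>X.E\<^esub> y \<in> ?I" if xy: "x \<in> ?I" "y \<in> ?I" for x y
    proof -
      obtain u v where uv: "u \<in> carrier L.E" "v \<in> carrier L.E" "x = \<Upsilon> u" "y = \<Upsilon> v" using xy by blast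
      have "x \<oplus>\<^bsub>X.E\<^esub> y = \<Upsilon> (u \<oplus>\<^bsub>L.E\<^esub> v)"
        unfolding uv(3,4) by (rule additive_mapD(2)[OF \<Upsilon> uv(1,2), symmetric])
      thus ?thesis using uv(1,2) by simp
    qed
    have I_sum: "X.tn (\<Sum>i<n. symb_mult (A_to_Phi (r i)) (fls_const (fps_X ^ i))) c1 \<in> ?I"
      if r: "\<And>i. r i \<in> carrier A" for r n
    proof (induction n)
      case 0
      have "X.tn 0 c1 = \<zero>\<^bsub>X.E\<^esub>" using X.tens_zero_left[of c1] by simp
      also have "\<dots> = \<Upsilon> \<zero>\<^bsub>L.E\<^esub>" using additive_map_0[OF \<Upsilon> Lab Xab] by simp
      finally show ?case by simp
    next
      case (Suc n)
      let ?f = "\<lambda>i. symb_mult (A_to_Phi (r i)) (fls_const (fps_X ^ i))"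
      have f: "?f i \<in> carrier (Phi p)" for i using r tpow by simp
      have "X.tn (sum ?f {..<Suc n}) c1 = X.tn (sum ?f {..<n}) c1 \<oplus>\<^bsub>X.E\<^esub> X.tn (?f n) c1"
      proof -
        have "sum ?f {..<n} \<in> carrier (Phi p)" by (rule H.sum_closed) (rule f)
        from X.tens_add_left[OF this f[of n] cyc_mem[of 1]] show ?thesis
          unfolding sum.lessThan_Suc Phi_simps .
      qed
      moreover have "X.tn (?f n) c1 \<in> ?I"
        unfolding \<Upsilon>_gen[OF r, of n n, symmetric] by (rule imageI) (simp add: r)
      ultimately show ?case using I_add Suc.IH by (simp only:)
    qed
    show "carrier X.E \<subseteq> ?I"
    proof
      fix x assume "x \<in> carrier X.E"
      thus "x \<in> ?I"
      proof (induction rule: X.tens_induct)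
        case (pure F m)
        then obtain G where m: "m = cyc P G" by (auto simp: cyclic_carrier)
        have "symb_mult F (Phi_hom p \<pi> G) \<in> carrier (Phi p)" using pure(1) by (simp add: Phi_hom_closed)
        from D.division[OF this] obtain Q R where QR: "Q \<in> carrier (Phi p)" "R \<in> carrier (Phi p)" "t_degree_less \<delta> R"
          and FG: "symb_mult F (Phi_hom p \<pi> G) = symb_mult Q (Phi_hom p \<pi> P) + R" by blast
        have "X.tn F m = X.tn (symb_mult Q (Phi_hom p \<pi> P) + R) c1"
          unfolding m FG[symmetric] by (rule X_tn_cyc[OF pure(1)])
        also have "\<dots> = X.tn (symb_mult Q (Phi_hom p \<pi> P)) c1 \<oplus>\<^bsub>X.E\<^esub> X.tn R c1"
          using X.tens_add_left[of "symb_mult Q (Phi_hom p \<pi> P)" R c1] QR by (simp add: Phi_hom_closed)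
        also have "\<dots> = X.tn R c1" using QR by (simp add: X_tn_P)
        finally have x: "X.tn F m = X.tn R c1" .
        obtain r where r: "\<And>i. r i \<in> carrier A" "R = (\<Sum>i<\<delta>. symb_mult (A_to_Phi (r i)) (fls_const (fps_X ^ i)))"
          using t_poly_exists[OF om QR(2,3)] by blast
        show ?case unfolding x r(2) by (rule I_sum[OF r(1)])
      qed (rule I_add)
    qed
  qed
  ultimately show ?thesis by (simp add: bij_betw_def)
qed

lemma comparison_iso:
  "\<exists>\<Upsilon>. connection_iso A fls_const fls_deriv (at_infinity_module p (fourier \<pi> M)) conn (Phi_module p \<pi> M) conn' \<Upsilon> \<and>
    (\<forall>\<beta>\<in>carrier A. \<forall>m\<in>carrier M.
      \<Upsilon> (tens A poly_in_eta (as_poly_module (fourier \<pi> M)) \<beta> (hat \<pi> M m)) = X.tn (A_to_Phi \<beta>) m)"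
proof -
  obtain \<Upsilon> where *: "additive_map L.E X.E \<Upsilon> \<and> (\<forall>\<beta>\<in>carrier A. \<forall>Q. \<forall>m\<in>carrier M.
      \<Upsilon> (L.tn \<beta> (N.tn Q m)) = X.tn (symb_mult (A_to_Phi \<beta>) (H.ev Q)) m)"
    by (rule exE[OF comparison_map_exists])
  note \<Upsilon> = conjunct1[OF *]
  have \<Upsilon>_tn: "\<Upsilon> (L.tn \<beta> (N.tn Q m)) = X.tn (symb_mult (A_to_Phi \<beta>) (H.ev Q)) m"
    if "\<beta> \<in> carrier A" "m \<in> carrier M" for \<beta> Q m
    by (rule conjunct2[OF *, THEN bspec, THEN spec, THEN bspec, OF that])
  have smult: "\<Upsilon> (\<beta> \<odot>\<^bsub>L.E\<^esub> v) = A_to_Phi \<beta> \<odot>\<^bsub>X.E\<^esub> \<Upsilon> v" if b: "\<beta> \<in> carrier A" and v: "v \<in> carrier L.E" for \<beta> v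
  proof (rule L_ext[OF additive_map_comp[OF L.E_smult(1)[OF b] \<Upsilon>] additive_map_comp[OF \<Upsilon> X.E_smult(1)[OF A_to_Phi_closed[OF b]]] _ v])
    fix \<gamma> Q m assume g: "\<gamma> \<in> carrier A" and m: "m \<in> carrier M"
    have "\<beta> \<odot>\<^bsub>L.E\<^esub> L.tn \<gamma> (N.tn Q m) = L.tn (\<beta> * \<gamma>) (N.tn Q m)"
      using L.E_smult(2)[OF b g, of "N.tn Q m"] m by simp
    thus "\<Upsilon> (\<beta> \<odot>\<^bsub>L.E\<^esub> L.tn \<gamma> (N.tn Q m)) = A_to_Phi \<beta> \<odot>\<^bsub>X.E\<^esub> \<Upsilon> (L.tn \<gamma> (N.tn Q m))"
      using b g m A_eta_mult_closed[OF om b g]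
      by (simp add: \<Upsilon>_tn X.E_smult(2) A_to_Phi_symb_mult symb_mult_assoc)
  qed
  have conn'_add: "additive_map X.E X.E conn'"
    using X.E_smult(1)[OF e2t_closed] by (simp add: additive_map_def conn'_eq)
  \<comment> \<open>On pure tensors this amounts to the identity \<eta>^2 t \<gamma> = \<gamma>' +
    \<gamma> \<eta>^2 t in \<open>Phi\<close>, the prime being the derivation in 1/\<eta>.\<close>
  have connection: "\<Upsilon> (conn v) = conn' (\<Upsilon> v)" if v: "v \<in> carrier L.E" for v
  proof (rule L_ext[OF additive_map_comp[OF L_connection(1) \<Upsilon>] additive_map_comp[OF \<Upsilon> conn'_add] _ v])
    fix \<gamma> Q m assume g: "\<gamma> \<in> carrier A" and m: "m \<in> carrier M"
    have g': "fls_deriv \<gamma> \<in> carrier A" using g by (rule A_eta_deriv_closed[OF om])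
    have n: "N.tn Q m \<in> carrier N.E" using m by simp
    have "minus_eta2_d \<odot>\<^bsub>N.E\<^esub> N.tn Q m = N.tn (weyl_mult minus_eta2_d Q) m"
      using N.E_smult(2)[of minus_eta2_d Q m] m by simp
    hence "conn (L.tn \<gamma> (N.tn Q m)) = L.tn (fls_deriv \<gamma>) (N.tn Q m) \<oplus>\<^bsub>L.E\<^esub> L.tn \<gamma> (N.tn (weyl_mult minus_eta2_d Q) m)"
      using L_connection(2)[OF g n] by simp
    hence "\<Upsilon> (conn (L.tn \<gamma> (N.tn Q m))) =
        X.tn (symb_mult (A_to_Phi (fls_deriv \<gamma>)) (H.ev Q)) m \<oplus>\<^bsub>X.E\<^esub> X.tn (symb_mult (symb_mult (A_to_Phi \<gamma>) e2t) (H.ev Q)) m"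
      using additive_mapD(2)[OF \<Upsilon> L_tn_closed[OF g' n] L_tn_closed[OF g, of "N.tn (weyl_mult minus_eta2_d Q) m"]] g g' m
      by (simp add: \<Upsilon>_tn H_mult minus_eta2_d_def H_eta2_d symb_mult_assoc)
    also have "\<dots> = X.tn (symb_mult (A_to_Phi (fls_deriv \<gamma>) + symb_mult (A_to_Phi \<gamma>) e2t) (H.ev Q)) m"
      using X.tens_add_left[of "symb_mult (A_to_Phi (fls_deriv \<gamma>)) (H.ev Q)" "symb_mult (symb_mult (A_to_Phi \<gamma>) e2t) (H.ev Q)" m] g g' m
      by (simp add: symb_mult_distrib_right)
    also have "\<dots> = X.tn (symb_mult e2t (symb_mult (A_to_Phi \<gamma>) (H.ev Q))) m"
      unfolding symb_eta2_t_commutator[symmetric] unfolding symb_mult_assoc[of e2t] ..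
    also have "\<dots> = conn' (\<Upsilon> (L.tn \<gamma> (N.tn Q m)))"
      using X.E_smult(2)[OF e2t_closed, of "symb_mult (A_to_Phi \<gamma>) (H.ev Q)" m] g m by (simp add: conn'_eq \<Upsilon>_tn)
    finally show "\<Upsilon> (conn (L.tn \<gamma> (N.tn Q m))) = conn' (\<Upsilon> (L.tn \<gamma> (N.tn Q m)))" .
  qed
  have hat: "\<Upsilon> (tens A poly_in_eta (as_poly_module (fourier \<pi> M)) \<beta> (hat \<pi> M m)) = X.tn (A_to_Phi \<beta>) m"
    if "\<beta> \<in> carrier A" "m \<in> carrier M" for \<beta> m
    unfolding fourier_eq hat_def using \<Upsilon>_tn[OF that, of 1] by (simp add: H_1)
  show ?thesis
  proof (intro exI[of _ \<Upsilon>] conjI ballI hat)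
    show "connection_iso A fls_const fls_deriv (at_infinity_module p (fourier \<pi> M)) conn (Phi_module p \<pi> M) conn' \<Upsilon>"
      unfolding connection_iso_def
    proof (intro conjI ballI L_module_with_connection Phi_module_with_connection)
      have aE: "at_infinity_module p (fourier \<pi> M) = L.E" by (simp add: at_infinity_module_def fourier_eq)
      show "bij_betw \<Upsilon> (carrier (at_infinity_module p (fourier \<pi> M))) (carrier (Phi_module p \<pi> M))"
        unfolding aE Phi_module_simps by (rule comparison_bij[OF \<Upsilon> \<Upsilon>_tn])
      fix v assume "v \<in> carrier (at_infinity_module p (fourier \<pi> M))"
      hence v: "v \<in> carrier L.E" unfolding aE .
      show "\<Upsilon> (conn v) = conn' (\<Upsilon> v)" by (rule connection[OF v])
      show "\<Upsilon> (v \<oplus>\<^bsub>at_infinity_module p (fourier \<pi> M)\<^esub> u) = \<Upsilon> v \<oplus>\<^bsub>Phi_module p \<pi> M\<^esub> \<Upsilon> u"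
        if "u \<in> carrier (at_infinity_module p (fourier \<pi> M))" for u
        using additive_mapD(2)[OF \<Upsilon> v] that unfolding aE Phi_module_simps by blast
      show "\<Upsilon> (\<beta> \<odot>\<^bsub>at_infinity_module p (fourier \<pi> M)\<^esub> v) = \<beta> \<odot>\<^bsub>Phi_module p \<pi> M\<^esub> \<Upsilon> v" if "\<beta> \<in> carrier A" for \<beta>
        unfolding aE Phi_module_simps by (rule smult[OF that v])
    qed
  qed
qed

end

theorem mainTheorem9:
  fixes p d :: nat and \<pi> :: "'k::nonarch_field"
    and a :: "nat \<Rightarrow> 'k poly" and P :: "'k weyl"
  assumes "prime p" and "av (of_nat p :: 'k) = 1 / real p"
    and "spherically_complete TYPE('k)"
    and "\<pi> ^ (p - 1) + of_nat p = 0"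
    and "P = (\<Sum>k\<le>d. monom (a k) k)" and "a d \<noteq> 0"
    and "\<exists>\<alpha> \<delta>. \<alpha> \<noteq> 0 \<and> a d = monom \<alpha> \<delta>"
    and "\<forall>i\<le>d. degree (a i) \<le> degree (a d)"
    and "soluble_at_1 (robba_module (cyclic_module P)) (robba_connection (cyclic_module P))"
  shows "\<exists>\<Upsilon>.
     connection_iso (A_eta p) fls_const fls_deriv
       (at_infinity_module p (fourier \<pi> (cyclic_module P)))
       (at_infinity_connection p (fourier \<pi> (cyclic_module P)))
       (Phi_module p \<pi> (cyclic_module P))
       (Phi_connection p \<pi> (cyclic_module P)) \<Upsilon> \<and>
     (\<forall>\<alpha>\<in>carrier (A_eta p). \<forall>m\<in>carrier (cyclic_module P).
        \<Upsilon> (tens (A_eta p) poly_in_eta (as_poly_module (fourier \<pi> (cyclic_module P)))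
             \<alpha> (hat \<pi> (cyclic_module P) m))
        = tens (Phi p) (Phi_hom p \<pi>) (cyclic_module P) (A_to_Phi \<alpha>) m)"
proof -
  obtain \<alpha> \<delta> where \<alpha>: "\<alpha> \<noteq> 0" and ad: "a d = monom \<alpha> \<delta>" using assms(7) by blast
  have P: "coeff P k = (if k \<le> d then a k else 0)" for k
    by (simp add: assms(5) coeff_sum)
  have top: "coeff P d = monom \<alpha> \<delta>" by (simp add: P ad)
  have degP: "degree P \<le> d" by (rule degree_le) (simp add: P)
  have degs: "degree (coeff P k) \<le> \<delta>" for k
    using assms(8) \<alpha> by (simp add: P ad degree_monom_eq)
  note om = omega_bounds[OF assms(1)]
  have p2: "2 \<le> p" using assms(1) by (rule prime_ge_2_nat)
  have "\<pi> ^ (p - 1) = - of_nat p" using assms(4) by (simp add: eq_neg_iff_add_eq_0)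
  hence "av (\<pi> ^ (p - 1)) = av (of_nat p :: 'k)" by simp
  hence "av \<pi> ^ (p - 1) = 1 / real p" by (simp add: av_power assms(2))
  hence av_pi: "av \<pi> = omega p"
    unfolding omega_def using p2 by (intro real_root_pos_unique[symmetric]) simp_all
  hence \<pi>0: "\<pi> \<noteq> 0" using om by auto
  interpret laurent_remainder P d \<delta> \<alpha> by unfold_locales (fact degP top \<alpha>)+
  interpret S: slope_condition p \<pi> P d \<delta> \<alpha>
    by unfold_locales (fact om \<pi>0 av_pi degP top \<alpha> degs soluble_coeff_bound[OF assms(1-3,9)])+
  show ?thesis by (rule S.comparison_iso)
qed

end
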